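(* Let $f:X\to X$ be a transitive (one-sided) subshift of finite type, let $\Phi\in LC(X,\mathbb R^m)$ and let $F$ be a non-singleton face of the rotation set $\mathrm{Rot}(\Phi)$. Then the restriction $\mathcal H|_F$ of the localized entropy function is the concave envelope of finitely many concave functions $h_i:F_i\to\mathbb R$ defined on sub-polyhedra $F_i\subset F$. Moreover, the functions $h_i$ are (real-)analytic on $\mathrm{ri}\,F_i$, but $\mathcal H$ is in general not analytic on $\mathrm{ri}\,F$ (that is, there exist a transitive subshift of finite type, a locally constant $\Phi$ and a non-singleton face $F$ of $\mathrm{Rot}(\Phi)$ for which $\mathcal H|_F$ is not analytic on $\mathrm{ri}\,F$). If $m=2$, then $\mathcal H$ is a piecewise $C^1$-function on $\partial\,\mathrm{Rot}(\Phi)$.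
   Context: Let $\mathcal A=\{0,\dots,d-1\}$ and let $A$ be a $d\times d$ matrix with entries in $\{0,1\}$. The one-sided subshift of finite type is $X=X_A=\{x=(x_n)_{n\ge1}\in\mathcal A^{\mathbb N}: A_{x_n,x_{n+1}}=1 \text{ for all } n\}$ with the shift map $f(x)_n=x_{n+1}$. Transitive means topologically transitive, i.e. $A$ is irreducible. $LC(X,\mathbb R^m)$ is the set of locally constant functions $\Phi:X\to\mathbb R^m$, i.e. those which for some $k$ are constant on all cylinders $\{y\in X:y_1=x_1,\dots,y_k=x_k\}$ of length $k$. $\mathcal M$ is the set of $f$-invariant Borel probability measures. For $\Phi=(\phi_1,\dots,\phi_m)$ the rotation vector of $\mu\in\mathcal M$ is $\mathrm{rv}(\mu)=(\int\phi_1\,d\mu,\dots,\int\phi_m\,d\mu)$ and the (generalized) rotation set is $\mathrm{Rot}(\Phi)=\{\mathrm{rv}(\mu):\mu\in\mathcal M\}$; for locally constant $\Phi$ it is known to be a polyhedron, meaning the convex hull of finitely many points. The localized entropy function is $\mathcal H(w)=\sup\{h_\mu(f):\mu\in\mathcal M,\ \mathrm{rv}(\mu)=w\}$ for $w\in\mathrm{Rot}(\Phi)$, where $h_\mu(f)$ is measure-theoretic entropy. A hyperplane $H$ is a supporting hyperplane of a convex set $K\subset\mathbb R^m$ if its distance to $K$ is zero and it does not cut $K$ (i.e. not both open half spaces determined by $H$ contain points of $K$); a face of $K$ is a set $K\cap H$ with $H$ a supporting hyperplane (so $K$ is a face of itself if it has empty interior). $\mathrm{ri}$ denotes the relative interior,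 i.e. the interior relative to the affine hull, and analyticity on $\mathrm{ri}$ is with respect to the affine hull. Concave envelope: for functions $h_i:D_i\to\mathbb R$, $i=1,\dots,t$, with $D=\mathrm{conv}(D_1\cup\dots\cup D_t)$, a function $h:D\to\mathbb R$ is the concave envelope of $h_1,\dots,h_t$ if it is the smallest concave function on $D$ satisfying $h|_{D_i}\ge h_i$ for all $i$. For $m=2$, $\mathcal H$ is piecewise $C^1$ on $\partial\,\mathrm{Rot}(\Phi)$ if there exist finitely many points $a_0,\dots,a_\ell=a_0\in\partial\,\mathrm{Rot}(\Phi)$ such that the segments $[a_i,a_{i+1}]$ cover $\partial\,\mathrm{Rot}(\Phi)$, each $[a_i,a_{i+1}]$ is a line segment contained in a face of $\mathrm{Rot}(\Phi)$, and $\mathcal H|_{(a_i,a_{i+1})}$ is $C^1$. *)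

theory Defs
  imports "HOL-Probability.Probability"
begin

section \<open>Subshifts of finite type\<close>

text \<open>
  The alphabet is \<open>{0..<d}\<close>, a \<open>d \<times> d\<close> matrix is a function on \<open>nat \<times> nat\<close> of which only the
  entries with both indices below \<open>d\<close> are used, and sequences are indexed from \<open>0\<close>.
\<close>

definition zero_one_matrix :: "nat \<Rightarrow> (nat \<Rightarrow> nat \<Rightarrow> nat) \<Rightarrow> bool" where
  "zero_one_matrix d A \<longleftrightarrow> d \<ge> 1 \<and> (\<forall>i<d. \<forall>j<d. A i j \<in> {0, 1})"

primrec matrix_power :: "nat \<Rightarrow> (nat \<Rightarrow> nat \<Rightarrow> nat) \<Rightarrow> nat \<Rightarrow> nat \<Rightarrow> nat \<Rightarrow> nat" where
  "matrix_power d A 0 = (\<lambda>i j. if i = j then 1 else 0)"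
| "matrix_power d A (Suc n) = (\<lambda>i j. \<Sum>k<d. matrix_power d A n i k * A k j)"

definition irreducible_matrix :: "nat \<Rightarrow> (nat \<Rightarrow> nat \<Rightarrow> nat) \<Rightarrow> bool" where
  "irreducible_matrix d A \<longleftrightarrow> (\<forall>i<d. \<forall>j<d. \<exists>n\<ge>1. matrix_power d A n i j > 0)"

definition sft :: "nat \<Rightarrow> (nat \<Rightarrow> nat \<Rightarrow> nat) \<Rightarrow> (nat \<Rightarrow> nat) set" where
  "sft d A = {x. \<forall>n. x n < d \<and> A (x n) (x (Suc n)) = 1}"

definition transitive_sft :: "nat \<Rightarrow> (nat \<Rightarrow> nat \<Rightarrow> nat) \<Rightarrow> bool" where
  "transitive_sft d A \<longleftrightarrow> zero_one_matrix d A \<and> irreducible_matrix d A"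

definition left_shift :: "(nat \<Rightarrow> 'a) \<Rightarrow> nat \<Rightarrow> 'a" where
  "left_shift x = (\<lambda>n. x (Suc n))"

definition locally_constant_on :: "(nat \<Rightarrow> nat) set \<Rightarrow> ((nat \<Rightarrow> nat) \<Rightarrow> 'v) \<Rightarrow> bool" where
  "locally_constant_on X \<Phi> \<longleftrightarrow>
     (\<exists>k. \<forall>x\<in>X. \<forall>y\<in>X. (\<forall>i<k. x i = y i) \<longrightarrow> \<Phi> x = \<Phi> y)"

section \<open>Invariant measures and entropy\<close>

text \<open>
  \<^term>\<open>borel\<close> is taken with respect to the product topology on \<^typ>\<open>nat \<Rightarrow> nat\<close>, where
  \<^typ>\<open>nat\<close> is discrete.
\<close>

definition invariant_measures :: "(nat \<Rightarrow> nat) set \<Rightarrow> (nat \<Rightarrow> nat) measure set" where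
  "invariant_measures X =
     {\<mu>. prob_space \<mu> \<and> sets \<mu> = sets (restrict_space borel X) \<and> distr \<mu> \<mu> left_shift = \<mu>}"

definition finite_measurable_partition :: "'a measure \<Rightarrow> 'a set set \<Rightarrow> bool" where
  "finite_measurable_partition M \<xi> \<longleftrightarrow> finite \<xi> \<and> \<xi> \<subseteq> sets M \<and> partition_on (space M) \<xi>"

text \<open>
  The join of the pulled back partitions \<open>T\<^sup>-\<^sup>i \<xi>\<close>, \<open>i < n\<close>. It may contain the empty set, which does not
  contribute to the entropy because \<open>0 * ln 0 = 0\<close>.
\<close>

definition iterated_join :: "'a measure \<Rightarrow> ('a \<Rightarrow> 'a) \<Rightarrow> 'a set set \<Rightarrow> nat \<Rightarrow> 'a set set" where
  "iterated_join M T \<xi> n =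
     (\<lambda>C. space M \<inter> (\<Inter>i<n. (T ^^ i) -` C i)) ` ({..<n} \<rightarrow>\<^sub>E \<xi>)"

definition partition_entropy :: "'a measure \<Rightarrow> 'a set set \<Rightarrow> real" where
  "partition_entropy M \<xi> = - (\<Sum>C\<in>\<xi>. measure M C * ln (measure M C))"

definition ks_entropy :: "'a measure \<Rightarrow> ('a \<Rightarrow> 'a) \<Rightarrow> ereal" where
  "ks_entropy M T =
     (SUP \<xi>\<in>{\<xi>. finite_measurable_partition M \<xi>}.
        ereal (lim (\<lambda>n. partition_entropy M (iterated_join M T \<xi> n) / real n)))"

section \<open>Rotation sets and localized entropy\<close>

definition rotation_vector :: "((nat \<Rightarrow> nat) \<Rightarrow> real ^ 'm) \<Rightarrow> (nat \<Rightarrow> nat) measure \<Rightarrow> real ^ 'm" where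
  "rotation_vector \<Phi> \<mu> = (\<chi> i. \<integral>x. \<Phi> x $ i \<partial>\<mu>)"

definition rotation_set :: "(nat \<Rightarrow> nat) set \<Rightarrow> ((nat \<Rightarrow> nat) \<Rightarrow> real ^ 'm) \<Rightarrow> (real ^ 'm) set" where
  "rotation_set X \<Phi> = rotation_vector \<Phi> ` invariant_measures X"

text \<open>
  The supremum is formed in \<^typ>\<open>ereal\<close>. For \<open>w\<close> in the rotation set of a subshift over \<open>d\<close> symbols
  it lies between \<open>0\<close> and \<open>ln d\<close>, so that \<^const>\<open>real_of_ereal\<close> does not change its value.
\<close>

definition localized_entropy ::
    "(nat \<Rightarrow> nat) set \<Rightarrow> ((nat \<Rightarrow> nat) \<Rightarrow> real ^ 'm) \<Rightarrow> real ^ 'm \<Rightarrow> real" where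
  "localized_entropy X \<Phi> w =
     real_of_ereal (SUP \<mu>\<in>{\<mu> \<in> invariant_measures X. rotation_vector \<Phi> \<mu> = w}.
                      ks_entropy \<mu> left_shift)"

section \<open>Faces, analyticity, concave envelopes\<close>

definition supporting_hyperplane :: "'v::euclidean_space set \<Rightarrow> 'v set \<Rightarrow> bool" where
  "supporting_hyperplane K H \<longleftrightarrow>
     (\<exists>a b. a \<noteq> 0 \<and> H = {x. a \<bullet> x = b} \<and> setdist H K = 0 \<and>
            \<not> (K \<inter> {x. a \<bullet> x < b} \<noteq> {} \<and> K \<inter> {x. a \<bullet> x > b} \<noteq> {}))"

text \<open>
  This is not the library's \<^const>\<open>face_of\<close>: the whole set counts as a face only if it
  lies in a hyperplane.
\<close>

definition is_face :: "'v::euclidean_space set \<Rightarrow> 'v set \<Rightarrow> bool" where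
  "is_face K F \<longleftrightarrow> (\<exists>H. supporting_hyperplane K H \<and> F = K \<inter> H)"

text \<open>
  Real analyticity with respect to the affine hull, for a set \<open>S\<close> that is open in its affine hull:
  near every \<open>p \<in> S\<close>, \<open>f\<close> is the sum of a power series in the coordinates \<open>u\<close> given by some basis \<open>B\<close>
  of the direction space of the affine hull. The sum ranges over the multi-indices \<open>\<alpha>\<close> on \<open>B\<close>.
\<close>

definition rel_real_analytic_on :: "'v::euclidean_space set \<Rightarrow> ('v \<Rightarrow> real) \<Rightarrow> bool" where
  "rel_real_analytic_on S f \<longleftrightarrow>
     (\<forall>p\<in>S. \<exists>B c r. independent B \<and> span B = (\<lambda>x. x - p) ` (affine hull S) \<and> r > 0 \<and>
        (\<forall>u. (\<forall>b\<in>B. \<bar>u b\<bar> < r) \<longrightarrow>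
           ((\<lambda>\<alpha>. c \<alpha> * (\<Prod>b\<in>B. u b ^ \<alpha> b)) has_sum f (p + (\<Sum>b\<in>B. u b *\<^sub>R b)))
             (B \<rightarrow>\<^sub>E (UNIV :: nat set))))"

definition concave_envelope ::
    "'i set \<Rightarrow> ('i \<Rightarrow> 'v::real_vector set) \<Rightarrow> ('i \<Rightarrow> 'v \<Rightarrow> real) \<Rightarrow> 'v set \<Rightarrow> ('v \<Rightarrow> real) \<Rightarrow> bool" where
  "concave_envelope I Ds hs D h \<longleftrightarrow>
     D = convex hull (\<Union>i\<in>I. Ds i) \<and>
     concave_on D h \<and> (\<forall>i\<in>I. \<forall>x\<in>Ds i. hs i x \<le> h x) \<and>
     (\<forall>g. concave_on D g \<and> (\<forall>i\<in>I. \<forall>x\<in>Ds i. hs i x \<le> g x) \<longrightarrow> (\<forall>x\<in>D. h x \<le> g x))"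

text \<open>To be used for a planar set \<open>K\<close>; the closed polygon \<open>a 0, \<dots>, a l = a 0\<close> traverses its boundary.\<close>

definition piecewise_C1_on_frontier :: "'v::euclidean_space set \<Rightarrow> ('v \<Rightarrow> real) \<Rightarrow> bool" where
  "piecewise_C1_on_frontier K h \<longleftrightarrow>
     (\<exists>(l::nat) a. a l = a 0 \<and> (\<forall>i\<le>l. a i \<in> frontier K) \<and>
        frontier K \<subseteq> (\<Union>i<l. closed_segment (a i) (a (Suc i))) \<and>
        (\<forall>i<l. (\<exists>F. is_face K F \<and> closed_segment (a i) (a (Suc i)) \<subseteq> F) \<and>
               (\<lambda>t. h ((1 - t) *\<^sub>R a i + t *\<^sub>R a (Suc i))) C1_differentiable_on {0<..<1}))"

end

(*
  Words of length N + 1, on which the potential depends, are the edges of a finite graph. The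
  probabilities of these words under an invariant measure form a stationary flow q on it, and the
  integral of the potential is a linear function (mean) of q. Among the measures with a given flow the
  Markov measure has the largest entropy, E(q) = - sum_e q(e) ln (q(e) / outflow of q at src e). So the
  rotation set is the image of the polytope of flows, and the localized entropy is the maximum of the
  concave function E over the fibres of the mean.

  The flows over a face are those carried by some set of edges. By conservation of mass this set is a
  union of strongly connected components without edges between them, and a flow is a convex combination
  of flows on the components, the entropy being affine in it. Hence the entropy on the face is the
  concave envelope of the functions h_i of the components. On a connected component the maximiser over
  an interior point is positive on all edges and is a nondegenerate critical point. The critical point
  equation involves only logarithms of affine functions, and is solved by the contraction principle in
  the Banach algebra of absolutely summable power series, which gives the analyticity of h_i.

  On an edge of a planar rotation set, the supporting line of the envelope at a point is unique unless
  the point is an endpoint of some F_i, and a concave function with unique supporting lines is C1.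
  Finally, for the full shift on the symbols 0, ..., 3 with the blocks {0}, {1, 2}, {3}, the face of
  the measures that do not change the block carries the entropy min(s, 2 - s) ln 2, where s is the mean
  number of the block.
*)

theory Submission
  imports Defs "HOL-Library.Function_Algebras" "HOL-Real_Asymp.Real_Asymp"
begin

section \<open>Absolutely summable families as a Banach algebra\<close>

text \<open>Three points carry the weight. First, analyticity asks for a power series of a
  constrained maximum whose maximiser is only implicit. Evaluation at a point of the polydisc is a
  bounded ring homomorphism on the algebra of series, so it commutes with the logarithm series; one
  fixed point in the algebra solves the critical equations at all points at once, and the entropy
  there is itself an element of the algebra, whose coefficients are the required ones. Second,
  nondegeneracy: the entropy is homogeneous of degree one, so its second derivative vanishes along
  the flow itself, and on a disconnected graph along each component. Connectedness leaves only the
  multiples of the flow, and fixing the total mass excludes these. Third, the bounds on the entropy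
  of a flow (concavity, first order conditions, optimality, the example) come from one Gibbs
  inequality with a freely chosen substochastic weight on the edges. On the side of the measures the
  corresponding role is played by the nonnegativity of conditional mutual information.\<close>

lemma abs_summable_on_real_iff: "(\<lambda>a. \<bar>f a\<bar>) summable_on A \<longleftrightarrow> f summable_on A" for f :: "'a \<Rightarrow> real"
  by (subst (2) summable_on_iff_abs_summable_on_real) simp

text \<open>Over the reals, unconditional summability is absolute summability, so this is the space
  l^1. With multisets as indices its elements are the power series that converge absolutely on the
  closed unit polydisc.\<close>

typedef 'a l1 = "{c :: 'a \<Rightarrow> real. c summable_on UNIV}"
  morphisms coeff Abs_l1
  by (rule exI[of _ "\<lambda>_. 0"]) simp

setup_lifting type_definition_l1

lemma coeff_summable [simp]: "coeff f summable_on UNIV"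
  using coeff by auto

lemma coeff_abs_summable [simp]: "(\<lambda>a. \<bar>coeff f a\<bar>) summable_on UNIV"
  by (simp add: abs_summable_on_real_iff)

lemma l1_eqI: "(\<And>a. coeff f a = coeff g a) \<Longrightarrow> f = g"
  by transfer auto

instantiation l1 :: (type) real_vector
begin

lift_definition zero_l1 :: "'a l1" is "\<lambda>_. 0" by simp
lift_definition plus_l1 :: "'a l1 \<Rightarrow> 'a l1 \<Rightarrow> 'a l1" is "\<lambda>f g a. f a + g a"
  by (simp add: summable_on_add)
lift_definition uminus_l1 :: "'a l1 \<Rightarrow> 'a l1" is "\<lambda>f a. - f a"
  by (simp add: summable_on_uminus)
lift_definition minus_l1 :: "'a l1 \<Rightarrow> 'a l1 \<Rightarrow> 'a l1" is "\<lambda>f g a. f a - g a"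
  by (simp only: mem_Collect_eq diff_conv_add_uminus summable_on_add summable_on_uminus)
lift_definition scaleR_l1 :: "real \<Rightarrow> 'a l1 \<Rightarrow> 'a l1" is "\<lambda>r f a. r * f a"
  by (simp add: summable_on_cmult_right)

instance
  by standard (transfer; auto simp: algebra_simps fun_eq_iff)+

end

lemma coeff_simps [simp]:
  "coeff 0 a = 0" "coeff (f + g) a = coeff f a + coeff g a" "coeff (- f) a = - coeff f a"
  "coeff (f - g) a = coeff f a - coeff g a" "coeff (r *\<^sub>R f) a = r * coeff f a"
  by (simp_all add: zero_l1.rep_eq plus_l1.rep_eq uminus_l1.rep_eq minus_l1.rep_eq scaleR_l1.rep_eq)

instantiation l1 :: (type) real_normed_vector
begin

definition norm_l1 :: "'a l1 \<Rightarrow> real" where "norm_l1 f = (\<Sum>\<^sub>\<infinity>a. \<bar>coeff f a\<bar>)"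
definition sgn_l1 :: "'a l1 \<Rightarrow> 'a l1" where "sgn_l1 f = f /\<^sub>R norm f"
definition dist_l1 :: "'a l1 \<Rightarrow> 'a l1 \<Rightarrow> real" where "dist_l1 f g = norm (f - g)"
definition uniformity_l1 :: "('a l1 \<times> 'a l1) filter" where
  "uniformity_l1 = (INF e\<in>{0<..}. principal {(x, y). dist x y < e})"
definition open_l1 :: "'a l1 set \<Rightarrow> bool" where
  "open_l1 U \<longleftrightarrow> (\<forall>x\<in>U. eventually (\<lambda>(x', y). x' = x \<longrightarrow> y \<in> U) uniformity)"

instance
proof
  fix f g h :: "'a l1" and r s :: real
  show "dist f g = norm (f - g)" by (simp add: dist_l1_def)
  show "sgn f = f /\<^sub>R norm f" by (simp add: sgn_l1_def)
  show "norm (r *\<^sub>R f) = \<bar>r\<bar> * norm f"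
    by (simp add: norm_l1_def abs_mult infsum_cmult_right')
  have "(\<Sum>\<^sub>\<infinity>a. \<bar>coeff f a + coeff g a\<bar>) \<le> (\<Sum>\<^sub>\<infinity>a. \<bar>coeff f a\<bar> + \<bar>coeff g a\<bar>)"
    using coeff_abs_summable[of "f + g"]
    by (intro infsum_mono summable_on_add coeff_abs_summable) (simp_all add: abs_triangle_ineq)
  then show "norm (f + g) \<le> norm f + norm g"
    by (simp add: norm_l1_def infsum_add)
  show "norm f = 0 \<longleftrightarrow> f = 0"
  proof
    assume "norm f = 0"
    then have "\<bar>coeff f a\<bar> = 0" for a
      by (intro nonneg_infsum_le_0D[of "\<lambda>a. \<bar>coeff f a\<bar>" UNIV]) (auto simp: norm_l1_def)
    then show "f = 0" by (intro l1_eqI) (simp add: zero_l1.rep_eq)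
  qed (simp add: norm_l1_def zero_l1.rep_eq)
qed (fact uniformity_l1_def open_l1_def)+

end

lemma sum_abs_coeff_le_norm: "finite F \<Longrightarrow> (\<Sum>a\<in>F. \<bar>coeff f a\<bar>) \<le> norm f"
  unfolding norm_l1_def by (rule finite_sum_le_infsum) auto

lemma abs_coeff_le_norm: "\<bar>coeff f a\<bar> \<le> norm f"
  using sum_abs_coeff_le_norm[of "{a}" f] by simp

instance l1 :: (type) banach
proof
  fix X :: "nat \<Rightarrow> 'a l1"
  assume X: "Cauchy X"
  have "Cauchy (\<lambda>n. coeff (X n) a)" for a
    unfolding Cauchy_def
  proof (intro allI impI)
    fix e :: real assume "e > 0"
    then obtain M where "\<forall>m\<ge>M. \<forall>n\<ge>M. dist (X m) (X n) < e" using X unfolding Cauchy_def by blast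
    moreover have "dist (coeff (X m) a) (coeff (X n) a) \<le> dist (X m) (X n)" for m n
      using abs_coeff_le_norm[of "X m - X n" a] by (simp add: dist_norm)
    ultimately show "\<exists>M. \<forall>m\<ge>M. \<forall>n\<ge>M. dist (coeff (X m) a) (coeff (X n) a) < e"
      by (meson le_less_trans)
  qed
  then have "\<exists>l. (\<lambda>n. coeff (X n) a) \<longlonglongrightarrow> l" for a by (simp add: Cauchy_convergent_iff convergent_def)
  then obtain c where c: "\<And>a. (\<lambda>n. coeff (X n) a) \<longlonglongrightarrow> c a" by metis
  \<comment> \<open>The finite partial sums of the distances are bounded uniformly and keep the
    bound when \<open>n\<close> tends to infinity; the supremum over finite sets then bounds the
    distance to the pointwise limit \<open>c\<close>.\<close>
  have tail: "\<exists>M. \<forall>m\<ge>M. (\<lambda>a. coeff (X m) a - c a) summable_on UNIV \<and> (\<Sum>\<^sub>\<infinity>a. \<bar>coeff (X m) a - c a\<bar>) \<le> e"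
    if "e > 0" for e
  proof -
    obtain M where M: "\<And>m n. m \<ge> M \<Longrightarrow> n \<ge> M \<Longrightarrow> dist (X m) (X n) < e"
      using X \<open>e > 0\<close> unfolding Cauchy_def by meson
    have fin: "(\<Sum>a\<in>F. \<bar>coeff (X m) a - c a\<bar>) \<le> e" if "finite F" "m \<ge> M" for F m
    proof (rule LIMSEQ_le_const2)
      show "(\<lambda>n. \<Sum>a\<in>F. \<bar>coeff (X m) a - coeff (X n) a\<bar>) \<longlonglongrightarrow> (\<Sum>a\<in>F. \<bar>coeff (X m) a - c a\<bar>)"
        by (intro tendsto_intros c)
      have "(\<Sum>a\<in>F. \<bar>coeff (X m) a - coeff (X n) a\<bar>) \<le> e" if "n \<ge> M" for n
        using sum_abs_coeff_le_norm[OF \<open>finite F\<close>, of "X m - X n"] M[OF \<open>m \<ge> M\<close> that]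
        by (simp add: dist_norm)
      then show "\<exists>N. \<forall>n\<ge>N. (\<Sum>a\<in>F. \<bar>coeff (X m) a - coeff (X n) a\<bar>) \<le> e" by blast
    qed
    have "(\<lambda>a. \<bar>coeff (X m) a - c a\<bar>) summable_on UNIV" if "m \<ge> M" for m
      using fin[OF _ that] by (intro nonneg_bdd_above_summable_on) (auto intro!: bdd_aboveI)
    then show ?thesis
      using fin
      by (intro exI[of _ M]) (auto intro!: infsum_le_finite_sums simp: abs_summable_on_real_iff)
  qed
  obtain m0 where "(\<lambda>a. coeff (X m0) a - c a) summable_on UNIV" using tail[of 1] by auto
  then have "(\<lambda>a. coeff (X m0) a + - (coeff (X m0) a - c a)) summable_on UNIV"
    by (intro summable_on_add coeff_summable) (simp only: summable_on_uminus)
  then have cs: "c summable_on UNIV" by simp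
  then have cc: "coeff (Abs_l1 c) = c" by (simp add: Abs_l1_inverse)
  have "X \<longlonglongrightarrow> Abs_l1 c"
  proof (rule metric_LIMSEQ_I)
    fix r :: real assume "r > 0"
    then obtain M where "\<And>m. m \<ge> M \<Longrightarrow> (\<Sum>\<^sub>\<infinity>a. \<bar>coeff (X m) a - c a\<bar>) \<le> r / 2"
      using tail[of "r/2"] by auto
    then show "\<exists>no. \<forall>n\<ge>no. dist (X n) (Abs_l1 c) < r"
      using \<open>r > 0\<close> by (intro exI[of _ M]) (force simp: dist_norm norm_l1_def cc)
  qed
  then show "convergent X" by (auto simp: convergent_def)
qed

section \<open>Pairing of summable families with bounded functions\<close>

definition l1_pair :: "('a \<Rightarrow> real) \<Rightarrow> 'a l1 \<Rightarrow> real" where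
  "l1_pair T f = (\<Sum>\<^sub>\<infinity>a. T a * coeff f a)"

lemma l1_pair_summable:
  assumes "\<And>a. \<bar>T a\<bar> \<le> C"
  shows "(\<lambda>a. T a * coeff f a) summable_on UNIV"
proof -
  have "(\<lambda>a. norm (T a * coeff f a)) summable_on UNIV"
  proof (rule summable_on_comparison_test)
    show "(\<lambda>a. C * \<bar>coeff f a\<bar>) summable_on UNIV" by (simp add: summable_on_cmult_right)
    show "norm (T a * coeff f a) \<le> C * \<bar>coeff f a\<bar>" for a
      using assms[of a] by (simp add: abs_mult mult_right_mono)
  qed simp
  then show ?thesis by (simp only: real_norm_def abs_summable_on_real_iff)
qed

lemma l1_pair_has_sum:
  assumes "\<And>a. \<bar>T a\<bar> \<le> C"
  shows "((\<lambda>a. T a * coeff f a) has_sum l1_pair T f) UNIV"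
  using l1_pair_summable[of T C f, OF assms] by (simp add: l1_pair_def)

lemma l1_pair_bound:
  assumes "\<And>a. \<bar>T a\<bar> \<le> C"
  shows "\<bar>l1_pair T f\<bar> \<le> C * norm f"
proof -
  have *: "(\<lambda>a. norm (T a * coeff f a)) summable_on UNIV"
    using l1_pair_summable[of T C f, OF assms] by (simp only: real_norm_def abs_summable_on_real_iff)
  have "\<bar>l1_pair T f\<bar> \<le> (\<Sum>\<^sub>\<infinity>a. \<bar>T a * coeff f a\<bar>)"
    unfolding l1_pair_def using norm_infsum_bound[OF *] by simp
  also have "\<dots> \<le> (\<Sum>\<^sub>\<infinity>a. C * \<bar>coeff f a\<bar>)"
  proof (rule infsum_mono)
    show "\<bar>T a * coeff f a\<bar> \<le> C * \<bar>coeff f a\<bar>" for a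
      using assms[of a] by (simp add: abs_mult mult_right_mono)
  qed (use * in \<open>simp_all add: summable_on_cmult_right\<close>)
  finally show ?thesis by (simp add: norm_l1_def infsum_cmult_right')
qed

lemma l1_pair_linear:
  assumes "\<And>a. \<bar>T a\<bar> \<le> C"
  shows "l1_pair T (f + g) = l1_pair T f + l1_pair T g" "l1_pair T (r *\<^sub>R f) = r * l1_pair T f"
proof -
  show "l1_pair T (f + g) = l1_pair T f + l1_pair T g"
    using infsum_add[OF l1_pair_summable[of T C f, OF assms] l1_pair_summable[of T C g, OF assms]]
    by (simp only: l1_pair_def coeff_simps distrib_left)
  have "(\<Sum>\<^sub>\<infinity>a. T a * (r * coeff f a)) = (\<Sum>\<^sub>\<infinity>a. r * (T a * coeff f a))"
    by (simp only: mult.left_commute)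
  then show "l1_pair T (r *\<^sub>R f) = r * l1_pair T f"
    by (simp add: l1_pair_def infsum_cmult_right')
qed

lemma bounded_linear_l1_pair:
  assumes "\<And>a. \<bar>T a\<bar> \<le> C"
  shows "bounded_linear (l1_pair T)"
  by (rule bounded_linear_intro[where K = C])
     (use l1_pair_linear[OF assms] l1_pair_bound[OF assms] in \<open>auto simp: mult.commute\<close>)

lemma l1_pair_delta: "l1_pair (\<lambda>x. if x = a then 1 else 0) f = coeff f a"
proof -
  have "l1_pair (\<lambda>x. if x = a then 1 else 0) f = (\<Sum>\<^sub>\<infinity>x\<in>{a}. coeff f x)"
    unfolding l1_pair_def by (rule infsum_cong_neutral) auto
  then show ?thesis by simp
qed

text \<open>Bounded functions include the deltas and so separate points. Associativity, unit and
  distributivity are verified against arbitrary bounded functions, where products become iterated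
  pairings.\<close>

lemma l1_pair_eqI:
  assumes "\<And>T C. (\<And>a. \<bar>T a\<bar> \<le> C) \<Longrightarrow> l1_pair T f = l1_pair T g"
  shows "f = g"
proof (rule l1_eqI)
  fix a
  have "l1_pair (\<lambda>x. if x = a then 1 else 0) f = l1_pair (\<lambda>x. if x = a then 1 else 0) g"
    by (rule assms[of _ 1]) auto
  then show "coeff f a = coeff g a" by (simp only: l1_pair_delta)
qed

lift_definition l1_unit :: "'a \<Rightarrow> 'a l1" is "\<lambda>a x. if x = a then 1 else 0"
  by (rule finite_nonzero_values_imp_summable_on) auto

lemma coeff_unit [simp]: "coeff (l1_unit a) x = (if x = a then 1 else 0)"
  by (simp add: l1_unit.rep_eq)

lemma l1_pair_unit [simp]: "l1_pair T (l1_unit a) = T a"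
proof -
  have "l1_pair T (l1_unit a) = (\<Sum>\<^sub>\<infinity>x\<in>{a}. T x)"
    unfolding l1_pair_def by (rule infsum_cong_neutral) auto
  then show ?thesis by simp
qed

lemma norm_unit [simp]: "norm (l1_unit a) = 1"
proof -
  have "norm (l1_unit a) = (\<Sum>\<^sub>\<infinity>x. \<bar>coeff (l1_unit a) x\<bar>)" by (simp add: norm_l1_def)
  also have "\<dots> = (\<Sum>\<^sub>\<infinity>x\<in>{a}. 1)" by (rule infsum_cong_neutral) auto
  finally show ?thesis by simp
qed

section \<open>Convolution over a commutative monoid\<close>

lemma l1_product_has_sum_fibres:
  fixes f g :: "'a::comm_monoid_add l1" and T :: "'a \<Rightarrow> real"
  assumes T: "\<And>a. \<bar>T a\<bar> \<le> C"
  defines "S \<equiv> \<lambda>a. {p. fst p + snd p = a}"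
  shows "((\<lambda>a. T a * (\<Sum>\<^sub>\<infinity>p\<in>S a. coeff f (fst p) * coeff g (snd p))) has_sum
           (l1_pair (\<lambda>b. l1_pair (\<lambda>c. T (b + c)) g) f)) UNIV"
proof -
  define G where "G p = coeff f (fst p) * coeff g (snd p)" for p
  define F where "F p = T (fst p + snd p) * G p" for p
  have "(\<Sum>\<^sub>\<infinity>y. \<bar>G (x, y)\<bar>) = \<bar>coeff f x\<bar> * norm g" for x
    by (simp add: G_def abs_mult infsum_cmult_right' norm_l1_def)
  moreover have "(\<lambda>x. \<bar>coeff f x\<bar> * norm g) summable_on UNIV"
    by (rule summable_on_cmult_left) simp
  moreover have "(\<lambda>y. \<bar>G (x, y)\<bar>) summable_on UNIV" for x
    by (simp add: G_def abs_mult summable_on_cmult_right)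
  ultimately have pr: "(\<lambda>p. norm (G p)) summable_on UNIV \<times> UNIV"
    using Infinite_Sum.abs_summable_on_Sigma_iff[of G UNIV "\<lambda>_. UNIV"] by (simp add: abs_mult)
  have "(\<lambda>p. norm (F p)) summable_on UNIV"
  proof (rule summable_on_comparison_test)
    show "(\<lambda>p. C * norm (G p)) summable_on UNIV"
      using pr by (intro summable_on_cmult_right) simp
    show "norm (F p) \<le> C * norm (G p)" for p
      by (simp add: F_def abs_mult T mult_right_mono)
  qed simp
  then have Fs: "F summable_on UNIV"
    by (simp only: real_norm_def abs_summable_on_real_iff)
  have inner: "(\<Sum>\<^sub>\<infinity>c. F (b, c)) = l1_pair (\<lambda>c. T (b + c)) g * coeff f b" for b
  proof -
    have "F (b, c) = coeff f b * (T (b + c) * coeff g c)" for c by (simp add: F_def G_def)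
    then show ?thesis by (simp add: l1_pair_def infsum_cmult_right')
  qed
  have "(\<Sum>\<^sub>\<infinity>b. \<Sum>\<^sub>\<infinity>c. F (b, c)) = infsum F (UNIV \<times> UNIV)"
    using infsum_Sigma'_banach[of "\<lambda>b c. F (b, c)" UNIV "\<lambda>_. UNIV"] Fs
    by (simp add: case_prod_unfold)
  then have 1: "infsum F UNIV = l1_pair (\<lambda>b. l1_pair (\<lambda>c. T (b + c)) g) f"
    unfolding inner by (simp add: l1_pair_def[of "\<lambda>b. l1_pair (\<lambda>c. T (b + c)) g"])
  \<comment> \<open>The absolutely convergent double sum is regrouped along the fibres of
    addition.\<close>
  have bij: "bij_betw snd (Sigma UNIV S) UNIV"
    by (rule bij_betwI[where g = "\<lambda>p. (fst p + snd p, p)"]) (auto simp: S_def)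
  have "((\<lambda>p. F (snd p)) has_sum infsum F UNIV) (Sigma UNIV S)"
    using has_sum_reindex_bij_betw[OF bij, of F] Fs by simp
  then have s2: "((\<lambda>(a, p). F p) has_sum infsum F UNIV) (Sigma UNIV S)"
    by (simp add: case_prod_unfold)
  have "((\<lambda>a. \<Sum>\<^sub>\<infinity>p\<in>S a. F p) has_sum infsum F UNIV) UNIV"
  proof (rule has_sum_SigmaD[OF s2])
    fix a :: 'a
    have "F summable_on S a" using summable_on_subset_banach[OF Fs] by simp
    then show "((\<lambda>y. case (a, y) of (a, p) \<Rightarrow> F p) has_sum infsum F (S a)) (S a)" by simp
  qed
  moreover have "(\<Sum>\<^sub>\<infinity>p\<in>S a. F p) = T a * (\<Sum>\<^sub>\<infinity>p\<in>S a. G p)" for a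
  proof -
    have "(\<Sum>\<^sub>\<infinity>p\<in>S a. F p) = (\<Sum>\<^sub>\<infinity>p\<in>S a. T a * G p)"
      by (rule infsum_cong) (auto simp: F_def S_def)
    then show ?thesis by (simp add: infsum_cmult_right')
  qed
  ultimately show ?thesis using 1 by (simp add: G_def)
qed

instantiation l1 :: (comm_monoid_add) comm_ring_1
begin

lift_definition times_l1 :: "'a l1 \<Rightarrow> 'a l1 \<Rightarrow> 'a l1" is
  "\<lambda>f g a. \<Sum>\<^sub>\<infinity>p\<in>{p. fst p + snd p = a}. f (fst p) * g (snd p)"
subgoal premises fg for f g
proof -
  have eq: "coeff (Abs_l1 f) = f" "coeff (Abs_l1 g) = g" using fg by (auto simp: Abs_l1_inverse)
  \<comment> \<open>The weight \<open>T = 1\<close> in the fibre sum shows that the convolution is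
    summable.\<close>
  have "\<bar>1 :: real\<bar> \<le> 1" by simp
  from has_sum_imp_summable[OF l1_product_has_sum_fibres[of "\<lambda>_. 1", OF this, of "Abs_l1 f" "Abs_l1 g"]]
  show ?thesis by (simp add: eq)
qed
done

definition one_l1 :: "'a l1" where "one_l1 = l1_unit 0"

lemma l1_pair_times:
  fixes f g :: "'a l1"
  assumes "\<And>a. \<bar>T a\<bar> \<le> C"
  shows "l1_pair T (f * g) = l1_pair (\<lambda>b. l1_pair (\<lambda>c. T (b + c)) g) f"
  using infsumI[OF l1_product_has_sum_fibres[of T C f g, OF assms]]
  by (simp add: l1_pair_def[of T "f * g"] times_l1.rep_eq)

instance
proof
  fix f g h :: "'a l1"
  show "f * g * h = f * (g * h)"
  proof (rule l1_pair_eqI)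
    fix T :: "'a \<Rightarrow> real" and C assume T: "\<And>a. \<bar>T a\<bar> \<le> C"
    have "\<bar>l1_pair (\<lambda>c. T (b + c)) h\<bar> \<le> C * norm h" for b by (rule l1_pair_bound) (rule T)
    then have "l1_pair T (f * g * h) = l1_pair (\<lambda>b. l1_pair (\<lambda>c. l1_pair (\<lambda>d. T (b + c + d)) h) g) f"
      unfolding l1_pair_times[of T C "f * g" h, OF T] by (rule l1_pair_times)
    also have "\<dots> = l1_pair (\<lambda>b. l1_pair (\<lambda>c. T (b + c)) (g * h)) f"
      by (subst l1_pair_times[of _ C g h]) (simp_all only: T add.assoc)
    also have "\<dots> = l1_pair T (f * (g * h))"
      by (rule l1_pair_times[symmetric]) (rule T)
    finally show "l1_pair T (f * g * h) = l1_pair T (f * (g * h))" .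
  qed
  show "f * g = g * f"
  proof (rule l1_eqI)
    fix a :: 'a
    have "bij_betw prod.swap {p. fst p + snd p = a} {p. fst p + snd p = a}"
      by (rule bij_betwI[where g = prod.swap]) (auto simp: add.commute[of "fst _"])
    from infsum_reindex_bij_betw[OF this, of "\<lambda>p. coeff f (fst p) * coeff g (snd p)"]
    show "coeff (f * g) a = coeff (g * f) a"
      by (simp add: times_l1.rep_eq mult.commute)
  qed
  show "1 * f = f"
  proof (rule l1_pair_eqI)
    fix T :: "'a \<Rightarrow> real" and C assume T: "\<And>a. \<bar>T a\<bar> \<le> C"
    show "l1_pair T (1 * f) = l1_pair T f"
      unfolding l1_pair_times[of T C 1 f, OF T] by (simp add: one_l1_def)
  qed
  show "(f + g) * h = f * h + g * h"
  proof (rule l1_pair_eqI)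
    fix T :: "'a \<Rightarrow> real" and C assume T: "\<And>a. \<bar>T a\<bar> \<le> C"
    have "\<bar>l1_pair (\<lambda>c. T (b + c)) h\<bar> \<le> C * norm h" for b by (rule l1_pair_bound) (rule T)
    note lin = l1_pair_linear(1)[of "\<lambda>b. l1_pair (\<lambda>c. T (b + c)) h", OF this]
    show "l1_pair T ((f + g) * h) = l1_pair T (f * h + g * h)"
      unfolding l1_pair_times[of T C _ h, OF T] l1_pair_linear(1)[of T C, OF T] lin ..
  qed
  show "(0 :: 'a l1) \<noteq> 1"
    by (metis coeff_simps(1) coeff_unit one_l1_def zero_neq_one)
qed

end

instance l1 :: (comm_monoid_add) real_normed_algebra_1
proof
  fix f g :: "'a l1" and r :: real
  show scale: "r *\<^sub>R f * g = r *\<^sub>R (f * g)" for f g :: "'a l1"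
  proof (rule l1_pair_eqI)
    fix T :: "'a \<Rightarrow> real" and C assume T: "\<And>a. \<bar>T a\<bar> \<le> C"
    have "\<bar>l1_pair (\<lambda>c. T (b + c)) g\<bar> \<le> C * norm g" for b by (rule l1_pair_bound) (rule T)
    note lin = l1_pair_linear(2)[of "\<lambda>b. l1_pair (\<lambda>c. T (b + c)) g", OF this]
    show "l1_pair T (r *\<^sub>R f * g) = l1_pair T (r *\<^sub>R (f * g))"
      unfolding l1_pair_times[of T C _ g, OF T] l1_pair_linear(2)[of T C, OF T] lin ..
  qed
  show "f * r *\<^sub>R g = r *\<^sub>R (f * g)"
    by (metis scale mult.commute)
  show "norm (1 :: 'a l1) = 1" by (simp add: one_l1_def)
  \<comment> \<open>The sign of the product is a bounded function against which the pairing attains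
    the norm.\<close>
  have "norm (f * g) = l1_pair (\<lambda>a. sgn (coeff (f * g) a)) (f * g)"
    by (simp add: norm_l1_def l1_pair_def abs_sgn mult.commute)
  also have "\<dots> = l1_pair (\<lambda>b. l1_pair (\<lambda>c. sgn (coeff (f * g) (b + c))) g) f"
    by (rule l1_pair_times[of _ 1]) (simp add: sgn_if)
  also have "\<bar>\<dots>\<bar> \<le> (1 * norm g) * norm f"
    by (intro l1_pair_bound) (simp add: sgn_if)
  finally show "norm (f * g) \<le> norm f * norm g" by (simp add: mult.commute)
qed

text \<open>A bounded character of the index monoid induces a ring homomorphism to the reals.
  Evaluation of power series at a point is of this kind.\<close>

lemma l1_pair_character_times:
  fixes f g :: "'a::comm_monoid_add l1"
  assumes T: "\<And>a. \<bar>T a\<bar> \<le> C" and "\<And>a b. T (a + b) = T a * T b"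
  shows "l1_pair T (f * g) = l1_pair T f * l1_pair T g"
proof -
  have "l1_pair (\<lambda>c. T (b + c)) g = T b * l1_pair T g" for b
    by (simp add: assms(2) l1_pair_def mult.assoc infsum_cmult_right')
  then have "l1_pair T (f * g) = (\<Sum>\<^sub>\<infinity>a. (T a * coeff f a) * l1_pair T g)"
    by (simp add: l1_pair_times[OF T] l1_pair_def[of _ f] mult_ac)
  then show ?thesis by (simp add: infsum_cmult_left' l1_pair_def[of _ f])
qed

section \<open>An implicit function theorem in Banach algebras\<close>

definition ln1p :: "'a::{real_normed_algebra_1,banach} \<Rightarrow> 'a" where
  "ln1p z = (\<Sum>n. ((-1) ^ n / real (Suc n)) *\<^sub>R z ^ Suc n)"

lemma norm_power_diff_le:
  fixes x y :: "'a::{real_normed_algebra_1,comm_ring_1}"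
  assumes "norm x \<le> s" "norm y \<le> s"
  shows "norm (x ^ Suc n - y ^ Suc n) \<le> real (Suc n) * s ^ n * norm (x - y)"
proof (induction n)
  case (Suc n)
  have s: "s \<ge> 0" using assms(1) norm_ge_zero order_trans by blast
  have "x ^ Suc (Suc n) - y ^ Suc (Suc n) = x * (x ^ Suc n - y ^ Suc n) + (x - y) * y ^ Suc n"
    by (simp add: algebra_simps)
  also have "norm \<dots> \<le> norm x * norm (x ^ Suc n - y ^ Suc n) + norm (x - y) * norm (y ^ Suc n)"
    by (intro order_trans[OF norm_triangle_ineq] add_mono norm_mult_ineq)
  also have "\<dots> \<le> s * (real (Suc n) * s ^ n * norm (x - y)) + norm (x - y) * s ^ Suc n"
    using assms Suc s order_trans[OF norm_power_ineq[of y "Suc n"] power_mono[OF assms(2)]]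
    by (intro add_mono mult_mono mult_left_mono) auto
  also have "\<dots> = real (Suc (Suc n)) * s ^ Suc n * norm (x - y)"
    by (simp add: algebra_simps)
  finally show ?case .
qed simp

lemma ln1p_summable:
  fixes z :: "'a::{real_normed_algebra_1,banach}"
  assumes "norm z < 1"
  shows "summable (\<lambda>n. ((-1) ^ n / real (Suc n)) *\<^sub>R z ^ Suc n)"
proof (rule summable_comparison_test')
  show "summable (\<lambda>n. norm z ^ n)" using assms by (simp add: summable_geometric)
  fix n :: nat
  have "norm (((-1) ^ n / real (Suc n)) *\<^sub>R z ^ Suc n) = (1 / real (Suc n)) * norm (z ^ Suc n)"
    by (simp add: power_abs)
  also have "\<dots> \<le> 1 * norm z ^ Suc n"
    by (intro mult_mono norm_power_ineq) auto
  also have "\<dots> \<le> norm z ^ n"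
    using assms by (simp add: mult_left_le_one_le)
  finally show "norm (((-1) ^ n / real (Suc n)) *\<^sub>R z ^ Suc n) \<le> norm z ^ n" .
qed

text \<open>Without its linear term the series has Lipschitz constant s + s^2 + ... = s / (1 - s)
  \<le> 2 s on the ball of radius s. That this tends to 0 with s makes the Newton type map below a
  contraction.\<close>

lemma ln1p_remainder_lipschitz:
  fixes x y :: "'a::{real_normed_algebra_1,comm_ring_1,banach}"
  assumes x: "norm x \<le> s" and y: "norm y \<le> s" and s: "s \<le> 1/2"
  shows "norm ((ln1p x - x) - (ln1p y - y)) \<le> 2 * s * norm (x - y)"
proof -
  define t where "t n = ((-1) ^ n / real (Suc n)) *\<^sub>R (x ^ Suc n - y ^ Suc n)" for n
  have s0: "s \<ge> 0" using x norm_ge_zero order_trans by blast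
  have xs: "norm x < 1" and ys: "norm y < 1" using assms by auto
  have t: "t sums (ln1p x - ln1p y)"
    using sums_diff[OF summable_sums[OF ln1p_summable[OF xs]] summable_sums[OF ln1p_summable[OF ys]]]
    by (simp only: t_def[abs_def] ln1p_def scaleR_diff_right)
  have "(\<lambda>n. t (Suc n)) sums (ln1p x - ln1p y - t 0)"
    using t sums_Suc_iff by (metis add.commute diff_add_cancel)
  then have t1: "(\<lambda>n. t (Suc n)) sums ((ln1p x - x) - (ln1p y - y))"
    by (simp add: t_def algebra_simps)
  have bound: "norm (t (Suc n)) \<le> s ^ Suc n * norm (x - y)" for n
  proof -
    have "norm (t (Suc n)) = (1 / real (Suc (Suc n))) * norm (x ^ Suc (Suc n) - y ^ Suc (Suc n))"
      by (simp add: t_def power_abs)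
    also have "\<dots> \<le> (1 / real (Suc (Suc n))) * (real (Suc (Suc n)) * s ^ Suc n * norm (x - y))"
      by (intro mult_left_mono norm_power_diff_le x y) auto
    finally show ?thesis by simp
  qed
  have g: "(\<lambda>n. s ^ Suc n * norm (x - y)) sums (s * (1 / (1 - s)) * norm (x - y))"
    using sums_mult2[OF sums_mult[OF geometric_sums[of s], of s], of "norm (x - y)"] s s0 by simp
  have "norm ((ln1p x - x) - (ln1p y - y)) \<le> (\<Sum>n. s ^ Suc n * norm (x - y))"
    unfolding sums_unique[OF t1] by (rule norm_suminf_le) (use bound g sums_summable in blast)+
  also have "\<dots> = s * (1 / (1 - s)) * norm (x - y)" using g sums_unique by metis
  also have "\<dots> \<le> 2 * s * norm (x - y)"
    using s s0 mult_left_mono[of "1 / (1 - s)" 2 s] by (intro mult_right_mono) (auto simp: field_simps)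
  finally show ?thesis .
qed

lemma ln1p_0 [simp]: "ln1p 0 = 0"
  by (simp add: ln1p_def)

text \<open>A bounded multiplicative functional acts on the series term by term. This carries
  solutions found in the algebra over to real numbers.\<close>

lemma ln1p_homomorphism:
  fixes h :: "'a::{real_normed_algebra_1,banach} \<Rightarrow> real"
  assumes h: "bounded_linear h" and h_mult: "\<And>f g. h (f * g) = h f * h g"
    and h_bound: "\<And>f. \<bar>h f\<bar> \<le> norm f" and z: "norm z < 1"
  shows "h (ln1p z) = ln (1 + h z)"
proof -
  have pow: "h (z ^ Suc n) = h z ^ Suc n" for n by (induction n) (simp_all add: h_mult)
  have hz: "\<bar>h z\<bar> < 1" using h_bound[of z] z by linarith
  have "h (ln1p z) = (\<Sum>n. h (((-1) ^ n / real (Suc n)) *\<^sub>R z ^ Suc n))"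
    unfolding ln1p_def by (rule bounded_linear.suminf[OF h ln1p_summable[OF z]])
  also have "\<dots> = (\<Sum>n. (-1) ^ n * (1 / real (n + 1)) * (1 + h z - 1) ^ Suc n)"
    by (simp only: linear_simps(5)[OF h] pow) simp
  also have "\<dots> = ln (1 + h z)"
    by (rule ln_series[symmetric]) (use hz in auto)
  finally show ?thesis .
qed

text \<open>Banach's fixed point theorem for the sum norm on tuples. Tuples are plain functions of
  which only the coordinates in \<open>K\<close> are controlled, so the equation is asserted only
  there.\<close>

lemma finite_tuple_banach_fix:
  fixes T :: "('k \<Rightarrow> 'a::banach) \<Rightarrow> 'k \<Rightarrow> 'a"
  assumes fin: "finite K" and r: "r \<ge> 0"
    and ball: "\<And>x. (\<Sum>k\<in>K. norm (x k)) \<le> r \<Longrightarrow> (\<Sum>k\<in>K. norm (T x k)) \<le> r"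
    and contr: "\<And>x y. (\<Sum>k\<in>K. norm (x k)) \<le> r \<Longrightarrow> (\<Sum>k\<in>K. norm (y k)) \<le> r \<Longrightarrow>
          (\<Sum>k\<in>K. norm (T x k - T y k)) \<le> 1/2 * (\<Sum>k\<in>K. norm (x k - y k))"
  obtains x where "(\<Sum>k\<in>K. norm (x k)) \<le> r" "\<And>k. k \<in> K \<Longrightarrow> T x k = x k"
proof -
  define Y where "Y n = (T ^^ n) (\<lambda>_. 0)" for n
  have YS: "Y (Suc n) = T (Y n)" for n by (simp add: Y_def)
  have Yr: "(\<Sum>k\<in>K. norm (Y n k)) \<le> r" for n
    by (induction n) (simp_all add: Y_def r ball)
  define D where "D n = (\<Sum>k\<in>K. norm (Y (Suc n) k - Y n k))" for n
  have DS: "D (Suc n) \<le> 1/2 * D n" for n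
    unfolding D_def YS[of "Suc n"] using contr[OF Yr Yr, of "Suc n" n] by (simp add: YS)
  have D: "D n \<le> D 0 * (1/2) ^ n" for n
  proof (induction n)
    case (Suc n) then show ?case using DS[of n] by simp
  qed simp
  have "convergent (\<lambda>n. Y n k)" if k: "k \<in> K" for k
  proof -
    have "norm (Y (Suc n) k - Y n k) \<le> D 0 * (1/2) ^ n" for n
      by (rule order_trans[OF _ D]) (use member_le_sum[of k K "\<lambda>k. norm (Y (Suc n) k - Y n k)"] k fin in \<open>simp add: D_def\<close>)
    then have "summable (\<lambda>n. Y (Suc n) k - Y n k)"
      by (intro summable_comparison_test'[where N = 0, OF summable_mult[OF summable_geometric]])
         (auto simp del: power_Suc)
    then have "convergent (\<lambda>n. \<Sum>i<n. Y (Suc i) k - Y i k)" by (simp add: summable_iff_convergent)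
    then have "convergent (\<lambda>n. Y n k - Y 0 k)"
      using sum_lessThan_telescope[of "\<lambda>n. Y n k"] by simp
    then have "convergent (\<lambda>n. Y n k - Y 0 k + Y 0 k)" by (intro convergent_add convergent_const)
    then show ?thesis by simp
  qed
  then have "\<forall>k. \<exists>x. k \<in> K \<longrightarrow> (\<lambda>n. Y n k) \<longlonglongrightarrow> x" by (auto simp: convergent_def)
  then obtain x where x: "\<And>k. k \<in> K \<Longrightarrow> (\<lambda>n. Y n k) \<longlonglongrightarrow> x k" by metis
  have xr: "(\<Sum>k\<in>K. norm (x k)) \<le> r"
    by (rule LIMSEQ_le_const2[OF tendsto_sum[OF tendsto_norm[OF x]]]) (use Yr in auto)
  have "(\<lambda>n. \<Sum>k\<in>K. norm (Y n k - x k)) \<longlonglongrightarrow> (\<Sum>k\<in>K. norm (x k - x k))"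
    by (intro tendsto_intros x)
  then have lim: "(\<lambda>n. 1/2 * (\<Sum>k\<in>K. norm (Y n k - x k))) \<longlonglongrightarrow> 0"
    using tendsto_mult_right_zero by fastforce
  have "T x k = x k" if k: "k \<in> K" for k
  proof -
    have "norm (Y (Suc n) k - T x k) \<le> 1/2 * (\<Sum>k\<in>K. norm (Y n k - x k))" for n
      using contr[OF Yr xr, of n] member_le_sum[of k K "\<lambda>k. norm (T (Y n) k - T x k)"] k fin
      by (simp add: YS)
    then have "(\<lambda>n. Y (Suc n) k - T x k) \<longlonglongrightarrow> 0"
      by (intro Lim_null_comparison[OF _ lim]) auto
    then have "(\<lambda>n. Y (Suc n) k) \<longlonglongrightarrow> T x k" by (simp add: LIM_zero_iff)
    then show ?thesis using LIMSEQ_unique x[OF k] LIMSEQ_Suc by blast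
  qed
  then show ?thesis using that xr by blast
qed

text \<open>\<open>N\<close> inverts the linearisation at 0. With z = b y + C and ln1p z = z + R z,
  applying \<open>N\<close> to the equations yields the fixed point form y = - N e (C + R z), which
  contracts for small \<open>C\<close> because R has a small Lipschitz constant.\<close>

lemma ln1p_system_solvable:
  fixes e b :: "'j \<Rightarrow> 'k \<Rightarrow> real" and N :: "'k \<Rightarrow> 'k \<Rightarrow> real"
  assumes J: "finite J" and K: "finite K"
    and inv1: "\<And>l m. l \<in> K \<Longrightarrow> m \<in> K \<Longrightarrow>
          (\<Sum>k\<in>K. N l k * (\<Sum>j\<in>J. e j k * b j m)) = (if l = m then 1 else 0)"
    and inv2: "\<And>m k. m \<in> K \<Longrightarrow> k \<in> K \<Longrightarrow>
          (\<Sum>l\<in>K. (\<Sum>j\<in>J. e j m * b j l) * N l k) = (if m = k then 1 else 0)"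
  shows "\<exists>\<delta>>0. \<forall>C :: 'j \<Rightarrow> 'a::{real_normed_algebra_1,comm_ring_1,banach}.
          (\<forall>j\<in>J. norm (C j) \<le> \<delta>) \<longrightarrow>
          (\<exists>y. (\<forall>j\<in>J. norm ((\<Sum>k\<in>K. b j k *\<^sub>R y k) + C j) \<le> 1/2) \<and>
               (\<forall>k\<in>K. (\<Sum>j\<in>J. e j k *\<^sub>R ln1p ((\<Sum>k\<in>K. b j k *\<^sub>R y k) + C j)) = 0))"
proof -
  define B where "B = 1 + (\<Sum>j\<in>J. \<Sum>k\<in>K. \<bar>b j k\<bar>)"
  define A where "A = 1 + (\<Sum>l\<in>K. \<Sum>k\<in>K. \<Sum>j\<in>J. \<bar>N l k * e j k\<bar>)"
  have B1: "B \<ge> 1" and A1: "A \<ge> 1" unfolding A_def B_def by (simp_all add: sum_nonneg)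
  have bB: "\<bar>b j k\<bar> \<le> B" if "j \<in> J" "k \<in> K" for j k
  proof -
    have "\<bar>b j k\<bar> \<le> (\<Sum>k\<in>K. \<bar>b j k\<bar>)" using that K by (intro member_le_sum) auto
    also have "\<dots> \<le> (\<Sum>j\<in>J. \<Sum>k\<in>K. \<bar>b j k\<bar>)"
      using that J by (intro member_le_sum[of j J "\<lambda>j. \<Sum>k\<in>K. \<bar>b j k\<bar>"]) (auto simp: sum_nonneg)
    finally show ?thesis by (simp add: B_def)
  qed
  \<comment> \<open>\<open>B\<close> bounds the coefficients \<open>b\<close>, and \<open>A\<close>
    the operator formed by \<open>N\<close> and \<open>e\<close>. The radius gives
    \<open>8 * A * B * s = 1\<close>, so that the contraction factor \<open>A * 2 * s * B\<close> is
    1/4. The ball is preserved because \<open>A * \<delta>\<close> and the remainder take up half of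
    \<open>r\<close> each.\<close>
  define r where "r = 1 / (16 * A * B\<^sup>2)"
  define \<delta> where "\<delta> = r / (2 * A)"
  define s where "s = 2 * B * r"
  have pos: "r > 0" "\<delta> > 0" "s > 0" "\<delta> \<le> r" using A1 B1 by (auto simp: r_def \<delta>_def s_def field_simps)
  have s8: "s * (8 * A * B) = 1" using A1 B1 by (simp add: s_def r_def power2_eq_square field_simps)
  have AB1: "A * B \<ge> 1" using mult_mono[OF A1 B1] A1 by simp
  have s_half: "s \<le> 1/2"
  proof -
    have "s * 8 \<le> s * (8 * A * B)" using AB1 pos by (intro mult_left_mono) auto
    then show ?thesis using s8 by simp
  qed
  show ?thesis
  proof (intro exI[of _ \<delta>] conjI allI impI \<open>\<delta> > 0\<close>)
    fix C :: "'j \<Rightarrow> 'a"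
    assume C: "\<forall>j\<in>J. norm (C j) \<le> \<delta>"
    define z where "z y j = (\<Sum>k\<in>K. b j k *\<^sub>R y k) + C j" for y j
    define R where "R w = ln1p w - w" for w :: 'a
    define T where "T y l = - (\<Sum>k\<in>K. \<Sum>j\<in>J. (N l k * e j k) *\<^sub>R (C j + R (z y j)))" for y l
    have zd: "norm (z y j - z y' j) \<le> B * (\<Sum>k\<in>K. norm (y k - y' k))" if "j \<in> J" for y y' j
    proof -
      have "z y j - z y' j = (\<Sum>k\<in>K. b j k *\<^sub>R (y k - y' k))"
        by (simp add: z_def sum_subtractf scaleR_diff_right)
      also have "norm \<dots> \<le> (\<Sum>k\<in>K. norm (b j k *\<^sub>R (y k - y' k)))" by (rule norm_sum)
      also have "\<dots> \<le> (\<Sum>k\<in>K. B * norm (y k - y' k))"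
        using bB that by (intro sum_mono) (simp add: mult_right_mono)
      finally show ?thesis by (simp add: sum_distrib_left)
    qed
    have zs: "norm (z y j) \<le> s" if "j \<in> J" "(\<Sum>k\<in>K. norm (y k)) \<le> r" for y j
    proof -
      have "norm (z y j) \<le> norm (z y j - z (\<lambda>_. 0) j) + norm (z (\<lambda>_. 0) j)"
        by (metis diff_add_cancel norm_triangle_ineq)
      also have "\<dots> \<le> B * r + B * r"
      proof (rule add_mono)
        show "norm (z y j - z (\<lambda>_. 0) j) \<le> B * r"
          using order_trans[OF zd[OF that(1), of y "\<lambda>_. 0"] mult_left_mono[of _ r B]] that(2) B1 by simp
        show "norm (z (\<lambda>_. 0) j) \<le> B * r"
        proof -
          have "1 * r \<le> B * r" using pos B1 by (intro mult_right_mono) auto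
          then have "norm (C j) \<le> B * r" using bspec[OF C that(1)] pos by linarith
          then show ?thesis by (simp add: z_def)
        qed
      qed
      finally show ?thesis by (simp add: s_def)
    qed
    have Tsum: "(\<Sum>l\<in>K. norm (\<Sum>k\<in>K. \<Sum>j\<in>J. (N l k * e j k) *\<^sub>R w j)) \<le> A * q"
      if "\<And>j. j \<in> J \<Longrightarrow> norm (w j) \<le> q" "q \<ge> 0" for w :: "'j \<Rightarrow> 'a" and q
    proof -
      have "(\<Sum>l\<in>K. norm (\<Sum>k\<in>K. \<Sum>j\<in>J. (N l k * e j k) *\<^sub>R w j))
            \<le> (\<Sum>l\<in>K. \<Sum>k\<in>K. \<Sum>j\<in>J. norm ((N l k * e j k) *\<^sub>R w j))"
        by (intro sum_mono order_trans[OF norm_sum] order_refl)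
      also have "\<dots> \<le> (\<Sum>l\<in>K. \<Sum>k\<in>K. \<Sum>j\<in>J. \<bar>N l k * e j k\<bar> * q)"
        using that by (intro sum_mono) (simp add: mult_left_mono)
      also have "\<dots> = (A - 1) * q" by (simp add: A_def sum_distrib_right)
      also have "\<dots> \<le> A * q" using that by (intro mult_right_mono) auto
      finally show ?thesis .
    qed
    have R_lip: "norm (R x - R y) \<le> 2 * s * norm (x - y)" if "norm x \<le> s" "norm y \<le> s" for x y :: 'a
      unfolding R_def by (rule ln1p_remainder_lipschitz) (use that s_half in auto)
    have R0: "R 0 = 0" by (simp add: R_def)
    obtain y where y: "(\<Sum>k\<in>K. norm (y k)) \<le> r" "\<And>k. k \<in> K \<Longrightarrow> T y k = y k"
    proof (rule finite_tuple_banach_fix[OF K, of r T])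
      fix y :: "'k \<Rightarrow> 'a" assume yr: "(\<Sum>k\<in>K. norm (y k)) \<le> r"
      have "norm (C j + R (z y j)) \<le> \<delta> + 2 * s * s" if j: "j \<in> J" for j
      proof -
        have "norm (R (z y j)) \<le> 2 * s * norm (z y j)"
          using R_lip[OF zs[OF j yr], of 0] pos by (simp add: R0)
        also have "\<dots> \<le> 2 * s * s" using zs[OF j yr] pos by (intro mult_left_mono) auto
        finally show ?thesis using bspec[OF C j] norm_triangle_ineq[of "C j" "R (z y j)"] by linarith
      qed
      then have "(\<Sum>l\<in>K. norm (T y l)) \<le> A * (\<delta> + 2 * s * s)"
        unfolding T_def norm_minus_cancel using pos by (intro Tsum) auto
      also have "\<dots> = r / 2 + (s * (8 * A * B)) * r / 2"
        using A1 B1 by (simp add: \<delta>_def s_def field_simps)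
      also have "\<dots> = r" unfolding s8 by simp
      finally show "(\<Sum>l\<in>K. norm (T y l)) \<le> r" .
    next
      fix y y' :: "'k \<Rightarrow> 'a" assume yr: "(\<Sum>k\<in>K. norm (y k)) \<le> r" "(\<Sum>k\<in>K. norm (y' k)) \<le> r"
      define q where "q = (\<Sum>k\<in>K. norm (y k - y' k))"
      have q0: "q \<ge> 0" by (simp add: q_def sum_nonneg)
      have "norm (R (z y j) - R (z y' j)) \<le> 2 * s * (B * q)" if j: "j \<in> J" for j
      proof -
        have "norm (R (z y j) - R (z y' j)) \<le> 2 * s * norm (z y j - z y' j)"
          by (intro R_lip zs yr j)
        also have "\<dots> \<le> 2 * s * (B * q)"
          using zd[OF j, of y y'] pos by (intro mult_left_mono) (auto simp: q_def)
        finally show ?thesis .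
      qed
      then have "(\<Sum>l\<in>K. norm (\<Sum>k\<in>K. \<Sum>j\<in>J. (N l k * e j k) *\<^sub>R (R (z y' j) - R (z y j))))
                 \<le> A * (2 * s * (B * q))"
        using pos B1 q0 by (intro Tsum) (auto simp: norm_minus_commute)
      also have "\<dots> = (s * (8 * A * B)) * q / 4" by simp
      also have "\<dots> \<le> 1/2 * q" unfolding s8 using q0 by simp
      finally show "(\<Sum>l\<in>K. norm (T y l - T y' l)) \<le> 1/2 * (\<Sum>k\<in>K. norm (y k - y' k))"
        by (simp add: T_def q_def sum_subtractf[symmetric] scaleR_diff_right[symmetric])
    qed (use pos in auto)
    have zhalf: "norm (z y j) \<le> 1/2" if "j \<in> J" for j using zs[OF that y(1)] s_half by simp
    define G where "G k = (\<Sum>j\<in>J. e j k *\<^sub>R ln1p (z y j))" for k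
    have NG: "(\<Sum>k\<in>K. N l k *\<^sub>R G k) = 0" if l: "l \<in> K" for l
    proof -
      have "ln1p (z y j) = (C j + R (z y j)) + (\<Sum>m\<in>K. b j m *\<^sub>R y m)" for j
        by (simp add: R_def z_def)
      then have "(\<Sum>k\<in>K. N l k *\<^sub>R G k)
          = (\<Sum>k\<in>K. \<Sum>j\<in>J. (N l k * e j k) *\<^sub>R (C j + R (z y j)))
            + (\<Sum>k\<in>K. \<Sum>j\<in>J. (N l k * e j k) *\<^sub>R (\<Sum>m\<in>K. b j m *\<^sub>R y m))"
        by (simp add: G_def scaleR_sum_right scaleR_add_right sum.distrib mult.assoc)
      also have "(\<Sum>k\<in>K. \<Sum>j\<in>J. (N l k * e j k) *\<^sub>R (\<Sum>m\<in>K. b j m *\<^sub>R y m))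
          = (\<Sum>m\<in>K. (\<Sum>k\<in>K. N l k * (\<Sum>j\<in>J. e j k * b j m)) *\<^sub>R y m)"
      proof -
        have "(\<Sum>k\<in>K. \<Sum>j\<in>J. (N l k * e j k) *\<^sub>R (\<Sum>m\<in>K. b j m *\<^sub>R y m))
            = (\<Sum>k\<in>K. \<Sum>j\<in>J. \<Sum>m\<in>K. (N l k * e j k * b j m) *\<^sub>R y m)"
          by (simp add: scaleR_sum_right)
        also have "\<dots> = (\<Sum>k\<in>K. \<Sum>m\<in>K. \<Sum>j\<in>J. (N l k * e j k * b j m) *\<^sub>R y m)"
          by (intro sum.cong refl sum.swap)
        also have "\<dots> = (\<Sum>m\<in>K. \<Sum>k\<in>K. \<Sum>j\<in>J. (N l k * e j k * b j m) *\<^sub>R y m)"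
          by (rule sum.swap)
        finally show ?thesis by (simp add: scaleR_sum_left sum_distrib_left mult.assoc)
      qed
      also have "\<dots> = (\<Sum>m\<in>K. if l = m then y m else 0)"
        by (intro sum.cong) (auto simp: inv1[OF l])
      also have "\<dots> = y l" using l K by simp
      finally show ?thesis using arg_cong[OF y(2)[OF l], of uminus] by (simp add: T_def)
    qed
    \<comment> \<open>The fixed point only says that \<open>N\<close> annihilates \<open>G\<close>;
      the second inverse identity cancels \<open>N\<close>.\<close>
    have "G m = 0" if m: "m \<in> K" for m
    proof -
      have "0 = (\<Sum>l\<in>K. (\<Sum>j\<in>J. e j m * b j l) *\<^sub>R (\<Sum>k\<in>K. N l k *\<^sub>R G k))" by (simp add: NG)
      also have "\<dots> = (\<Sum>l\<in>K. \<Sum>k\<in>K. ((\<Sum>j\<in>J. e j m * b j l) * N l k) *\<^sub>R G k)"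
        by (simp add: scaleR_sum_right)
      also have "\<dots> = (\<Sum>k\<in>K. (\<Sum>l\<in>K. (\<Sum>j\<in>J. e j m * b j l) * N l k) *\<^sub>R G k)"
        by (subst sum.swap) (simp add: scaleR_sum_left)
      also have "\<dots> = (\<Sum>k\<in>K. if m = k then G k else 0)"
        by (intro sum.cong) (auto simp: inv2[OF m])
      also have "\<dots> = G m" using m K by simp
      finally show ?thesis by simp
    qed
    then show "\<exists>y. (\<forall>j\<in>J. norm ((\<Sum>k\<in>K. b j k *\<^sub>R y k) + C j) \<le> 1/2) \<and>
               (\<forall>k\<in>K. (\<Sum>j\<in>J. e j k *\<^sub>R ln1p ((\<Sum>k\<in>K. b j k *\<^sub>R y k) + C j)) = 0)"
      using zhalf by (intro exI[of _ y]) (auto simp: z_def G_def)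
  qed
qed

section \<open>Power series on the unit polydisc\<close>

text \<open>The monomial with exponent multiset \<open>M\<close>. It is 0 as soon as a variable
  outside \<open>B\<close> occurs, since \<open>u\<close> is arbitrary there; so it is still
  multiplicative, and bounded by 1 if \<open>u\<close> is bounded by 1 on \<open>B\<close>.\<close>

definition eval_character :: "'v set \<Rightarrow> ('v \<Rightarrow> real) \<Rightarrow> 'v multiset \<Rightarrow> real" where
  "eval_character B u M = (if set_mset M \<subseteq> B then prod_mset (image_mset u M) else 0)"

abbreviation eval_series :: "'v set \<Rightarrow> ('v \<Rightarrow> real) \<Rightarrow> 'v multiset l1 \<Rightarrow> real" where
  "eval_series B u \<equiv> l1_pair (eval_character B u)"

lemma eval_character_eq:
  assumes "finite B" "set_mset M \<subseteq> B"
  shows "eval_character B u M = (\<Prod>v\<in>B. u v ^ count M v)"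
  using assms
  by (auto simp: eval_character_def image_prod_mset_multiplicity not_in_iff intro!: prod.mono_neutral_left)

lemma abs_eval_character_le:
  assumes "finite B" "\<And>v. v \<in> B \<Longrightarrow> \<bar>u v\<bar> \<le> 1"
  shows "\<bar>eval_character B u M\<bar> \<le> 1"
proof (cases "set_mset M \<subseteq> B")
  case True
  then show ?thesis
    unfolding eval_character_eq[OF assms(1) True] abs_prod
    by (intro prod_le_1) (auto simp: power_abs assms(2) power_le_one)
qed (simp add: eval_character_def)

lemma eval_character_add: "eval_character B u (M + N) = eval_character B u M * eval_character B u N"
  by (auto simp: eval_character_def)

lemma
  assumes "finite B" "\<And>v. v \<in> B \<Longrightarrow> \<bar>u v\<bar> \<le> 1"
  shows eval_series_mult: "eval_series B u (f * g) = eval_series B u f * eval_series B u g"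
    and bounded_linear_eval_series: "bounded_linear (eval_series B u)"
    and eval_series_bound: "\<bar>eval_series B u f\<bar> \<le> norm f"
    and eval_series_1: "eval_series B u 1 = 1"
proof -
  note C = abs_eval_character_le[of B u, OF assms]
  show "eval_series B u (f * g) = eval_series B u f * eval_series B u g"
    by (rule l1_pair_character_times[OF C]) (simp_all add: eval_character_add)
  show "bounded_linear (eval_series B u)" by (rule bounded_linear_l1_pair[OF C])
  show "\<bar>eval_series B u f\<bar> \<le> norm f" using l1_pair_bound[of "eval_character B u" 1 f, OF C] by simp
  show "eval_series B u 1 = 1" by (simp add: one_l1_def eval_character_def)
qed

text \<open>Exponents are recoded from multisets to extensional functions on \<open>B\<close>, the
  index set over which \<open>rel_real_analytic_on\<close> sums.\<close>

lemma eval_series_has_sum: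
  assumes B: "finite B" and u: "\<And>v. v \<in> B \<Longrightarrow> \<bar>u v\<bar> \<le> 1"
  shows "((\<lambda>\<alpha>. coeff f (Abs_multiset (\<lambda>v. if v \<in> B then \<alpha> v else 0)) * (\<Prod>v\<in>B. u v ^ \<alpha> v))
           has_sum eval_series B u f) (B \<rightarrow>\<^sub>E (UNIV :: nat set))"
proof -
  define m where "m \<alpha> = Abs_multiset (\<lambda>v. if v \<in> B then \<alpha> v else 0)" for \<alpha> :: "'a \<Rightarrow> nat"
  have count_m: "count (m \<alpha>) = (\<lambda>v. if v \<in> B then \<alpha> v else 0)" for \<alpha>
    unfolding m_def by (rule count_Abs_multiset) (use B in \<open>auto intro: finite_subset[of _ B]\<close>)
  have set_m: "set_mset (m \<alpha>) \<subseteq> B" for \<alpha>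
    by (auto simp: set_mset_def count_m split: if_splits)
  have bij: "bij_betw m (B \<rightarrow>\<^sub>E UNIV) {M. set_mset M \<subseteq> B}"
  proof (rule bij_betwI[where g = "\<lambda>M. restrict (count M) B"])
    show "m (restrict (count M) B) = M" if "M \<in> {M. set_mset M \<subseteq> B}" for M
      using that by (intro multiset_eqI) (auto simp: count_m not_in_iff[symmetric])
    show "restrict (count (m \<alpha>)) B = \<alpha>" if "\<alpha> \<in> B \<rightarrow>\<^sub>E UNIV" for \<alpha>
      using that by (auto simp: count_m fun_eq_iff PiE_def extensional_def)
  qed (use set_m in auto)
  have "((\<lambda>M. eval_character B u M * coeff f M) has_sum eval_series B u f) UNIV"
    by (rule l1_pair_has_sum) (rule abs_eval_character_le[of B u, OF B u])
  then have "((\<lambda>M. eval_character B u M * coeff f M) has_sum eval_series B u f) {M. set_mset M \<subseteq> B}"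
    by (rule has_sum_cong_neutral[THEN iffD1, rotated -1]) (auto simp: eval_character_def)
  then have "((\<lambda>\<alpha>. eval_character B u (m \<alpha>) * coeff f (m \<alpha>)) has_sum eval_series B u f) (B \<rightarrow>\<^sub>E UNIV)"
    using has_sum_reindex_bij_betw[OF bij, of "\<lambda>M. eval_character B u M * coeff f M"] by simp
  moreover have "eval_character B u (m \<alpha>) = (\<Prod>v\<in>B. u v ^ \<alpha> v)" for \<alpha>
    unfolding eval_character_eq[OF B set_m] by (intro prod.cong) (auto simp: count_m)
  ultimately show ?thesis by (simp add: m_def mult.commute)
qed

text \<open>
  The unknowns \<open>y k\<close> are sought as absolutely convergent power series in \<open>u\<close>; the implicit function
  theorem in their Banach algebra yields them, and evaluation at \<open>u\<close> turns them into real solutions.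
\<close>

lemma log_affine_critical_value_analytic:
  fixes a s :: "'j \<Rightarrow> real" and b :: "'j \<Rightarrow> 'k \<Rightarrow> real" and N :: "'k \<Rightarrow> 'k \<Rightarrow> real"
  assumes J: "finite J" and K: "finite K" and B: "finite (B :: 'v set)" and a: "\<And>j. j \<in> J \<Longrightarrow> a j > 0"
    and crit: "\<And>k. k \<in> K \<Longrightarrow> (\<Sum>j\<in>J. s j * b j k * ln (a j)) = 0"
    and inv1: "\<And>l m. l \<in> K \<Longrightarrow> m \<in> K \<Longrightarrow>
          (\<Sum>k\<in>K. N l k * (\<Sum>j\<in>J. s j * b j k * b j m / a j)) = (if l = m then 1 else 0)"
    and inv2: "\<And>m k. m \<in> K \<Longrightarrow> k \<in> K \<Longrightarrow>
          (\<Sum>l\<in>K. (\<Sum>j\<in>J. s j * b j m * b j l / a j) * N l k) = (if m = k then 1 else 0)"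
  obtains \<delta> where "\<delta> > 0"
    "\<And>c :: 'j \<Rightarrow> 'v \<Rightarrow> real. (\<And>j. j \<in> J \<Longrightarrow> (\<Sum>v\<in>B. \<bar>c j v\<bar>) \<le> \<delta>) \<Longrightarrow>
      \<exists>y p. \<forall>u. (\<forall>v\<in>B. \<bar>u v\<bar> < 1) \<longrightarrow>
        (\<forall>j\<in>J. a j + (\<Sum>k\<in>K. b j k * y u k) + (\<Sum>v\<in>B. c j v * u v) > 0) \<and>
        (\<forall>k\<in>K. (\<Sum>j\<in>J. s j * b j k *
            ln (a j + (\<Sum>k\<in>K. b j k * y u k) + (\<Sum>v\<in>B. c j v * u v))) = 0) \<and>
        ((\<lambda>\<alpha>. p \<alpha> * (\<Prod>v\<in>B. u v ^ \<alpha> v)) has_sum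
          (\<Sum>j\<in>J. s j * (a j + (\<Sum>k\<in>K. b j k * y u k) + (\<Sum>v\<in>B. c j v * u v)) *
            ln (a j + (\<Sum>k\<in>K. b j k * y u k) + (\<Sum>v\<in>B. c j v * u v)))) (B \<rightarrow>\<^sub>E (UNIV :: nat set))"
proof -
  have "\<exists>\<delta>>0. \<forall>C :: 'j \<Rightarrow> 'v multiset l1.
          (\<forall>j\<in>J. norm (C j) \<le> \<delta>) \<longrightarrow>
          (\<exists>y. (\<forall>j\<in>J. norm ((\<Sum>k\<in>K. (b j k / a j) *\<^sub>R y k) + C j) \<le> 1/2) \<and>
               (\<forall>k\<in>K. (\<Sum>j\<in>J. (s j * b j k) *\<^sub>R ln1p ((\<Sum>k\<in>K. (b j k / a j) *\<^sub>R y k) + C j)) = 0))"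
    using inv1 inv2 by (intro ln1p_system_solvable[where N = N] J K) simp_all
  then obtain \<delta>0 where \<delta>0: "\<delta>0 > 0" and sol: "\<And>C :: 'j \<Rightarrow> 'v multiset l1.
          (\<forall>j\<in>J. norm (C j) \<le> \<delta>0) \<Longrightarrow>
          (\<exists>y. (\<forall>j\<in>J. norm ((\<Sum>k\<in>K. (b j k / a j) *\<^sub>R y k) + C j) \<le> 1/2) \<and>
               (\<forall>k\<in>K. (\<Sum>j\<in>J. (s j * b j k) *\<^sub>R ln1p ((\<Sum>k\<in>K. (b j k / a j) *\<^sub>R y k) + C j)) = 0))"
    by blast
  \<comment> \<open>The least base value turns a bound on \<open>c\<close> into one relative to
    \<open>a j\<close>; the inserted 1 covers an empty \<open>J\<close>.\<close>
  define A where "A = Min (insert 1 (a ` J))"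
  have A0: "A > 0" using J a by (auto simp: A_def)
  have Aa: "A \<le> a j" if "j \<in> J" for j using J that by (auto simp: A_def)
  show ?thesis
  proof (rule that[of "\<delta>0 * A"])
    show "\<delta>0 * A > 0" using \<delta>0 A0 by simp
    fix c :: "'j \<Rightarrow> 'v \<Rightarrow> real"
    assume c: "\<And>j. j \<in> J \<Longrightarrow> (\<Sum>v\<in>B. \<bar>c j v\<bar>) \<le> \<delta>0 * A"
    \<comment> \<open>The linear perturbation of the j-th argument, relative to \<open>a j\<close>,
      as an element of the algebra: the variable \<open>v\<close> is the unit at the singleton
      multiset.\<close>
    define C :: "'j \<Rightarrow> 'v multiset l1" where "C j = (\<Sum>v\<in>B. (c j v / a j) *\<^sub>R l1_unit {#v#})" for j
    have "norm (C j) \<le> \<delta>0" if j: "j \<in> J" for j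
    proof -
      have "norm (C j) \<le> (\<Sum>v\<in>B. norm ((c j v / a j) *\<^sub>R l1_unit {#v#} :: 'v multiset l1))"
        unfolding C_def by (rule norm_sum)
      also have "\<dots> = (\<Sum>v\<in>B. \<bar>c j v\<bar>) / a j" using a[OF j] by (simp add: sum_divide_distrib)
      also have "\<dots> \<le> \<delta>0 * A / a j" using c[OF j] a[OF j] by (intro divide_right_mono) auto
      also have "\<dots> \<le> \<delta>0" using Aa[OF j] a[OF j] \<delta>0 by (simp add: divide_le_eq)
      finally show ?thesis .
    qed
    then obtain Y where Y: "\<And>j. j \<in> J \<Longrightarrow> norm ((\<Sum>k\<in>K. (b j k / a j) *\<^sub>R Y k) + C j) \<le> 1/2"
        "\<And>k. k \<in> K \<Longrightarrow> (\<Sum>j\<in>J. (s j * b j k) *\<^sub>R ln1p ((\<Sum>k\<in>K. (b j k / a j) *\<^sub>R Y k) + C j)) = 0"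
      using sol[of C] by blast
    define Z where "Z j = (\<Sum>k\<in>K. (b j k / a j) *\<^sub>R Y k) + C j" for j
    \<comment> \<open>The critical value computed inside the algebra, each argument being factored
      as \<open>a j * (1 + Z j)\<close>. Its coefficients serve for all \<open>u\<close>
      simultaneously.\<close>
    define V where "V = (\<Sum>j\<in>J. (s j * a j) *\<^sub>R ((1 + Z j) * (ln (a j) *\<^sub>R 1 + ln1p (Z j))))"
    define p where "p \<alpha> = coeff V (Abs_multiset (\<lambda>v. if v \<in> B then \<alpha> v else 0))" for \<alpha>
    show "\<exists>y p. \<forall>u. (\<forall>v\<in>B. \<bar>u v\<bar> < 1) \<longrightarrow>
        (\<forall>j\<in>J. a j + (\<Sum>k\<in>K. b j k * y u k) + (\<Sum>v\<in>B. c j v * u v) > 0) \<and>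
        (\<forall>k\<in>K. (\<Sum>j\<in>J. s j * b j k *
            ln (a j + (\<Sum>k\<in>K. b j k * y u k) + (\<Sum>v\<in>B. c j v * u v))) = 0) \<and>
        ((\<lambda>\<alpha>. p \<alpha> * (\<Prod>v\<in>B. u v ^ \<alpha> v)) has_sum
          (\<Sum>j\<in>J. s j * (a j + (\<Sum>k\<in>K. b j k * y u k) + (\<Sum>v\<in>B. c j v * u v)) *
            ln (a j + (\<Sum>k\<in>K. b j k * y u k) + (\<Sum>v\<in>B. c j v * u v)))) (B \<rightarrow>\<^sub>E (UNIV :: nat set))"
    proof (intro exI[of _ "\<lambda>u k. eval_series B u (Y k)"] exI[of _ p] allI impI)
      fix u :: "'v \<Rightarrow> real" assume u: "\<forall>v\<in>B. \<bar>u v\<bar> < 1"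
      then have u1: "\<And>v. v \<in> B \<Longrightarrow> \<bar>u v\<bar> \<le> 1" by force
      define h where "h = eval_series B u"
      have lin: "bounded_linear h" and mult: "\<And>f g. h (f * g) = h f * h g"
        and bnd: "\<And>f. \<bar>h f\<bar> \<le> norm f" and one: "h 1 = 1"
        unfolding h_def
        by (rule bounded_linear_eval_series[OF B u1] eval_series_mult[OF B u1]
              eval_series_bound[OF B u1] eval_series_1[OF B u1]; assumption)+
      interpret h: bounded_linear h by (fact lin)
      define L where "L j = a j + (\<Sum>k\<in>K. b j k * h (Y k)) + (\<Sum>v\<in>B. c j v * u v)" for j
      have hz: "L j = a j * (1 + h (Z j))" if j: "j \<in> J" for j
      proof -
        have "h (C j) = (\<Sum>v\<in>B. c j v / a j * u v)"
          unfolding C_def h.sum h.scaleR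
          by (intro sum.cong refl) (simp add: h_def eval_character_def)
        then have "h (Z j) = (\<Sum>k\<in>K. b j k / a j * h (Y k)) + (\<Sum>v\<in>B. c j v / a j * u v)"
          by (simp add: Z_def h.add h.sum h.scaleR)
        then show ?thesis
          using a[OF j] by (simp add: L_def distrib_left sum_distrib_left)
      qed
      have Z1: "norm (Z j) < 1" if "j \<in> J" for j using Y(1)[OF that] by (simp add: Z_def)
      have Zpos: "1 + h (Z j) > 0" if "j \<in> J" for j using bnd[of "Z j"] Z1[OF that] by linarith
      have Lpos: "L j > 0" if "j \<in> J" for j using hz[OF that] a[OF that] Zpos[OF that] by simp
      have lnL: "ln (L j) = ln (a j) + h (ln1p (Z j))" if j: "j \<in> J" for j
        unfolding hz[OF j] ln1p_homomorphism[OF lin mult bnd Z1[OF j]]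
        using a[OF j] Zpos[OF j] by (simp add: ln_mult)
      have "(\<Sum>j\<in>J. s j * b j k * ln (L j)) = 0" if k: "k \<in> K" for k
      proof -
        have "(\<Sum>j\<in>J. s j * b j k * ln (L j))
            = (\<Sum>j\<in>J. s j * b j k * ln (a j)) + h (\<Sum>j\<in>J. (s j * b j k) *\<^sub>R ln1p (Z j))"
          by (simp add: lnL h.sum h.scaleR sum.distrib distrib_left)
        then show ?thesis using crit[OF k] Y(2)[OF k] by (simp add: Z_def h.zero)
      qed
      moreover have "h V = (\<Sum>j\<in>J. s j * L j * ln (L j))"
        unfolding V_def h.sum h.scaleR
        by (intro sum.cong refl) (simp add: mult h.add h.scaleR one lnL, simp add: hz)
      then have "((\<lambda>\<alpha>. p \<alpha> * (\<Prod>v\<in>B. u v ^ \<alpha> v)) has_sum (\<Sum>j\<in>J. s j * L j * ln (L j))) (B \<rightarrow>\<^sub>E (UNIV :: nat set))"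
        unfolding p_def h_def using eval_series_has_sum[of B u V, OF B u1] by simp
      ultimately show "(\<forall>j\<in>J. a j + (\<Sum>k\<in>K. b j k * eval_series B u (Y k)) + (\<Sum>v\<in>B. c j v * u v) > 0) \<and>
        (\<forall>k\<in>K. (\<Sum>j\<in>J. s j * b j k *
            ln (a j + (\<Sum>k\<in>K. b j k * eval_series B u (Y k)) + (\<Sum>v\<in>B. c j v * u v))) = 0) \<and>
        ((\<lambda>\<alpha>. p \<alpha> * (\<Prod>v\<in>B. u v ^ \<alpha> v)) has_sum
          (\<Sum>j\<in>J. s j * (a j + (\<Sum>k\<in>K. b j k * eval_series B u (Y k)) + (\<Sum>v\<in>B. c j v * u v)) *
            ln (a j + (\<Sum>k\<in>K. b j k * eval_series B u (Y k)) + (\<Sum>v\<in>B. c j v * u v)))) (B \<rightarrow>\<^sub>E (UNIV :: nat set))"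
        using Lpos by (simp only: L_def h_def simp_thms) blast
    qed
  qed
qed

section \<open>Finite linear systems\<close>

instantiation "fun" :: (type, real_vector) real_vector
begin

definition scaleR_fun :: "real \<Rightarrow> ('a \<Rightarrow> 'b) \<Rightarrow> 'a \<Rightarrow> 'b" where
  "scaleR_fun r f = (\<lambda>x. r *\<^sub>R f x)"

instance
  by standard (auto simp: scaleR_fun_def fun_eq_iff scaleR_add_right scaleR_add_left)

end

lemma scaleR_fun_apply [simp]: "(r *\<^sub>R f) x = r *\<^sub>R f x"
  by (simp add: scaleR_fun_def)

lemma sum_fun_apply: "(\<Sum>i\<in>I. f i) x = (\<Sum>i\<in>I. f i x)"
  by (induction I rule: infinite_finite_induct) auto

lemma supported_in_span:
  fixes f :: "'k \<Rightarrow> real"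
  assumes K: "finite K" and f: "\<And>k. k \<notin> K \<Longrightarrow> f k = 0"
  shows "f \<in> span ((\<lambda>k x. if x = k then 1 else 0) ` K)"
proof -
  have "f = (\<Sum>k\<in>K. f k *\<^sub>R (\<lambda>x. if x = k then 1 else 0))"
  proof
    fix x
    have "(\<Sum>k\<in>K. f k *\<^sub>R (\<lambda>x. if x = k then 1 else 0)) x = (\<Sum>k\<in>K. if k = x then f k else 0)"
      unfolding sum_fun_apply by (intro sum.cong) auto
    then show "f x = (\<Sum>k\<in>K. f k *\<^sub>R (\<lambda>x. if x = k then 1 else 0)) x"
      using K f[of x] by simp
  qed
  also have "\<dots> \<in> span ((\<lambda>k x. if x = k then 1 else 0) ` K)"
    by (intro span_sum span_scale span_base) auto
  finally show ?thesis .
qed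

text \<open>An injective square system is onto: the independent columns and the right hand side all
  lie in the span of \<open>card K\<close> unit vectors, so the right hand side depends on the
  columns. Indices range over a finite set because later they are circulations.\<close>

lemma finite_square_system_solvable:
  fixes M :: "'k \<Rightarrow> 'k \<Rightarrow> real"
  assumes K: "finite K"
    and ker: "\<And>x. (\<And>k. k \<in> K \<Longrightarrow> (\<Sum>m\<in>K. M k m * x m) = 0) \<Longrightarrow> (\<And>k. k \<in> K \<Longrightarrow> x k = 0)"
  obtains x where "\<And>k. k \<in> K \<Longrightarrow> (\<Sum>m\<in>K. M k m * x m) = c k"
proof -
  define col where "col m = (\<lambda>k. if k \<in> K then M k m else 0)" for m
  define c' where "c' = (\<lambda>k. if k \<in> K then c k else 0)"
  define \<delta> where "\<delta> = (\<lambda>(k :: 'k) x. if x = k then 1 else 0 :: real)"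
  have lin: "(\<Sum>m\<in>K. x m *\<^sub>R col m) k = (\<Sum>m\<in>K. M k m * x m)" if "k \<in> K" for x k
    using that by (simp add: sum_fun_apply col_def mult.commute)
  have inj: "inj_on col K"
  proof (rule inj_onI, rule ccontr)
    fix l m assume lm: "l \<in> K" "m \<in> K" "col l = col m" "l \<noteq> m"
    define x where "x k = (if k = l then 1 else if k = m then -1 else 0 :: real)" for k
    have "(\<Sum>j\<in>K. M k j * x j) = M k l - M k m" for k
    proof -
      have "(\<Sum>j\<in>K. M k j * x j) = (\<Sum>j\<in>{l, m}. M k j * x j)"
        by (rule sum.mono_neutral_right) (use K lm in \<open>auto simp: x_def\<close>)
      then show ?thesis using lm by (simp add: x_def)
    qed
    moreover have "M k l = M k m" if "k \<in> K" for k
      using fun_cong[OF lm(3), of k] that by (simp add: col_def)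
    ultimately have "x l = 0" using ker[of x l] lm by simp
    then show False by (simp add: x_def)
  qed
  have indep: "independent (col ` K)"
  proof (rule independent_if_scalars_zero)
    fix f w assume f0: "(\<Sum>w\<in>col ` K. f w *\<^sub>R w) = 0" and w: "w \<in> col ` K"
    have "(\<Sum>m\<in>K. f (col m) *\<^sub>R col m) = 0" using f0 by (simp add: sum.reindex[OF inj])
    then have "(\<Sum>m\<in>K. M k m * f (col m)) = 0" if "k \<in> K" for k
      using lin[OF that, of "\<lambda>m. f (col m)"] by simp
    then show "f w = 0" using ker[of "\<lambda>m. f (col m)"] w by auto
  qed (use K in simp)
  have "c' \<in> span (col ` K)"
  proof (rule ccontr)
    assume notin: "c' \<notin> span (col ` K)"
    then have ind: "independent (insert c' (col ` K))" using indep by (rule independent_insertI)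
    have "insert c' (col ` K) \<subseteq> span (\<delta> ` K)"
      using supported_in_span[OF K] by (auto simp: \<delta>_def c'_def col_def)
    then have "card (insert c' (col ` K)) \<le> card (\<delta> ` K)"
      using independent_span_bound[OF _ ind] K by blast
    moreover have "c' \<notin> col ` K" using notin span_base[of c' "col ` K"] by argo
    then have "card (insert c' (col ` K)) = Suc (card K)"
      using card_insert_disjoint[of "col ` K" c'] K card_image[OF inj] by simp
    ultimately show False using card_image_le[OF K, of \<delta>] by linarith
  qed
  then obtain y where y: "c' = (\<Sum>w\<in>col ` K. y w *\<^sub>R w)"
    using span_finite[of "col ` K"] K by auto
  show ?thesis
  proof (rule that)
    fix k assume k: "k \<in> K"
    have "c k = c' k" using k by (simp add: c'_def)
    also have "\<dots> = (\<Sum>m\<in>K. y (col m) *\<^sub>R col m) k" unfolding y by (simp add: sum.reindex[OF inj])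
    also have "\<dots> = (\<Sum>m\<in>K. M k m * y (col m))" by (rule lin[OF k])
    finally show "(\<Sum>m\<in>K. M k m * y (col m)) = c k" ..
  qed
qed

text \<open>Solving for the unit vectors gives a right inverse. Symmetry of \<open>M\<close> makes
  it symmetric and hence a left inverse too.\<close>

lemma symmetric_matrix_inverse:
  fixes M :: "'k \<Rightarrow> 'k \<Rightarrow> real"
  assumes K: "finite K" and sym: "\<And>k m. k \<in> K \<Longrightarrow> m \<in> K \<Longrightarrow> M k m = M m k"
    and ker: "\<And>x. (\<And>k. k \<in> K \<Longrightarrow> (\<Sum>m\<in>K. M k m * x m) = 0) \<Longrightarrow> (\<And>k. k \<in> K \<Longrightarrow> x k = 0)"
  obtains N where
    "\<And>l m. l \<in> K \<Longrightarrow> m \<in> K \<Longrightarrow> (\<Sum>k\<in>K. N l k * M k m) = (if l = m then 1 else 0)"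
    "\<And>l m. l \<in> K \<Longrightarrow> m \<in> K \<Longrightarrow> (\<Sum>k\<in>K. M l k * N k m) = (if l = m then 1 else 0)"
proof -
  have "\<exists>x. \<forall>k\<in>K. (\<Sum>m\<in>K. M k m * x m) = (if k = j then 1 else 0)" for j
  proof (rule finite_square_system_solvable[OF K, of M "\<lambda>k. if k = j then 1 else 0"])
    show "\<And>x k. (\<And>k. k \<in> K \<Longrightarrow> (\<Sum>m\<in>K. M k m * x m) = 0) \<Longrightarrow> k \<in> K \<Longrightarrow> x k = 0" by (rule ker)
  qed blast
  then obtain X where X: "\<And>j k. k \<in> K \<Longrightarrow> (\<Sum>m\<in>K. M k m * X j m) = (if k = j then 1 else 0)"
    by metis
  define N where "N m j = X j m" for m j
  have right: "(\<Sum>m\<in>K. M k m * N m j) = (if k = j then 1 else 0)" if "k \<in> K" for k j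
    using X[OF that] by (simp add: N_def)
  have N_sym: "N l j = N j l" if lj: "l \<in> K" "j \<in> K" for l j
  proof -
    have "N l j = (\<Sum>m\<in>K. if m = l then N m j else 0)" using lj K by simp
    also have "\<dots> = (\<Sum>m\<in>K. (\<Sum>k\<in>K. M m k * N k l) * N m j)"
      by (intro sum.cong refl) (simp add: right)
    also have "\<dots> = (\<Sum>m\<in>K. \<Sum>k\<in>K. N k l * (M k m * N m j))"
      unfolding sum_distrib_right by (intro sum.cong refl) (simp add: sym)
    also have "\<dots> = (\<Sum>k\<in>K. N k l * (\<Sum>m\<in>K. M k m * N m j))"
      unfolding sum_distrib_left by (rule sum.swap)
    also have "\<dots> = (\<Sum>k\<in>K. if k = j then N k l else 0)"
      by (intro sum.cong refl) (simp add: right)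
    also have "\<dots> = N j l" using lj K by simp
    finally show ?thesis .
  qed
  show ?thesis
  proof (rule that)
    fix l m assume lm: "l \<in> K" "m \<in> K"
    have "(\<Sum>k\<in>K. N l k * M k m) = (\<Sum>k\<in>K. M m k * N k l)"
      using lm by (intro sum.cong refl) (simp add: sym N_sym mult.commute)
    then show "(\<Sum>k\<in>K. N l k * M k m) = (if l = m then 1 else 0)" using right[OF lm(2), of l] by simp
    show "(\<Sum>k\<in>K. M l k * N k m) = (if l = m then 1 else 0)" using right[OF lm(1)] .
  qed
qed

section \<open>Stationary flows on a finite graph\<close>

locale finite_graph =
  fixes E :: "'e set" and src tgt :: "'e \<Rightarrow> 'v"
  assumes finite_E: "finite E"
begin

definition outflow :: "('e \<Rightarrow> real) \<Rightarrow> 'v \<Rightarrow> real" where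
  "outflow q v = (\<Sum>e | e \<in> E \<and> src e = v. q e)"

definition inflow :: "('e \<Rightarrow> real) \<Rightarrow> 'v \<Rightarrow> real" where
  "inflow q v = (\<Sum>e | e \<in> E \<and> tgt e = v. q e)"

text \<open>Values outside \<open>E\<close> are fixed to 0 so that a circulation is determined by
  its values on the edges, and equality on edges is equality of functions.\<close>

definition circulations :: "('e \<Rightarrow> real) set" where
  "circulations = {q. (\<forall>v. inflow q v = outflow q v) \<and> (\<forall>e. e \<notin> E \<longrightarrow> q e = 0)}"

definition flows :: "('e \<Rightarrow> real) set" where
  "flows = {q \<in> circulations. (\<forall>e. q e \<ge> 0) \<and> sum q E = 1}"

text \<open>The entropy rate of the stationary Markov chain that leaves a vertex along
  \<open>e\<close> with probability \<open>q e / outflow q (src e)\<close>. Edges with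
  \<open>q e = 0\<close> contribute 0.\<close>

definition flow_entropy :: "('e \<Rightarrow> real) \<Rightarrow> real" where
  "flow_entropy q = - (\<Sum>e\<in>E. q e * ln (q e / outflow q (src e)))"

lemma outflow_linear [simp]:
  "outflow (q + q') v = outflow q v + outflow q' v" "outflow (q - q') v = outflow q v - outflow q' v"
  "outflow (r *\<^sub>R q) v = r * outflow q v" "outflow 0 v = 0"
  by (simp_all add: outflow_def sum.distrib sum_subtractf sum_distrib_left)

lemma inflow_linear [simp]:
  "inflow (q + q') v = inflow q v + inflow q' v" "inflow (q - q') v = inflow q v - inflow q' v"
  "inflow (r *\<^sub>R q) v = r * inflow q v" "inflow 0 v = 0"
  by (simp_all add: inflow_def sum.distrib sum_subtractf sum_distrib_left)

lemma subspace_circulations: "subspace circulations"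
  by (rule subspaceI) (auto simp: circulations_def)

lemma sum_outflow: "(\<Sum>e\<in>E. f (src e) * q e) = (\<Sum>v\<in>src ` E. f v * outflow q v)"
proof -
  have "(\<Sum>e\<in>E. f (src e) * q e) = (\<Sum>v\<in>src ` E. \<Sum>e | e \<in> E \<and> src e = v. f (src e) * q e)"
    by (rule sum.image_gen[OF finite_E])
  also have "\<dots> = (\<Sum>v\<in>src ` E. f v * outflow q v)"
    by (intro sum.cong refl) (simp add: outflow_def sum_distrib_left)
  finally show ?thesis .
qed

lemma outflow_nonneg: "(\<And>e. e \<in> E \<Longrightarrow> q e \<ge> 0) \<Longrightarrow> outflow q v \<ge> 0"
  unfolding outflow_def by (rule sum_nonneg) auto

lemma le_outflow: "(\<And>e. e \<in> E \<Longrightarrow> q e \<ge> 0) \<Longrightarrow> e \<in> E \<Longrightarrow> q e \<le> outflow q (src e)"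
  unfolding outflow_def using finite_E by (intro member_le_sum[of e _ q]) auto

lemma flowsD:
  assumes "q \<in> flows"
  shows "q \<in> circulations" "q e \<ge> 0" "sum q E = 1" "e \<notin> E \<Longrightarrow> q e = 0" "inflow q v = outflow q v"
  using assms by (auto simp: flows_def circulations_def)

lemma flows_le_1: "q \<in> flows \<Longrightarrow> q e \<le> 1"
  using member_le_sum[of e E q] finite_E flowsD[of q] by (cases "e \<in> E") auto

lemma outflow_flows_le_1:
  assumes "q \<in> flows" shows "outflow q v \<le> 1"
proof -
  have "outflow q v \<le> sum q E"
    unfolding outflow_def using finite_E flowsD(2)[OF assms] by (intro sum_mono2) auto
  then show ?thesis using flowsD(3)[OF assms] by simp
qed

lemma flows_convex:
  assumes "q \<in> flows" "q' \<in> flows" "0 \<le> t" "t \<le> 1"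
  shows "(1 - t) *\<^sub>R q + t *\<^sub>R q' \<in> flows"
proof -
  have "(1 - t) *\<^sub>R q + t *\<^sub>R q' \<in> circulations"
    using assms flowsD(1) subspace_circulations by (simp add: subspace_add subspace_scale)
  moreover have "sum ((1 - t) *\<^sub>R q + t *\<^sub>R q') E = (1 - t) * sum q E + t * sum q' E"
    by (simp add: sum.distrib sum_distrib_left)
  ultimately show ?thesis
    using assms(3,4) flowsD(2,3)[OF assms(1)] flowsD(2,3)[OF assms(2)] unfolding flows_def by auto
qed

text \<open>Gibbs' inequality: ln x \<le> x - 1 is applied at x =
  \<open>p e * outflow q (src e) / q e\<close>. The linear terms sum to at most 0 because
  \<open>p\<close> is substochastic at every vertex.\<close>

lemma flow_entropy_gibbs:
  assumes q: "\<And>e. e \<in> E \<Longrightarrow> q e \<ge> 0" and p: "\<And>e. e \<in> E \<Longrightarrow> p e \<ge> 0"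
    and pos: "\<And>e. e \<in> E \<Longrightarrow> q e > 0 \<Longrightarrow> p e > 0"
    and sub: "\<And>v. outflow p v \<le> 1"
  shows "flow_entropy q \<le> - (\<Sum>e\<in>E. q e * ln (p e))"
proof -
  have step: "- (q e * ln (q e / outflow q (src e))) \<le> - (q e * ln (p e)) + (outflow q (src e) * p e - 1 * q e)"
    if e: "e \<in> E" for e
  proof (cases "q e = 0")
    case True
    then show ?thesis using p[OF e] outflow_nonneg[of q "src e"] q by simp
  next
    case False
    then have qe: "q e > 0" using q[OF e] by simp
    then have Q: "outflow q (src e) > 0" using le_outflow[of q e] q e by force
    have "ln (p e * outflow q (src e) / q e) \<le> p e * outflow q (src e) / q e - 1"
      using pos[OF e qe] qe Q by (intro ln_le_minus_one) simp
    moreover have "ln (p e * outflow q (src e) / q e) = ln (p e) - ln (q e / outflow q (src e))"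
      using pos[OF e qe] qe Q by (simp add: ln_div ln_mult)
    ultimately have "q e * (ln (p e) - ln (q e / outflow q (src e))) \<le> q e * (p e * outflow q (src e) / q e - 1)"
      using qe by (intro mult_left_mono) auto
    also have "\<dots> = p e * outflow q (src e) - q e" using qe by (simp add: algebra_simps)
    finally show ?thesis by (simp add: algebra_simps)
  qed
  have "flow_entropy q \<le> (\<Sum>e\<in>E. - (q e * ln (p e)) + (outflow q (src e) * p e - 1 * q e))"
    unfolding flow_entropy_def sum_negf[symmetric] by (rule sum_mono) (rule step)
  also have "\<dots> = - (\<Sum>e\<in>E. q e * ln (p e)) + ((\<Sum>v\<in>src ` E. outflow q v * outflow p v) - (\<Sum>v\<in>src ` E. 1 * outflow q v))"
    unfolding sum.distrib sum_subtractf sum_negf sum_outflow[of "outflow q" p] sum_outflow[of "\<lambda>_. 1" q] ..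
  also have "(\<Sum>v\<in>src ` E. outflow q v * outflow p v) \<le> (\<Sum>v\<in>src ` E. 1 * outflow q v)"
    using sub outflow_nonneg[of q] q by (intro sum_mono) (simp add: mult_left_le)
  finally show ?thesis by simp
qed

lemma outflow_transition_le_1:
  assumes "\<And>e. e \<in> E \<Longrightarrow> r e \<ge> 0"
  shows "outflow (\<lambda>e. r e / outflow r (src e)) v \<le> 1"
proof -
  have "outflow (\<lambda>e. r e / outflow r (src e)) v = (\<Sum>e | e \<in> E \<and> src e = v. r e / outflow r v)"
    unfolding outflow_def[of "\<lambda>e. r e / outflow r (src e)"] by (intro sum.cong) auto
  also have "\<dots> = outflow r v / outflow r v"
    unfolding sum_divide_distrib[symmetric] by (simp add: outflow_def)
  finally show ?thesis by simp
qed

text \<open>The weight is the transition probability of \<open>r\<close>, with outgoing sum 1, or 0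
  at vertices without mass. \<open>r\<close> is only assumed nonnegative, not balanced.\<close>

lemma flow_entropy_le_transition:
  assumes q: "\<And>e. e \<in> E \<Longrightarrow> q e \<ge> 0" and r: "\<And>e. e \<in> E \<Longrightarrow> r e \<ge> 0"
    and pos: "\<And>e. e \<in> E \<Longrightarrow> q e > 0 \<Longrightarrow> r e > 0"
  shows "flow_entropy q \<le> - (\<Sum>e\<in>E. q e * ln (r e / outflow r (src e)))"
proof (rule flow_entropy_gibbs[OF q])
  show "0 < r e / outflow r (src e)" if "e \<in> E" "q e > 0" for e
    using pos[OF that] le_outflow[of r e] r that by force
qed (use r outflow_nonneg[of r] in \<open>auto intro: outflow_transition_le_1\<close>)

text \<open>Both entropies are estimated by the transition probabilities of the mixture. The
  logarithms being the same, the two bounds add up to the entropy of the mixture.\<close>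

lemma flow_entropy_concave:
  assumes q: "q \<in> flows" "q' \<in> flows" and t: "0 \<le> t" "t \<le> 1"
  shows "(1 - t) * flow_entropy q + t * flow_entropy q' \<le> flow_entropy ((1 - t) *\<^sub>R q + t *\<^sub>R q')"
proof (cases "t = 0 \<or> t = 1")
  case False
  define r where "r = (1 - t) *\<^sub>R q + t *\<^sub>R q'"
  have r: "r e \<ge> 0" for e using flowsD(2)[OF q(1), of e] flowsD(2)[OF q(2), of e] t by (simp add: r_def)
  have pos: "r e > 0" if "q e > 0 \<or> q' e > 0" for e
    using that t False flowsD(2)[OF q(1), of e] flowsD(2)[OF q(2), of e]
    by (auto simp: r_def add_pos_nonneg add_nonneg_pos)
  let ?L = "\<lambda>e. ln (r e / outflow r (src e))"
  have "(1 - t) * flow_entropy q + t * flow_entropy q'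
      \<le> (1 - t) * - (\<Sum>e\<in>E. q e * ?L e) + t * - (\<Sum>e\<in>E. q' e * ?L e)"
    using t r pos flowsD(2)[OF q(1)] flowsD(2)[OF q(2)]
    by (intro add_mono mult_left_mono flow_entropy_le_transition) auto
  also have "\<dots> = - (\<Sum>e\<in>E. ((1 - t) * q e + t * q' e) * ?L e)"
    by (simp add: sum_distrib_left sum.distrib distrib_right mult.assoc)
  also have "\<dots> = flow_entropy r" by (simp add: flow_entropy_def r_def)
  finally show ?thesis by (simp add: r_def)
qed auto

text \<open>The quotient has no limit where the outflow vanishes. In this form only x ln x occurs,
  which is continuous at 0.\<close>

lemma flow_entropy_alt:
  assumes q: "\<And>e. e \<in> E \<Longrightarrow> q e \<ge> 0"
  shows "flow_entropy q = - (\<Sum>e\<in>E. q e * ln (q e)) + (\<Sum>v\<in>src ` E. outflow q v * ln (outflow q v))"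
proof -
  have "q e * ln (q e / outflow q (src e)) = q e * ln (q e) - ln (outflow q (src e)) * q e" if e: "e \<in> E" for e
  proof (cases "q e = 0")
    case False
    then have "q e > 0" using q[OF e] by simp
    then have "outflow q (src e) > 0" using le_outflow[of q e] q e by force
    then show ?thesis using \<open>q e > 0\<close> by (simp add: ln_div algebra_simps)
  qed simp
  then have "flow_entropy q = - (\<Sum>e\<in>E. q e * ln (q e) - ln (outflow q (src e)) * q e)"
    unfolding flow_entropy_def by (intro arg_cong[where f = uminus] sum.cong) auto
  also have "\<dots> = - (\<Sum>e\<in>E. q e * ln (q e)) + (\<Sum>v\<in>src ` E. ln (outflow q v) * outflow q v)"
    unfolding sum_subtractf sum_outflow[of "\<lambda>v. ln (outflow q v)" q] by simp
  finally show ?thesis by (simp add: mult.commute)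
qed

end

section \<open>Continuity of the entropy and compactness of the set of flows\<close>

lemma continuous_on_x_ln_x: "continuous_on {0..} (\<lambda>x::real. x * ln x)"
proof -
  have "((\<lambda>x::real. x * ln x) \<longlongrightarrow> 0) (at_right 0)" by real_asymp
  then have "((\<lambda>x::real. x * ln x) \<longlongrightarrow> 0 * ln 0) (at 0 within {0..})"
    by (simp add: at_within_Ici_at_right)
  then have 0: "continuous (at 0 within {0..}) (\<lambda>x::real. x * ln x)" by (simp add: continuous_within)
  have "continuous (at x within {0..}) (\<lambda>x::real. x * ln x)" if "x > 0" for x
  proof (rule continuous_at_imp_continuous_at_within)
    show "isCont (\<lambda>x::real. x * ln x) x"
      using that by (intro isCont_mult continuous_ident) (simp add: isCont_ln)
  qed
  moreover have "x > 0 \<or> x = 0" if "x \<in> {0..}" for x :: real using that by auto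
  ultimately show ?thesis using 0 unfolding continuous_on_eq_continuous_within by blast
qed

context finite_graph
begin

lemma continuous_on_flow_entropy: "continuous_on flows flow_entropy"
proof -
  have coord: "continuous_on flows (\<lambda>q. q e)" for e
    by (rule continuous_on_subset[OF continuous_on_product_coordinates]) auto
  have out: "continuous_on flows (\<lambda>q. outflow q v)" for v
    unfolding outflow_def by (intro continuous_on_sum coord)
  have "continuous_on flows (\<lambda>q. - (\<Sum>e\<in>E. q e * ln (q e)) + (\<Sum>v\<in>src ` E. outflow q v * ln (outflow q v)))"
    by (intro continuous_on_add continuous_on_minus continuous_on_sum
          continuous_on_compose2[OF continuous_on_x_ln_x coord] continuous_on_compose2[OF continuous_on_x_ln_x out])
       (auto intro: flowsD(2) outflow_nonneg)
  then show ?thesis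
    by (rule continuous_on_eq) (simp add: flow_entropy_alt flowsD(2))
qed

text \<open>In the product topology the flows form a closed subset of a product of compact sets,
  unit intervals on \<open>E\<close> and {0} elsewhere.\<close>

lemma compact_flows: "compact flows"
proof -
  have coord: "continuous_on UNIV (\<lambda>q :: 'e \<Rightarrow> real. q e)" for e by simp
  have "compactin (product_topology (\<lambda>_. euclidean) UNIV) (PiE UNIV (\<lambda>e::'e. if e \<in> E then {0..1::real} else {0}))"
    by (subst compactin_PiE) auto
  then have "compact (PiE UNIV (\<lambda>e. if e \<in> E then {0..1::real} else {0}))"
    by (simp add: euclidean_product_topology)
  moreover have "closed flows"
  proof -
    have "flows = (\<Inter>v. {q. inflow q v = outflow q v}) \<inter> (\<Inter>e\<in>-E. {q. q e = 0}) \<inter> (\<Inter>e. {q. 0 \<le> q e}) \<inter> {q. sum q E = 1}"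
      by (auto simp: flows_def circulations_def)
    also have "closed \<dots>"
      unfolding inflow_def outflow_def
      by (intro closed_Int closed_INT ballI closed_Collect_eq closed_Collect_le continuous_on_sum coord continuous_on_const)
    finally show ?thesis .
  qed
  moreover have "flows \<subseteq> PiE UNIV (\<lambda>e. if e \<in> E then {0..1::real} else {0})"
    using flowsD(2,4) flows_le_1 by (auto simp: PiE_def)
  ultimately show ?thesis using closed_subset compact_Int_closed by (metis inf.absorb_iff2)
qed

section \<open>Means of flows and the maximal entropy over a given mean\<close>

definition mean :: "('e \<Rightarrow> 'w::real_vector) \<Rightarrow> ('e \<Rightarrow> real) \<Rightarrow> 'w" where
  "mean \<phi> q = (\<Sum>e\<in>E. q e *\<^sub>R \<phi> e)"

definition max_entropy :: "('e \<Rightarrow> 'w::real_vector) \<Rightarrow> 'w \<Rightarrow> real" where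
  "max_entropy \<phi> w = Sup (flow_entropy ` {q \<in> flows. mean \<phi> q = w})"

lemma mean_linear [simp]:
  "mean \<phi> (q + q') = mean \<phi> q + mean \<phi> q'" "mean \<phi> (q - q') = mean \<phi> q - mean \<phi> q'"
  "mean \<phi> (r *\<^sub>R q) = r *\<^sub>R mean \<phi> q"
  by (simp_all add: mean_def sum.distrib sum_subtractf scaleR_add_left scaleR_diff_left scaleR_sum_right)

lemma mean_sum: "mean \<phi> (\<Sum>i\<in>I. f i) = (\<Sum>i\<in>I. mean \<phi> (f i))"
  by (rule linear_sum[of "mean \<phi>"]) (rule linearI, simp_all)

lemma max_entropy_attained:
  fixes \<phi> :: "'e \<Rightarrow> 'w::real_normed_vector"
  assumes "w \<in> mean \<phi> ` flows"
  obtains q where "q \<in> flows" "mean \<phi> q = w" "flow_entropy q = max_entropy \<phi> w"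
    "\<And>q'. q' \<in> flows \<Longrightarrow> mean \<phi> q' = w \<Longrightarrow> flow_entropy q' \<le> flow_entropy q"
proof -
  have "continuous_on UNIV (\<lambda>q :: 'e \<Rightarrow> real. mean \<phi> q)"
    unfolding mean_def by (intro continuous_on_sum continuous_on_scaleR) auto
  then have "closed {q. mean \<phi> q = w}" by (intro closed_Collect_eq) auto
  then have "compact (flows \<inter> {q. mean \<phi> q = w})" using compact_flows by (rule compact_Int_closed[rotated])
  moreover have "flows \<inter> {q. mean \<phi> q = w} \<noteq> {}" using assms by auto
  moreover have "continuous_on (flows \<inter> {q. mean \<phi> q = w}) flow_entropy"
    using continuous_on_flow_entropy continuous_on_subset by blast
  ultimately obtain q where q: "q \<in> flows \<inter> {q. mean \<phi> q = w}"
      "\<forall>q'\<in>flows \<inter> {q. mean \<phi> q = w}. flow_entropy q' \<le> flow_entropy q"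
    using continuous_attains_sup by blast
  then have "max_entropy \<phi> w = flow_entropy q"
    unfolding max_entropy_def by (intro cSup_eq_maximum) auto
  then show ?thesis using that q by auto
qed

lemma max_entropy_ge:
  fixes \<phi> :: "'e \<Rightarrow> 'w::real_normed_vector"
  assumes "q \<in> flows"
  shows "flow_entropy q \<le> max_entropy \<phi> (mean \<phi> q)"
  using max_entropy_attained[of "mean \<phi> q" \<phi>] assms by (metis image_eqI)

lemma convex_mean_flows:
  fixes \<phi> :: "'e \<Rightarrow> 'w::real_normed_vector"
  shows "convex (mean \<phi> ` flows)"
  unfolding convex_alt
proof (safe)
  fix q q' and t :: real assume *: "q \<in> flows" "q' \<in> flows" "0 \<le> t" "t \<le> 1"
  have "(1 - t) *\<^sub>R mean \<phi> q + t *\<^sub>R mean \<phi> q' = mean \<phi> ((1 - t) *\<^sub>R q + t *\<^sub>R q')" by simp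
  then show "(1 - t) *\<^sub>R mean \<phi> q + t *\<^sub>R mean \<phi> q' \<in> mean \<phi> ` flows"
    using flows_convex[OF *] by blast
qed

lemma concave_on_max_entropy:
  fixes \<phi> :: "'e \<Rightarrow> 'w::real_normed_vector"
  shows "concave_on (mean \<phi> ` flows) (max_entropy \<phi>)"
  unfolding concave_on_iff
proof (intro conjI ballI allI impI)
  show "convex (mean \<phi> ` flows)" by (rule convex_mean_flows)
  fix x y and u v :: real
  assume x: "x \<in> mean \<phi> ` flows" and y: "y \<in> mean \<phi> ` flows" and uv: "0 \<le> u" "0 \<le> v" "u + v = 1"
  obtain p where p: "p \<in> flows" "mean \<phi> p = x" "flow_entropy p = max_entropy \<phi> x"
    using max_entropy_attained[OF x] by metis
  obtain q where q: "q \<in> flows" "mean \<phi> q = y" "flow_entropy q = max_entropy \<phi> y"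
    using max_entropy_attained[OF y] by metis
  define r where "r = (1 - v) *\<^sub>R p + v *\<^sub>R q"
  have u: "u = 1 - v" using uv by simp
  have "u * max_entropy \<phi> x + v * max_entropy \<phi> y \<le> flow_entropy r"
    unfolding r_def u p(3)[symmetric] q(3)[symmetric] using uv by (intro flow_entropy_concave p q) auto
  also have "\<dots> \<le> max_entropy \<phi> (mean \<phi> r)"
    unfolding r_def using uv by (intro max_entropy_ge flows_convex p q) auto
  also have "mean \<phi> r = u *\<^sub>R x + v *\<^sub>R y" by (simp add: r_def u p q)
  finally show "u * max_entropy \<phi> x + v * max_entropy \<phi> y \<le> max_entropy \<phi> (u *\<^sub>R x + v *\<^sub>R y)" .
qed

end

section \<open>The polytope of means\<close>

context finite_graph
begin

abbreviation support :: "('e \<Rightarrow> real) \<Rightarrow> 'e set" where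
  "support q \<equiv> {e. q e \<noteq> 0}"

lemma finite_support: "q \<in> flows \<Longrightarrow> finite (support q)"
  by (rule finite_subset[OF _ finite_E]) (auto dest: flowsD(4))

text \<open>The largest multiple of \<open>q'\<close> lying below \<open>q\<close> is removed; the
  edge with the smallest ratio then drops out of the support. The multiple is less than 1 because
  both flows have mass 1 and differ.\<close>

lemma flow_split_off:
  assumes q: "q \<in> flows" and q': "q' \<in> flows" "q' \<noteq> q" "support q' \<subseteq> support q"
  obtains t r where "0 \<le> t" "t \<le> 1" "r \<in> flows" "q = (1 - t) *\<^sub>R r + t *\<^sub>R q'" "support r \<subset> support q"
proof -
  define S where "S = support q'"
  have S: "finite S" unfolding S_def by (rule finite_support[OF q'(1)])
  have "S \<noteq> {}"
  proof
    assume "S = {}"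
    then have "q' e = 0" for e by (auto simp: S_def)
    then show False using flowsD(3)[OF q'(1)] by simp
  qed
  define t where "t = Min ((\<lambda>e. q e / q' e) ` S)"
  have "t \<in> (\<lambda>e. q e / q' e) ` S" unfolding t_def using S \<open>S \<noteq> {}\<close> by (intro Min_in) auto
  then obtain e0 where e0: "e0 \<in> S" "t = q e0 / q' e0" by auto
  have q'pos: "q' e > 0" if "e \<in> S" for e
    using that flowsD(2)[OF q'(1), of e] by (simp add: S_def)
  have tle: "t * q' e \<le> q e" for e
  proof (cases "e \<in> S")
    case True
    then have "t \<le> q e / q' e" using S by (simp add: t_def)
    then show ?thesis using q'pos[OF True] by (simp add: pos_le_divide_eq)
  next
    case False
    then show ?thesis using flowsD(2)[OF q, of e] by (simp add: S_def)
  qed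
  have t0: "t \<ge> 0" using e0 q'pos[OF e0(1)] flowsD(2)[OF q, of e0] by (simp add: divide_nonneg_pos)
  have t1: "t < 1"
  proof (rule ccontr)
    assume "\<not> t < 1"
    then have le: "q' e \<le> q e" for e
      using tle[of e] flowsD(2)[OF q'(1), of e] mult_right_mono[of 1 t "q' e"] by simp
    have "sum q' E = sum q E" using flowsD(3) q q'(1) by metis
    then have "q' e = q e" if "e \<in> E" for e
      using sum_mono_inv[of q' E q] le that finite_E by blast
    then have "q' = q" using flowsD(4)[OF q] flowsD(4)[OF q'(1)] by (metis ext)
    then show False using q' by simp
  qed
  define r where "r = (1 / (1 - t)) *\<^sub>R (q - t *\<^sub>R q')"
  have "r \<in> circulations"
    unfolding r_def using flowsD(1)[OF q] flowsD(1)[OF q'(1)] subspace_circulations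
    by (intro subspace_scale subspace_diff) auto
  moreover have "r e \<ge> 0" for e using tle[of e] t1 by (simp add: r_def)
  moreover have "sum r E = 1"
  proof -
    have "sum r E = (1 / (1 - t)) * (sum q E - t * sum q' E)"
      by (simp add: r_def sum_distrib_left sum_subtractf sum_divide_distrib[symmetric])
    then show ?thesis using flowsD(3)[OF q] flowsD(3)[OF q'(1)] t1 by simp
  qed
  ultimately have r: "r \<in> flows" by (simp add: flows_def)
  have "q = (1 - t) *\<^sub>R r + t *\<^sub>R q'" using t1 by (simp add: r_def fun_eq_iff)
  moreover have "support r \<subseteq> support q" using q'(3) by (auto simp: r_def)
  moreover have "r e0 = 0" "q e0 \<noteq> 0" using e0 q'(3) by (auto simp: r_def S_def)
  then have "support r \<noteq> support q" by blast
  ultimately show ?thesis using that[of t r] t0 t1 r by (simp add: psubset_eq)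
qed

text \<open>The vertices of the polytope of flows. They are determined by their supports, hence
  finite in number.\<close>

definition minimal_flows :: "('e \<Rightarrow> real) set" where
  "minimal_flows = {q \<in> flows. \<forall>q'\<in>flows. support q' \<subseteq> support q \<longrightarrow> q' = q}"

lemma finite_minimal_flows: "finite minimal_flows"
proof (rule finite_imageD)
  show "finite (support ` minimal_flows)"
    by (rule finite_subset[of _ "Pow E"]) (use finite_E flowsD(4) in \<open>auto simp: minimal_flows_def\<close>)
  show "inj_on support minimal_flows"
  proof (rule inj_onI)
    fix q q' assume *: "q \<in> minimal_flows" "q' \<in> minimal_flows" "support q = support q'"
    then have "q' \<in> flows" "support q' \<subseteq> support q" by (auto simp: minimal_flows_def)
    then show "q = q'" using *(1) unfolding minimal_flows_def by blast
  qed
qed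

lemma mean_in_hull_minimal:
  fixes \<phi> :: "'e \<Rightarrow> 'w::real_normed_vector"
  shows "q \<in> flows \<Longrightarrow> mean \<phi> q \<in> convex hull (mean \<phi> ` minimal_flows)"
proof (induction "card (support q)" arbitrary: q rule: less_induct)
  case less
  have combine: "mean \<phi> q \<in> convex hull (mean \<phi> ` minimal_flows)"
    if "0 \<le> t" "t \<le> 1" "q = (1 - t) *\<^sub>R r + t *\<^sub>R s" "r \<in> flows" "s \<in> flows"
      "support r \<subset> support q" "support s \<subset> support q" for t r s
  proof -
    have "mean \<phi> r \<in> convex hull (mean \<phi> ` minimal_flows)" "mean \<phi> s \<in> convex hull (mean \<phi> ` minimal_flows)"
      using less.hyps that finite_support[OF less.prems] by (auto intro: psubset_card_mono)
    then have "(1 - t) *\<^sub>R mean \<phi> r + t *\<^sub>R mean \<phi> s \<in> convex hull (mean \<phi> ` minimal_flows)"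
      using that convex_convex_hull by (intro convexD) auto
    then show ?thesis by (simp add: that(3))
  qed
  show ?case
  proof (cases "q \<in> minimal_flows")
    case True
    then show ?thesis by (simp add: hull_inc)
  next
    case False
    then obtain q' where q': "q' \<in> flows" "q' \<noteq> q" "support q' \<subseteq> support q"
      using less.prems by (auto simp: minimal_flows_def)
    obtain t r where r: "0 \<le> t" "t \<le> 1" "r \<in> flows" "q = (1 - t) *\<^sub>R r + t *\<^sub>R q'" "support r \<subset> support q"
      by (rule flow_split_off[OF less.prems q'])
    \<comment> \<open>\<open>q'\<close> may have the same support as \<open>q\<close>, so it is
      unsuitable for the induction. Splitting once more, this time by \<open>r\<close>, expresses
      \<open>q\<close> by two flows of smaller support.\<close>
    have "r \<noteq> q" "support r \<subseteq> support q" using r(5) by auto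
    then obtain t' r' where r': "0 \<le> t'" "t' \<le> 1" "r' \<in> flows" "q = (1 - t') *\<^sub>R r' + t' *\<^sub>R r" "support r' \<subset> support q"
      by (rule flow_split_off[OF less.prems r(3)])
    show ?thesis by (rule combine[OF r'(1,2,4,3) r(3) r'(5) r(5)])
  qed
qed

lemma mean_flows_eq_hull:
  fixes \<phi> :: "'e \<Rightarrow> 'w::real_normed_vector"
  shows "mean \<phi> ` flows = convex hull (mean \<phi> ` minimal_flows)"
proof
  show "mean \<phi> ` flows \<subseteq> convex hull (mean \<phi> ` minimal_flows)" using mean_in_hull_minimal by blast
  show "convex hull (mean \<phi> ` minimal_flows) \<subseteq> mean \<phi> ` flows"
    by (rule hull_minimal) (auto simp: convex_mean_flows minimal_flows_def)
qed

lemma polytope_mean_flows: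
  fixes \<phi> :: "'e \<Rightarrow> 'w::euclidean_space"
  shows "polytope (mean \<phi> ` flows)"
  unfolding polytope_def mean_flows_eq_hull using finite_minimal_flows by blast

definition edge_rel :: "('v \<times> 'v) set" where
  "edge_rel = (\<lambda>e. (src e, tgt e)) ` E"

text \<open>The Gibbs bound for \<open>q\<close> with the transition probabilities of
  \<open>r\<close> is set against the optimality of \<open>q\<close>. Only logarithms at the
  positive flow \<open>r\<close> occur, so the inequality is informative even where \<open>q\<close>
  vanishes.\<close>

lemma optimal_flow_inequality:
  fixes \<phi> :: "'e \<Rightarrow> 'w::real_normed_vector"
  assumes q: "q \<in> flows" and max: "\<And>q'. q' \<in> flows \<Longrightarrow> mean \<phi> q' = mean \<phi> q \<Longrightarrow> flow_entropy q' \<le> flow_entropy q"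
    and r: "r \<in> flows" "mean \<phi> r = mean \<phi> q" "\<And>e. e \<in> E \<Longrightarrow> r e > 0"
  shows "0 \<le> (\<Sum>e\<in>E. (r e - q e) * ln (r e / outflow r (src e)))"
proof -
  have "flow_entropy q \<le> - (\<Sum>e\<in>E. q e * ln (r e / outflow r (src e)))"
    using flowsD(2)[OF q] r(3) by (intro flow_entropy_le_transition) (auto simp: less_imp_le)
  moreover have "flow_entropy r \<le> flow_entropy q" by (rule max[OF r(1,2)])
  ultimately show ?thesis
    by (simp add: flow_entropy_def left_diff_distrib sum_subtractf)
qed

end

section \<open>Maximising flows on a connected graph\<close>

locale ergodic_graph = finite_graph E src tgt
  for E :: "'e set" and src tgt :: "'e \<Rightarrow> 'v" +
  fixes q0 :: "'e \<Rightarrow> real"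
  assumes q0: "q0 \<in> flows" and q0_pos: "\<And>e. e \<in> E \<Longrightarrow> q0 e > 0"
    and connected_graph: "\<And>e e'. e \<in> E \<Longrightarrow> e' \<in> E \<Longrightarrow> (src e, src e') \<in> edge_rel\<^sup>*"
begin

text \<open>The segment from the mean of \<open>q0\<close> to \<open>w\<close> can be prolonged
  beyond \<open>w\<close> inside the polytope. Mixing \<open>q0\<close> with a flow over the new end
  point gives mean \<open>w\<close> and keeps the positivity of \<open>q0\<close>.\<close>

lemma positive_flow_exists:
  fixes \<phi> :: "'e \<Rightarrow> 'w::euclidean_space"
  assumes w: "w \<in> rel_interior (mean \<phi> ` flows)"
  obtains q where "q \<in> flows" "mean \<phi> q = w" "\<And>e. e \<in> E \<Longrightarrow> q e > 0"
proof -
  have "mean \<phi> q0 \<in> affine hull (mean \<phi> ` flows)" using q0 by (simp add: hull_inc)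
  then obtain s where s: "s > 1" "(1 - s) *\<^sub>R mean \<phi> q0 + s *\<^sub>R w \<in> mean \<phi> ` flows"
    using convex_rel_interior_if2[OF convex_mean_flows w] by blast
  then obtain q1 where q1: "q1 \<in> flows" "mean \<phi> q1 = (1 - s) *\<^sub>R mean \<phi> q0 + s *\<^sub>R w" by auto
  define q where "q = (1 - 1 / s) *\<^sub>R q0 + (1 / s) *\<^sub>R q1"
  have "q \<in> flows" unfolding q_def using s by (intro flows_convex q0 q1) auto
  moreover have "mean \<phi> q = w"
  proof -
    have "mean \<phi> q = (1 - 1 / s + (1 / s) * (1 - s)) *\<^sub>R mean \<phi> q0 + ((1 / s) * s) *\<^sub>R w"
      unfolding q_def mean_linear q1(2) scaleR_add_left scaleR_add_right scaleR_scaleR by simp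
    also have "1 - 1 / s + (1 / s) * (1 - s) = 0" using s by (simp add: field_simps)
    finally show ?thesis using s by simp
  qed
  moreover have "q e > 0" if "e \<in> E" for e
    using q0_pos[OF that] s flowsD(2)[OF q1(1), of e] by (auto simp: q_def intro!: add_pos_nonneg mult_pos_pos)
  ultimately show ?thesis using that by blast
qed

text \<open>
  If a maximiser vanished on some edge, then by connectedness it would vanish on an edge starting at a
  vertex of positive mass. Moving towards a positive flow, the entropy would increase at infinite rate there.
\<close>

lemma maximal_flow_positive:
  fixes \<phi> :: "'e \<Rightarrow> 'w::euclidean_space"
  assumes w: "w \<in> rel_interior (mean \<phi> ` flows)" and q: "q \<in> flows" "mean \<phi> q = w"
    and max: "\<And>q'. q' \<in> flows \<Longrightarrow> mean \<phi> q' = w \<Longrightarrow> flow_entropy q' \<le> flow_entropy q"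
  shows "e \<in> E \<Longrightarrow> q e > 0"
proof (rule ccontr)
  assume e: "e \<in> E" and "\<not> 0 < q e"
  then have qe: "q e = 0" using flowsD(2)[OF q(1), of e] by simp
  have nonneg: "q e \<ge> 0" for e by (rule flowsD(2)[OF q(1)])
  obtain z where z: "z \<in> E" "q z = 0" "outflow q (src z) > 0"
  proof (rule ccontr)
    assume "\<not> thesis"
    then have no: "q z > 0" if "z \<in> E" "outflow q (src z) > 0" for z
      using that nonneg \<open>\<And>z. \<lbrakk>z \<in> E; q z = 0; 0 < outflow q (src z)\<rbrakk> \<Longrightarrow> thesis\<close> by (metis less_eq_real_def)
    obtain e0 where e0: "e0 \<in> E" "q e0 > 0"
    proof (rule ccontr)
      assume *: "\<not> thesis"
      have "q x = 0" if "x \<in> E" for x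
        using * that nonneg[of x] \<open>\<And>e0. \<lbrakk>e0 \<in> E; 0 < q e0\<rbrakk> \<Longrightarrow> thesis\<close> by (metis less_eq_real_def)
      then show False using flowsD(3)[OF q(1)] by simp
    qed
    have "outflow q (src e0) > 0" using le_outflow[of q e0] nonneg e0 by force
    have "(src e0, src e) \<in> edge_rel\<^sup>*" by (rule connected_graph[OF e0(1) e])
    then have "outflow q (src e) > 0"
    proof (induction rule: rtrancl_induct)
      case (step v v')
      then obtain f where f: "f \<in> E" "src f = v" "tgt f = v'" by (auto simp: edge_rel_def)
      then have "q f > 0" using no step by blast
      also have "q f \<le> inflow q v'"
        unfolding inflow_def using f finite_E nonneg by (intro member_le_sum[of f _ q]) auto
      finally show ?case using flowsD(5)[OF q(1)] by simp
    qed fact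
    then show False using no[OF e] qe by simp
  qed
  obtain r where r: "r \<in> flows" "mean \<phi> r = w" "\<And>e. e \<in> E \<Longrightarrow> r e > 0"
    using positive_flow_exists[OF w] by metis
  \<comment> \<open>Bounds the contribution of the other edges: where \<open>q\<close> vanishes,
    \<open>(r - q) * ln p\<close> is at most 0; elsewhere \<open>r - q\<close> is at least -1 and
    \<open>p\<close> at least \<open>q / 2\<close>, as \<epsilon> \<le> 1/2.\<close>
  define c where "c x = (if q x = 0 then 0 else - ln (q x / 2))" for x
  have c0: "c x \<ge> 0" for x
    using flows_le_1[OF q(1), of x] nonneg[of x] by (auto simp: c_def intro!: ln_le_zero_iff[THEN iffD2])
  define Q where "Q = outflow q (src z)"
  \<comment> \<open>Chosen so that the transition probability at \<open>z\<close> is at most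
    \<open>exp (- ((sum c E + 1) / r z))\<close>. The edge \<open>z\<close> then contributes at most
    \<open>- (sum c E + 1)\<close>, which outweighs all other edges.\<close>
  define \<epsilon> where "\<epsilon> = Q / 2 * exp (- ((sum c E + 1) / r z))"
  have Q: "0 < Q" "Q \<le> 1" using z outflow_flows_le_1[OF q(1)] by (auto simp: Q_def)
  have rz: "r z > 0" using r(3)[OF z(1)] .
  have expl: "exp (- ((sum c E + 1) / r z)) \<le> 1" using c0 rz by (simp add: sum_nonneg)
  have eps: "0 < \<epsilon>" "\<epsilon> \<le> 1/2"
    using Q mult_mono[of "Q/2" "1/2" _ 1, OF _ expl] by (auto simp: \<epsilon>_def)
  define s where "s = (1 - \<epsilon>) *\<^sub>R q + \<epsilon> *\<^sub>R r"
  have s: "s \<in> flows" unfolding s_def using eps by (intro flows_convex q r) auto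
  have s_pos: "s e > 0" if "e \<in> E" for e
    using r(3)[OF that] eps nonneg[of e] by (auto simp: s_def intro!: add_nonneg_pos mult_pos_pos)
  have mean_s: "mean \<phi> s = w"
  proof -
    have "mean \<phi> s = (1 - \<epsilon>) *\<^sub>R w + \<epsilon> *\<^sub>R w" by (simp add: s_def q r)
    then show ?thesis by (simp add: scaleR_left_distrib[symmetric])
  qed
  define p where "p e = s e / outflow s (src e)" for e
  have out_s: "s e \<le> outflow s (src e)" if "e \<in> E" for e
    by (rule le_outflow[OF _ that]) (rule flowsD(2)[OF s])
  have p: "0 < p e" "p e \<le> 1" "s e \<le> p e" if "e \<in> E" for e
  proof -
    have *: "0 < outflow s (src e)" using out_s[OF that] s_pos[OF that] by linarith
    show "0 < p e" "p e \<le> 1" using * s_pos[OF that] out_s[OF that] by (auto simp: p_def)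
    have "s e * outflow s (src e) \<le> s e * 1"
      by (rule mult_left_mono) (use s_pos[OF that] outflow_flows_le_1[OF s] in auto)
    then show "s e \<le> p e" using * by (simp add: p_def pos_le_divide_eq)
  qed
  have "0 \<le> (\<Sum>e\<in>E. (s e - q e) * ln (p e))"
    unfolding p_def using optimal_flow_inequality[OF q(1), of \<phi> s] max s mean_s s_pos q(2) by simp
  also have "\<dots> = \<epsilon> * (\<Sum>e\<in>E. (r e - q e) * ln (p e))"
    by (simp add: s_def sum_distrib_left algebra_simps)
  finally have "0 \<le> (\<Sum>e\<in>E. (r e - q e) * ln (p e))" using eps by (simp add: zero_le_mult_iff)
  also have "\<dots> = (r z - q z) * ln (p z) + (\<Sum>e\<in>E - {z}. (r e - q e) * ln (p e))"
    by (rule sum.remove[OF finite_E z(1)])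
  also have "(\<Sum>e\<in>E - {z}. (r e - q e) * ln (p e)) \<le> (\<Sum>e\<in>E - {z}. c e)"
  proof (rule sum_mono)
    fix x assume "x \<in> E - {z}"
    then have x: "x \<in> E" by simp
    have lnp: "ln (p x) \<le> 0" using p[OF x] by simp
    show "(r x - q x) * ln (p x) \<le> c x"
    proof (cases "q x = 0")
      case True
      then show ?thesis using r(3)[OF x] lnp by (simp add: c_def mult_nonneg_nonpos)
    next
      case False
      have "q x / 2 \<le> (1 - \<epsilon>) * q x" using eps nonneg[of x] mult_right_mono[of "1/2" "1 - \<epsilon>" "q x"] by simp
      also have "\<dots> \<le> s x" using eps r(3)[OF x] by (simp add: s_def)
      also have "\<dots> \<le> p x" by (rule p(3)[OF x])
      finally have le: "ln (q x / 2) \<le> ln (p x)" using False nonneg[of x] p(1)[OF x] by simp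
      have "(r x - q x) * ln (p x) \<le> (- 1) * ln (p x)"
        by (rule mult_right_mono_neg) (use r(3)[OF x] flows_le_1[OF q(1), of x] lnp in auto)
      then show ?thesis using le False by (simp add: c_def)
    qed
  qed
  also have "\<dots> \<le> sum c E" using c0 finite_E by (intro sum_mono2) auto
  also have "(r z - q z) * ln (p z) \<le> r z * (- ((sum c E + 1) / r z))"
  proof -
    have "Q / 2 \<le> (1 - \<epsilon>) * Q" using eps Q mult_right_mono[of "1/2" "1 - \<epsilon>" Q] by simp
    also have "\<dots> \<le> outflow s (src z)"
      using outflow_nonneg[of r "src z"] flowsD(2)[OF r(1)] eps by (simp add: s_def Q_def)
    finally have Qs: "Q / 2 \<le> outflow s (src z)" .
    have "s z \<le> \<epsilon>" using z eps flows_le_1[OF r(1), of z] by (simp add: s_def mult_left_le)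
    then have "p z \<le> \<epsilon> / (Q / 2)"
      unfolding p_def using Qs Q eps by (intro frac_le) auto
    then have "ln (p z) \<le> ln (\<epsilon> / (Q / 2))" using p(1)[OF z(1)] Q eps by (subst ln_le_cancel_iff) auto
    also have "\<epsilon> / (Q / 2) = exp (- ((sum c E + 1) / r z))" using Q by (simp add: \<epsilon>_def)
    finally have "r z * ln (p z) \<le> r z * (- ((sum c E + 1) / r z))" using rz by (intro mult_left_mono) auto
    then show ?thesis using z(2) by simp
  qed
  finally show False using rz by simp
qed

text \<open>The optimality inequality along q + t \<eta> is divided by t > 0, and t tends to 0; this
  gives one sign, and the direction - \<eta> gives the other.\<close>

lemma maximal_flow_stationary:
  fixes \<phi> :: "'e \<Rightarrow> 'w::euclidean_space"
  assumes q: "q \<in> flows" "\<And>e. e \<in> E \<Longrightarrow> q e > 0"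
    and max: "\<And>q'. q' \<in> flows \<Longrightarrow> mean \<phi> q' = mean \<phi> q \<Longrightarrow> flow_entropy q' \<le> flow_entropy q"
    and \<eta>: "\<eta> \<in> circulations" "sum \<eta> E = 0" "mean \<phi> \<eta> = 0"
  shows "(\<Sum>e\<in>E. \<eta> e * ln (q e / outflow q (src e))) = 0"
proof -
  have ge: "0 \<le> (\<Sum>e\<in>E. \<eta> e * ln (q e / outflow q (src e)))"
    if \<eta>: "\<eta> \<in> circulations" "sum \<eta> E = 0" "mean \<phi> \<eta> = 0" for \<eta>
  proof -
    define r where "r t = q + t *\<^sub>R \<eta>" for t :: real
    have r_lim: "((\<lambda>t. r t e) \<longlongrightarrow> q e) (at_right 0)" for e
    proof -
      have "((\<lambda>t. q e + t * \<eta> e) \<longlongrightarrow> q e + 0 * \<eta> e) (at_right 0)" by (intro tendsto_intros)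
      then show ?thesis by (simp add: r_def)
    qed
    have out_lim: "((\<lambda>t. outflow (r t) v) \<longlongrightarrow> outflow q v) (at_right 0)" for v
      unfolding outflow_def by (intro tendsto_sum r_lim)
    have "eventually (\<lambda>t. \<forall>e\<in>E. r t e > 0) (at_right 0)"
      using finite_E q(2) by (intro eventually_ball_finite ballI order_tendstoD(1)[OF r_lim]) auto
    moreover have "eventually (\<lambda>t. t > (0::real)) (at_right 0)" by (simp add: eventually_at_right_less)
    ultimately have ev: "eventually (\<lambda>t. 0 \<le> (\<Sum>e\<in>E. \<eta> e * ln (r t e / outflow (r t) (src e)))) (at_right 0)"
    proof eventually_elim
      case (elim t)
      have "r t \<in> circulations"
        unfolding r_def using flowsD(1)[OF q(1)] \<eta>(1) subspace_circulations by (intro subspace_add subspace_scale)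
      moreover have "r t e \<ge> 0" for e
        using elim flowsD(4)[OF q(1)] \<eta>(1) by (cases "e \<in> E") (auto simp: r_def circulations_def less_imp_le)
      moreover have "sum (r t) E = sum q E + t * sum \<eta> E"
        by (simp add: r_def sum.distrib sum_distrib_left)
      ultimately have "r t \<in> flows" using \<eta>(2) flowsD(3)[OF q(1)] by (simp add: flows_def)
      moreover have "mean \<phi> (r t) = mean \<phi> q" by (simp add: r_def \<eta>)
      ultimately have "0 \<le> (\<Sum>e\<in>E. (r t e - q e) * ln (r t e / outflow (r t) (src e)))"
        using elim by (intro optimal_flow_inequality[OF q(1) max]) auto
      also have "\<dots> = t * (\<Sum>e\<in>E. \<eta> e * ln (r t e / outflow (r t) (src e)))"
        by (simp add: r_def sum_distrib_left mult.assoc)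
      finally show ?case using elim by (simp add: zero_le_mult_iff)
    qed
    have pos: "outflow q (src e) > 0" if "e \<in> E" for e
      using le_outflow[of q e] that q(2)[OF that] flowsD(2)[OF q(1)] by force
    have "((\<lambda>t. \<Sum>e\<in>E. \<eta> e * ln (r t e / outflow (r t) (src e))) \<longlongrightarrow> (\<Sum>e\<in>E. \<eta> e * ln (q e / outflow q (src e)))) (at_right 0)"
    proof (intro tendsto_sum tendsto_mult tendsto_const tendsto_ln tendsto_divide r_lim out_lim)
      fix e assume "e \<in> E"
      then show "outflow q (src e) \<noteq> 0" "q e / outflow q (src e) \<noteq> 0" using pos[of e] q(2)[of e] by auto
    qed
    then show ?thesis using ev by (rule tendsto_lowerbound) simp
  qed
  have "-\<eta> \<in> circulations" using \<eta>(1) subspace_circulations subspace_neg by blast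
  moreover have "sum (-\<eta>) E = 0" using \<eta>(2) by (simp add: sum_negf)
  moreover have "mean \<phi> (-\<eta>) = 0" using \<eta>(3) by (simp add: mean_def sum_negf)
  ultimately have "0 \<le> (\<Sum>e\<in>E. (-\<eta>) e * ln (q e / outflow q (src e)))" by (rule ge)
  then have "(\<Sum>e\<in>E. \<eta> e * ln (q e / outflow q (src e))) \<le> 0" by (simp add: sum_negf)
  then show ?thesis using ge[OF \<eta>] by simp
qed

text \<open>By stationarity, the Gibbs bound for \<open>q'\<close> formed with the transition
  probabilities of \<open>q\<close> has the same value as for \<open>q\<close>, namely the entropy
  of \<open>q\<close>.\<close>

lemma stationary_flow_maximal:
  fixes \<phi> :: "'e \<Rightarrow> 'w::euclidean_space"
  assumes q: "q \<in> flows" "\<And>e. e \<in> E \<Longrightarrow> q e > 0"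
    and stat: "\<And>\<eta>. \<eta> \<in> circulations \<Longrightarrow> sum \<eta> E = 0 \<Longrightarrow> mean \<phi> \<eta> = 0 \<Longrightarrow>
        (\<Sum>e\<in>E. \<eta> e * ln (q e / outflow q (src e))) = 0"
  shows "max_entropy \<phi> (mean \<phi> q) = flow_entropy q"
proof -
  have "flow_entropy q' \<le> flow_entropy q" if q': "q' \<in> flows" "mean \<phi> q' = mean \<phi> q" for q'
  proof -
    have "q' - q \<in> circulations" using flowsD(1) q(1) q'(1) subspace_circulations subspace_diff by blast
    moreover have "sum (q' - q) E = 0" using flowsD(3)[OF q(1)] flowsD(3)[OF q'(1)] by (simp add: sum_subtractf)
    moreover have "mean \<phi> (q' - q) = 0" using q' by simp
    ultimately have "(\<Sum>e\<in>E. (q' - q) e * ln (q e / outflow q (src e))) = 0" by (rule stat)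
    then have "(\<Sum>e\<in>E. q' e * ln (q e / outflow q (src e))) = (\<Sum>e\<in>E. q e * ln (q e / outflow q (src e)))"
      by (simp add: left_diff_distrib sum_subtractf)
    moreover have "flow_entropy q' \<le> - (\<Sum>e\<in>E. q' e * ln (q e / outflow q (src e)))"
      using q flowsD(2)[OF q'(1)] by (intro flow_entropy_le_transition) (auto simp: less_imp_le)
    ultimately show ?thesis by (simp add: flow_entropy_def)
  qed
  then show ?thesis
    unfolding max_entropy_def using q(1) by (intro cSup_eq_maximum) auto
qed

text \<open>The quadratic form below is the negative of the second derivative of the entropy.\<close>

lemma flow_entropy_hessian_definite:
  assumes q: "q \<in> flows" "\<And>e. e \<in> E \<Longrightarrow> q e > 0"
    and \<eta>: "\<eta> \<in> circulations" "sum \<eta> E = 0"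
    and zero: "(\<Sum>e\<in>E. \<eta> e * \<eta> e / q e) = (\<Sum>v\<in>src ` E. outflow \<eta> v * outflow \<eta> v / outflow q v)"
  shows "\<eta> = 0"
proof -
  define c where "c v = outflow \<eta> v / outflow q v" for v
  have pos: "outflow q (src e) > 0" if "e \<in> E" for e
    using le_outflow[of q e] that q(2)[OF that] flowsD(2)[OF q(1)] by force
  \<comment> \<open>The two sides of \<open>zero\<close> differ by a weighted variance of
    \<open>\<eta> / q\<close> around its mean \<open>c\<close> at each vertex. Its vanishing makes
    \<eta> equal to \<open>c (src e) * q e\<close> on every edge.\<close>
  have "(\<Sum>e\<in>E. q e * (\<eta> e / q e - c (src e))\<^sup>2)
      = (\<Sum>e\<in>E. \<eta> e * \<eta> e / q e - 2 * (c (src e) * \<eta> e) + (c (src e))\<^sup>2 * q e)"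
  proof (rule sum.cong)
    fix e assume "e \<in> E"
    then have "q e \<noteq> 0" using q(2) by force
    then show "q e * (\<eta> e / q e - c (src e))\<^sup>2 = \<eta> e * \<eta> e / q e - 2 * (c (src e) * \<eta> e) + (c (src e))\<^sup>2 * q e"
      by (simp add: power2_eq_square field_simps)
  qed simp
  also have "\<dots> = (\<Sum>e\<in>E. \<eta> e * \<eta> e / q e) - 2 * (\<Sum>v\<in>src ` E. c v * outflow \<eta> v) + (\<Sum>v\<in>src ` E. (c v)\<^sup>2 * outflow q v)"
    unfolding sum.distrib sum_subtractf sum_distrib_left[symmetric] sum_outflow sum_outflow[of "\<lambda>v. (c v)\<^sup>2"] ..
  also have "(\<Sum>v\<in>src ` E. (c v)\<^sup>2 * outflow q v) = (\<Sum>v\<in>src ` E. c v * outflow \<eta> v)"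
    using pos by (intro sum.cong) (force simp: c_def power2_eq_square)+
  also have "(\<Sum>v\<in>src ` E. c v * outflow \<eta> v) = (\<Sum>e\<in>E. \<eta> e * \<eta> e / q e)"
    unfolding zero by (intro sum.cong) (simp_all add: c_def)
  finally have "(\<Sum>e\<in>E. q e * (\<eta> e / q e - c (src e))\<^sup>2) = 0" by simp
  then have "q e * (\<eta> e / q e - c (src e))\<^sup>2 = 0" if "e \<in> E" for e
    using sum_nonneg_eq_0_iff[OF finite_E, of "\<lambda>e. q e * (\<eta> e / q e - c (src e))\<^sup>2"] q(2) that
    by (auto simp: less_imp_le)
  then have \<eta>c: "\<eta> e = c (src e) * q e" if "e \<in> E" for e
    using that q(2)[OF that] by (fastforce simp: field_simps)
  show ?thesis
  proof (cases "E = {}")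
    case True
    then have "\<eta> e = 0" for e using \<eta>(1) unfolding circulations_def by blast
    then show ?thesis by (simp add: fun_eq_iff)
  next
    case False
    define m where "m = Max (c ` src ` E)"
    have m: "c (src e) \<le> m" if "e \<in> E" for e using that finite_E by (simp add: m_def)
    have "m \<in> c ` src ` E" unfolding m_def using False finite_E by (intro Max_in) auto
    then obtain e0 where e0: "e0 \<in> E" "c (src e0) = m" by auto
    \<comment> \<open>Maximum principle: since \<eta> and \<open>q\<close> are balanced at
      \<open>tgt f\<close>, the value of \<open>c\<close> there is an average, weighted by
      \<open>q\<close>, of the values at the predecessors. A maximum forces all of them to be
      maximal.\<close>
    have pred: "c (src f) = m" if f: "f \<in> E" "c (tgt f) = m" for f
    proof -
      define I where "I = {e \<in> E. tgt e = tgt f}"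
      have I: "finite I" "f \<in> I" "I \<subseteq> E" using finite_E f by (auto simp: I_def)
      have "outflow q (tgt f) \<ge> q f"
        using member_le_sum[of f I q] I flowsD(2)[OF q(1)] flowsD(5)[OF q(1), of "tgt f"] by (simp add: inflow_def I_def)
      then have "outflow q (tgt f) > 0" using q(2)[OF f(1)] by linarith
      then have "outflow \<eta> (tgt f) = m * outflow q (tgt f)" using f(2) by (simp add: c_def field_simps)
      then have "sum \<eta> I = m * sum q I"
        using flowsD(5)[OF q(1), of "tgt f"] \<eta>(1) by (simp add: circulations_def inflow_def I_def)
      moreover have "sum \<eta> I = (\<Sum>e\<in>I. c (src e) * q e)" using \<eta>c I(3) by (intro sum.cong) auto
      ultimately have "(\<Sum>e\<in>I. (m - c (src e)) * q e) = 0"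
        by (simp add: left_diff_distrib sum_subtractf sum_distrib_left)
      moreover have "0 \<le> (m - c (src e)) * q e" if "e \<in> I" for e
        using that I(3) m[of e] flowsD(2)[OF q(1), of e] by auto
      ultimately have "(m - c (src f)) * q f = 0"
        using sum_nonneg_eq_0_iff[OF I(1), of "\<lambda>e. (m - c (src e)) * q e"] I(2) by blast
      then show ?thesis using q(2)[OF f(1)] by simp
    qed
    have const: "c (src e) = m" if e: "e \<in> E" for e
      using connected_graph[OF e e0(1)]
    proof (induction rule: converse_rtrancl_induct)
      case base show ?case by (rule e0(2))
    next
      case (step v v')
      then show ?case using pred by (auto simp: edge_rel_def)
    qed
    \<comment> \<open>A constant \<open>c\<close> makes \<eta> a multiple of \<open>q\<close>; the
      masses 0 of \<eta> and 1 of \<open>q\<close> leave only the multiple 0.\<close>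
    have "0 = (\<Sum>e\<in>E. m * q e)" using \<eta>(2) \<eta>c const by simp
    then have "m = 0" using flowsD(3)[OF q(1)] by (simp add: sum_distrib_left[symmetric])
    then have "\<eta> e = 0" for e using \<eta>c const \<eta>(1) by (cases "e \<in> E") (auto simp: circulations_def)
    then show ?thesis by (simp add: fun_eq_iff)
  qed
qed

end

section \<open>Analyticity of the maximal entropy of a connected graph\<close>

context ergodic_graph
begin

text \<open>Differences of flows are circulations of mass 0, and their means span the direction
  space. The lifts allow a flow to be moved so that its mean follows given coordinates on the affine
  hull.\<close>

lemma mean_deviations_span:
  fixes \<phi> :: "'e \<Rightarrow> 'w::euclidean_space"
  assumes q: "q \<in> flows" and v: "v \<in> (\<lambda>x. x - mean \<phi> q) ` (affine hull (mean \<phi> ` flows))"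
  obtains \<eta> where "\<eta> \<in> circulations" "sum \<eta> E = 0" "mean \<phi> \<eta> = v"
proof -
  define T where "T = {\<eta> \<in> circulations. sum \<eta> E = 0}"
  have "subspace T"
    using subspace_circulations
    by (auto simp: T_def subspace_def sum.distrib sum_distrib_left[symmetric])
  moreover have "linear (mean \<phi>)" by (rule linearI) simp_all
  ultimately have sub: "subspace (mean \<phi> ` T)" by (rule linear_subspace_image[rotated])
  have "(\<lambda>x. - mean \<phi> q + x) ` mean \<phi> ` flows \<subseteq> mean \<phi> ` T"
  proof safe
    fix r assume r: "r \<in> flows"
    have "r - q \<in> T"
      using flowsD(1)[OF q] flowsD(1)[OF r] flowsD(3)[OF q] flowsD(3)[OF r] subspace_circulations
      by (auto simp: T_def sum_subtractf intro: subspace_diff)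
    then show "- mean \<phi> q + mean \<phi> r \<in> mean \<phi> ` T" by (intro image_eqI[of _ _ "r - q"]) simp_all
  qed
  then have "span ((\<lambda>x. - mean \<phi> q + x) ` mean \<phi> ` flows) \<subseteq> mean \<phi> ` T"
    using sub by (rule span_minimal)
  moreover have "affine hull (mean \<phi> ` flows) = (\<lambda>x. mean \<phi> q + x) ` span ((\<lambda>x. - mean \<phi> q + x) ` mean \<phi> ` flows)"
    by (rule affine_hull_span_gen) (use q in \<open>simp add: hull_inc\<close>)
  ultimately have "v \<in> mean \<phi> ` T" using v by auto
  then show ?thesis using that by (auto simp: T_def)
qed

lemma tangent_basis:
  fixes \<phi> :: "'e \<Rightarrow> 'w::euclidean_space"
  obtains K where "finite K" "independent K" "\<And>k. k \<in> K \<Longrightarrow> k \<in> circulations" "\<And>k. k \<in> K \<Longrightarrow> sum k E = 0"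
    "\<And>k. k \<in> K \<Longrightarrow> mean \<phi> k = 0"
    "\<And>\<eta>. \<eta> \<in> circulations \<Longrightarrow> sum \<eta> E = 0 \<Longrightarrow> mean \<phi> \<eta> = 0 \<Longrightarrow> \<eta> \<in> span K"
proof -
  define T where "T = {\<eta> \<in> circulations. sum \<eta> E = 0 \<and> mean \<phi> \<eta> = 0}"
  obtain K where K: "K \<subseteq> T" "independent K" "T \<subseteq> span K" using basis_exists by metis
  have "K \<subseteq> span ((\<lambda>k x. if x = k then 1 else 0) ` E)"
    using K(1) by (auto simp: T_def circulations_def intro!: supported_in_span finite_E)
  then have "finite K" using independent_span_bound[OF _ K(2)] finite_E by blast
  then show ?thesis using that[of K] K by (auto simp: T_def)
qed

text \<open>A flow near the maximiser is \<open>q\<close>, plus a combination of a basis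
  \<open>K\<close> of the fibre directions (the unknowns \<open>y\<close>), plus lifted tangent
  vectors (the parameters \<open>u\<close>). The series solves the critical equations for
  \<open>y\<close>, and by \<open>stationary_flow_maximal\<close> a positive critical flow is a
  maximiser, so the value of the series is the maximal entropy.\<close>

theorem max_entropy_analytic:
  fixes \<phi> :: "'e \<Rightarrow> 'w::euclidean_space"
  shows "rel_real_analytic_on (rel_interior (mean \<phi> ` flows)) (max_entropy \<phi>)"
  unfolding rel_real_analytic_on_def
proof
  fix w assume w: "w \<in> rel_interior (mean \<phi> ` flows)"
  then have wF: "w \<in> mean \<phi> ` flows" using rel_interior_subset by blast
  obtain q where q: "q \<in> flows" "mean \<phi> q = w"
    and max: "\<And>q'. q' \<in> flows \<Longrightarrow> mean \<phi> q' = w \<Longrightarrow> flow_entropy q' \<le> flow_entropy q"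
    using max_entropy_attained[OF wF] by metis
  have q_pos: "q e > 0" if "e \<in> E" for e using maximal_flow_positive[OF w q max that] .
  have out_pos: "outflow q v > 0" if "v \<in> src ` E" for v
    using that le_outflow[of q] q_pos flowsD(2)[OF q(1)] by (force intro: less_le_trans)
  obtain K where K: "finite K" "independent K" and
    Kc: "\<And>k. k \<in> K \<Longrightarrow> k \<in> circulations" "\<And>k. k \<in> K \<Longrightarrow> sum k E = 0" "\<And>k. k \<in> K \<Longrightarrow> mean \<phi> k = 0" and
    Ks: "\<And>\<eta>. \<eta> \<in> circulations \<Longrightarrow> sum \<eta> E = 0 \<Longrightarrow> mean \<phi> \<eta> = 0 \<Longrightarrow> \<eta> \<in> span K"
    using tangent_basis[of \<phi>] by blast
  have stat: "(\<Sum>e\<in>E. k e * ln (q e / outflow q (src e))) = 0" if "k \<in> K" for k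
    using maximal_flow_stationary[OF q(1) q_pos _ Kc(1,2,3)[OF that]] max q(2) by blast
  let ?F = "mean \<phi> ` flows"
  let ?V = "(\<lambda>x. x - w) ` (affine hull ?F)"
  have subV: "subspace ?V"
  proof -
    have "affine hull ?F = (\<lambda>x. w + x) ` span ((\<lambda>x. - w + x) ` ?F)"
      by (rule affine_hull_span_gen) (use wF in \<open>simp add: hull_inc\<close>)
    then have "?V = span ((\<lambda>x. - w + x) ` ?F)" by (auto simp: image_image)
    then show ?thesis by simp
  qed
  obtain B where B: "B \<subseteq> ?V" "independent B" "?V \<subseteq> span B"
    using basis_exists by metis
  have finB: "finite B" using B(2) by (rule independent_imp_finite)
  have spanB: "span B = ?V" using B subV by (metis span_minimal subset_antisym)
  have "\<exists>\<eta>. \<eta> \<in> circulations \<and> sum \<eta> E = 0 \<and> mean \<phi> \<eta> = v" if v: "v \<in> B" for v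
    using mean_deviations_span[OF q(1), of v \<phi>] v B(1) q(2) by blast
  then obtain \<eta> where \<eta>: "\<And>v. v \<in> B \<Longrightarrow> \<eta> v \<in> circulations" "\<And>v. v \<in> B \<Longrightarrow> sum (\<eta> v) E = 0"
      "\<And>v. v \<in> B \<Longrightarrow> mean \<phi> (\<eta> v) = v" by metis

  \<comment> \<open>Edges and vertices together index the linear forms in the entropy: it is the sum
    of \<open>s j * val q j * ln (val q j)\<close>, with sign -1 for the edges and +1 for the
    outflows.\<close>
  define J where "J = Inl ` E \<union> Inr ` src ` E"
  define val where "val k j = (case j of Inl e \<Rightarrow> k e | Inr v \<Rightarrow> outflow k v)" for k :: "'e \<Rightarrow> real" and j :: "'e + 'v"
  define s where "s j = (case j of Inl e \<Rightarrow> - (1::real) | Inr v \<Rightarrow> 1)" for j :: "'e + 'v"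
  have J: "finite J" unfolding J_def using finite_E by auto
  have sumJ: "(\<Sum>j\<in>J. f j) = (\<Sum>e\<in>E. f (Inl e)) + (\<Sum>v\<in>src ` E. f (Inr v))" for f :: "'e + 'v \<Rightarrow> real"
    unfolding J_def using finite_E by (subst sum.union_disjoint) (auto simp: sum.reindex)
  have val_scale: "val (x *\<^sub>R f) j = x * val f j" for x f j by (cases j) (simp_all add: val_def)
  have val_add: "val (f + g) j = val f j + val g j" for f g j by (cases j) (simp_all add: val_def)
  have val_linear: "linear (\<lambda>f. val f j)" for j
    by (rule linearI) (simp_all add: val_add val_scale)
  note val_sum = linear_sum[OF val_linear]
  have val_pos: "val q j > 0" if "j \<in> J" for j
    using that q_pos out_pos by (auto simp: J_def val_def)
  have log_sum: "(\<Sum>j\<in>J. s j * val k j * ln (val r j)) = - (\<Sum>e\<in>E. k e * ln (r e / outflow r (src e)))"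
    if r: "\<And>j. j \<in> J \<Longrightarrow> val r j > 0" for k r
  proof -
    have pos: "r e > 0" "outflow r (src e) > 0" if "e \<in> E" for e
      using r[of "Inl e"] r[of "Inr (src e)"] that by (auto simp: J_def val_def)
    have "(\<Sum>j\<in>J. s j * val k j * ln (val r j))
        = - (\<Sum>e\<in>E. k e * ln (r e)) + (\<Sum>v\<in>src ` E. ln (outflow r v) * outflow k v)"
      by (simp add: sumJ s_def val_def sum_negf mult.commute)
    also have "\<dots> = - (\<Sum>e\<in>E. k e * ln (r e)) + (\<Sum>e\<in>E. ln (outflow r (src e)) * k e)"
      by (simp only: sum_outflow[of "\<lambda>v. ln (outflow r v)"])
    also have "\<dots> = - (\<Sum>e\<in>E. k e * ln (r e / outflow r (src e)))"
    proof -
      have "k e * ln (r e / outflow r (src e)) = k e * ln (r e) - ln (outflow r (src e)) * k e" if "e \<in> E" for e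
        using pos[OF that] by (simp add: ln_div algebra_simps)
      then have "(\<Sum>e\<in>E. k e * ln (r e / outflow r (src e))) = (\<Sum>e\<in>E. k e * ln (r e) - ln (outflow r (src e)) * k e)"
        by (intro sum.cong) auto
      then show ?thesis by (simp add: sum_subtractf)
    qed
    finally show ?thesis .
  qed
  define M where "M k m = (\<Sum>j\<in>J. s j * val k j * val m j / val q j)" for k m
  have ker: "x k = 0" if x: "\<And>k. k \<in> K \<Longrightarrow> (\<Sum>m\<in>K. M k m * x m) = 0" and k: "k \<in> K" for x k
  proof -
    define h where "h = (\<Sum>m\<in>K. x m *\<^sub>R m)"
    have h: "h \<in> circulations" "sum h E = 0"
    proof -
      show "h \<in> circulations"
        unfolding h_def using Kc(1) subspace_circulations by (intro subspace_sum subspace_scale)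
      have "sum h E = (\<Sum>m\<in>K. x m * sum m E)"
        unfolding h_def sum_fun_apply by (subst sum.swap) (simp add: sum_distrib_left)
      then show "sum h E = 0" using Kc(2) by simp
    qed
    have val_h: "val h j = (\<Sum>m\<in>K. val m j * x m)" for j
      unfolding h_def val_sum val_scale by (simp add: mult.commute)
    \<comment> \<open>Contracting \<open>M x = 0\<close> with \<open>x\<close> gives the quadratic
      form of the second derivative at \<open>h\<close>, which is definite.\<close>
    have "0 = (\<Sum>k\<in>K. x k * (\<Sum>m\<in>K. M k m * x m))" using x by simp
    also have "\<dots> = (\<Sum>k\<in>K. \<Sum>m\<in>K. \<Sum>j\<in>J. s j / val q j * (val k j * x k) * (val m j * x m))"
      unfolding M_def by (simp add: sum_distrib_left sum_distrib_right mult_ac)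
    also have "\<dots> = (\<Sum>j\<in>J. \<Sum>k\<in>K. \<Sum>m\<in>K. s j / val q j * (val k j * x k) * (val m j * x m))"
      by (subst sum.swap[of _ J K]) (rule sum.swap)
    also have "\<dots> = (\<Sum>j\<in>J. s j / val q j * (val h j * val h j))"
      unfolding val_h sum_product by (simp add: sum_distrib_left mult_ac)
    also have "\<dots> = (\<Sum>v\<in>src ` E. outflow h v * outflow h v / outflow q v) - (\<Sum>e\<in>E. h e * h e / q e)"
      by (simp add: sumJ s_def val_def sum_negf)
    finally have "h = 0" using flow_entropy_hessian_definite[OF q(1) q_pos h] by simp
    then show "x k = 0" using K k unfolding h_def by (metis independentD subset_refl)
  qed
  have M_sym: "M k m = M m k" for k m by (simp add: M_def mult_ac)
  obtain N where N: "\<And>l m. l \<in> K \<Longrightarrow> m \<in> K \<Longrightarrow> (\<Sum>k\<in>K. N l k * M k m) = (if l = m then 1 else 0)"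
      "\<And>l m. l \<in> K \<Longrightarrow> m \<in> K \<Longrightarrow> (\<Sum>k\<in>K. M l k * N k m) = (if l = m then 1 else 0)"
  proof (rule symmetric_matrix_inverse[OF K(1), of M])
    show "M k m = M m k" for k m by (rule M_sym)
    show "\<And>x k. (\<And>k. k \<in> K \<Longrightarrow> (\<Sum>m\<in>K. M k m * x m) = 0) \<Longrightarrow> k \<in> K \<Longrightarrow> x k = 0" by (rule ker)
  qed (rule that)
  have crit: "(\<Sum>j\<in>J. s j * val k j * ln (val q j)) = 0" if "k \<in> K" for k
    using log_sum[OF val_pos, of k] stat[OF that] by simp
  obtain \<delta> where \<delta>: "\<delta> > 0" and sol:
    "\<And>c :: 'e + 'v \<Rightarrow> 'w \<Rightarrow> real. (\<And>j. j \<in> J \<Longrightarrow> (\<Sum>v\<in>B. \<bar>c j v\<bar>) \<le> \<delta>) \<Longrightarrow>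
      \<exists>y p. \<forall>u. (\<forall>v\<in>B. \<bar>u v\<bar> < 1) \<longrightarrow>
        (\<forall>j\<in>J. val q j + (\<Sum>k\<in>K. val k j * y u k) + (\<Sum>v\<in>B. c j v * u v) > 0) \<and>
        (\<forall>k\<in>K. (\<Sum>j\<in>J. s j * val k j *
            ln (val q j + (\<Sum>k\<in>K. val k j * y u k) + (\<Sum>v\<in>B. c j v * u v))) = 0) \<and>
        ((\<lambda>\<alpha>. p \<alpha> * (\<Prod>v\<in>B. u v ^ \<alpha> v)) has_sum
          (\<Sum>j\<in>J. s j * (val q j + (\<Sum>k\<in>K. val k j * y u k) + (\<Sum>v\<in>B. c j v * u v)) *
            ln (val q j + (\<Sum>k\<in>K. val k j * y u k) + (\<Sum>v\<in>B. c j v * u v)))) (B \<rightarrow>\<^sub>E (UNIV :: nat set))"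
  proof (rule log_affine_critical_value_analytic[OF J K(1) finB, of "val q" s "\<lambda>j k. val k j" N])
    show "\<And>l m. l \<in> K \<Longrightarrow> m \<in> K \<Longrightarrow> (\<Sum>k\<in>K. N l k * (\<Sum>j\<in>J. s j * val k j * val m j / val q j)) = (if l = m then 1 else 0)"
      using N(1) unfolding M_def .
    show "\<And>m k. m \<in> K \<Longrightarrow> k \<in> K \<Longrightarrow> (\<Sum>l\<in>K. (\<Sum>j\<in>J. s j * val m j * val l j / val q j) * N l k) = (if m = k then 1 else 0)"
      using N(2) unfolding M_def .
  qed (use val_pos crit in blast)+
  \<comment> \<open>The lifts are scaled by \<epsilon> to be admissible perturbations on the unit
    polydisc; hence \<epsilon> is the radius in the original coordinates, and the coefficients are
    divided by the powers of \<epsilon> at the end.\<close>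
  define C where "C = 1 + (\<Sum>j\<in>J. \<Sum>v\<in>B. \<bar>val (\<eta> v) j\<bar>)"
  have C1: "C \<ge> 1" by (simp add: C_def sum_nonneg)
  define \<epsilon> where "\<epsilon> = \<delta> / C"
  have \<epsilon>: "\<epsilon> > 0" using \<delta> C1 by (simp add: \<epsilon>_def)
  have "(\<Sum>v\<in>B. \<bar>\<epsilon> * val (\<eta> v) j\<bar>) \<le> \<delta>" if "j \<in> J" for j
  proof -
    have "(\<Sum>v\<in>B. \<bar>\<epsilon> * val (\<eta> v) j\<bar>) = \<epsilon> * (\<Sum>v\<in>B. \<bar>val (\<eta> v) j\<bar>)"
      using \<epsilon> by (simp add: abs_mult sum_distrib_left)
    also have "(\<Sum>v\<in>B. \<bar>val (\<eta> v) j\<bar>) \<le> C"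
      using member_le_sum[of j J "\<lambda>j. \<Sum>v\<in>B. \<bar>val (\<eta> v) j\<bar>"] that J by (simp add: C_def sum_nonneg)
    also have "\<epsilon> * C = \<delta>" using C1 by (simp add: \<epsilon>_def)
    finally show ?thesis using \<epsilon> by simp
  qed
  from sol[of "\<lambda>j v. \<epsilon> * val (\<eta> v) j", OF this] obtain y p where
    yp: "\<And>u. (\<forall>v\<in>B. \<bar>u v\<bar> < 1) \<Longrightarrow>
        (\<forall>j\<in>J. val q j + (\<Sum>k\<in>K. val k j * y u k) + (\<Sum>v\<in>B. \<epsilon> * val (\<eta> v) j * u v) > 0) \<and>
        (\<forall>k\<in>K. (\<Sum>j\<in>J. s j * val k j *
            ln (val q j + (\<Sum>k\<in>K. val k j * y u k) + (\<Sum>v\<in>B. \<epsilon> * val (\<eta> v) j * u v))) = 0) \<and>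
        ((\<lambda>\<alpha>. p \<alpha> * (\<Prod>v\<in>B. u v ^ \<alpha> v)) has_sum
          (\<Sum>j\<in>J. s j * (val q j + (\<Sum>k\<in>K. val k j * y u k) + (\<Sum>v\<in>B. \<epsilon> * val (\<eta> v) j * u v)) *
            ln (val q j + (\<Sum>k\<in>K. val k j * y u k) + (\<Sum>v\<in>B. \<epsilon> * val (\<eta> v) j * u v)))) (B \<rightarrow>\<^sub>E (UNIV :: nat set))"
    by blast
  show "\<exists>B c r. independent B \<and> span B = (\<lambda>x. x - w) ` (affine hull (rel_interior ?F)) \<and> r > 0 \<and>
        (\<forall>u. (\<forall>b\<in>B. \<bar>u b\<bar> < r) \<longrightarrow>
           ((\<lambda>\<alpha>. c \<alpha> * (\<Prod>b\<in>B. u b ^ \<alpha> b)) has_sum max_entropy \<phi> (w + (\<Sum>b\<in>B. u b *\<^sub>R b)))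
             (B \<rightarrow>\<^sub>E (UNIV :: nat set)))"
  proof (intro exI conjI allI impI)
    show "independent B" by (rule B)
    show "span B = (\<lambda>x. x - w) ` (affine hull (rel_interior ?F))"
      unfolding spanB rel_interior_same_affine_hull[OF convex_mean_flows] ..
    show "\<epsilon> > 0" by (rule \<epsilon>)
    fix u :: "'w \<Rightarrow> real" assume u: "\<forall>b\<in>B. \<bar>u b\<bar> < \<epsilon>"
    define u' where "u' b = u b / \<epsilon>" for b
    have u': "\<forall>b\<in>B. \<bar>u' b\<bar> < 1" using u \<epsilon> by (simp add: u'_def)
    define r where "r = q + (\<Sum>k\<in>K. y u' k *\<^sub>R k) + (\<Sum>b\<in>B. u b *\<^sub>R \<eta> b)"
    have val_r: "val r j = val q j + (\<Sum>k\<in>K. val k j * y u' k) + (\<Sum>v\<in>B. \<epsilon> * val (\<eta> v) j * u' v)" for j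
    proof -
      have "val (\<Sum>k\<in>K. y u' k *\<^sub>R k) j = (\<Sum>k\<in>K. val k j * y u' k)"
        unfolding val_sum val_scale by (simp add: mult.commute)
      moreover have "val (\<Sum>b\<in>B. u b *\<^sub>R \<eta> b) j = (\<Sum>v\<in>B. \<epsilon> * val (\<eta> v) j * u' v)"
        unfolding val_sum val_scale using \<epsilon> by (simp add: u'_def mult.commute)
      ultimately show ?thesis by (simp add: r_def val_add)
    qed
    note sol_u = yp[OF u', folded val_r]
    have val_r_pos: "val r j > 0" if "j \<in> J" for j using sol_u that by blast
    have r_pos: "r e > 0" if "e \<in> E" for e
      using val_r_pos[of "Inl e"] that by (auto simp: J_def val_def)
    have "r \<in> circulations"
      unfolding r_def using flowsD(1)[OF q(1)] Kc(1) \<eta>(1) subspace_circulations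
      by (intro subspace_add subspace_sum subspace_scale)
    moreover have "sum r E = 1"
    proof -
      have "sum r E = sum q E + (\<Sum>k\<in>K. y u' k * sum k E) + (\<Sum>b\<in>B. u b * sum (\<eta> b) E)"
        unfolding r_def plus_fun_apply sum.distrib sum_fun_apply
        by (subst (1 2) sum.swap) (simp add: sum_distrib_left)
      then show ?thesis using Kc(2) \<eta>(2) flowsD(3)[OF q(1)] by simp
    qed
    moreover have "r e \<ge> 0" for e
      using r_pos[of e] \<open>r \<in> circulations\<close> by (cases "e \<in> E") (auto simp: circulations_def less_imp_le)
    ultimately have r: "r \<in> flows" by (simp add: flows_def)
    have mean_r: "mean \<phi> r = w + (\<Sum>b\<in>B. u b *\<^sub>R b)"
      unfolding r_def mean_linear mean_sum q(2) using Kc(3) \<eta>(3) by simp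
    have "(\<Sum>e\<in>E. h e * ln (r e / outflow r (src e))) = 0"
      if h: "h \<in> circulations" "sum h E = 0" "mean \<phi> h = 0" for h
    proof -
      have "h \<in> span K" using Ks h by blast
      then obtain x where hx: "h = (\<Sum>k\<in>K. x k *\<^sub>R k)" using span_finite[OF K(1)] by auto
      have k0: "(\<Sum>e\<in>E. k e * ln (r e / outflow r (src e))) = 0" if "k \<in> K" for k
        using log_sum[OF val_r_pos, of k] sol_u that by simp
      have "(\<Sum>e\<in>E. h e * ln (r e / outflow r (src e)))
          = (\<Sum>k\<in>K. x k * (\<Sum>e\<in>E. k e * ln (r e / outflow r (src e))))"
        unfolding hx sum_fun_apply sum_distrib_left sum_distrib_right by (subst sum.swap) (simp add: mult.assoc)
      then show ?thesis using k0 by simp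
    qed
    then have "max_entropy \<phi> (mean \<phi> r) = flow_entropy r"
      by (intro stationary_flow_maximal r r_pos) auto
    also have "\<dots> = (\<Sum>j\<in>J. s j * val r j * ln (val r j))"
      using log_sum[of r r, OF val_r_pos] by (simp add: flow_entropy_def)
    finally have ent: "(\<Sum>j\<in>J. s j * val r j * ln (val r j)) = max_entropy \<phi> (w + (\<Sum>b\<in>B. u b *\<^sub>R b))"
      by (simp add: mean_r)
    have "((\<lambda>\<alpha>. p \<alpha> * (\<Prod>v\<in>B. u' v ^ \<alpha> v)) has_sum max_entropy \<phi> (w + (\<Sum>b\<in>B. u b *\<^sub>R b))) (B \<rightarrow>\<^sub>E UNIV)"
      using sol_u unfolding ent by blast
    moreover have "p \<alpha> * (\<Prod>v\<in>B. u' v ^ \<alpha> v) = p \<alpha> / (\<Prod>v\<in>B. \<epsilon> ^ \<alpha> v) * (\<Prod>v\<in>B. u v ^ \<alpha> v)" for \<alpha>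
      by (simp add: u'_def power_divide prod_dividef)
    ultimately show "((\<lambda>\<alpha>. p \<alpha> / (\<Prod>v\<in>B. \<epsilon> ^ \<alpha> v) * (\<Prod>b\<in>B. u b ^ \<alpha> b)) has_sum
        max_entropy \<phi> (w + (\<Sum>b\<in>B. u b *\<^sub>R b))) (B \<rightarrow>\<^sub>E UNIV)" by simp
  qed
qed

end

section \<open>Decomposition into connected components\<close>

context finite_graph
begin

lemma subgraph:
  assumes "D \<subseteq> E"
  shows "finite_graph D"
  using finite_subset[OF assms finite_E] by (simp add: finite_graph_def)

lemma subgraph_eq:
  assumes D: "D \<subseteq> E" and q: "\<And>e. e \<notin> D \<Longrightarrow> q e = 0"
  shows "finite_graph.outflow D src q v = outflow q v" "finite_graph.inflow D tgt q v = inflow q v"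
    "finite_graph.mean D \<phi> q = mean \<phi> q" "sum q D = sum q E"
    "finite_graph.flow_entropy D src q = flow_entropy q"
proof -
  interpret D: finite_graph D src tgt by (rule subgraph[OF D])
  show out: "D.outflow q v = outflow q v" for v
    unfolding D.outflow_def outflow_def by (rule sum.mono_neutral_left) (use finite_E D q in auto)
  show "D.inflow q v = inflow q v"
    unfolding D.inflow_def inflow_def by (rule sum.mono_neutral_left) (use finite_E D q in auto)
  show "D.mean \<phi> q = mean \<phi> q"
    unfolding D.mean_def mean_def by (rule sum.mono_neutral_left) (use finite_E D q in auto)
  show "sum q D = sum q E"
    by (rule sum.mono_neutral_left) (use finite_E D q in auto)
  show "D.flow_entropy q = flow_entropy q"
    unfolding D.flow_entropy_def flow_entropy_def out
    by (intro arg_cong[where f = uminus] sum.mono_neutral_left) (use finite_E D q in auto)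
qed

lemma subgraph_flows:
  assumes D: "D \<subseteq> E"
  shows "finite_graph.flows D src tgt = {q \<in> flows. \<forall>e. e \<notin> D \<longrightarrow> q e = 0}"
proof -
  interpret D: finite_graph D src tgt by (rule subgraph[OF D])
  show ?thesis
  proof (intro set_eqI)
    fix q
    show "q \<in> D.flows \<longleftrightarrow> q \<in> {q \<in> flows. \<forall>e. e \<notin> D \<longrightarrow> q e = 0}"
    proof (cases "\<forall>e. e \<notin> D \<longrightarrow> q e = 0")
      case True
      then have off: "\<And>e. e \<notin> D \<Longrightarrow> q e = 0" by blast
      have "\<And>e. e \<notin> E \<Longrightarrow> q e = 0" using off D by blast
      then show ?thesis
        using off subgraph_eq(1,2,4)[of D q, OF D off]
        unfolding flows_def circulations_def D.flows_def D.circulations_def mem_Collect_eq by simp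
    next
      case False
      then show ?thesis unfolding D.flows_def D.circulations_def by blast
    qed
  qed
qed

lemma sum_outflow_vertices:
  assumes "finite S"
  shows "(\<Sum>v\<in>S. outflow q v) = (\<Sum>e | e \<in> E \<and> src e \<in> S. q e)"
proof -
  have "(\<Sum>v\<in>S. outflow q v) = (\<Sum>v\<in>S. sum q {e \<in> {e. e \<in> E \<and> src e \<in> S}. src e = v})"
    unfolding outflow_def by (intro sum.cong) auto
  also have "\<dots> = (\<Sum>e | e \<in> E \<and> src e \<in> S. q e)"
    by (rule sum.group) (use finite_E assms in auto)
  finally show ?thesis .
qed

lemma sum_inflow_vertices:
  assumes "finite S"
  shows "(\<Sum>v\<in>S. inflow q v) = (\<Sum>e | e \<in> E \<and> tgt e \<in> S. q e)"
proof -
  have "(\<Sum>v\<in>S. inflow q v) = (\<Sum>v\<in>S. sum q {e \<in> {e. e \<in> E \<and> tgt e \<in> S}. tgt e = v})"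
    unfolding inflow_def by (intro sum.cong) auto
  also have "\<dots> = (\<Sum>e | e \<in> E \<and> tgt e \<in> S. q e)"
    by (rule sum.group) (use finite_E assms in auto)
  finally show ?thesis .
qed

text \<open>
  No mass leaves the set of vertices reachable from a given one. By conservation none enters it either,
  so that every edge carrying a positive flow lies on a cycle.
\<close>

lemma edge_reversible:
  assumes q: "q \<in> flows" "\<And>e. e \<in> E \<Longrightarrow> q e > 0" and e: "e \<in> E"
  shows "(tgt e, src e) \<in> edge_rel\<^sup>*"
proof -
  define S where "S = {v \<in> src ` E \<union> tgt ` E. (tgt e, v) \<in> edge_rel\<^sup>*}"
  have S: "finite S" unfolding S_def using finite_E by auto
  define A where "A = {f. f \<in> E \<and> src f \<in> S}"
  define B where "B = {f. f \<in> E \<and> tgt f \<in> S}"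
  have "A \<subseteq> B"
    unfolding A_def B_def S_def by (auto intro: rtrancl_into_rtrancl simp: edge_rel_def)
  have B: "finite B" unfolding B_def using finite_E by auto
  have "sum q A = sum q B"
    unfolding A_def B_def sum_outflow_vertices[OF S, symmetric] sum_inflow_vertices[OF S, symmetric]
    using flowsD(5)[OF q(1)] by simp
  then have "sum q (B - A) = 0" using \<open>A \<subseteq> B\<close> B by (simp add: sum_diff)
  then have "B - A = {}"
    using sum_nonneg_eq_0_iff[of "B - A" q] B q(2) flowsD(2)[OF q(1)]
    by (metis B_def DiffD1 finite_Diff less_irrefl mem_Collect_eq ex_in_conv)
  moreover have "e \<in> B" using e by (auto simp: B_def S_def)
  ultimately show ?thesis by (auto simp: A_def S_def)
qed

text \<open>Reversibility of the edges makes reachability an equivalence, and the edges at a vertex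
  all belong to one class. So a flow restricts to each class, and normalising it leaves the
  transition probabilities unchanged; therefore the entropy is affine in the decomposition.\<close>

theorem component_decomposition:
  assumes q0: "q0 \<in> flows" "\<And>e. e \<in> E \<Longrightarrow> q0 e > 0"
  obtains \<D> where "finite \<D>" "\<And>D. D \<in> \<D> \<Longrightarrow> D \<subseteq> E" "\<And>D. D \<in> \<D> \<Longrightarrow> \<exists>r. ergodic_graph D src tgt r"
    "\<And>q. q \<in> flows \<Longrightarrow> \<exists>l r. (\<forall>D\<in>\<D>. 0 \<le> l D \<and> r D \<in> finite_graph.flows D src tgt) \<and> sum l \<D> = 1 \<and>
        q = (\<Sum>D\<in>\<D>. l D *\<^sub>R r D) \<and>
        flow_entropy q = (\<Sum>D\<in>\<D>. l D * finite_graph.flow_entropy D src (r D))"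
proof -
  define comp where "comp e = {f \<in> E. (src e, src f) \<in> edge_rel\<^sup>*}" for e
  define \<D> where "\<D> = comp ` E"
  have edge: "(src e, tgt e) \<in> edge_rel" if "e \<in> E" for e using that by (auto simp: edge_rel_def)
  have "(v, u) \<in> edge_rel\<^sup>*" if "(u, v) \<in> edge_rel\<^sup>*" for u v
    using that
  proof (induction rule: rtrancl_induct)
    case (step v v')
    then have "(v', v) \<in> edge_rel\<^sup>*" using edge_reversible[OF q0] by (auto simp: edge_rel_def)
    then show ?case using step by (meson rtrancl_trans)
  qed simp
  note sym = this
  have fin: "finite \<D>" unfolding \<D>_def using finite_E by simp
  have sub: "D \<subseteq> E" if "D \<in> \<D>" for D using that by (auto simp: \<D>_def comp_def)
  have comp_cong: "comp e = comp f" if "(src e, src f) \<in> edge_rel\<^sup>*" for e f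
  proof -
    have "(src e, src x) \<in> edge_rel\<^sup>* \<longleftrightarrow> (src f, src x) \<in> edge_rel\<^sup>*" for x
      by (meson that sym rtrancl_trans)
    then show ?thesis by (simp add: comp_def)
  qed
  have comp_mem: "D = comp e" if "D \<in> \<D>" "e \<in> D" for D e
    using that comp_cong by (auto simp: \<D>_def comp_def)
  have disj: "D = D'" if "D \<in> \<D>" "D' \<in> \<D>" "e \<in> D" "e \<in> D'" for D D' e
    using that comp_mem by metis
  have cover: "\<Union>\<D> = E" by (auto simp: \<D>_def comp_def)
  have same_src: "f \<in> D" if "D \<in> \<D>" "e \<in> D" "f \<in> E" "src f = src e" for D e f
    using that by (auto simp: \<D>_def comp_def)
  \<comment> \<open>A vertex of the class keeps all its incoming and outgoing edges, and any other
    vertex keeps none.\<close>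
  have balance: "(\<Sum>e | e \<in> D \<and> tgt e = v. q e) = (\<Sum>e | e \<in> D \<and> src e = v. q e)"
    if D: "D \<in> \<D>" and q: "q \<in> circulations" for D q v
  proof -
    obtain e0 where e0: "e0 \<in> E" "D = comp e0" using D by (auto simp: \<D>_def)
    show ?thesis
    proof (cases "(src e0, v) \<in> edge_rel\<^sup>*")
      case True
      then have "{e. e \<in> D \<and> src e = v} = {e. e \<in> E \<and> src e = v}" by (auto simp: e0 comp_def)
      moreover have "{e. e \<in> D \<and> tgt e = v} = {e. e \<in> E \<and> tgt e = v}"
        using True edge_reversible[OF q0] by (auto simp: e0 comp_def intro: rtrancl_trans)
      ultimately show ?thesis using q by (simp add: circulations_def inflow_def outflow_def)
    next
      case False
      then have "{e. e \<in> D \<and> src e = v} = {}" "{e. e \<in> D \<and> tgt e = v} = {}"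
        using edge by (auto simp: e0 comp_def dest: rtrancl_into_rtrancl)
      then show ?thesis by (simp only: sum.empty)
    qed
  qed
  define part where "part q D = (\<lambda>e. if e \<in> D then q e / sum q D else 0)" for q :: "'e \<Rightarrow> real" and D :: "'e set"
  have part: "part q D \<in> finite_graph.flows D src tgt" if D: "D \<in> \<D>" and q: "q \<in> flows" "sum q D > 0" for q D
  proof -
    interpret D: finite_graph D src tgt by (rule subgraph[OF sub[OF D]])
    have "D.inflow (part q D) v = D.outflow (part q D) v" for v
      using balance[OF D flowsD(1)[OF q(1)], of v]
      by (simp add: D.inflow_def D.outflow_def part_def sum_divide_distrib[symmetric])
    then have "part q D \<in> D.circulations" by (simp add: D.circulations_def part_def)
    moreover have "part q D e \<ge> 0" for e using flowsD(2)[OF q(1), of e] q(2) by (simp add: part_def)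
    moreover have "sum (part q D) D = 1" using q(2) by (simp add: part_def sum_divide_distrib[symmetric])
    ultimately show ?thesis by (simp add: D.flows_def)
  qed
  have nonempty: "D \<noteq> {}" if "D \<in> \<D>" for D using that by (auto simp: \<D>_def comp_def)
  have q0_sum: "sum q0 D > 0" if "D \<in> \<D>" for D
    by (rule sum_pos) (use sub[OF that] q0(2) nonempty[OF that] finite_subset[OF _ finite_E] in auto)
  have erg: "ergodic_graph D src tgt (part q0 D)" if D: "D \<in> \<D>" for D
  proof -
    interpret D: finite_graph D src tgt by (rule subgraph[OF sub[OF D]])
    obtain e0 where e0: "e0 \<in> E" "D = comp e0" using D by (auto simp: \<D>_def)
    show ?thesis
    proof
      show "part q0 D \<in> D.flows" by (rule part[OF D q0(1) q0_sum[OF D]])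
      show "part q0 D e > 0" if "e \<in> D" for e
        using that sub[OF D] q0(2)[of e] q0_sum[OF D] by (auto simp: part_def)
      fix e e' assume e: "e \<in> D" "e' \<in> D"
      then have "(src e, src e') \<in> edge_rel\<^sup>*" using sym by (auto simp: e0 comp_def intro: rtrancl_trans)
      then have "(src e, src e') \<in> edge_rel\<^sup>* \<and> (src e, src e') \<in> D.edge_rel\<^sup>*"
      proof (induction rule: rtrancl_induct)
        case (step v v')
        then obtain f where f: "f \<in> E" "src f = v" "tgt f = v'" by (auto simp: edge_rel_def)
        have "(src e0, src e) \<in> edge_rel\<^sup>*" using e(1) by (simp add: e0 comp_def)
        then have "f \<in> D" using f step by (auto simp: e0 comp_def intro: rtrancl_trans)
        then have "(v, v') \<in> D.edge_rel" using f by (auto simp: D.edge_rel_def)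
        then show ?case using step by (meson rtrancl_into_rtrancl)
      qed simp
      then show "(src e, src e') \<in> D.edge_rel\<^sup>*" by simp
    qed
  qed
  have decomp: "\<exists>l r. (\<forall>D\<in>\<D>. 0 \<le> l D \<and> r D \<in> finite_graph.flows D src tgt) \<and> sum l \<D> = 1 \<and>
        q = (\<Sum>D\<in>\<D>. l D *\<^sub>R r D) \<and>
        flow_entropy q = (\<Sum>D\<in>\<D>. l D * finite_graph.flow_entropy D src (r D))" if q: "q \<in> flows" for q
  proof -
    define l where "l D = sum q D" for D
    \<comment> \<open>A component without mass gets weight 0, with the normalised \<open>q0\<close>
      as a placeholder.\<close>
    define r where "r D = (if l D = 0 then part q0 D else part q D)" for D
    have l0: "l D \<ge> 0" for D unfolding l_def by (rule sum_nonneg) (use flowsD(2)[OF q] in auto)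
    have r: "r D \<in> finite_graph.flows D src tgt" if "D \<in> \<D>" for D
      using part[OF that q] part[OF that q0(1) q0_sum[OF that]] l0[of D] by (auto simp: r_def l_def)
    have lr: "l D * r D e = q e" if D: "D \<in> \<D>" "e \<in> D" for D e
    proof (cases "l D = 0")
      case True
      have "finite D" using sub[OF D(1)] finite_E finite_subset by blast
      then show ?thesis
        using True sum_nonneg_eq_0_iff[of D q] D(2) flowsD(2)[OF q] by (simp add: l_def)
    next
      case False
      then show ?thesis using D(2) by (simp add: r_def part_def l_def)
    qed
    have r_off: "r D e = 0" if "e \<notin> D" for D e using that by (simp add: r_def part_def)
    have sum_comp: "(\<Sum>e\<in>E. g e) = (\<Sum>D\<in>\<D>. \<Sum>e\<in>D. g e)" for g :: "'e \<Rightarrow> real"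
    proof -
      have "\<forall>A\<in>\<D>. finite A" using sub finite_subset[OF _ finite_E] by blast
      moreover have "\<forall>A\<in>\<D>. \<forall>B\<in>\<D>. A \<noteq> B \<longrightarrow> A \<inter> B = {}" using disj by blast
      ultimately show ?thesis using sum.Union_disjoint[of \<D> g] by (simp add: cover)
    qed
    have "sum l \<D> = 1"
      using sum_comp[of q] flowsD(3)[OF q] by (simp add: l_def)
    moreover have "q = (\<Sum>D\<in>\<D>. l D *\<^sub>R r D)"
    proof
      fix e
      show "q e = (\<Sum>D\<in>\<D>. l D *\<^sub>R r D) e"
      proof (cases "e \<in> E")
        case True
        then obtain D where D: "D \<in> \<D>" "e \<in> D" using cover by blast
        have "(\<Sum>D\<in>\<D>. l D *\<^sub>R r D) e = (\<Sum>D'\<in>{D}. l D' * r D' e)"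
          unfolding sum_fun_apply scaleR_fun_apply real_scaleR_def
        proof (rule sum.mono_neutral_right)
          show "\<forall>D'\<in>\<D> - {D}. l D' * r D' e = 0"
          proof
            fix D' assume D': "D' \<in> \<D> - {D}"
            then have "e \<notin> D'" using disj[OF D(1) _ D(2)] by blast
            then show "l D' * r D' e = 0" by (simp add: r_off)
          qed
        qed (use fin D(1) in auto)
        then show ?thesis using lr[OF D] by simp
      next
        case False
        then have "r D e = 0" if "D \<in> \<D>" for D using r_off sub[OF that] by blast
        then show ?thesis using flowsD(4)[OF q False] by (simp add: sum_fun_apply)
      qed
    qed
    moreover have "flow_entropy q = (\<Sum>D\<in>\<D>. l D * finite_graph.flow_entropy D src (r D))"
    proof -
      have "flow_entropy q = (\<Sum>D\<in>\<D>. - (\<Sum>e\<in>D. q e * ln (q e / outflow q (src e))))"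
        unfolding flow_entropy_def sum_comp sum_negf ..
      also have "\<dots> = (\<Sum>D\<in>\<D>. l D * finite_graph.flow_entropy D src (r D))"
      proof (rule sum.cong)
        fix D assume D: "D \<in> \<D>"
        interpret D: finite_graph D src tgt by (rule subgraph[OF sub[OF D]])
        have "q e * ln (q e / outflow q (src e)) = l D * (r D e * ln (r D e / D.outflow (r D) (src e)))"
          if e: "e \<in> D" for e
        proof (cases "l D = 0")
          case True
          then show ?thesis using lr[OF D e] by simp
        next
          case False
          have "{f. f \<in> E \<and> src f = src e} = {f. f \<in> D \<and> src f = src e}"
            using same_src[OF D e] sub[OF D] by auto
          then have "outflow q (src e) = (\<Sum>f | f \<in> D \<and> src f = src e. l D * r D f)"
            unfolding outflow_def using lr[OF D] by (intro sum.cong) auto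
          then have "outflow q (src e) = l D * D.outflow (r D) (src e)"
            by (simp add: D.outflow_def sum_distrib_left)
          then show ?thesis using lr[OF D e, symmetric] False by simp
        qed
        then show "- (\<Sum>e\<in>D. q e * ln (q e / outflow q (src e))) = l D * D.flow_entropy (r D)"
          by (simp add: D.flow_entropy_def sum_distrib_left)
      qed simp
      finally show ?thesis .
    qed
    ultimately show ?thesis using l0 r by (intro exI[of _ l] exI[of _ r] conjI ballI)
  qed
  show ?thesis
    using erg by (intro that[of \<D>] fin sub decomp exI)
qed

text \<open>
  The flows whose mean lies on a face form a face of the set of all flows, hence they are the flows
  supported on some set of edges.
\<close>

theorem face_decomposition:
  fixes \<phi> :: "'e \<Rightarrow> 'w::euclidean_space"
  assumes le: "\<And>q. q \<in> flows \<Longrightarrow> a \<bullet> mean \<phi> q \<le> b"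
  obtains \<D> where "finite \<D>" "\<And>D. D \<in> \<D> \<Longrightarrow> \<exists>r. ergodic_graph D src tgt r"
    "\<And>D. D \<in> \<D> \<Longrightarrow> finite_graph.mean D \<phi> ` finite_graph.flows D src tgt \<subseteq> {w \<in> mean \<phi> ` flows. a \<bullet> w = b}"
    "\<And>D w. D \<in> \<D> \<Longrightarrow> w \<in> finite_graph.mean D \<phi> ` finite_graph.flows D src tgt \<Longrightarrow>
        finite_graph.max_entropy D src tgt \<phi> w \<le> max_entropy \<phi> w"
    "\<And>w. w \<in> mean \<phi> ` flows \<Longrightarrow> a \<bullet> w = b \<Longrightarrow>
        \<exists>l x. (\<forall>D\<in>\<D>. 0 \<le> l D \<and> x D \<in> finite_graph.mean D \<phi> ` finite_graph.flows D src tgt) \<and> sum l \<D> = 1 \<and>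
          w = (\<Sum>D\<in>\<D>. l D *\<^sub>R x D) \<and>
          max_entropy \<phi> w \<le> (\<Sum>D\<in>\<D>. l D * finite_graph.max_entropy D src tgt \<phi> (x D))"
proof (cases "\<exists>q\<in>flows. a \<bullet> mean \<phi> q = b")
  case False
  show ?thesis by (rule that[of "{}"]) (use False in auto)
next
  case True
  then obtain q1 where q1: "q1 \<in> flows" "a \<bullet> mean \<phi> q1 = b" by blast
  define D where "D = {e \<in> E. \<exists>q\<in>flows. a \<bullet> mean \<phi> q = b \<and> q e > 0}"
  have DE: "D \<subseteq> E" and finD: "finite D" using finite_E by (auto simp: D_def)
  have supp: "q e = 0" if "q \<in> flows" "a \<bullet> mean \<phi> q = b" "e \<notin> D" for q e
    using that flowsD(2)[OF that(1), of e] flowsD(4)[OF that(1), of e] by (force simp: D_def)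
  interpret D: finite_graph D src tgt by (rule subgraph[OF DE])
  have Dflows: "D.flows = {q \<in> flows. \<forall>e. e \<notin> D \<longrightarrow> q e = 0}" by (rule subgraph_flows[OF DE])
  \<comment> \<open>Averaging witnesses edge by edge yields one flow over the face that is positive
    on all of \<open>D\<close>.\<close>
  have "\<exists>q\<in>flows. a \<bullet> mean \<phi> q = b \<and> (\<forall>e\<in>A. q e > 0)" if "finite A" "A \<subseteq> D" for A
    using that
  proof (induction A rule: finite_induct)
    case empty then show ?case using q1 by auto
  next
    case (insert e A)
    then obtain q where q: "q \<in> flows" "a \<bullet> mean \<phi> q = b" "\<forall>e\<in>A. q e > 0" by auto
    obtain q' where q': "q' \<in> flows" "a \<bullet> mean \<phi> q' = b" "q' e > 0" using insert.prems by (auto simp: D_def)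
    define r where "r = (1 - 1/2) *\<^sub>R q + (1/2 :: real) *\<^sub>R q'"
    have "r \<in> flows" unfolding r_def by (rule flows_convex) (use q q' in auto)
    moreover have "a \<bullet> mean \<phi> r = b" using q q' by (simp add: r_def inner_add_right)
    moreover have "r f > 0" if "f \<in> insert e A" for f
      using that q q' flowsD(2)[OF q(1), of f] flowsD(2)[OF q'(1), of f] by (auto simp: r_def add_pos_nonneg add_nonneg_pos)
    ultimately show ?case by blast
  qed
  then obtain q0 where q0: "q0 \<in> flows" "a \<bullet> mean \<phi> q0 = b" "\<And>e. e \<in> D \<Longrightarrow> q0 e > 0" using finD by blast
  have q0D: "q0 \<in> D.flows" unfolding Dflows using q0 supp by blast
  \<comment> \<open>\<open>q0\<close> dominates a small multiple of every flow supported on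
    \<open>D\<close>, so it lies strictly between \<open>q\<close> and a further flow
    \<open>r\<close>. A linear function that is maximal at \<open>q0\<close> is then maximal at
    \<open>q\<close>.\<close>
  have on_face: "a \<bullet> mean \<phi> q = b" if q: "q \<in> D.flows" for q
  proof -
    have qf: "q \<in> flows" and off: "\<And>e. e \<notin> D \<Longrightarrow> q e = 0" using q by (auto simp: Dflows)
    \<comment> \<open>Below all values of \<open>q0\<close> on \<open>D\<close>; the 1/2 keeps
      \<open>1 - t\<close> positive for the normalisation of \<open>r\<close>.\<close>
    define t where "t = Min (insert (1/2) (q0 ` D))"
    have "0 < t" unfolding t_def using finD q0(3) by (subst Min_gr_iff) auto
    moreover have "t \<le> 1/2" unfolding t_def using finD by (intro Min_le) auto
    moreover have "t \<le> q0 e" if "e \<in> D" for e unfolding t_def using finD that by (intro Min_le) auto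
    ultimately have t: "0 < t" "t \<le> 1/2" "\<And>e. e \<in> D \<Longrightarrow> t \<le> q0 e" by auto
    define r where "r = (1 / (1 - t)) *\<^sub>R (q0 - t *\<^sub>R q)"
    have "t * q e \<le> q0 e" for e
    proof (cases "e \<in> D")
      case True
      have "t * q e \<le> t * 1" using t flows_le_1[OF qf, of e] by (intro mult_left_mono) auto
      then show ?thesis using t(3)[OF True] by simp
    qed (use off flowsD(2)[OF q0(1)] in simp)
    then have "r e \<ge> 0" for e using t by (simp add: r_def)
    moreover have "r \<in> circulations"
      unfolding r_def using flowsD(1)[OF q0(1)] flowsD(1)[OF qf] subspace_circulations
      by (intro subspace_scale subspace_diff) auto
    moreover have "sum r E = (1 / (1 - t)) * (sum q0 E - t * sum q E)"
      by (simp add: r_def sum_distrib_left sum_subtractf sum_divide_distrib[symmetric])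
    ultimately have "r \<in> flows" using t flowsD(3)[OF q0(1)] flowsD(3)[OF qf] by (simp add: flows_def)
    then have "a \<bullet> mean \<phi> r \<le> b" by (rule le)
    then have "(1 - t) * (a \<bullet> mean \<phi> r) \<le> (1 - t) * b" using t by (intro mult_left_mono) auto
    moreover have "(1 - t) * (a \<bullet> mean \<phi> r) = b - t * (a \<bullet> mean \<phi> q)"
      using t q0(2) by (simp add: r_def inner_diff_right)
    ultimately have "t * b \<le> t * (a \<bullet> mean \<phi> q)" by (simp add: algebra_simps)
    then have "b \<le> a \<bullet> mean \<phi> q" using t by simp
    then show ?thesis using le[OF qf] by simp
  qed
  obtain \<D> where \<D>: "finite \<D>" "\<And>C. C \<in> \<D> \<Longrightarrow> C \<subseteq> D" "\<And>C. C \<in> \<D> \<Longrightarrow> \<exists>r. ergodic_graph C src tgt r"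
    and dec: "\<And>q. q \<in> D.flows \<Longrightarrow> \<exists>l r. (\<forall>C\<in>\<D>. 0 \<le> l C \<and> r C \<in> finite_graph.flows C src tgt) \<and> sum l \<D> = 1 \<and>
        q = (\<Sum>C\<in>\<D>. l C *\<^sub>R r C) \<and>
        D.flow_entropy q = (\<Sum>C\<in>\<D>. l C * finite_graph.flow_entropy C src (r C))"
    using D.component_decomposition[OF q0D q0(3)] by blast
  have sub: "q \<in> D.flows" "q \<in> flows" "finite_graph.mean C \<phi> q = mean \<phi> q"
      "finite_graph.flow_entropy C src q = flow_entropy q"
    if "C \<in> \<D>" "q \<in> finite_graph.flows C src tgt" for C q
  proof -
    have C: "C \<subseteq> D" "C \<subseteq> E" using \<D>(2)[OF that(1)] DE by auto
    show "q \<in> D.flows" "q \<in> flows" using that(2) by (auto simp: subgraph_flows[OF C(2)] Dflows C(1)[THEN subsetD] dest: contra_subsetD[OF C(1)])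
    have "\<And>e. e \<notin> C \<Longrightarrow> q e = 0" using that(2) by (auto simp: subgraph_flows[OF C(2)])
    then show "finite_graph.mean C \<phi> q = mean \<phi> q" "finite_graph.flow_entropy C src q = flow_entropy q"
      using subgraph_eq[OF C(2)] by blast+
  qed
  have ent_le: "finite_graph.flow_entropy C src r \<le> finite_graph.max_entropy C src tgt \<phi> (mean \<phi> r)"
    if "C \<in> \<D>" "r \<in> finite_graph.flows C src tgt" for C r
    using finite_graph.max_entropy_ge[OF D.subgraph[OF \<D>(2)[OF that(1)]] that(2), of \<phi>] sub(3)[OF that] by simp
  show ?thesis
  proof (rule that[OF \<D>(1,3)])
    fix C assume C: "C \<in> \<D>"
    show "finite_graph.mean C \<phi> ` finite_graph.flows C src tgt \<subseteq> {w \<in> mean \<phi> ` flows. a \<bullet> w = b}"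
    proof
      fix w assume "w \<in> finite_graph.mean C \<phi> ` finite_graph.flows C src tgt"
      then obtain q where q: "q \<in> finite_graph.flows C src tgt" "w = finite_graph.mean C \<phi> q" by blast
      show "w \<in> {w \<in> mean \<phi> ` flows. a \<bullet> w = b}"
        unfolding q(2) sub(3)[OF C q(1)] using sub(1,2)[OF C q(1)] on_face by blast
    qed
    fix w assume w: "w \<in> finite_graph.mean C \<phi> ` finite_graph.flows C src tgt"
    interpret C: finite_graph C src tgt by (rule D.subgraph[OF \<D>(2)[OF C]])
    obtain q where q: "q \<in> C.flows" "C.mean \<phi> q = w" "C.flow_entropy q = C.max_entropy \<phi> w"
      using C.max_entropy_attained[OF w] by metis
    then show "C.max_entropy \<phi> w \<le> max_entropy \<phi> w"
      using max_entropy_ge[of q \<phi>] sub[OF C q(1)] by simp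
  next
    fix w assume w: "w \<in> mean \<phi> ` flows" "a \<bullet> w = b"
    obtain q where q: "q \<in> flows" "mean \<phi> q = w" "flow_entropy q = max_entropy \<phi> w"
      using max_entropy_attained[OF w(1)] by metis
    then have qD: "q \<in> D.flows" using supp w(2) by (auto simp: Dflows)
    obtain l r where lr: "\<forall>C\<in>\<D>. 0 \<le> l C \<and> r C \<in> finite_graph.flows C src tgt" "sum l \<D> = 1"
        "q = (\<Sum>C\<in>\<D>. l C *\<^sub>R r C)"
        "D.flow_entropy q = (\<Sum>C\<in>\<D>. l C * finite_graph.flow_entropy C src (r C))"
      using dec[OF qD] by blast
    have "w = (\<Sum>C\<in>\<D>. l C *\<^sub>R mean \<phi> (r C))" using q(2) unfolding lr(3) mean_sum mean_linear by simp
    moreover have "mean \<phi> (r C) \<in> finite_graph.mean C \<phi> ` finite_graph.flows C src tgt" if "C \<in> \<D>" for C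
      using that lr(1) sub(3)[OF that] by (metis image_eqI)
    moreover have "max_entropy \<phi> w \<le> (\<Sum>C\<in>\<D>. l C * finite_graph.max_entropy C src tgt \<phi> (mean \<phi> (r C)))"
    proof -
      have "max_entropy \<phi> w = D.flow_entropy q" using q qD subgraph_eq(5)[OF DE, of q] by (simp add: Dflows)
      also have "\<dots> \<le> (\<Sum>C\<in>\<D>. l C * finite_graph.max_entropy C src tgt \<phi> (mean \<phi> (r C)))"
        unfolding lr(4) using lr(1) ent_le by (intro sum_mono mult_left_mono) auto
      finally show ?thesis .
    qed
    ultimately show "\<exists>l x. (\<forall>D\<in>\<D>. 0 \<le> l D \<and> x D \<in> finite_graph.mean D \<phi> ` finite_graph.flows D src tgt) \<and> sum l \<D> = 1 \<and>
          w = (\<Sum>D\<in>\<D>. l D *\<^sub>R x D) \<and>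
          max_entropy \<phi> w \<le> (\<Sum>D\<in>\<D>. l D * finite_graph.max_entropy D src tgt \<phi> (x D))"
      using lr(1,2) by (intro exI[of _ l] exI[of _ "\<lambda>C. mean \<phi> (r C)"]) auto
  qed
qed

end

section \<open>Entropy of finite-valued random variables\<close>

context prob_space
begin

definition rv_entropy :: "('a \<Rightarrow> 'b) \<Rightarrow> real" where
  "rv_entropy X = - (\<Sum>x\<in>X ` space M. prob (X -` {x} \<inter> space M) * ln (prob (X -` {x} \<inter> space M)))"

text \<open>The chain rule serves as definition, so that all arguments stay at the level of joint
  entropies.\<close>

definition cond_entropy :: "('a \<Rightarrow> 'b) \<Rightarrow> ('a \<Rightarrow> 'c) \<Rightarrow> real" where
  "cond_entropy X Y = rv_entropy (\<lambda>x. (X x, Y x)) - rv_entropy Y"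

text \<open>Formulated by fibres, so that variables with values in different types can be compared
  as partitions.\<close>

definition refines :: "('a \<Rightarrow> 'b) \<Rightarrow> ('a \<Rightarrow> 'c) \<Rightarrow> bool" where
  "refines X Y \<longleftrightarrow> (\<forall>x\<in>space M. \<forall>x'\<in>space M. X x = X x' \<longrightarrow> Y x = Y x')"

lemma rv_entropy_eq_entropy:
  assumes "simple_function M X"
  shows "entropy (exp 1) (count_space (X ` space M)) X = rv_entropy X"
proof -
  interpret information_space M "exp 1" by standard simp
  have "simple_distributed M X (\<lambda>x. prob (X -` {x} \<inter> space M))"
    by (rule simple_distributedI[OF assms]) (simp_all add: measure_nonneg)
  then show ?thesis by (simp add: entropy_simple_distributed rv_entropy_def log_def)
qed

lemma refines_factor:
  assumes "refines X Y"
  obtains f where "\<And>x. x \<in> space M \<Longrightarrow> Y x = f (X x)"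
proof
  fix x assume "x \<in> space M"
  then show "Y x = (\<lambda>y. Y (SOME x'. x' \<in> space M \<and> X x' = y)) (X x)"
    using someI[of "\<lambda>x'. x' \<in> space M \<and> X x' = X x" x] assms unfolding refines_def by metis
qed

lemma rv_entropy_cong:
  assumes "\<And>x. x \<in> space M \<Longrightarrow> X x = Y x"
  shows "rv_entropy X = rv_entropy Y"
proof -
  have "X ` space M = Y ` space M" "X -` {x} \<inter> space M = Y -` {x} \<inter> space M" for x
    using assms by auto
  then show ?thesis by (simp add: rv_entropy_def)
qed

lemma rv_entropy_refines:
  assumes "simple_function M X" "refines X Y"
  shows "rv_entropy Y \<le> rv_entropy X"
proof -
  interpret information_space M "exp 1" by standard simp
  obtain f where f: "\<And>x. x \<in> space M \<Longrightarrow> Y x = f (X x)" using refines_factor[OF assms(2)] by blast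
  have "rv_entropy Y = rv_entropy (f \<circ> X)" by (rule rv_entropy_cong) (simp add: f)
  also have "\<dots> \<le> rv_entropy X"
    using entropy_data_processing[OF assms(1), of f]
    unfolding rv_entropy_eq_entropy[OF assms(1)] rv_entropy_eq_entropy[OF simple_function_compose[OF assms(1)]] .
  finally show ?thesis .
qed

lemma prob_factor_sum:
  assumes W: "simple_function M W" and f: "\<And>x. x \<in> space M \<Longrightarrow> X x = f (W x)"
  shows "prob (X -` {x} \<inter> space M) = (\<Sum>w | w \<in> W ` space M \<and> f w = x. prob (W -` {w} \<inter> space M))"
proof -
  have "X -` {x} \<inter> space M = (\<Union>w\<in>{w \<in> W ` space M. f w = x}. W -` {w} \<inter> space M)"
    using f by auto
  also have "prob \<dots> = (\<Sum>w | w \<in> W ` space M \<and> f w = x. prob (W -` {w} \<inter> space M))"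
    using simple_functionD[OF W] by (intro finite_measure_finite_Union) (auto simp: disjoint_family_on_def)
  finally show ?thesis .
qed

lemma rv_entropy_factor_sum:
  assumes W: "simple_function M W" and f: "\<And>x. x \<in> space M \<Longrightarrow> X x = f (W x)"
  shows "rv_entropy X = - (\<Sum>w\<in>W ` space M. prob (W -` {w} \<inter> space M) * ln (prob (X -` {f w} \<inter> space M)))"
proof -
  have fin: "finite (W ` space M)" using W by (rule simple_functionD)
  have X: "X ` space M = f ` W ` space M" using f by force
  note p = prob_factor_sum[of W X f, OF assms]
  have "(\<Sum>w\<in>W ` space M. prob (W -` {w} \<inter> space M) * ln (prob (X -` {f w} \<inter> space M)))
     = (\<Sum>x\<in>f ` W ` space M. \<Sum>w | w \<in> W ` space M \<and> f w = x. prob (W -` {w} \<inter> space M) * ln (prob (X -` {f w} \<inter> space M)))"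
    by (rule sum.image_gen[OF fin])
  also have "\<dots> = (\<Sum>x\<in>f ` W ` space M. prob (X -` {x} \<inter> space M) * ln (prob (X -` {x} \<inter> space M)))"
    by (intro sum.cong refl) (simp add: p sum_distrib_right[symmetric])
  finally show ?thesis by (simp add: rv_entropy_def X)
qed

text \<open>The difference of the two sides is the conditional mutual information of
  \<open>X\<close> and \<open>Y\<close> given \<open>Z\<close>, which is nonnegative. The rules for
  conditional entropy below are derived from this and from
  \<open>rv_entropy_refines\<close>.\<close>

lemma rv_entropy_submodular:
  assumes X: "simple_function M X" and Y: "simple_function M Y" and Z: "simple_function M Z"
  shows "rv_entropy (\<lambda>x. (X x, Y x, Z x)) + rv_entropy Z \<le> rv_entropy (\<lambda>x. (X x, Z x)) + rv_entropy (\<lambda>x. (Y x, Z x))"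
proof -
  interpret information_space M "exp 1" by standard simp
  let ?W = "\<lambda>x. (X x, Y x, Z x)"
  have W: "simple_function M ?W" "simple_function M (\<lambda>x. (X x, Z x))" "simple_function M (\<lambda>x. (Y x, Z x))"
    using X Y Z by (auto intro!: simple_function_Pair)
  note sd = simple_distributedI[OF _ measure_nonneg refl]
  have "0 \<le> conditional_mutual_information (exp 1) (count_space (X ` space M)) (count_space (Y ` space M)) (count_space (Z ` space M)) X Y Z"
    by (rule conditional_mutual_information_nonneg[OF X Y Z])
  also have "\<dots> = (\<Sum>(x, y, z)\<in>?W ` space M. prob (?W -` {(x, y, z)} \<inter> space M) *
      log (exp 1) (prob (?W -` {(x, y, z)} \<inter> space M) /
        (prob ((\<lambda>x. (X x, Z x)) -` {(x, z)} \<inter> space M) *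
         (prob ((\<lambda>x. (Y x, Z x)) -` {(y, z)} \<inter> space M) / prob (Z -` {z} \<inter> space M)))))"
    by (rule conditional_mutual_information_eq[OF sd[OF Z] sd[OF W(3)] sd[OF W(2)] sd[OF W(1)]])
  also have "\<dots> = (\<Sum>(x, y, z)\<in>?W ` space M.
      prob (?W -` {(x, y, z)} \<inter> space M) * ln (prob (?W -` {(x, y, z)} \<inter> space M))
      + prob (?W -` {(x, y, z)} \<inter> space M) * ln (prob (Z -` {z} \<inter> space M))
      - prob (?W -` {(x, y, z)} \<inter> space M) * ln (prob ((\<lambda>x. (X x, Z x)) -` {(x, z)} \<inter> space M))
      - prob (?W -` {(x, y, z)} \<inter> space M) * ln (prob ((\<lambda>x. (Y x, Z x)) -` {(y, z)} \<inter> space M)))"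
  proof (intro sum.cong refl, clarify)
    fix x
    have pos: "0 < prob B" if "prob A \<noteq> 0" "A \<subseteq> B" "B \<in> events" for A B
      using finite_measure_mono[OF that(2,3)] that(1) measure_nonneg[of M A] by linarith
    let ?A = "?W -` {(X x, Y x, Z x)} \<inter> space M"
    have "0 < prob (Z -` {Z x} \<inter> space M)" "0 < prob ?A"
        "0 < prob ((\<lambda>x. (X x, Z x)) -` {(X x, Z x)} \<inter> space M)"
        "0 < prob ((\<lambda>x. (Y x, Z x)) -` {(Y x, Z x)} \<inter> space M)" if "prob ?A \<noteq> 0"
      using W Z by (auto intro!: pos[OF that] simple_functionD(2))
    then show "prob (?W -` {(X x, Y x, Z x)} \<inter> space M) *
      log (exp 1) (prob (?W -` {(X x, Y x, Z x)} \<inter> space M) /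
        (prob ((\<lambda>x. (X x, Z x)) -` {(X x, Z x)} \<inter> space M) *
         (prob ((\<lambda>x. (Y x, Z x)) -` {(Y x, Z x)} \<inter> space M) / prob (Z -` {Z x} \<inter> space M)))) =
      prob (?W -` {(X x, Y x, Z x)} \<inter> space M) * ln (prob (?W -` {(X x, Y x, Z x)} \<inter> space M))
      + prob (?W -` {(X x, Y x, Z x)} \<inter> space M) * ln (prob (Z -` {Z x} \<inter> space M))
      - prob (?W -` {(X x, Y x, Z x)} \<inter> space M) * ln (prob ((\<lambda>x. (X x, Z x)) -` {(X x, Z x)} \<inter> space M))
      - prob (?W -` {(X x, Y x, Z x)} \<inter> space M) * ln (prob ((\<lambda>x. (Y x, Z x)) -` {(Y x, Z x)} \<inter> space M))"
      by (cases "prob (?W -` {(X x, Y x, Z x)} \<inter> space M) = 0") (auto simp: log_def ln_div ln_mult algebra_simps)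
  qed
  also have "\<dots> = - rv_entropy ?W - rv_entropy Z + rv_entropy (\<lambda>x. (X x, Z x)) + rv_entropy (\<lambda>x. (Y x, Z x))"
    using rv_entropy_factor_sum[OF W(1), of ?W "\<lambda>w. w"]
      rv_entropy_factor_sum[OF W(1), of Z "\<lambda>(x, y, z). z"]
      rv_entropy_factor_sum[OF W(1), of "\<lambda>x. (X x, Z x)" "\<lambda>(x, y, z). (x, z)"]
      rv_entropy_factor_sum[OF W(1), of "\<lambda>x. (Y x, Z x)" "\<lambda>(x, y, z). (y, z)"]
    by (simp add: sum.distrib sum_subtractf split_beta)
  finally show ?thesis by simp
qed

lemma rv_entropy_superset:
  assumes "finite S" "X ` space M \<subseteq> S"
  shows "rv_entropy X = - (\<Sum>x\<in>S. prob (X -` {x} \<inter> space M) * ln (prob (X -` {x} \<inter> space M)))"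
  unfolding rv_entropy_def neg_equal_iff_equal
proof (rule sum.mono_neutral_left[OF assms], rule ballI)
  fix x assume "x \<in> S - X ` space M"
  then have "X -` {x} \<inter> space M = {}" by auto
  then show "prob (X -` {x} \<inter> space M) * ln (prob (X -` {x} \<inter> space M)) = 0"
    by (simp only: measure_empty mult_zero_left)
qed

lemma rv_entropy_nonneg: "0 \<le> rv_entropy X"
  unfolding rv_entropy_def sum_negf[symmetric]
proof (rule sum_nonneg)
  fix x
  show "0 \<le> - (prob (X -` {x} \<inter> space M) * ln (prob (X -` {x} \<inter> space M)))"
    using prob_le_1[of "X -` {x} \<inter> space M"]
    by (cases "prob (X -` {x} \<inter> space M) = 0")
       (simp_all add: mult_nonneg_nonpos ln_le_zero_iff[THEN iffD2] zero_less_measure_iff)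
qed

lemma refines_prod [simp]: "refines X (\<lambda>x. (Y x, Z x)) \<longleftrightarrow> refines X Y \<and> refines X Z"
  by (auto simp: refines_def)

lemma refines_fst [simp]: "refines (\<lambda>x. (X x, Y x)) X"
  and refines_snd [simp]: "refines (\<lambda>x. (X x, Y x)) Y"
  and refines_refl [simp]: "refines X X"
  by (auto simp: refines_def)

text \<open>This is submodularity, because under refinement the pair of \<open>Y\<close> and
  \<open>Z\<close> carries no more entropy than \<open>Y\<close>.\<close>

lemma cond_entropy_mono:
  assumes "simple_function M X" "simple_function M Y" "simple_function M Z" "refines Y Z"
  shows "cond_entropy X Y \<le> cond_entropy X Z"
proof -
  have "rv_entropy (\<lambda>x. (X x, Y x)) \<le> rv_entropy (\<lambda>x. (X x, Y x, Z x))"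
    by (intro rv_entropy_refines simple_function_Pair assms) (auto simp: refines_def)
  moreover have "rv_entropy (\<lambda>x. (Y x, Z x)) \<le> rv_entropy Y"
    using assms by (intro rv_entropy_refines) auto
  ultimately show ?thesis
    using rv_entropy_submodular[OF assms(1-3)] by (simp add: cond_entropy_def)
qed

lemma cond_entropy_refines:
  assumes "simple_function M X" "simple_function M Z" "refines (\<lambda>x. (X x, Z x)) Y"
  shows "cond_entropy Y Z \<le> cond_entropy X Z"
  unfolding cond_entropy_def
  by (intro diff_right_mono rv_entropy_refines simple_function_Pair assms) (use assms(3) in simp_all)

lemma cond_entropy_pair:
  assumes "simple_function M X" "simple_function M Y" "simple_function M Z"
  shows "cond_entropy (\<lambda>x. (X x, Y x)) Z \<le> cond_entropy X Z + cond_entropy Y Z"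
proof -
  have "rv_entropy (\<lambda>x. ((X x, Y x), Z x)) \<le> rv_entropy (\<lambda>x. (X x, Y x, Z x))"
    by (intro rv_entropy_refines simple_function_Pair assms) (auto simp: refines_def)
  then show ?thesis using rv_entropy_submodular[OF assms] by (simp add: cond_entropy_def)
qed

lemma cond_entropy_trans:
  assumes "simple_function M X" "simple_function M Y" "simple_function M Z"
  shows "cond_entropy X Z \<le> cond_entropy X Y + cond_entropy Y Z"
proof -
  have "rv_entropy (\<lambda>x. (X x, Z x)) \<le> rv_entropy (\<lambda>x. (X x, Z x, Y x))"
    by (intro rv_entropy_refines simple_function_Pair assms) (auto simp: refines_def)
  moreover have "rv_entropy (\<lambda>x. (Z x, Y x)) \<le> rv_entropy (\<lambda>x. (Y x, Z x))"
    by (intro rv_entropy_refines simple_function_Pair assms) (auto simp: refines_def)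
  ultimately show ?thesis
    using rv_entropy_submodular[OF assms(1,3,2)] by (simp add: cond_entropy_def)
qed

lemma cond_entropy_zero:
  assumes "simple_function M Z" "refines Z X"
  shows "cond_entropy X Z \<le> 0"
  unfolding cond_entropy_def using rv_entropy_refines[OF assms(1), of "\<lambda>x. (X x, Z x)"] assms(2) by simp

text \<open>Submodularity conditioned on a constant variable.\<close>

lemma rv_entropy_pair:
  assumes "simple_function M X" "simple_function M Y"
  shows "rv_entropy (\<lambda>x. (X x, Y x)) \<le> rv_entropy X + rv_entropy Y"
proof -
  have triv: "rv_entropy (\<lambda>x. (Z x, ())) \<le> rv_entropy Z" if "simple_function M Z" for Z :: "'a \<Rightarrow> 'z"
    using that by (intro rv_entropy_refines) (auto simp: refines_def)
  have "rv_entropy (\<lambda>x. (X x, Y x)) \<le> rv_entropy (\<lambda>x. (X x, Y x, ()))"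
    by (intro rv_entropy_refines simple_function_Pair assms) (auto simp: refines_def)
  then show ?thesis
    using rv_entropy_submodular[OF assms simple_function_const[of M "()"]] triv[OF assms(1)] triv[OF assms(2)]
      rv_entropy_nonneg[of "\<lambda>_. ()"] by linarith
qed

end

text \<open>Fekete's lemma: division of n by m with remainder bounds \<open>a n\<close> by (n / m)
  \<open>a m\<close> plus a constant, so the limit is the infimum of the quotients.\<close>

lemma subadditive_convergent:
  fixes a :: "nat \<Rightarrow> real"
  assumes sub: "\<And>m n. a (m + n) \<le> a m + a n" and nonneg: "\<And>n. 0 \<le> a n"
  shows "\<exists>L. (\<lambda>n. a n / real n) \<longlonglongrightarrow> L"
proof -
  define L where "L = (INF n\<in>{1..}. a n / real n)"
  have L: "L \<le> a n / real n" if "n \<ge> 1" for n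
    unfolding L_def using that nonneg by (intro cINF_lower bdd_belowI2[of _ 0]) auto
  have mult: "a (k * m + r) \<le> real k * a m + a r" for k m r
  proof (induction k)
    case (Suc k)
    then show ?case using sub[of m "k * m + r"] by (simp add: algebra_simps)
  qed simp
  have "(\<lambda>n. a n / real n) \<longlonglongrightarrow> L"
  proof (rule order_tendstoI)
    fix y assume "y < L"
    then show "eventually (\<lambda>n. y < a n / real n) sequentially"
      using L by (intro eventually_sequentiallyI[of 1]) (meson less_le_trans)
  next
    fix y assume "L < y"
    then obtain m where m: "m \<ge> 1" "a m / real m < y"
      unfolding L_def by (subst (asm) cINF_less_iff) (auto intro!: bdd_belowI2[of _ 0] divide_nonneg_nonneg nonneg)
    define C where "C = Max (a ` {..<m})"
    have C: "a r \<le> C" if "r < m" for r unfolding C_def using that by (intro Max_ge) auto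
    have "(\<lambda>n. a m / real m + C / real n) \<longlonglongrightarrow> a m / real m + 0"
      by (intro tendsto_add tendsto_const tendsto_divide_0[OF tendsto_const] filterlim_at_top_imp_at_infinity filterlim_real_sequentially)
    then have "eventually (\<lambda>n. a m / real m + C / real n < y) sequentially"
      using m(2) by (intro order_tendstoD(2)) auto
    then show "eventually (\<lambda>n. a n / real n < y) sequentially"
      using eventually_ge_at_top[of 1]
    proof eventually_elim
      case (elim n)
      have "a n \<le> real (n div m) * a m + a (n mod m)" using mult[of "n div m" m "n mod m"] by simp
      also have "\<dots> \<le> real n / real m * a m + C"
        using C[of "n mod m"] m(1) nonneg[of m] of_nat_div_le_of_nat[of n m, where 'a = real]
        by (intro add_mono mult_right_mono) auto
      finally have "a n / real n \<le> (real n / real m * a m + C) / real n" by (rule divide_right_mono) simp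
      also have "\<dots> = a m / real m + C / real n" using elim by (simp add: field_simps)
      finally show ?case using elim by simp
    qed
  qed
  then show ?thesis by blast
qed

section \<open>Measure preserving maps and the entropy of itineraries\<close>

locale measure_preserving_map = prob_space M for M :: "'a measure" +
  fixes T :: "'a \<Rightarrow> 'a"
  assumes T_measurable [measurable]: "T \<in> M \<rightarrow>\<^sub>M M" and distr_T: "distr M M T = M"
begin

definition itinerary :: "('a \<Rightarrow> 'b) \<Rightarrow> nat \<Rightarrow> 'a \<Rightarrow> 'b list" where
  "itinerary f n x = map (\<lambda>i. f ((T ^^ i) x)) [0..<n]"

lemma funpow_measurable [measurable]: "(T ^^ n) \<in> M \<rightarrow>\<^sub>M M"
  by (induction n) auto

lemma funpow_space: "x \<in> space M \<Longrightarrow> (T ^^ n) x \<in> space M"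
  using measurable_space[OF funpow_measurable] .

lemma distr_funpow: "distr M M (T ^^ n) = M"
proof (induction n)
  case (Suc n)
  have "distr M M (T ^^ Suc n) = distr (distr M M (T ^^ n)) M T"
    by (subst distr_distr) auto
  then show ?case unfolding Suc distr_T .
qed (simp add: distr_id)

lemma prob_funpow:
  assumes "A \<in> events" shows "prob ((T ^^ n) -` A \<inter> space M) = prob A"
  using measure_distr[OF funpow_measurable assms, of n] by (simp add: distr_funpow)

lemma simple_function_funpow:
  assumes "simple_function M f" shows "simple_function M (\<lambda>x. f ((T ^^ n) x))"
proof -
  have "(\<lambda>x. f ((T ^^ n) x)) ` space M \<subseteq> f ` space M" using funpow_space by auto
  then have "finite ((\<lambda>x. f ((T ^^ n) x)) ` space M)" using simple_functionD(1)[OF assms] finite_subset by blast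
  moreover have "(\<lambda>x. f ((T ^^ n) x)) -` {y} \<inter> space M \<in> events" for y
  proof -
    have "(\<lambda>x. f ((T ^^ n) x)) -` {y} \<inter> space M = (T ^^ n) -` (f -` {y} \<inter> space M) \<inter> space M"
      using funpow_space by auto
    then show ?thesis using simple_functionD(2)[OF assms] measurable_sets[OF funpow_measurable] by metis
  qed
  ultimately show ?thesis by (simp add: simple_function_def)
qed

lemma rv_entropy_funpow:
  assumes f: "simple_function M f"
  shows "rv_entropy (\<lambda>x. f ((T ^^ n) x)) = rv_entropy f"
proof -
  have "prob ((\<lambda>x. f ((T ^^ n) x)) -` {y} \<inter> space M) = prob (f -` {y} \<inter> space M)" for y
  proof -
    have "(\<lambda>x. f ((T ^^ n) x)) -` {y} \<inter> space M = (T ^^ n) -` (f -` {y} \<inter> space M) \<inter> space M"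
      using funpow_space by auto
    then show ?thesis using prob_funpow simple_functionD(2)[OF f] by metis
  qed
  moreover have "(\<lambda>x. f ((T ^^ n) x)) ` space M \<subseteq> f ` space M" using funpow_space by auto
  ultimately show ?thesis
    using rv_entropy_superset[of "f ` space M" "\<lambda>x. f ((T ^^ n) x)"] simple_functionD(1)[OF f]
    by (simp add: rv_entropy_def)
qed

lemma cond_entropy_funpow:
  assumes "simple_function M f" "simple_function M g"
  shows "cond_entropy (\<lambda>x. f ((T ^^ n) x)) (\<lambda>x. g ((T ^^ n) x)) = cond_entropy f g"
  unfolding cond_entropy_def
  using rv_entropy_funpow[OF simple_function_Pair[OF assms], of n] rv_entropy_funpow[OF assms(2), of n] by simp

lemma itinerary_Suc: "itinerary f (Suc n) x = itinerary f n x @ [f ((T ^^ n) x)]"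
  by (simp add: itinerary_def)

lemma itinerary_eq_iff: "itinerary f n x = itinerary f n y \<longleftrightarrow> (\<forall>i<n. f ((T ^^ i) x) = f ((T ^^ i) y))"
  by (auto simp: itinerary_def)

lemma itinerary_funpow_eq_iff: "itinerary f n ((T ^^ m) x) = itinerary f n ((T ^^ m) y) \<longleftrightarrow>
    (\<forall>i<n. f ((T ^^ (i + m)) x) = f ((T ^^ (i + m)) y))"
  by (auto simp: itinerary_def funpow_add)

lemma simple_function_itinerary:
  assumes "simple_function M f" shows "simple_function M (itinerary f n)"
proof (induction n)
  case 0
  then show ?case by (simp add: itinerary_def[abs_def])
next
  case (Suc n)
  have "itinerary f (Suc n) = (\<lambda>(w, a). w @ [a]) \<circ> (\<lambda>x. (itinerary f n x, f ((T ^^ n) x)))"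
    by (simp add: fun_eq_iff itinerary_Suc)
  then show ?case
    using simple_function_compose[OF simple_function_Pair[OF Suc simple_function_funpow[OF assms]]] by (simp only:)
qed

text \<open>A long itinerary is determined by its beginning and by the shifted remainder, whose
  entropy is unchanged by invariance; so the entropies are subadditive.\<close>

lemma itinerary_entropy_convergent:
  assumes f: "simple_function M f"
  shows "\<exists>L. (\<lambda>n. rv_entropy (itinerary f n) / real n) \<longlonglongrightarrow> L"
proof -
  have sub: "rv_entropy (itinerary f (m + n)) \<le> rv_entropy (itinerary f m) + rv_entropy (itinerary f n)" for m n
  proof -
  note simple = simple_function_itinerary[OF f]
  have "rv_entropy (itinerary f (m + n)) \<le> rv_entropy (\<lambda>x. (itinerary f m x, itinerary f n ((T ^^ m) x)))"
  proof (rule rv_entropy_refines)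
    show "simple_function M (\<lambda>x. (itinerary f m x, itinerary f n ((T ^^ m) x)))"
      using simple simple_function_funpow[OF simple] by (intro simple_function_Pair)
    show "refines (\<lambda>x. (itinerary f m x, itinerary f n ((T ^^ m) x))) (itinerary f (m + n))"
      unfolding refines_def prod.inject itinerary_funpow_eq_iff unfolding itinerary_eq_iff
    proof (intro ballI impI allI)
      fix x y i assume *: "(\<forall>i<m. f ((T ^^ i) x) = f ((T ^^ i) y)) \<and> (\<forall>i<n. f ((T ^^ (i + m)) x) = f ((T ^^ (i + m)) y))"
        and i: "i < m + n"
      show "f ((T ^^ i) x) = f ((T ^^ i) y)"
      proof (cases "i < m")
        case False
        then have "i - m < n" "i - m + m = i" using i by auto
        then show ?thesis using * by metis
      qed (use * in blast)
    qed
  qed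
  also have "\<dots> \<le> rv_entropy (itinerary f m) + rv_entropy (\<lambda>x. itinerary f n ((T ^^ m) x))"
    by (intro rv_entropy_pair simple simple_function_funpow)
    finally show ?thesis using rv_entropy_funpow[OF simple] by simp
  qed
  show ?thesis by (rule subadditive_convergent[OF sub rv_entropy_nonneg])
qed

text \<open>The nonempty cells of the join are the fibres of the itinerary, and an empty cell
  contributes 0.\<close>

lemma partition_entropy_iterated_join:
  assumes f: "f ` space M \<subseteq> \<xi>" "\<And>x. x \<in> space M \<Longrightarrow> x \<in> f x"
    and \<xi>: "finite_measurable_partition M \<xi>"
  shows "partition_entropy M (iterated_join M T \<xi> n) = rv_entropy (itinerary f n)"
proof -
  have part: "partition_on (space M) \<xi>" and fin: "finite \<xi>" using \<xi> by (auto simp: finite_measurable_partition_def)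
  have fC: "f x = C \<longleftrightarrow> x \<in> C" if "x \<in> space M" "C \<in> \<xi>" for x C
  proof -
    have "f x \<in> \<xi>" "x \<in> f x" using f that(1) by auto
    then show ?thesis using disjointD[OF partition_onD2[OF part], of "f x" C] that(2) by blast
  qed
  let ?c = "\<lambda>C. space M \<inter> (\<Inter>i<n. (T ^^ i) -` C i)"
  let ?b = "\<lambda>w. itinerary f n -` {w} \<inter> space M"
  have it: "itinerary f n x = map C [0..<n] \<longleftrightarrow> x \<in> ?c C" if "x \<in> space M" "C \<in> {..<n} \<rightarrow>\<^sub>E \<xi>" for x C
    using that fC funpow_space[OF that(1)] by (auto simp: itinerary_def PiE_iff)
  have b: "?b (map C [0..<n]) = ?c C" if C: "C \<in> {..<n} \<rightarrow>\<^sub>E \<xi>" for C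
  proof (rule set_eqI)
    fix x show "x \<in> ?b (map C [0..<n]) \<longleftrightarrow> x \<in> ?c C"
      using it[OF _ C, of x] by blast
  qed
  have J: "iterated_join M T \<xi> n - {{}} = ?b ` itinerary f n ` space M"
  proof (intro equalityI subsetI)
    fix B assume "B \<in> iterated_join M T \<xi> n - {{}}"
    then obtain C x where C: "C \<in> {..<n} \<rightarrow>\<^sub>E \<xi>" "B = ?c C" "x \<in> B" by (auto simp: iterated_join_def)
    have B: "B = ?b (map C [0..<n])" by (simp only: C(2) b[OF C(1)])
    then have "itinerary f n x = map C [0..<n]" "x \<in> space M" using C(3) by blast+
    then have "map C [0..<n] \<in> itinerary f n ` space M" by (rule rev_image_eqI[OF _ sym, rotated])
    then show "B \<in> ?b ` itinerary f n ` space M" unfolding B by (rule imageI)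
  next
    fix B assume "B \<in> ?b ` itinerary f n ` space M"
    then obtain x where x: "x \<in> space M" "B = ?b (itinerary f n x)" by blast
    define C where "C = restrict (\<lambda>i. f ((T ^^ i) x)) {..<n}"
    have C: "C \<in> {..<n} \<rightarrow>\<^sub>E \<xi>" using f(1) funpow_space[OF x(1)] by (auto simp: C_def)
    have "itinerary f n x = map C [0..<n]" by (simp add: itinerary_def C_def)
    then have "B = ?c C" using b[OF C] x(2) by (simp only:)
    then have "B \<in> iterated_join M T \<xi> n" unfolding iterated_join_def by (rule image_eqI[OF _ C])
    moreover have "x \<in> B" using x by blast
    ultimately show "B \<in> iterated_join M T \<xi> n - {{}}" by blast
  qed
  have "finite (iterated_join M T \<xi> n)" unfolding iterated_join_def using fin by (intro finite_imageI finite_PiE) auto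
  then have "partition_entropy M (iterated_join M T \<xi> n) = - (\<Sum>B\<in>iterated_join M T \<xi> n - {{}}. prob B * ln (prob B))"
    unfolding partition_entropy_def neg_equal_iff_equal by (intro sum.mono_neutral_right) auto
  also have "(\<Sum>B\<in>iterated_join M T \<xi> n - {{}}. prob B * ln (prob B)) = (\<Sum>w\<in>itinerary f n ` space M. prob (?b w) * ln (prob (?b w)))"
    unfolding J by (subst sum.reindex) (auto simp: inj_on_def)
  finally show ?thesis by (simp add: rv_entropy_def)
qed

lemma partition_function:
  assumes \<xi>: "finite_measurable_partition M \<xi>"
  obtains f where "simple_function M f" "f ` space M \<subseteq> \<xi>" "\<And>x. x \<in> space M \<Longrightarrow> x \<in> f x"
proof -
  have part: "partition_on (space M) \<xi>" and fin: "finite \<xi>" "\<xi> \<subseteq> events"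
    using \<xi> by (auto simp: finite_measurable_partition_def)
  have "\<forall>x\<in>space M. \<exists>C. C \<in> \<xi> \<and> x \<in> C" using partition_onD1[OF part] by blast
  then obtain f where f: "\<And>x. x \<in> space M \<Longrightarrow> f x \<in> \<xi>" "\<And>x. x \<in> space M \<Longrightarrow> x \<in> f x" by metis
  have "f -` {C} \<inter> space M = C" if "C \<in> \<xi>" for C
  proof -
    have "C \<subseteq> space M" using partition_onD1[OF part] that by auto
    moreover have "f x = C \<longleftrightarrow> x \<in> C" if x: "x \<in> space M" for x
      using disjointD[OF partition_onD2[OF part] f(1)[OF x] \<open>C \<in> \<xi>\<close>] f(2)[OF x] by blast
    ultimately show ?thesis by auto
  qed
  then have "simple_function M f"
    using fin f(1) by (auto simp: simple_function_def intro: finite_subset[of _ \<xi>])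
  then show ?thesis using that f by auto
qed

text \<open>Generator argument: by \<open>gen\<close>, a single value of \<open>f\<close> is nearly
  determined by a window of \<open>g\<close> of some length m. So the itinerary of \<open>f\<close>
  of length n is determined by that of \<open>g\<close> of length n + m up to conditional entropy n
  \<epsilon>, and the latter gains at most \<open>c\<close> per step.\<close>

lemma ks_entropy_le:
  assumes g: "simple_function M g"
    and c: "\<And>n. n \<ge> N \<Longrightarrow> rv_entropy (itinerary g (Suc n)) - rv_entropy (itinerary g n) \<le> c"
    and gen: "\<And>(f :: 'a \<Rightarrow> 'a set) \<epsilon> :: real. simple_function M f \<Longrightarrow> \<epsilon> > 0 \<Longrightarrow> \<exists>m. cond_entropy f (itinerary g m) \<le> \<epsilon>"
  shows "ks_entropy M T \<le> ereal c"
  unfolding ks_entropy_def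
proof (rule SUP_least, clarify, simp)
  fix \<xi> assume \<xi>: "finite_measurable_partition M \<xi>"
  obtain f where f: "simple_function M f" "f ` space M \<subseteq> \<xi>" "\<And>x. x \<in> space M \<Longrightarrow> x \<in> f x"
    using partition_function[OF \<xi>] by blast
  obtain L where L: "(\<lambda>n. rv_entropy (itinerary f n) / real n) \<longlonglongrightarrow> L"
    using itinerary_entropy_convergent[OF f(1)] by blast
  note sg = simple_function_itinerary[OF g] and sf = simple_function_itinerary[OF f(1)]
  have "L \<le> c + \<epsilon>" if \<epsilon>: "\<epsilon> > 0" for \<epsilon>
  proof -
    obtain m0 where m0: "cond_entropy f (itinerary g m0) \<le> \<epsilon>" using gen[OF f(1) \<epsilon>] by blast
    \<comment> \<open>At least \<open>N\<close>, so that the bound on the increments of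
      \<open>g\<close> applies from \<open>m\<close> on.\<close>
    define m where "m = max m0 N"
    have m: "cond_entropy f (itinerary g m) \<le> \<epsilon>"
      using cond_entropy_mono[OF f(1) sg sg, of m m0] m0
      by (force simp: m_def refines_def itinerary_eq_iff)
    have step: "cond_entropy (itinerary f n) (itinerary g (n + m)) \<le> real n * \<epsilon>" for n
    proof (induction n)
      case 0
      show ?case using cond_entropy_zero[OF sg, of m "itinerary f 0"] by (simp add: refines_def itinerary_eq_iff)
    next
      case (Suc n)
      let ?G = "itinerary g (Suc n + m)"
      have "cond_entropy (itinerary f (Suc n)) ?G \<le> cond_entropy (\<lambda>x. (itinerary f n x, f ((T ^^ n) x))) ?G"
        using sf sg simple_function_funpow[OF f(1)]
        by (intro cond_entropy_refines simple_function_Pair) (auto simp: refines_def itinerary_Suc)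
      also have "\<dots> \<le> cond_entropy (itinerary f n) ?G + cond_entropy (\<lambda>x. f ((T ^^ n) x)) ?G"
        by (intro cond_entropy_pair sf sg simple_function_funpow f(1))
      also have "cond_entropy (itinerary f n) ?G \<le> cond_entropy (itinerary f n) (itinerary g (n + m))"
        by (intro cond_entropy_mono sf sg) (auto simp: refines_def itinerary_eq_iff)
      also have "cond_entropy (\<lambda>x. f ((T ^^ n) x)) ?G \<le> cond_entropy (\<lambda>x. f ((T ^^ n) x)) (\<lambda>x. itinerary g m ((T ^^ n) x))"
        by (intro cond_entropy_mono sf sg simple_function_funpow f(1))
           (simp only: refines_def itinerary_funpow_eq_iff, simp add: itinerary_eq_iff)
      also have "\<dots> = cond_entropy f (itinerary g m)" by (rule cond_entropy_funpow[OF f(1) sg])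
      finally show ?case using Suc m by (simp add: algebra_simps)
    qed
    have grow: "rv_entropy (itinerary g (n + m)) \<le> rv_entropy (itinerary g m) + real n * c" for n
    proof (induction n)
      case (Suc n)
      have "N \<le> n + m" by (simp add: m_def)
      from c[OF this] Suc show ?case by (simp add: algebra_simps)
    qed simp
    have le: "rv_entropy (itinerary f n) / real n \<le> (c + \<epsilon>) + rv_entropy (itinerary g m) / real n" if "n \<ge> 1" for n
    proof -
      have "rv_entropy (itinerary f n) \<le> rv_entropy (\<lambda>x. (itinerary f n x, itinerary g (n + m) x))"
        by (intro rv_entropy_refines simple_function_Pair sf sg) (auto simp: refines_def)
      then have "rv_entropy (itinerary f n) \<le> rv_entropy (itinerary g m) + real n * c + real n * \<epsilon>"
        using step[of n] grow[of n] by (simp add: cond_entropy_def)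
      then show ?thesis using that by (simp add: field_simps)
    qed
    have "(\<lambda>n. (c + \<epsilon>) + rv_entropy (itinerary g m) / real n) \<longlonglongrightarrow> (c + \<epsilon>) + 0"
      by (intro tendsto_add tendsto_const tendsto_divide_0[OF tendsto_const] filterlim_at_top_imp_at_infinity filterlim_real_sequentially)
    with L have "L \<le> (c + \<epsilon>) + 0" by (rule LIMSEQ_le) (use le in blast)
    then show "L \<le> c + \<epsilon>" by simp
  qed
  then have "L \<le> c" by (rule field_le_epsilon)
  moreover have "lim (\<lambda>n. partition_entropy M (iterated_join M T \<xi> n) / real n) = L"
    using limI[OF L] by (simp add: partition_entropy_iterated_join[OF f(2,3) \<xi>])
  ultimately show "lim (\<lambda>n. partition_entropy M (iterated_join M T \<xi> n) / real n) \<le> c" by simp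
qed

text \<open>The fibres of \<open>g\<close> form an admissible partition, and adding up the
  increments from \<open>N\<close> on bounds its entropy rate from below.\<close>

lemma ks_entropy_ge:
  assumes g: "simple_function M g"
    and c: "\<And>n. n \<ge> N \<Longrightarrow> c \<le> rv_entropy (itinerary g (Suc n)) - rv_entropy (itinerary g n)"
  shows "ereal c \<le> ks_entropy M T"
proof -
  define \<xi> where "\<xi> = (\<lambda>x. g -` {g x} \<inter> space M) ` space M"
  have "\<xi> = (\<lambda>y. g -` {y} \<inter> space M) ` g ` space M" by (auto simp: \<xi>_def)
  then have "finite \<xi>" using simple_functionD(1)[OF g] by simp
  then have \<xi>: "finite_measurable_partition M \<xi>"
    using simple_functionD(2)[OF g]
    by (auto simp: finite_measurable_partition_def partition_on_def disjoint_def \<xi>_def)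
  define f where "f x = g -` {g x} \<inter> space M" for x
  have f: "f ` space M \<subseteq> \<xi>" "\<And>x. x \<in> space M \<Longrightarrow> x \<in> f x" by (auto simp: f_def \<xi>_def)
  have "f = (\<lambda>y. g -` {y} \<inter> space M) \<circ> g" by (simp add: f_def fun_eq_iff)
  then have sf: "simple_function M f" using simple_function_compose[OF g] by (simp only:)
  have fg: "f x = f y \<longleftrightarrow> g x = g y" if "x \<in> space M" "y \<in> space M" for x y
    using that by (auto simp: f_def)
  have eq: "rv_entropy (itinerary f n) = rv_entropy (itinerary g n)" for n
  proof (rule antisym)
    show "rv_entropy (itinerary f n) \<le> rv_entropy (itinerary g n)"
      by (intro rv_entropy_refines simple_function_itinerary g) (auto simp: refines_def itinerary_eq_iff f_def)
    show "rv_entropy (itinerary g n) \<le> rv_entropy (itinerary f n)"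
      using fg funpow_space by (intro rv_entropy_refines simple_function_itinerary sf) (auto simp: refines_def itinerary_eq_iff)
  qed
  obtain L where L: "(\<lambda>n. rv_entropy (itinerary g n) / real n) \<longlonglongrightarrow> L"
    using itinerary_entropy_convergent[OF g] by blast
  have grow: "real n * c \<le> rv_entropy (itinerary g (n + N))" for n
  proof (induction n)
    case (Suc n)
    then show ?case using c[of "n + N"] by (simp add: algebra_simps)
  qed (simp add: rv_entropy_nonneg)
  have le: "c - real N * c / real n \<le> rv_entropy (itinerary g n) / real n" if "n \<ge> max 1 N" for n
  proof -
    have "(real n - real N) * c / real n \<le> rv_entropy (itinerary g n) / real n"
      using grow[of "n - N"] that by (intro divide_right_mono) (simp_all add: of_nat_diff)
    then show ?thesis using that by (simp add: left_diff_distrib diff_divide_distrib)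
  qed
  have "(\<lambda>n. c - real N * c / real n) \<longlonglongrightarrow> c - 0"
    by (intro tendsto_diff tendsto_const tendsto_divide_0[OF tendsto_const] filterlim_at_top_imp_at_infinity filterlim_real_sequentially)
  then have "c - 0 \<le> L" by (rule LIMSEQ_le[OF _ L]) (use le in blast)
  then have "c \<le> L" by simp
  also have "L = lim (\<lambda>n. partition_entropy M (iterated_join M T \<xi> n) / real n)"
    using limI[OF L] by (simp add: partition_entropy_iterated_join[OF f \<xi>] eq)
  finally have "ereal c \<le> ereal (lim (\<lambda>n. partition_entropy M (iterated_join M T \<xi> n) / real n))" by simp
  also have "\<dots> \<le> ks_entropy M T" unfolding ks_entropy_def using \<xi> by (intro SUP_upper) auto
  finally show ?thesis .
qed

end

section \<open>Approximation by cylinders\<close>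

context prob_space
begin

lemma cond_entropy_cong:
  assumes "\<And>x. x \<in> space M \<Longrightarrow> X x = X' x" "\<And>x. x \<in> space M \<Longrightarrow> Y x = Y' x"
  shows "cond_entropy X Y = cond_entropy X' Y'"
  unfolding cond_entropy_def
  using rv_entropy_cong[of "\<lambda>x. (X x, Y x)" "\<lambda>x. (X' x, Y' x)"] rv_entropy_cong[of Y Y'] assms by simp

lemma simple_function_mem: "A \<inter> space M \<in> events \<Longrightarrow> simple_function M (\<lambda>x. x \<in> A)"
proof -
  assume A: "A \<inter> space M \<in> events"
  have "(\<lambda>x. x \<in> A) -` {b} \<inter> space M = (if b then A \<inter> space M else space M - A \<inter> space M)" for b
    by auto
  then show ?thesis using A by (simp add: simple_function_def sets.compl_sets)
qed

text \<open>For nested sets the conditional entropy is a continuous expression in the two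
  probabilities that vanishes when they agree. This gives its limit along increasing unions.\<close>

lemma cond_entropy_mem_subset:
  assumes A: "A \<in> events" and B: "B \<in> events" and BA: "B \<subseteq> A"
  shows "cond_entropy (\<lambda>x. x \<in> A) (\<lambda>x. x \<in> B) =
    (1 - prob B) * ln (1 - prob B) - (prob A - prob B) * ln (prob A - prob B) - (1 - prob A) * ln (1 - prob A)"
proof -
  let ?h = "\<lambda>b :: bool \<times> bool. prob ((\<lambda>x. (x \<in> A, x \<in> B)) -` {b} \<inter> space M)"
  have sub: "A \<subseteq> space M" "B \<subseteq> space M" using A B by (auto dest: sets.sets_into_space)
  have "(\<lambda>x. (x \<in> A, x \<in> B)) -` {(True, True)} \<inter> space M = B"
    "(\<lambda>x. (x \<in> A, x \<in> B)) -` {(True, False)} \<inter> space M = A - B"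
    "(\<lambda>x. (x \<in> A, x \<in> B)) -` {(False, True)} \<inter> space M = {}"
    "(\<lambda>x. (x \<in> A, x \<in> B)) -` {(False, False)} \<inter> space M = space M - A"
    "(\<lambda>x. x \<in> B) -` {True} \<inter> space M = B" "(\<lambda>x. x \<in> B) -` {False} \<inter> space M = space M - B"
    using sub BA by auto
  note eqs = this
  have U: "UNIV = {(True, True), (True, False), (False, True), (False, False)}" by auto
  have "rv_entropy (\<lambda>x. (x \<in> A, x \<in> B)) = - (\<Sum>b\<in>UNIV. ?h b * ln (?h b))"
    by (rule rv_entropy_superset) auto
  also have "\<dots> = - (prob B * ln (prob B) + (prob A - prob B) * ln (prob A - prob B) + (1 - prob A) * ln (1 - prob A))"
    unfolding U using finite_measure_Diff[OF A B BA] prob_compl[OF A] by (simp add: eqs)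
  finally have 1: "rv_entropy (\<lambda>x. (x \<in> A, x \<in> B)) =
      - (prob B * ln (prob B) + (prob A - prob B) * ln (prob A - prob B) + (1 - prob A) * ln (1 - prob A))" .
  have "rv_entropy (\<lambda>x. x \<in> B) = - (\<Sum>b\<in>UNIV. prob ((\<lambda>x. x \<in> B) -` {b} \<inter> space M) * ln (prob ((\<lambda>x. x \<in> B) -` {b} \<inter> space M)))"
    by (rule rv_entropy_superset) auto
  also have "\<dots> = - (prob B * ln (prob B) + (1 - prob B) * ln (1 - prob B))"
    unfolding UNIV_bool using prob_compl[OF B] by (simp add: eqs)
  finally show ?thesis using 1 by (simp add: cond_entropy_def)
qed

lemma cond_entropy_incseq_tendsto:
  assumes B: "\<And>n. B n \<in> events" "incseq B"
  shows "(\<lambda>n. cond_entropy (\<lambda>x. x \<in> (\<Union>n. B n)) (\<lambda>x. x \<in> B n)) \<longlonglongrightarrow> 0"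
proof -
  let ?A = "\<Union>n. B n" and ?\<eta> = "\<lambda>x::real. x * ln x"
  have A: "?A \<in> events" using B(1) by auto
  have p: "(\<lambda>n. prob (B n)) \<longlonglongrightarrow> prob ?A" using B by (intro finite_Lim_measure_incseq) auto
  have le: "prob (B n) \<le> prob ?A" for n using A by (intro finite_measure_mono) auto
  have \<eta>: "(\<lambda>n. ?\<eta> (f n)) \<longlonglongrightarrow> ?\<eta> l" if "f \<longlonglongrightarrow> l" "\<And>n. 0 \<le> f n" for f l
    using continuous_on_tendsto_compose[OF continuous_on_x_ln_x that(1)] LIMSEQ_le_const[OF that(1)] that(2)
    by (simp add: eventually_sequentially)
  have "(\<lambda>n. ?\<eta> (1 - prob (B n)) - ?\<eta> (prob ?A - prob (B n)) - ?\<eta> (1 - prob ?A))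
      \<longlonglongrightarrow> ?\<eta> (1 - prob ?A) - ?\<eta> (prob ?A - prob ?A) - ?\<eta> (1 - prob ?A)"
    using le by (intro tendsto_diff \<eta> p tendsto_const) (auto intro: prob_le_1)
  then show ?thesis
    using cond_entropy_mem_subset[OF A B(1) UN_upper] by simp
qed

end

section \<open>Words and cylinder sets\<close>

abbreviation word :: "nat \<Rightarrow> (nat \<Rightarrow> nat) \<Rightarrow> nat list" where
  "word n x \<equiv> map x [0..<n]"

lemma word_eq_iff: "word n x = word n y \<longleftrightarrow> (\<forall>i<n. x i = y i)"
  by auto

text \<open>Arbitrary unions of cylinders of one length: a generator of the Borel sets closed under
  intersection, for uniqueness of measures and for induction over sets.\<close>

definition word_sets :: "(nat \<Rightarrow> nat) set set" where
  "word_sets = {{x. word m x \<in> W} |m W. True}"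

lemma Int_stable_word_sets: "Int_stable word_sets"
proof (rule Int_stableI)
  fix a b assume "a \<in> word_sets" "b \<in> word_sets"
  then obtain m W m' W' where ab: "a = {x. word m x \<in> W}" "b = {x. word m' x \<in> W'}"
    by (auto simp: word_sets_def)
  have "take m (word (max m m') x) = word m x" "take m' (word (max m m') x) = word m' x" for x
    by (simp_all add: take_map)
  then have "a \<inter> b = {x. word (max m m') x \<in> {w. take m w \<in> W \<and> take m' w \<in> W'}}"
    by (auto simp: ab)
  then show "a \<inter> b \<in> word_sets" unfolding word_sets_def by blast
qed

lemma coordinate_measurable [measurable]: "(\<lambda>x :: nat \<Rightarrow> nat. x i) \<in> borel \<rightarrow>\<^sub>M count_space UNIV"
proof -
  have "(\<lambda>x :: nat \<Rightarrow> nat. x i) \<in> borel_measurable borel"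
    by (intro borel_measurable_continuous_onI) simp
  then show ?thesis using measurable_cong_sets[OF refl sets_borel_eq_count_space] by blast
qed

lemma word_measurable [measurable]: "word n \<in> borel \<rightarrow>\<^sub>M count_space UNIV"
proof (rule measurable_count_space_eq2_countable[THEN iffD2], intro conjI ballI)
  fix w :: "nat list"
  have "word n -` {w} = (if length w = n then (\<Inter>i\<in>{..<n}. {x. x i = w ! i}) else {})"
  proof (cases "length w = n")
    case True
    then have "word n x = w \<longleftrightarrow> (\<forall>i<n. x i = w ! i)" for x by (subst list_eq_iff_nth_eq) simp
    then show ?thesis using True by auto
  qed auto
  moreover have "closed (\<Inter>i\<in>{..<n}. {x :: nat \<Rightarrow> nat. x i = w ! i})"
    by (intro closed_INT ballI closed_Collect_eq continuous_on_const) simp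
  ultimately show "word n -` {w} \<inter> space borel \<in> sets borel" using borel_closed by simp
qed simp

lemma sets_borel_word_sets: "sets (borel :: (nat \<Rightarrow> nat) measure) = sigma_sets UNIV word_sets"
proof
  have "sets (borel :: (nat \<Rightarrow> nat) measure) = sets (PiM UNIV (\<lambda>_. borel :: nat measure))"
    by (rule sets_PiM_equal_borel[symmetric])
  also have "\<dots> = sigma_sets UNIV {{f. f i \<in> A} |i A. A \<in> sets (borel :: nat measure)}"
    by (subst sets_PiM_single) (simp add: PiE_UNIV_domain)
  also have "\<dots> \<subseteq> sigma_sets UNIV word_sets"
  proof (rule sigma_sets_mono', clarify)
    fix i and A :: "nat set"
    have "{f. f i \<in> A} = {f. word (Suc i) f \<in> {w. last w \<in> A}}" by simp
    then show "{f. f i \<in> A} \<in> word_sets" unfolding word_sets_def by blast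
  qed
  finally show "sets (borel :: (nat \<Rightarrow> nat) measure) \<subseteq> sigma_sets UNIV word_sets" .
  show "sigma_sets UNIV word_sets \<subseteq> sets borel"
  proof (rule sets.sigma_sets_subset[where M = borel, simplified], rule subsetI)
    fix B assume "B \<in> word_sets"
    then obtain m W where "B = word m -` W \<inter> space borel" by (auto simp: word_sets_def)
    then show "B \<in> sets borel" using measurable_sets[OF word_measurable, of W] by simp
  qed
qed

text \<open>The sets whose membership is nearly determined by long words include the cylinders and
  are closed under complements and countable disjoint unions, hence comprise all Borel sets.\<close>

lemma cond_entropy_word_approx_set:
  fixes M :: "(nat \<Rightarrow> nat) measure"
  assumes prob: "prob_space M" and sets: "sets M = sets (restrict_space borel X)" and simple: "\<And>n. simple_function M (word n)"
    and A: "A \<in> sets borel" and "\<epsilon> > 0"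
  shows "\<exists>m. prob_space.cond_entropy M (\<lambda>x. x \<in> A) (word m) \<le> \<epsilon>"
proof -
  interpret prob_space M by (rule prob)
  have space: "space M = X" using sets_eq_imp_space_eq[OF sets] by (simp add: space_restrict_space)
  have ev: "B \<inter> space M \<in> events" if "B \<in> sets borel" for B
    using that by (auto simp: sets space sets_restrict_space Int_commute)
  have sf: "simple_function M (\<lambda>x. x \<in> B)" if "B \<in> sets borel" for B
    by (rule simple_function_mem[OF ev[OF that]])
  have mono: "cond_entropy Z (word m') \<le> cond_entropy Z (word m)"
    if "m \<le> m'" "simple_function M Z" for m m' and Z :: "(nat \<Rightarrow> nat) \<Rightarrow> 'z"
    using that(1) by (intro cond_entropy_mono that(2) simple) (auto simp: refines_def word_eq_iff)
  define P where "P B \<longleftrightarrow> (\<forall>\<epsilon>>0. \<exists>m. cond_entropy (\<lambda>x. x \<in> B) (word m) \<le> \<epsilon>)" for B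
  have P_empty: "P {}"
    using cond_entropy_zero[OF simple, of 0 "\<lambda>x. x \<in> {}"] unfolding P_def refines_def by (meson empty_iff less_imp_le order_trans)
  have P_Un: "P (B \<union> C)" if "P B" "P C" "B \<in> sets borel" "C \<in> sets borel" for B C
    unfolding P_def
  proof (intro allI impI)
    fix \<epsilon> :: real assume "\<epsilon> > 0"
    then have "\<epsilon> / 2 > 0" by simp
    then obtain m m' where m: "cond_entropy (\<lambda>x. x \<in> B) (word m) \<le> \<epsilon> / 2" "cond_entropy (\<lambda>x. x \<in> C) (word m') \<le> \<epsilon> / 2"
      using \<open>P B\<close> \<open>P C\<close> unfolding P_def by blast
    let ?m = "max m m'"
    have "cond_entropy (\<lambda>x. x \<in> B \<union> C) (word ?m) \<le> cond_entropy (\<lambda>x. (x \<in> B, x \<in> C)) (word ?m)"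
      by (intro cond_entropy_refines simple_function_Pair sf simple that) (auto simp: refines_def)
    also have "\<dots> \<le> cond_entropy (\<lambda>x. x \<in> B) (word ?m) + cond_entropy (\<lambda>x. x \<in> C) (word ?m)"
      by (intro cond_entropy_pair sf simple that)
    finally show "\<exists>m. cond_entropy (\<lambda>x. x \<in> B \<union> C) (word m) \<le> \<epsilon>"
      using mono[OF max.cobounded1[of m m'] sf[OF that(3)]] mono[OF max.cobounded2[of m' m] sf[OF that(4)]] m
      by (intro exI[of _ ?m]) linarith
  qed
  have "A \<in> sigma_sets UNIV word_sets" using A by (simp add: sets_borel_word_sets)
  then have "P A"
  proof (induction rule: sigma_sets_induct_disjoint[OF Int_stable_word_sets, of UNIV, simplified, consumes 1, case_names basic empty compl union])
    case (basic B)
    then obtain m W where B: "B = {x. word m x \<in> W}" by (auto simp: word_sets_def)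
    have "cond_entropy (\<lambda>x. x \<in> B) (word m) \<le> 0"
      by (intro cond_entropy_zero simple) (simp add: refines_def B del: map_eq_conv)
    then show ?case unfolding P_def by (meson less_imp_le order_trans)
  next
    case empty
    show ?case by (rule P_empty)
  next
    case (compl B)
    have "cond_entropy (\<lambda>x. x \<in> - B) (word m) \<le> cond_entropy (\<lambda>x. x \<in> B) (word m)" for m
      using compl(1) by (intro cond_entropy_refines simple sf) (auto simp: refines_def sets_borel_word_sets)
    then show ?case using compl(2) unfolding P_def Compl_eq_Diff_UNIV[symmetric] by (meson order_trans)
  next
    case (union B)
    have B: "B n \<in> sets borel" for n using union(2) by (auto simp: sets_borel_word_sets)
    \<comment> \<open>Finite partial unions are settled by \<open>P_Un\<close>; passing to the whole
      union costs its conditional entropy given a partial union, which tends to 0.\<close>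
    define C where "C n = (\<Union>i<n. B i)" for n :: nat
    have C: "C n \<in> sets borel" for n using B by (auto simp: C_def)
    have PC: "P (C n)" for n
    proof (induction n)
      case (Suc n)
      have "C (Suc n) = C n \<union> B n" by (auto simp: C_def lessThan_Suc)
      then show ?case using P_Un[OF Suc union(3) C B] by simp
    qed (simp add: C_def P_empty)
    show ?case
      unfolding P_def
    proof (intro allI impI)
      fix \<epsilon> :: real assume e: "\<epsilon> > 0"
      let ?D = "\<lambda>n. C n \<inter> space M"
      have UD: "(\<Union>n. ?D n) = (\<Union>n. B n) \<inter> space M" by (auto simp: C_def)
      have "incseq ?D" by (fastforce simp: incseq_def C_def)
      then have "(\<lambda>n. cond_entropy (\<lambda>x. x \<in> (\<Union>n. ?D n)) (\<lambda>x. x \<in> ?D n)) \<longlonglongrightarrow> 0"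
        using ev[OF C] by (intro cond_entropy_incseq_tendsto)
      then have ev_small: "eventually (\<lambda>n. cond_entropy (\<lambda>x. x \<in> (\<Union>n. ?D n)) (\<lambda>x. x \<in> ?D n) < \<epsilon> / 2) sequentially"
        using e by (intro order_tendstoD(2)) auto
      obtain n where "cond_entropy (\<lambda>x. x \<in> (\<Union>n. ?D n)) (\<lambda>x. x \<in> ?D n) < \<epsilon> / 2"
        using eventually_happens'[OF sequentially_bot ev_small] by blast
      moreover have "cond_entropy (\<lambda>x. x \<in> (\<Union>n. ?D n)) (\<lambda>x. x \<in> ?D n) = cond_entropy (\<lambda>x. x \<in> (\<Union>n. B n)) (\<lambda>x. x \<in> C n)"
        unfolding UD by (intro cond_entropy_cong) auto
      ultimately have 1: "cond_entropy (\<lambda>x. x \<in> (\<Union>n. B n)) (\<lambda>x. x \<in> C n) < \<epsilon> / 2" by simp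
      obtain m where 2: "cond_entropy (\<lambda>x. x \<in> C n) (word m) \<le> \<epsilon> / 2"
        using PC[of n] e unfolding P_def by (meson half_gt_zero_iff)
      have "cond_entropy (\<lambda>x. x \<in> (\<Union>n. B n)) (word m)
          \<le> cond_entropy (\<lambda>x. x \<in> (\<Union>n. B n)) (\<lambda>x. x \<in> C n) + cond_entropy (\<lambda>x. x \<in> C n) (word m)"
        by (intro cond_entropy_trans sf simple C) (use B in auto)
      then show "\<exists>m. cond_entropy (\<lambda>x. x \<in> (\<Union>n. B n)) (word m) \<le> \<epsilon>" using 1 2 by (intro exI[of _ m]) linarith
    qed
  qed
  then show ?thesis using \<open>\<epsilon> > 0\<close> by (auto simp: P_def)
qed

lemma cond_entropy_word_approx:
  fixes M :: "(nat \<Rightarrow> nat) measure"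
  assumes prob: "prob_space M" and sets: "sets M = sets (restrict_space borel X)" and simple: "\<And>n. simple_function M (word n)"
    and f: "simple_function M f" and e: "\<epsilon> > 0"
  shows "\<exists>m. prob_space.cond_entropy M f (word m) \<le> \<epsilon>"
proof -
  interpret prob_space M by (rule prob)
  \<comment> \<open>Records the value of \<open>f\<close> if it lies in \<open>S\<close> and nothing
    otherwise, so that the values can be added one at a time.\<close>
  let ?F = "\<lambda>S x. {c \<in> S. f x = c}"
  have sF: "simple_function M (?F S)" for S
    using simple_function_compose1[OF f, of "\<lambda>y. {c \<in> S. y = c}"] .
  have eq: "simple_function M (\<lambda>x. f x = c)" for c
    using simple_function_compose1[OF f, of "\<lambda>y. y = c"] .
  have mono: "cond_entropy Z (word m') \<le> cond_entropy Z (word m)"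
    if "m \<le> m'" "simple_function M Z" for m m' and Z :: "(nat \<Rightarrow> nat) \<Rightarrow> 'z"
    using that(1) by (intro cond_entropy_mono that(2) simple) (auto simp: refines_def word_eq_iff)
  have "\<exists>m. cond_entropy (?F S) (word m) \<le> \<epsilon>" if "finite S" "\<epsilon> > 0" for S \<epsilon>
    using that
  proof (induction S arbitrary: \<epsilon> rule: finite_induct)
    case empty
    have "cond_entropy (?F {}) (word 0) \<le> 0" by (intro cond_entropy_zero simple) (auto simp: refines_def)
    then show ?case using empty by (meson less_imp_le order_trans)
  next
    case (insert c S)
    obtain m where m: "cond_entropy (?F S) (word m) \<le> \<epsilon> / 2" using insert.IH[of "\<epsilon> / 2"] insert.prems by auto
    have "f -` {c} \<inter> space M \<in> sets (restrict_space borel X)" using simple_functionD(2)[OF f] sets by simp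
    then obtain A where A: "A \<in> sets borel" "f -` {c} \<inter> space M = X \<inter> A" by (auto simp: sets_restrict_space)
    have "space M = X" using sets_eq_imp_space_eq[OF sets] by (simp add: space_restrict_space)
    then have cong: "cond_entropy (\<lambda>x. f x = c) (word m) = cond_entropy (\<lambda>x. x \<in> A) (word m)" for m
      using A(2) by (intro cond_entropy_cong) auto
    obtain m' where m': "cond_entropy (\<lambda>x. f x = c) (word m') \<le> \<epsilon> / 2"
      using cond_entropy_word_approx_set[OF prob sets simple A(1), of "\<epsilon> / 2"] insert.prems by (auto simp: cong)
    let ?m = "max m m'"
    have "cond_entropy (?F (insert c S)) (word ?m) \<le> cond_entropy (\<lambda>x. (?F S x, f x = c)) (word ?m)"
      by (intro cond_entropy_refines simple_function_Pair sF eq simple) (auto simp: refines_def)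
    also have "\<dots> \<le> cond_entropy (?F S) (word ?m) + cond_entropy (\<lambda>x. f x = c) (word ?m)"
      by (intro cond_entropy_pair sF eq simple)
    finally show ?case
      using mono[OF max.cobounded1[of m m'] sF[of S]] mono[OF max.cobounded2[of m' m] eq[of c]] m m'
      by (intro exI[of _ ?m]) linarith
  qed
  from this[OF simple_functionD(1)[OF f] e]
  obtain m where "cond_entropy (?F (f ` space M)) (word m) \<le> \<epsilon>" by blast
  moreover have "cond_entropy f (word m) \<le> cond_entropy (?F (f ` space M)) (word m)"
    by (intro cond_entropy_refines sF simple) (auto simp: refines_def)
  ultimately show ?thesis by (meson order_trans)
qed

section \<open>Shift spaces of finite memory\<close>

lemma left_shift_funpow: "(left_shift ^^ n) x = (\<lambda>i. x (i + n))"
  by (induction n arbitrary: x) (simp_all add: left_shift_def funpow_swap1)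

lemma word_left_shift: "word n (left_shift x) = tl (word (Suc n) x)"
  by (simp add: left_shift_def upt_conv_Cons map_Suc_upt[symmetric] del: upt_Suc)

lemma butlast_word: "butlast (word (Suc n) x) = word n x"
  by simp

text \<open>By \<open>memory\<close>, admissibility of all windows of length N + 1 decides
  membership. Words of length N become the vertices of the graph, and words of length N + 1 the
  edges.\<close>

locale shift_space =
  fixes X :: "(nat \<Rightarrow> nat) set" and d N :: nat
  assumes bounded: "x \<in> X \<Longrightarrow> x n < d" and shift: "x \<in> X \<Longrightarrow> left_shift x \<in> X"
    and memory: "(\<And>n. word (Suc N) ((left_shift ^^ n) x) \<in> word (Suc N) ` X) \<Longrightarrow> x \<in> X"
begin

definition edges :: "nat list set" where "edges = word (Suc N) ` X"

lemma finite_edges: "finite edges"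
proof (rule finite_subset)
  show "edges \<subseteq> {w. set w \<subseteq> {..<d} \<and> length w = Suc N}" using bounded by (auto simp: edges_def)
qed (rule finite_lists_length_eq, simp)

sublocale finite_graph edges butlast tl
  by standard (rule finite_edges)

definition flow_of :: "(nat \<Rightarrow> nat) measure \<Rightarrow> nat list \<Rightarrow> real" where
  "flow_of \<mu> e = measure \<mu> {x \<in> X. word (Suc N) x = e}"

lemma shift_funpow: "x \<in> X \<Longrightarrow> (left_shift ^^ n) x \<in> X"
  by (induction n) (auto intro: shift)

lemma left_shift_borel: "left_shift \<in> borel \<rightarrow>\<^sub>M (borel :: (nat \<Rightarrow> nat) measure)"
  unfolding left_shift_def by (intro borel_measurable_continuous_onI continuous_on_coordinatewise_then_product) simp

lemma left_shift_measurable: "left_shift \<in> restrict_space borel X \<rightarrow>\<^sub>M restrict_space borel X"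
  using left_shift_borel shift by (intro measurable_restrict_space3) auto

lemma space_borel_X: "X \<in> sets borel"
proof -
  have funpow: "(left_shift ^^ n) \<in> borel \<rightarrow>\<^sub>M (borel :: (nat \<Rightarrow> nat) measure)" for n
  proof (induction n)
    case (Suc n)
    then show ?case using measurable_comp[OF Suc left_shift_borel] by (simp only: funpow.simps)
  qed simp
  have "X = (\<Inter>n. (\<lambda>x. word (Suc N) ((left_shift ^^ n) x)) -` edges \<inter> space borel)"
    using shift_funpow memory by (auto simp: edges_def simp del: upt_Suc)
  moreover have "(\<lambda>x. word (Suc N) ((left_shift ^^ n) x)) -` edges \<inter> space borel \<in> sets borel" for n
    using measurable_sets[OF measurable_compose[OF funpow word_measurable], of edges n "Suc N"] by simp
  then have "(\<Inter>n. (\<lambda>x. word (Suc N) ((left_shift ^^ n) x)) -` edges \<inter> space borel) \<in> sets borel"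
    by (intro sets.countable_INT) auto
  ultimately show ?thesis by (simp only:)
qed

section \<open>The flow of an invariant measure\<close>

context
  fixes \<mu> assumes \<mu>: "\<mu> \<in> invariant_measures X"
begin

lemma sets_\<mu>: "sets \<mu> = sets (restrict_space borel X)" and prob_\<mu>: "prob_space \<mu>" and distr_\<mu>: "distr \<mu> \<mu> left_shift = \<mu>"
  using \<mu> by (auto simp: invariant_measures_def)

lemma space_\<mu>: "space \<mu> = X"
  using sets_eq_imp_space_eq[OF sets_\<mu>] by (simp add: space_restrict_space)

lemma measure_preserving_shift: "measure_preserving_map \<mu> left_shift"
  using prob_\<mu> left_shift_measurable distr_\<mu>
  by (simp add: measure_preserving_map_def measure_preserving_map_axioms_def measurable_cong_sets[OF sets_\<mu> sets_\<mu>])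

interpretation measure_preserving_map \<mu> left_shift
  by (rule measure_preserving_shift)

lemma itinerary_first: "itinerary (\<lambda>x. x 0) n = word n"
  by (simp add: itinerary_def left_shift_funpow fun_eq_iff)

lemma simple_first: "simple_function \<mu> (\<lambda>x. x 0)"
proof -
  have "(\<lambda>x. x 0) ` space \<mu> \<subseteq> {..<d}" using bounded by (auto simp: space_\<mu>)
  then have "finite ((\<lambda>x. x 0) ` space \<mu>)" using finite_subset by blast
  moreover have "(\<lambda>x. x 0) \<in> \<mu> \<rightarrow>\<^sub>M count_space UNIV"
    unfolding measurable_cong_sets[OF sets_\<mu> refl] by (rule measurable_restrict_space1) measurable
  then have "(\<lambda>x. x 0) -` {y} \<inter> space \<mu> \<in> sets \<mu>" for y by (rule measurable_sets) simp
  ultimately show ?thesis by (simp add: simple_function_def)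
qed

lemma simple_word: "simple_function \<mu> (word n)"
  using simple_function_itinerary[OF simple_first] by (simp add: itinerary_first)

lemma flow_of_eq: "flow_of \<mu> e = prob (word (Suc N) -` {e} \<inter> space \<mu>)"
  unfolding flow_of_def space_\<mu> by (rule arg_cong[where f = prob]) auto

lemma edges_space: "word (Suc N) ` space \<mu> = edges"
  by (simp add: space_\<mu> edges_def)

lemma outflow_flow_of: "outflow (flow_of \<mu>) v = prob (word N -` {v} \<inter> space \<mu>)"
  unfolding outflow_def
  using prob_factor_sum[OF simple_word[of "Suc N"], of "word N" butlast v] by (simp add: flow_of_eq edges_space butlast_word del: upt_Suc)

text \<open>Balance of the flow expresses invariance of the measure: the last N letters of a window
  are the first N letters after a shift.\<close>

lemma inflow_flow_of: "inflow (flow_of \<mu>) v = prob (word N -` {v} \<inter> space \<mu>)"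
proof -
  have "inflow (flow_of \<mu>) v = prob ((\<lambda>x. word N (left_shift x)) -` {v} \<inter> space \<mu>)"
    unfolding inflow_def
    using prob_factor_sum[OF simple_word[of "Suc N"], of "\<lambda>x. word N (left_shift x)" tl v]
    by (simp add: flow_of_eq edges_space word_left_shift del: upt_Suc)
  also have "(\<lambda>x. word N (left_shift x)) -` {v} \<inter> space \<mu> = (left_shift ^^ 1) -` (word N -` {v} \<inter> space \<mu>) \<inter> space \<mu>"
    using shift by (auto simp: space_\<mu>)
  also have "prob \<dots> = prob (word N -` {v} \<inter> space \<mu>)"
    by (rule prob_funpow) (rule simple_functionD(2)[OF simple_word])
  finally show ?thesis .
qed

lemma flow_of_in_flows: "flow_of \<mu> \<in> flows"
proof -
  have "flow_of \<mu> e = 0" if "e \<notin> edges" for e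
  proof -
    have "{x \<in> X. word (Suc N) x = e} = {}" using that by (auto simp: edges_def simp del: upt_Suc)
    then show ?thesis unfolding flow_of_def by (simp only: measure_empty)
  qed
  moreover have "sum (flow_of \<mu>) edges = 1"
    using prob_factor_sum[OF simple_word[of "Suc N"], of "\<lambda>_. ()" "\<lambda>_. ()" "()"] prob_space
    by (simp add: flow_of_eq edges_space vimage_def del: upt_Suc)
  ultimately show ?thesis
    using inflow_flow_of outflow_flow_of by (auto simp: flows_def circulations_def flow_of_def measure_nonneg)
qed

lemma entropy_increment: "rv_entropy (word (Suc N)) - rv_entropy (word N) = flow_entropy (flow_of \<mu>)"
proof -
  have 1: "rv_entropy (word (Suc N)) = - (\<Sum>e\<in>edges. flow_of \<mu> e * ln (flow_of \<mu> e))"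
    by (simp add: rv_entropy_def flow_of_eq edges_space del: upt_Suc)
  have "rv_entropy (word N) = - (\<Sum>e\<in>edges. flow_of \<mu> e * ln (outflow (flow_of \<mu>) (butlast e)))"
    using rv_entropy_factor_sum[OF simple_word[of "Suc N"], of "word N" butlast]
    by (simp add: flow_of_eq edges_space outflow_flow_of butlast_word del: upt_Suc)
  moreover have "flow_of \<mu> e * ln (flow_of \<mu> e / outflow (flow_of \<mu>) (butlast e)) =
      flow_of \<mu> e * ln (flow_of \<mu> e) - flow_of \<mu> e * ln (outflow (flow_of \<mu>) (butlast e))" if e: "e \<in> edges" for e
  proof (cases "flow_of \<mu> e = 0")
    case False
    have nn: "\<And>e. flow_of \<mu> e \<ge> 0" by (simp add: flow_of_def)
    then have "flow_of \<mu> e > 0" using False by (simp add: less_le)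
    moreover have "outflow (flow_of \<mu>) (butlast e) > 0" using le_outflow[of "flow_of \<mu>", OF nn e] calculation by linarith
    ultimately show ?thesis by (simp add: ln_div right_diff_distrib)
  qed simp
  ultimately show ?thesis using 1 by (simp add: flow_entropy_def sum_subtractf)
qed

text \<open>The increment is the entropy of a letter given all previous ones. Conditioning only on
  the last N of them does not decrease it, and invariance moves these to the front.\<close>

lemma entropy_increment_le:
  assumes "n \<ge> N"
  shows "rv_entropy (word (Suc n)) - rv_entropy (word n) \<le> flow_entropy (flow_of \<mu>)"
proof -
  have sx: "simple_function \<mu> (\<lambda>x. x m)" for m
    using simple_function_funpow[OF simple_first, of m] by (simp add: left_shift_funpow)
  have eq: "cond_entropy (\<lambda>x. x m) (word m) = rv_entropy (word (Suc m)) - rv_entropy (word m)" for m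
  proof -
    have "rv_entropy (\<lambda>x. (x m, word m x)) = rv_entropy (word (Suc m))"
    proof (rule antisym)
      show "rv_entropy (\<lambda>x. (x m, word m x)) \<le> rv_entropy (word (Suc m))"
        by (intro rv_entropy_refines simple_word) (auto simp: refines_def)
      show "rv_entropy (word (Suc m)) \<le> rv_entropy (\<lambda>x. (x m, word m x))"
        by (intro rv_entropy_refines simple_function_Pair sx simple_word) (auto simp: refines_def)
    qed
    then show ?thesis by (simp add: cond_entropy_def)
  qed
  have "cond_entropy (\<lambda>x. x n) (word n) \<le> cond_entropy (\<lambda>x. x n) (\<lambda>x. word N ((left_shift ^^ (n - N)) x))"
    using assms by (intro cond_entropy_mono sx simple_word simple_function_funpow)
      (auto simp: refines_def left_shift_funpow)
  also have "\<dots> = cond_entropy (\<lambda>x. x N) (word N)"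
    using cond_entropy_funpow[OF sx[of N] simple_word[of N], of "n - N"] assms by (simp add: left_shift_funpow)
  finally show ?thesis unfolding eq entropy_increment .
qed

lemma ks_entropy_le_flow_entropy: "ks_entropy \<mu> left_shift \<le> ereal (flow_entropy (flow_of \<mu>))"
proof (rule ks_entropy_le[OF simple_first, of N])
  show "rv_entropy (itinerary (\<lambda>x. x 0) (Suc n)) - rv_entropy (itinerary (\<lambda>x. x 0) n) \<le> flow_entropy (flow_of \<mu>)"
    if "n \<ge> N" for n
    using entropy_increment_le[OF that] by (simp only: itinerary_first)
  show "\<exists>m. cond_entropy f (itinerary (\<lambda>x. x 0) m) \<le> \<epsilon>" if "simple_function \<mu> f" "\<epsilon> > 0"
    for f :: "(nat \<Rightarrow> nat) \<Rightarrow> (nat \<Rightarrow> nat) set" and \<epsilon> :: real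
    unfolding itinerary_first by (rule cond_entropy_word_approx[OF prob_\<mu> sets_\<mu> simple_word that])
qed

lemma ks_entropy_ge_flow_entropy:
  assumes "\<And>n. n \<ge> N \<Longrightarrow> flow_entropy (flow_of \<mu>) \<le> rv_entropy (word (Suc n)) - rv_entropy (word n)"
  shows "ereal (flow_entropy (flow_of \<mu>)) \<le> ks_entropy \<mu> left_shift"
  by (rule ks_entropy_ge[OF simple_first, of N]) (use assms in \<open>simp only: itinerary_first\<close>)

lemma rotation_vector_eq_mean:
  fixes \<phi> :: "nat list \<Rightarrow> real ^ 'm"
  assumes \<Phi>: "\<And>x. x \<in> X \<Longrightarrow> \<Phi> x = \<phi> (word (Suc N) x)"
  shows "rotation_vector \<Phi> \<mu> = mean \<phi> (flow_of \<mu>)"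
proof -
  let ?C = "\<lambda>e. word (Suc N) -` {e} \<inter> space \<mu>"
  have C: "?C e \<in> events" for e by (rule simple_functionD(2)[OF simple_word])
  have "(\<integral>x. \<Phi> x $ i \<partial>\<mu>) = (\<Sum>e\<in>edges. flow_of \<mu> e * \<phi> e $ i)" for i
  proof -
    have "(\<integral>x. \<Phi> x $ i \<partial>\<mu>) = (\<integral>x. (\<Sum>e\<in>edges. indicator (?C e) x * \<phi> e $ i) \<partial>\<mu>)"
    proof (rule Bochner_Integration.integral_cong[OF refl])
      fix x assume x: "x \<in> space \<mu>"
      have "(\<Sum>e\<in>edges. indicator (?C e) x * \<phi> e $ i) = (\<Sum>e\<in>edges. if e = word (Suc N) x then \<phi> e $ i else 0)"
        using x by (intro sum.cong) (auto simp: indicator_def simp del: upt_Suc)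
      also have "\<dots> = \<phi> (word (Suc N) x) $ i"
        using x finite_edges imageI[OF x, of "word (Suc N)"] by (subst sum.delta) (simp_all add: edges_space del: upt_Suc)
      also have "\<dots> = \<Phi> x $ i" using x \<Phi> by (simp add: space_\<mu>)
      finally show "\<Phi> x $ i = (\<Sum>e\<in>edges. indicator (?C e) x * \<phi> e $ i)" by simp
    qed
    also have "\<dots> = (\<Sum>e\<in>edges. (\<integral>x. indicator (?C e) x * \<phi> e $ i \<partial>\<mu>))"
      using C by (intro Bochner_Integration.integral_sum) (simp add: integrable_real_indicator less_top[symmetric])
    also have "\<dots> = (\<Sum>e\<in>edges. flow_of \<mu> e * \<phi> e $ i)"
      using C by (intro sum.cong) (simp_all add: flow_of_eq Int_absorb2 del: upt_Suc)
    finally show ?thesis .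
  qed
  then show ?thesis by (simp add: vec_eq_iff rotation_vector_def mean_def sum_component)
qed

end

end

section \<open>Stationary Markov measures\<close>

text \<open>
  Kolmogorov's extension theorem is available for Polish spaces only, and \<^typ>\<open>nat\<close> is not an instance
  of a metric space. The limit is therefore formed over \<^typ>\<open>real\<close>.
\<close>

lemma word_measure_exists:
  fixes V :: "nat \<Rightarrow> nat list pmf"
  assumes len: "\<And>n w. w \<in> set_pmf (V n) \<Longrightarrow> length w = N + n"
    and cons: "\<And>n. map_pmf butlast (V (Suc n)) = V n"
  obtains \<mu> :: "(nat \<Rightarrow> nat) measure" where "prob_space \<mu>" "sets \<mu> = sets borel"
    "\<And>n. distr \<mu> (count_space UNIV) (word (N + n)) = measure_pmf (V n)"
proof -
  have take: "map_pmf (take (N + m)) (V (m + k)) = V m" for m k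
  proof (induction k)
    case 0
    have "map_pmf (take (N + m)) (V m) = map_pmf (\<lambda>w. w) (V m)" by (rule map_pmf_cong) (auto simp: len)
    then show ?case by simp
  next
    case (Suc k)
    have "map_pmf (take (N + m)) (V (m + Suc k)) = map_pmf (\<lambda>w. take (N + m) (butlast w)) (V (Suc (m + k)))"
      by (rule map_pmf_cong) (auto simp: len take_butlast)
    then show ?case using Suc cons[of "m + k"] by (simp add: map_pmf_comp[symmetric] del: map_pmf_comp)
  qed
  \<comment> \<open>A length beyond all indices in \<open>J\<close>, so that the law of the words of
    length \<open>N + up J\<close> determines the marginal on \<open>J\<close>.\<close>
  define up where "up J = Suc (Max (insert 0 J))" for J :: "nat set"
  have up: "i < N + up J" if "finite J" "i \<in> J" for i J
  proof -
    have "i \<le> Max (insert 0 J)" using that by (intro Max_ge) auto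
    then show ?thesis by (simp add: up_def)
  qed
  have up_mono: "up J \<le> up H" if "finite H" "J \<subseteq> H" for J H
    using that by (auto simp: up_def finite_subset intro!: Max_mono)
  define r where "r J w = restrict (\<lambda>i. real (w ! i)) J" for J and w :: "nat list"
  have r: "r J \<in> measure_pmf p \<rightarrow>\<^sub>M PiM J (\<lambda>_. borel)" for J and p :: "nat list pmf"
    by (auto simp: r_def measurable_measure_pmf space_PiM PiE_def)
  define P where "P J = distr (V (up J)) (PiM J (\<lambda>_. borel :: real measure)) (r J)" for J
  interpret polish_projective UNIV P
  proof (intro polish_projective.intro projective_family.intro)
    fix J H :: "nat set" assume JH: "J \<subseteq> H" "finite H"
    have fJ: "finite J" using JH finite_subset by blast
    have "distr (P H) (PiM J (\<lambda>_. borel)) (\<lambda>f. restrict f J) = distr (V (up H)) (PiM J (\<lambda>_. borel)) (r J)"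
      unfolding P_def
      by (subst distr_distr[OF measurable_restrict_subset[OF JH(1)] r])
         (simp add: o_def r_def[abs_def] Int_absorb1[OF JH(1)])
    also have "\<dots> = distr (V (up H)) (PiM J (\<lambda>_. borel)) (r J \<circ> take (N + up J))"
      using up[OF fJ] by (intro distr_cong refl) (auto simp: r_def intro!: restrict_ext)
    also have "\<dots> = distr (map_pmf (take (N + up J)) (V (up H))) (PiM J (\<lambda>_. borel)) (r J)"
      unfolding map_pmf_rep_eq by (subst distr_distr) (auto simp: r_def space_PiM PiE_def)
    also have "map_pmf (take (N + up J)) (V (up H)) = V (up J)"
      using take[of "up J" "up H - up J"] up_mono[OF JH(2,1)] by simp
    finally show "P J = distr (P H) (PiM J (\<lambda>_. borel)) (\<lambda>f. restrict f J)" unfolding P_def by (rule sym)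
  next
    show "prob_space (P J)" for J
      unfolding P_def by (rule prob_space.prob_space_distr[OF prob_space_measure_pmf r])
  qed
  \<comment> \<open>The marginals are carried by natural numbers, where rounding down inverts the
    embedding into the reals.\<close>
  define h where "h x i = nat \<lfloor>x i\<rfloor>" for x :: "nat \<Rightarrow> real" and i :: nat
  have "h \<in> PiM UNIV (\<lambda>_. borel) \<rightarrow>\<^sub>M PiM UNIV (\<lambda>_. borel)"
    unfolding h_def by (rule measurable_PiM_single') (auto simp: space_PiM)
  then have h: "h \<in> lim \<rightarrow>\<^sub>M borel"
    using measurable_cong_sets[OF sets_lim sets_PiM_equal_borel[symmetric]] by blast
  have word_h: "(\<lambda>x. word n (h x)) \<in> lim \<rightarrow>\<^sub>M count_space UNIV" for n
    by (rule measurable_compose[OF h word_measurable])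
  define \<mu> where "\<mu> = distr lim borel h"
  have "distr \<mu> (count_space UNIV) (word (N + n)) = measure_pmf (V n)" for n
  proof (rule measure_eqI_countable[of _ UNIV])
    fix w :: "nat list"
    have d: "emeasure (distr \<mu> (count_space UNIV) (word (N + n))) {w} = emeasure lim {x. word (N + n) (h x) = w}"
      unfolding \<mu>_def distr_distr[OF word_measurable h]
      using word_h by (subst emeasure_distr) (auto simp: o_def space_PiM vimage_def)
    show "emeasure (distr \<mu> (count_space UNIV) (word (N + n))) {w} = emeasure (V n) {w}"
    proof (cases "length w = N + n")
      case False
      then have "{x. word (N + n) (h x) = w} = {}" by auto
      moreover have "w \<notin> set_pmf (V n)" using False len by blast
      ultimately show ?thesis unfolding d by (metis emeasure_empty emeasure_pmf_single_eq_zero_iff)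
    next
      case True
      let ?J = "{..<N + n}"
      let ?X = "PiE ?J (\<lambda>i. {y. nat \<lfloor>y\<rfloor> = w ! i})"
      have word_iff: "word (N + n) (h x) = w \<longleftrightarrow> (\<forall>i<N + n. nat \<lfloor>x i\<rfloor> = w ! i)" for x
        using True by (subst list_eq_iff_nth_eq) (simp add: h_def)
      have "{x. word (N + n) (h x) = w} = prod_emb UNIV (\<lambda>_. borel) ?J ?X"
        unfolding word_iff by (auto simp: prod_emb_iff PiE_iff)
      moreover have X: "?X \<in> sets (PiM ?J (\<lambda>_. borel :: real measure))"
        by (intro sets_PiM_I_finite) auto
      ultimately have "emeasure lim {x. word (N + n) (h x) = w} = P ?J ?X"
        using emeasure_lim_emb[of ?J ?X] by simp
      also have "\<dots> = emeasure (V (up ?J)) (r ?J -` ?X)"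
        unfolding P_def by (subst emeasure_distr[OF r X]) simp
      also have "\<dots> = emeasure (V (up ?J)) (take (N + n) -` {w})"
      proof (rule emeasure_eq_AE)
        show "AE v in V (up ?J). v \<in> r ?J -` ?X \<longleftrightarrow> v \<in> take (N + n) -` {w}"
        proof (rule AE_pmfI)
          fix v assume v: "v \<in> set_pmf (V (up ?J))"
          have "N + n \<le> length v" using len[OF v] up[of ?J "N + n - 1"] by (cases "N + n") auto
          then show "v \<in> r ?J -` ?X \<longleftrightarrow> v \<in> take (N + n) -` {w}"
            using True by (auto simp: r_def PiE_iff list_eq_iff_nth_eq)
        qed
      qed simp_all
      also have "\<dots> = emeasure (map_pmf (take (N + n)) (V (up ?J))) {w}" by simp
      also have "map_pmf (take (N + n)) (V (up ?J)) = V n"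
      proof (cases "N + n = 0")
        case True
        then show ?thesis using take[of 0 "up ?J"] by simp
      next
        case False
        then have "N + n - 1 \<le> Max (insert 0 ?J)" by (intro Max_ge) auto
        then have "n \<le> up ?J" by (simp add: up_def)
        then show ?thesis using take[of n "up ?J - n"] by simp
      qed
      finally show ?thesis unfolding d .
    qed
  qed auto
  moreover have "prob_space \<mu>" unfolding \<mu>_def by (rule P.prob_space_distr[OF h])
  ultimately show ?thesis using that[of \<mu>] by (simp add: \<mu>_def)
qed

section \<open>The Markov chain generated by a flow\<close>

context shift_space
begin

context
  fixes q assumes q: "q \<in> flows"
begin

definition flow_pmf :: "nat list pmf" where "flow_pmf = embed_pmf q"

lemma pmf_flow_pmf: "pmf flow_pmf e = q e"
  unfolding flow_pmf_def
proof (rule pmf_embed_pmf)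
  have "(\<integral>\<^sup>+ e. ennreal (q e) \<partial>count_space UNIV) = (\<Sum>e\<in>edges. ennreal (q e))"
    by (rule nn_integral_count_space'[OF finite_edges]) (auto simp: flowsD(4)[OF q])
  also have "\<dots> = 1" using flowsD(2,3)[OF q] by (simp add: sum_ennreal)
  finally show "(\<integral>\<^sup>+ e. ennreal (q e) \<partial>count_space UNIV) = 1" .
qed (rule flowsD(2)[OF q])

lemma set_flow_pmf: "set_pmf flow_pmf \<subseteq> edges"
  using flowsD(4)[OF q] by (auto simp: set_pmf_eq pmf_flow_pmf)

lemma length_edges: "e \<in> edges \<Longrightarrow> length e = Suc N"
  by (auto simp: edges_def)

lemma measure_flow_pmf: "measure_pmf.prob flow_pmf S = sum q (edges \<inter> S)"
proof -
  have "measure_pmf.prob flow_pmf S = measure_pmf.prob flow_pmf (edges \<inter> S)"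
    using set_flow_pmf by (intro measure_pmf.finite_measure_eq_AE AE_pmfI) auto
  then show ?thesis using finite_edges by (simp add: measure_measure_pmf_finite pmf_flow_pmf)
qed

lemma map_flow_pmf: "map_pmf tl flow_pmf = map_pmf butlast flow_pmf"
proof (rule pmf_eqI)
  fix v
  have "edges \<inter> f -` {v} = {e. e \<in> edges \<and> f e = v}" for f :: "nat list \<Rightarrow> nat list" by auto
  then show "pmf (map_pmf tl flow_pmf) v = pmf (map_pmf butlast flow_pmf) v"
    using flowsD(5)[OF q, of v] by (simp add: pmf_map measure_flow_pmf outflow_def inflow_def)
qed

abbreviation next_edge :: "nat list \<Rightarrow> nat list pmf" where
  "next_edge v \<equiv> cond_pmf flow_pmf {e. butlast e = v}"

text \<open>The Markov chain on words of length \<open>N + k\<close>, each step glueing an edge to the last \<open>N\<close> letters.\<close>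

primrec chain :: "nat \<Rightarrow> nat list pmf" where
  "chain 0 = map_pmf butlast flow_pmf"
| "chain (Suc k) = bind_pmf (chain k) (\<lambda>w. map_pmf (\<lambda>e. take k w @ e) (next_edge (drop k w)))"

lemma set_next_edge:
  assumes "v \<in> butlast ` set_pmf flow_pmf"
  shows "set_pmf flow_pmf \<inter> {e. butlast e = v} \<noteq> {}" "set_pmf (next_edge v) = set_pmf flow_pmf \<inter> {e. butlast e = v}"
    "pmf (next_edge v) e = (if butlast e = v then q e / outflow q v else 0)"
proof -
  show ne: "set_pmf flow_pmf \<inter> {e. butlast e = v} \<noteq> {}" using assms by auto
  show "set_pmf (next_edge v) = set_pmf flow_pmf \<inter> {e. butlast e = v}" by (rule set_cond_pmf[OF ne])
  have "edges \<inter> {e. butlast e = v} = {e. e \<in> edges \<and> butlast e = v}" by auto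
  then show "pmf (next_edge v) e = (if butlast e = v then q e / outflow q v else 0)"
    by (simp add: pmf_cond[OF ne] pmf_flow_pmf measure_flow_pmf outflow_def)
qed

text \<open>The conditional law \<open>next_edge\<close> is meaningful only at vertices charged by
  the flow. Balance of the flow ensures that the last N letters of a possible word always form such
  a vertex.\<close>

lemma set_chain:
  "w \<in> set_pmf (chain k) \<Longrightarrow> length w = N + k \<and> drop k w \<in> butlast ` set_pmf flow_pmf"
proof (induction k arbitrary: w)
  case 0
  then show ?case using set_flow_pmf length_edges by force
next
  case (Suc k)
  then obtain u e where u: "u \<in> set_pmf (chain k)" and e: "e \<in> set_pmf (next_edge (drop k u))" and w: "w = take k u @ e"
    by auto
  have u': "length u = N + k" "drop k u \<in> butlast ` set_pmf flow_pmf" using Suc.IH[OF u] by auto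
  then have e': "e \<in> set_pmf flow_pmf" using e set_next_edge(2) by blast
  then have "length e = Suc N" using set_flow_pmf length_edges by blast
  moreover have "tl e \<in> butlast ` set_pmf flow_pmf"
    using arg_cong[OF map_flow_pmf, of set_pmf] e' by (metis image_eqI set_map_pmf)
  ultimately show ?case using u'(1) by (simp add: w drop_Suc)
qed

lemma glue:
  assumes "u \<in> set_pmf (chain k)" "e \<in> set_pmf (next_edge (drop k u))"
  shows "butlast e = drop k u" "length e = Suc N" "butlast (take k u @ e) = u" "drop k (take k u @ e) = e"
proof -
  have u: "length u = N + k" "drop k u \<in> butlast ` set_pmf flow_pmf" using set_chain[OF assms(1)] by auto
  have e: "e \<in> set_pmf flow_pmf" "butlast e = drop k u" using set_next_edge(2)[OF u(2)] assms(2) by auto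
  show "butlast e = drop k u" by (rule e(2))
  show l: "length e = Suc N" using e set_flow_pmf length_edges by blast
  then show "butlast (take k u @ e) = u" by (subst butlast_append) (auto simp: e(2))
  show "drop k (take k u @ e) = e" using u by simp
qed

text \<open>A step only appends one letter, and forgetting it restores the previous word. This is
  the consistency needed for a measure on sequences.\<close>

lemma map_butlast_chain: "map_pmf butlast (chain (Suc k)) = chain k"
proof -
  have "map_pmf butlast (chain (Suc k)) = bind_pmf (chain k) (\<lambda>u. map_pmf (\<lambda>e. butlast (take k u @ e)) (next_edge (drop k u)))"
    by (simp add: map_bind_pmf map_pmf_comp)
  also have "\<dots> = bind_pmf (chain k) (\<lambda>u. map_pmf (\<lambda>_. u) (next_edge (drop k u)))"
    by (intro bind_pmf_cong refl map_pmf_cong) (rule glue)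
  finally show ?thesis by (simp add: bind_return_pmf')
qed

lemma chain_1: "chain (Suc 0) = flow_pmf"
proof -
  have "chain (Suc 0) = bind_pmf (map_pmf butlast flow_pmf) (\<lambda>v. cond_pmf flow_pmf {e. (\<lambda>v e. butlast e = v) v e})"
    by simp
  also have "\<dots> = flow_pmf"
  proof (rule bind_cond_pmf_cancel)
    fix v e assume "v \<in> set_pmf (map_pmf butlast flow_pmf)" "e \<in> set_pmf flow_pmf" "butlast e = v"
    then show "measure_pmf.prob flow_pmf {e. butlast e = v} = measure_pmf.prob (map_pmf butlast flow_pmf) {v. butlast e = v}"
      by (simp add: vimage_def)
  qed auto
  finally show ?thesis .
qed

text \<open>Stationarity: a step reads only the last letters and so commutes with dropping the first
  one, while the initial case is the balance of the flow.\<close>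

lemma map_tl_chain: "map_pmf tl (chain (Suc k)) = chain k"
proof (induction k)
  case 0
  show ?case unfolding chain_1 by (simp add: map_flow_pmf)
next
  case (Suc k)
  have "map_pmf tl (chain (Suc (Suc k))) =
      bind_pmf (chain (Suc k)) (\<lambda>u. map_pmf (\<lambda>e. tl (take (Suc k) u @ e)) (next_edge (drop (Suc k) u)))"
    by (simp only: chain.simps(2)[of "Suc k"] map_bind_pmf map_pmf_comp)
  also have "\<dots> = bind_pmf (chain (Suc k)) (\<lambda>u. map_pmf (\<lambda>e. take k (tl u) @ e) (next_edge (drop k (tl u))))"
  proof (intro bind_pmf_cong refl)
    fix u assume "u \<in> set_pmf (chain (Suc k))"
    then have "length u = N + Suc k" using set_chain by blast
    then have "u \<noteq> []" by auto
    then show "map_pmf (\<lambda>e. tl (take (Suc k) u @ e)) (next_edge (drop (Suc k) u)) =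
        map_pmf (\<lambda>e. take k (tl u) @ e) (next_edge (drop k (tl u)))"
      by (cases u) simp_all
  qed
  also have "\<dots> = bind_pmf (map_pmf tl (chain (Suc k))) (\<lambda>u. map_pmf (\<lambda>e. take k u @ e) (next_edge (drop k u)))"
    by (simp only: bind_map_pmf)
  also have "\<dots> = chain (Suc k)" unfolding Suc by (simp only: chain.simps(2))
  finally show ?case .
qed

text \<open>A word has exactly one predecessor in the chain, its initial part, so the sum over the
  predecessors has a single term.\<close>

lemma pmf_chain_Suc:
  assumes w: "w \<in> set_pmf (chain (Suc k))"
  shows "pmf (chain (Suc k)) w = pmf (chain k) (butlast w) * (q (drop k w) / outflow q (butlast (drop k w)))"
proof -
  obtain u e where u: "u \<in> set_pmf (chain k)" and e: "e \<in> set_pmf (next_edge (drop k u))" and we: "w = take k u @ e"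
    using w by auto
  note gl = glue[OF u e]
  have u': "drop k u \<in> butlast ` set_pmf flow_pmf" using set_chain[OF u] by blast
  have "pmf (map_pmf (\<lambda>e. take k x @ e) (next_edge (drop k x))) w = indicator {u} x * (q e / outflow q (butlast e))"
    if x: "x \<in> set_pmf (chain k)" for x
  proof (cases "x = u")
    case True
    have "pmf (map_pmf (\<lambda>e. take k u @ e) (next_edge (drop k u))) (take k u @ e) = pmf (next_edge (drop k u)) e"
      by (rule pmf_map_inj') (simp add: inj_on_def)
    then show ?thesis using True set_next_edge(3)[OF u'] gl(1) by (simp add: we)
  next
    case False
    have "w \<noteq> take k x @ e'" if e': "e' \<in> set_pmf (next_edge (drop k x))" for e'
      using glue(3)[OF x e'] gl(3) False by (metis we)
    then have "w \<notin> set_pmf (map_pmf (\<lambda>e. take k x @ e) (next_edge (drop k x)))" by auto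
    then have "pmf (map_pmf (\<lambda>e. take k x @ e) (next_edge (drop k x))) w = 0" unfolding set_pmf_iff by blast
    moreover have "indicator {u} x = (0 :: real)" using False by simp
    ultimately show ?thesis by (simp only: mult_zero_left)
  qed
  then have "pmf (chain (Suc k)) w = measure_pmf.expectation (chain k) (\<lambda>x. indicator {u} x * (q e / outflow q (butlast e)))"
    unfolding chain.simps(2) pmf_bind by (intro integral_cong_AE) (auto simp: AE_measure_pmf_iff)
  also have "\<dots> = pmf (chain k) u * (q e / outflow q (butlast e))" by (simp add: pmf.rep_eq)
  finally show ?thesis using gl by (simp add: we)
qed

end

context
  fixes q assumes q: "q \<in> flows"
begin

lemma markov_measure_exists:
  obtains \<mu> :: "(nat \<Rightarrow> nat) measure" where "measure_preserving_map \<mu> left_shift" "sets \<mu> = sets borel"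
    "\<And>k. distr \<mu> (count_space UNIV) (word (N + k)) = measure_pmf (chain q k)"
proof -
  obtain \<mu> :: "(nat \<Rightarrow> nat) measure" where \<mu>: "prob_space \<mu>" "sets \<mu> = sets borel"
    and word_distr: "\<And>k. distr \<mu> (count_space UNIV) (word (N + k)) = measure_pmf (chain q k)"
    using word_measure_exists[of "chain q" N] set_chain[OF q] map_butlast_chain[OF q] by metis
  note meas = measurable_cong_sets[OF \<mu>(2) refl]
  have word: "word n \<in> \<mu> \<rightarrow>\<^sub>M count_space UNIV" for n unfolding meas by (rule word_measurable)
  have shift: "left_shift \<in> \<mu> \<rightarrow>\<^sub>M \<mu>" using left_shift_borel measurable_cong_sets[OF \<mu>(2) \<mu>(2)] by blast
  have space: "space \<mu> = UNIV" using sets_eq_imp_space_eq[OF \<mu>(2)] by simp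
  have "distr \<mu> \<mu> left_shift = \<mu>"
  proof (rule measure_eqI_generator_eq[OF Int_stable_word_sets, of UNIV _ _ "\<lambda>_. UNIV"])
    fix B assume "B \<in> word_sets"
    then obtain m W where B: "B = {x. word m x \<in> W}" by (auto simp: word_sets_def)
    \<comment> \<open>The laws are known for words of length at least N; the condition on the first
      m letters is therefore read off from words of length N + m.\<close>
    define S where "S = {w. take m w \<in> W}"
    have take: "take m (word (N + m) x) = word m x" for x by (simp add: take_map)
    have B': "B = word (N + m) -` S \<inter> space \<mu>" using take by (auto simp: B S_def space)
    have sB: "left_shift -` B \<inter> space \<mu> = word (N + Suc m) -` (tl -` S) \<inter> space \<mu>"
      unfolding B' space by (simp add: word_left_shift vimage_def del: upt_Suc)
    have Bs: "B \<in> sets \<mu>" unfolding B' by (rule measurable_sets[OF word]) simp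
    have "emeasure (distr \<mu> \<mu> left_shift) B = emeasure \<mu> (word (N + Suc m) -` (tl -` S) \<inter> space \<mu>)"
      by (simp only: emeasure_distr[OF shift Bs] sB)
    also have "\<dots> = emeasure (distr \<mu> (count_space UNIV) (word (N + Suc m))) (tl -` S)"
      by (rule emeasure_distr[OF word, symmetric]) simp
    also have "\<dots> = emeasure (map_pmf tl (chain q (Suc m))) S" unfolding word_distr by simp
    also have "\<dots> = emeasure (distr \<mu> (count_space UNIV) (word (N + m))) S"
      unfolding map_tl_chain[OF q] word_distr ..
    also have "\<dots> = emeasure \<mu> B" unfolding B' by (rule emeasure_distr[OF word]) simp
    finally show "emeasure (distr \<mu> \<mu> left_shift) B = emeasure \<mu> B" .
  next
    interpret prob_space "distr \<mu> \<mu> left_shift" by (rule prob_space.prob_space_distr[OF \<mu>(1) shift])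
    show "emeasure (distr \<mu> \<mu> left_shift) UNIV \<noteq> \<infinity>" by simp
    have "{x :: nat \<Rightarrow> nat. word 0 x \<in> UNIV} \<in> word_sets" unfolding word_sets_def by blast
    then show "range (\<lambda>_ :: nat. UNIV) \<subseteq> word_sets" by auto
  qed (auto simp: \<mu>(2) sets_borel_word_sets)
  then have "measure_preserving_map \<mu> left_shift"
    using \<mu>(1) shift by (simp add: measure_preserving_map_def measure_preserving_map_axioms_def)
  then show ?thesis using that \<mu>(2) word_distr by blast
qed

lemma flow_measure_exists:
  obtains \<mu> where "\<mu> \<in> invariant_measures X" "flow_of \<mu> = q" "ks_entropy \<mu> left_shift = ereal (flow_entropy q)"
proof -
  obtain \<mu> :: "(nat \<Rightarrow> nat) measure" where mp: "measure_preserving_map \<mu> left_shift" and sets: "sets \<mu> = sets borel"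
    and word_distr: "\<And>k. distr \<mu> (count_space UNIV) (word (N + k)) = measure_pmf (chain q k)"
    using markov_measure_exists by blast
  interpret measure_preserving_map \<mu> left_shift by (rule mp)
  have space: "space \<mu> = UNIV" using sets_eq_imp_space_eq[OF sets] by simp
  have word: "word n \<in> \<mu> \<rightarrow>\<^sub>M count_space UNIV" for n
    unfolding measurable_cong_sets[OF sets refl] by (rule word_measurable)
  have chain_eq: "prob (word (N + k) -` {w}) = pmf (chain q k) w" for k w
    using measure_distr[OF word[of "N + k"], of "{w}"] by (simp add: word_distr space measure_pmf_single)
  have "AE x in distr \<mu> (count_space UNIV) (word (N + Suc 0)). x \<in> edges"
    unfolding word_distr chain_1[OF q] using set_flow_pmf[OF q] by (auto simp: AE_measure_pmf_iff)
  then have "AE x in \<mu>. word (Suc N) x \<in> edges" by (simp add: AE_distr_iff[OF word] del: upt_Suc)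
  \<comment> \<open>By invariance every window has the law of the first one. So almost surely all
    windows are edges, and \<open>memory\<close> places the point in \<open>X\<close>.\<close>
  then have base: "AE x in distr \<mu> \<mu> (left_shift ^^ n). word (Suc N) x \<in> edges" for n by (simp only: distr_funpow)
  have "{x \<in> space \<mu>. word (Suc N) x \<in> edges} \<in> events"
    using measurable_sets[OF word[of "Suc N"], of edges] by (simp add: vimage_def Int_def conj_commute del: upt_Suc)
  then have "AE x in \<mu>. word (Suc N) ((left_shift ^^ n) x) \<in> edges" for n
    using base[of n] by (simp only: AE_distr_iff[OF funpow_measurable])
  then have "AE x in \<mu>. \<forall>n. word (Suc N) ((left_shift ^^ n) x) \<in> edges" by (simp add: AE_all_countable)
  then have AE: "AE x in \<mu>. x \<in> X" by eventually_elim (rule memory, simp add: edges_def)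
  have X: "X \<in> sets \<mu>" using space_borel_X sets by simp
  have X1: "emeasure \<mu> X = 1" using AE X by (simp add: emeasure_eq_1_AE)
  \<comment> \<open>Invariant measures live on \<open>X\<close>; the measure on all sequences is
    restricted to this set of full measure.\<close>
  define \<nu> where "\<nu> = restrict_space \<mu> X"
  have \<nu>: "emeasure \<nu> (A \<inter> X) = emeasure \<mu> A" if "A \<in> sets \<mu>" for A
  proof -
    have "emeasure \<nu> (A \<inter> X) = emeasure \<mu> (A \<inter> X)"
      unfolding \<nu>_def using X by (intro emeasure_restrict_space) (auto simp: space)
    also have "\<dots> = emeasure \<mu> A" using that X AE by (intro emeasure_eq_AE) auto
    finally show ?thesis .
  qed
  have space_\<nu>: "space \<nu> = X" by (simp add: \<nu>_def space_restrict_space space)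
  have sets_\<nu>: "sets \<nu> = sets (restrict_space borel X)" unfolding \<nu>_def by (rule sets_restrict_space_cong[OF sets])
  have shift_\<nu>: "left_shift \<in> \<nu> \<rightarrow>\<^sub>M \<nu>"
    using left_shift_measurable measurable_cong_sets[OF sets_\<nu> sets_\<nu>] by blast
  have "distr \<nu> \<nu> left_shift = \<nu>"
  proof (rule measure_eqI)
    fix A assume "A \<in> sets (distr \<nu> \<nu> left_shift)"
    then have A: "A \<in> sets \<nu>" by simp
    then have A': "A \<in> sets \<mu>" "A \<subseteq> X" using X by (auto simp: \<nu>_def sets_restrict_space)
    have "emeasure (distr \<nu> \<nu> left_shift) A = emeasure \<nu> ((left_shift -` A \<inter> space \<mu>) \<inter> X)"
      by (simp add: emeasure_distr[OF shift_\<nu> A] space space_\<nu>)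
    also have "\<dots> = emeasure (distr \<mu> \<mu> left_shift) A"
      using measurable_sets[OF T_measurable A'(1)] by (simp add: \<nu> emeasure_distr[OF T_measurable A'(1)])
    also have "\<dots> = emeasure \<nu> (A \<inter> X)" unfolding distr_T by (rule \<nu>[OF A'(1), symmetric])
    finally show "emeasure (distr \<nu> \<nu> left_shift) A = emeasure \<nu> A" using A'(2) by (simp add: Int_absorb2)
  qed simp
  moreover have "prob_space \<nu>" unfolding \<nu>_def by (rule prob_space_restrict_space[OF X X1])
  ultimately have inv: "\<nu> \<in> invariant_measures X" using sets_\<nu> by (simp add: invariant_measures_def)
  interpret nu: measure_preserving_map \<nu> left_shift by (rule measure_preserving_shift[OF inv])
  have pmf: "nu.prob (word (N + k) -` {w} \<inter> space \<nu>) = pmf (chain q k) w" for k w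
  proof -
    have "word (N + k) -` {w} \<in> sets \<mu>" using measurable_sets[OF word, of "{w}"] by (simp add: space)
    from \<nu>[OF this] show ?thesis by (simp add: measure_def space_\<nu> chain_eq[symmetric])
  qed
  have flow: "flow_of \<nu> = q"
  proof
    fix e
    have "flow_of \<nu> e = nu.prob (word (N + Suc 0) -` {e} \<inter> space \<nu>)"
      unfolding flow_of_def space_\<nu> by (rule arg_cong[where f = nu.prob]) auto
    then show "flow_of \<nu> e = q e" by (simp only: pmf chain_1[OF q] pmf_flow_pmf[OF q])
  qed
  \<comment> \<open>For the Markov measure the increments are constant: each new letter multiplies
    the probability by one transition, so the increment is minus the expected logarithm of the last
    transition probability.\<close>
  have "nu.rv_entropy (word (Suc n)) - nu.rv_entropy (word n) = flow_entropy q" if "n \<ge> N" for n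
  proof -
    define k where "k = n - N"
    have n: "n = N + k" "Suc n = N + Suc k" using that by (auto simp: k_def)
    define S where "S = word (Suc n) ` space \<nu>"
    define g where "g e = ln (q e / outflow q (butlast e))" for e
    define p where "p = pmf (chain q (Suc k))"
    note sw = simple_word[OF inv]
    have finS: "finite S" unfolding S_def by (rule simple_functionD(1)[OF sw])
    have 1: "nu.rv_entropy (word (Suc n)) = - (\<Sum>w\<in>S. p w * ln (p w))"
      unfolding nu.rv_entropy_def S_def p_def n(2) by (simp only: pmf)
    have 2: "nu.rv_entropy (word n) = - (\<Sum>w\<in>S. p w * ln (pmf (chain q k) (butlast w)))"
      using nu.rv_entropy_factor_sum[OF sw[of "Suc n"], of "word n" butlast, OF butlast_word[symmetric]]
      unfolding S_def p_def n(1,2)[symmetric] pmf[of "Suc k", folded n(2), symmetric] pmf[of k, folded n(1), symmetric] .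
    have "p w * ln (p w) - p w * ln (pmf (chain q k) (butlast w)) = p w * g (drop k w)" for w
    proof (cases "p w = 0")
      case False
      then have w: "w \<in> set_pmf (chain q (Suc k))" by (simp add: p_def set_pmf_iff)
      have eq: "p w = pmf (chain q k) (butlast w) * (q (drop k w) / outflow q (butlast (drop k w)))"
        unfolding p_def by (rule pmf_chain_Suc[OF q w])
      have "p w > 0" using False by (simp add: p_def less_le)
      then have *: "0 < pmf (chain q k) (butlast w) * (q (drop k w) / outflow q (butlast (drop k w)))"
        unfolding eq .
      then have "pmf (chain q k) (butlast w) \<noteq> 0" by (metis mult_zero_left less_irrefl)
      then have "pmf (chain q k) (butlast w) > 0" by (simp add: less_le)
      moreover from zero_less_mult_pos[OF * this] have "q (drop k w) / outflow q (butlast (drop k w)) > 0" .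
      ultimately have "ln (p w) = ln (pmf (chain q k) (butlast w)) + g (drop k w)"
        unfolding eq g_def by (rule ln_mult_pos)
      then show ?thesis by (simp add: algebra_simps)
    qed simp
    then have "(\<Sum>w\<in>S. p w * g (drop k w)) = (\<Sum>w\<in>S. p w * ln (p w)) - (\<Sum>w\<in>S. p w * ln (pmf (chain q k) (butlast w)))"
      by (simp add: sum_subtractf[symmetric])
    then have "nu.rv_entropy (word (Suc n)) - nu.rv_entropy (word n) = - (\<Sum>w\<in>S. p w * g (drop k w))"
      unfolding 1 2 by simp
    \<comment> \<open>Words are grouped by their last window, whose law is \<open>q\<close> by
      invariance.\<close>
    also have "(\<Sum>w\<in>S. p w * g (drop k w)) = (\<Sum>e\<in>edges. \<Sum>w | w \<in> S \<and> drop k w = e. p w * g (drop k w))"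
    proof (rule sum.group[OF finS finite_edges, symmetric])
      show "drop k ` S \<subseteq> edges"
      proof safe
        fix w assume "w \<in> S"
        then obtain x where x: "x \<in> X" "w = word (Suc n) x" by (auto simp: S_def space_\<nu>)
        have "drop k w = word (Suc N) ((left_shift ^^ k) x)"
          unfolding x(2) n(2) by (simp add: drop_map left_shift_funpow list_eq_iff_nth_eq add.commute del: upt_Suc)
        then show "drop k w \<in> edges" unfolding edges_def by (rule image_eqI[OF _ shift_funpow[OF x(1)]])
      qed
    qed
    also have "\<dots> = (\<Sum>e\<in>edges. q e * g e)"
    proof (rule sum.cong[OF refl])
      fix e assume "e \<in> edges"
      have drop: "word (Suc N) ((left_shift ^^ k) x) = drop k (word (Suc n) x)" for x
        unfolding n(2) by (simp add: drop_map left_shift_funpow list_eq_iff_nth_eq add.commute del: upt_Suc)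
      have "(\<Sum>w | w \<in> S \<and> drop k w = e. p w * g (drop k w)) = (\<Sum>w | w \<in> S \<and> drop k w = e. p w) * g e"
        unfolding sum_distrib_right by (intro sum.cong) auto
      also have "(\<Sum>w | w \<in> S \<and> drop k w = e. p w) = nu.prob ((\<lambda>x. word (Suc N) ((left_shift ^^ k) x)) -` {e} \<inter> space \<nu>)"
        unfolding nu.prob_factor_sum[OF sw[of "Suc n"], of "\<lambda>x. word (Suc N) ((left_shift ^^ k) x)" "drop k", OF drop]
        unfolding S_def p_def pmf[of "Suc k", folded n(2), symmetric] ..
      also have "(\<lambda>x. word (Suc N) ((left_shift ^^ k) x)) -` {e} \<inter> space \<nu>
          = (left_shift ^^ k) -` (word (Suc N) -` {e} \<inter> space \<nu>) \<inter> space \<nu>"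
        using nu.funpow_space by auto
      also have "nu.prob \<dots> = nu.prob (word (Suc N) -` {e} \<inter> space \<nu>)"
        by (rule nu.prob_funpow[OF simple_functionD(2)[OF sw]])
      also have "\<dots> = q e" unfolding flow_of_eq[OF inv, symmetric] flow ..
      finally show "(\<Sum>w | w \<in> S \<and> drop k w = e. p w * g (drop k w)) = q e * g e" .
    qed
    finally show ?thesis by (simp add: flow_entropy_def g_def)
  qed
  then have "ereal (flow_entropy q) \<le> ks_entropy \<nu> left_shift"
    using ks_entropy_ge_flow_entropy[OF inv] by (simp add: flow)
  then have "ks_entropy \<nu> left_shift = ereal (flow_entropy q)"
    using ks_entropy_le_flow_entropy[OF inv] by (intro antisym) (simp_all add: flow)
  then show ?thesis using that inv flow by blast
qed

end

section \<open>The rotation set and the localized entropy in terms of flows\<close>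

context
  fixes \<Phi> :: "(nat \<Rightarrow> nat) \<Rightarrow> real ^ 'm" and \<phi> :: "nat list \<Rightarrow> real ^ 'm"
  assumes \<Phi>: "\<And>x. x \<in> X \<Longrightarrow> \<Phi> x = \<phi> (word (Suc N) x)"
begin

lemma rotation_vector_mean: "\<mu> \<in> invariant_measures X \<Longrightarrow> rotation_vector \<Phi> \<mu> = mean \<phi> (flow_of \<mu>)"
  by (rule rotation_vector_eq_mean) (simp_all add: \<Phi> del: upt_Suc)

lemma rotation_set_eq_mean_flows: "rotation_set X \<Phi> = mean \<phi> ` flows"
proof
  show "rotation_set X \<Phi> \<subseteq> mean \<phi> ` flows"
    using rotation_vector_mean flow_of_in_flows by (auto simp: rotation_set_def)
  show "mean \<phi> ` flows \<subseteq> rotation_set X \<Phi>"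
  proof
    fix w assume "w \<in> mean \<phi> ` flows"
    then obtain q where q: "q \<in> flows" "w = mean \<phi> q" by blast
    obtain \<mu> where "\<mu> \<in> invariant_measures X" "flow_of \<mu> = q" using flow_measure_exists[OF q(1)] by metis
    then show "w \<in> rotation_set X \<Phi>"
      unfolding rotation_set_def using rotation_vector_mean[of \<mu>] q(2) by (metis image_eqI)
  qed
qed

lemma localized_entropy_eq_max_entropy:
  assumes w: "w \<in> mean \<phi> ` flows"
  shows "localized_entropy X \<Phi> w = max_entropy \<phi> w"
proof -
  have "(SUP \<mu>\<in>{\<mu> \<in> invariant_measures X. rotation_vector \<Phi> \<mu> = w}. ks_entropy \<mu> left_shift) = ereal (max_entropy \<phi> w)"
  proof (rule SUP_eqI)
    fix \<mu> assume "\<mu> \<in> {\<mu> \<in> invariant_measures X. rotation_vector \<Phi> \<mu> = w}"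
    then have \<mu>: "\<mu> \<in> invariant_measures X" "rotation_vector \<Phi> \<mu> = w" by auto
    have "flow_entropy (flow_of \<mu>) \<le> max_entropy \<phi> w"
      using max_entropy_ge[OF flow_of_in_flows[OF \<mu>(1)], of \<phi>] rotation_vector_mean[OF \<mu>(1)] \<mu>(2) by simp
    then have "ereal (flow_entropy (flow_of \<mu>)) \<le> ereal (max_entropy \<phi> w)" by simp
    with ks_entropy_le_flow_entropy[OF \<mu>(1)] show "ks_entropy \<mu> left_shift \<le> ereal (max_entropy \<phi> w)" by (rule order_trans)
  next
    fix y assume y: "\<And>\<mu>. \<mu> \<in> {\<mu> \<in> invariant_measures X. rotation_vector \<Phi> \<mu> = w} \<Longrightarrow> ks_entropy \<mu> left_shift \<le> y"
    obtain q where q: "q \<in> flows" "mean \<phi> q = w" "flow_entropy q = max_entropy \<phi> w"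
      using max_entropy_attained[OF w] by metis
    obtain \<mu> where \<mu>: "\<mu> \<in> invariant_measures X" "flow_of \<mu> = q" "ks_entropy \<mu> left_shift = ereal (flow_entropy q)"
      using flow_measure_exists[OF q(1)] by metis
    have "rotation_vector \<Phi> \<mu> = w" using rotation_vector_mean[OF \<mu>(1)] \<mu>(2) q(2) by simp
    then show "ereal (max_entropy \<phi> w) \<le> y" using y[of \<mu>] \<mu> q(3) by simp
  qed
  then show ?thesis by (simp add: localized_entropy_def)
qed

end

end

lemma sft_shift_space:
  assumes "N \<ge> 1"
  shows "shift_space (sft d A) d N"
proof
  fix x assume *: "\<And>n. word (Suc N) ((left_shift ^^ n) x) \<in> word (Suc N) ` sft d A"
  have "x n < d \<and> A (x n) (x (Suc n)) = 1" for n
  proof -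
    obtain y where y: "y \<in> sft d A" "word (Suc N) ((left_shift ^^ n) x) = word (Suc N) y" using *[of n] by blast
    then have "x (i + n) = y i" if "i < Suc N" for i using that unfolding word_eq_iff left_shift_funpow by blast
    from this[of 0] this[of 1] have "x n = y 0" "x (Suc n) = y (Suc 0)" using assms by simp_all
    then show ?thesis using y(1) by (simp add: sft_def)
  qed
  then show "x \<in> sft d A" by (simp add: sft_def)
qed (auto simp: sft_def left_shift_def)

lemma sft_coding:
  fixes \<Phi> :: "(nat \<Rightarrow> nat) \<Rightarrow> real ^ 'm"
  assumes "locally_constant_on (sft d A) \<Phi>"
  obtains N \<phi> where "shift_space (sft d A) d N" "\<And>x. x \<in> sft d A \<Longrightarrow> \<Phi> x = \<phi> (word (Suc N) x)"
proof -
  obtain k where k: "\<And>x y. x \<in> sft d A \<Longrightarrow> y \<in> sft d A \<Longrightarrow> \<forall>i<k. x i = y i \<Longrightarrow> \<Phi> x = \<Phi> y"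
    using assms unfolding locally_constant_on_def by blast
  \<comment> \<open>At least 1, because admissibility in the subshift reads pairs of
    letters.\<close>
  define N where "N = max 1 k"
  define \<phi> where "\<phi> e = \<Phi> (SOME x. x \<in> sft d A \<and> word (Suc N) x = e)" for e
  have "\<Phi> x = \<phi> (word (Suc N) x)" if x: "x \<in> sft d A" for x
  proof -
    define y where "y = (SOME y. y \<in> sft d A \<and> word (Suc N) y = word (Suc N) x)"
    have "y \<in> sft d A \<and> word (Suc N) y = word (Suc N) x" unfolding y_def by (rule someI[of _ x]) (simp add: x)
    then have "\<Phi> x = \<Phi> y" using x unfolding word_eq_iff by (intro k) (auto simp: N_def)
    then show ?thesis by (simp only: \<phi>_def y_def)
  qed
  moreover have "shift_space (sft d A) d N" by (rule sft_shift_space) (simp add: N_def)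
  ultimately show ?thesis using that by blast
qed

section \<open>Differentiability of concave envelopes on an interval\<close>

definition supergradient :: "(real \<Rightarrow> real) \<Rightarrow> real \<Rightarrow> real \<Rightarrow> bool" where
  "supergradient g t s \<longleftrightarrow> (\<forall>z\<in>{0..1}. g z \<le> g t + s * (z - t))"

lemma supergradient_exists:
  assumes "concave_on {0..1} g" "0 < t" "t < 1"
  shows "\<exists>s. supergradient g t s"
proof -
  have "convex_on {0..1} (\<lambda>x. - g x)" using assms(1) by (simp add: concave_on_def)
  from convex_le_Inf_differential[OF this, of t] assms(2,3)
  show ?thesis
    unfolding supergradient_def
    by (intro exI[of _ "- Inf ((\<lambda>y. (- g t - - g y) / (t - y)) ` ({t<..} \<inter> {0..1}))"]) (force simp: interior_atLeastAtMost_real)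
qed

lemma supergradient_antimono:
  assumes "supergradient g t s" "supergradient g t' s'" "t \<in> {0..1}" "t' \<in> {0..1}" "t < t'"
  shows "s' \<le> s"
proof -
  have "g t' \<le> g t + s * (t' - t)" "g t \<le> g t' + s' * (t - t')" using assms unfolding supergradient_def by auto
  then have "0 \<le> (s - s') * (t' - t)" by (simp add: algebra_simps)
  then show ?thesis using assms(5) by (simp add: zero_le_mult_iff)
qed

text \<open>If the slopes to the right of \<open>t\<close> stayed below \<open>s t - e\<close>,
  their supporting lines would produce in the limit a second supergradient at
  \<open>t\<close>.\<close>

lemma supergradient_right_continuous:
  assumes sg: "\<And>t. u < t \<Longrightarrow> t < v \<Longrightarrow> supergradient g t (s t)"
    and uniq: "\<And>t s'. u < t \<Longrightarrow> t < v \<Longrightarrow> supergradient g t s' \<Longrightarrow> s' = s t"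
    and uv: "0 \<le> u" "v \<le> 1" and t: "u < t" "t < v" and cont: "isCont g t" and e: "0 < e"
  shows "\<exists>t'>t. t' < v \<and> s t - e < s t'"
proof (rule ccontr)
  assume "\<not> ?thesis"
  then have le: "s t' \<le> s t - e" if "t < t'" "t' < v" for t' using that by force
  have "supergradient g t (s t - e)"
    unfolding supergradient_def
  proof
    fix z :: real assume z: "z \<in> {0..1}"
    have gz: "g z \<le> g t + s t * (z - t)" using sg[OF t] z unfolding supergradient_def by blast
    show "g z \<le> g t + (s t - e) * (z - t)"
    proof (cases "z \<le> t")
      case True
      then have "0 \<le> e * (t - z)" using e by simp
      then show ?thesis using gz by (simp add: algebra_simps)
    next
      case False
      have "((\<lambda>t'. g t' + (s t - e) * (z - t')) \<longlongrightarrow> g t + (s t - e) * (z - t)) (at_right t)"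
        using cont by (intro tendsto_intros) (simp add: isCont_def filterlim_at_split)
      moreover have "eventually (\<lambda>t'. g z \<le> g t' + (s t - e) * (z - t')) (at_right t)"
      proof (rule eventually_at_rightI[of t "min v z"])
        fix t' assume t': "t' \<in> {t<..<min v z}"
        have "g z \<le> g t' + s t' * (z - t')" using sg[of t'] z t t' unfolding supergradient_def by auto
        also have "s t' * (z - t') \<le> (s t - e) * (z - t')" using le[of t'] t' by (intro mult_right_mono) auto
        finally show "g z \<le> g t' + (s t - e) * (z - t')" by simp
      qed (use t False in auto)
      ultimately show ?thesis by (rule tendsto_lowerbound) simp
    qed
  qed
  then show False using uniq[OF t] e by fastforce
qed

text \<open>Reflection converts the statement on right limits of the slopes into the one on left
  limits.\<close>

lemma supergradient_reflect:
  "supergradient (\<lambda>t. g (1 - t)) t s \<longleftrightarrow> supergradient g (1 - t) (- s)"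
proof -
  have "(\<forall>z\<in>{0..1}. g (1 - z) \<le> g (1 - t) + s * (z - t)) \<longleftrightarrow> (\<forall>z\<in>{0..1}. g z \<le> g (1 - t) + - s * (z - (1 - t)))"
  proof (intro iffI ballI)
    fix z :: real assume *: "\<forall>z\<in>{0..1}. g (1 - z) \<le> g (1 - t) + s * (z - t)" and "z \<in> {0..1}"
    then have "g (1 - (1 - z)) \<le> g (1 - t) + s * ((1 - z) - t)" by (intro bspec[OF *]) auto
    then show "g z \<le> g (1 - t) + - s * (z - (1 - t))" by (simp add: algebra_simps)
  next
    fix z :: real assume *: "\<forall>z\<in>{0..1}. g z \<le> g (1 - t) + - s * (z - (1 - t))" and "z \<in> {0..1}"
    then have "g (1 - z) \<le> g (1 - t) + - s * ((1 - z) - (1 - t))" by (intro bspec[OF *]) auto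
    then show "g (1 - z) \<le> g (1 - t) + s * (z - t)" by (simp add: algebra_simps)
  qed
  then show ?thesis by (simp add: supergradient_def)
qed

text \<open>The slopes decrease, and uniqueness excludes jumps, so they are continuous. The
  supporting lines at two points then squeeze the difference quotient between their slopes.\<close>

lemma concave_C1_of_unique_supergradient:
  assumes conc: "concave_on {0..1} g" and uv: "0 \<le> u" "v \<le> 1"
    and uniq: "\<And>t s s'. u < t \<Longrightarrow> t < v \<Longrightarrow> supergradient g t s \<Longrightarrow> supergradient g t s' \<Longrightarrow> s = s'"
  shows "g C1_differentiable_on {u<..<v}"
proof -
  define s where "s t = (SOME s. supergradient g t s)" for t
  have sg: "supergradient g t (s t)" if "u < t" "t < v" for t
    unfolding s_def by (rule someI_ex) (use supergradient_exists[OF conc] that uv in auto)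
  have "continuous_on {0<..<1} g"
  proof -
    have "convex_on {0<..<1} (\<lambda>x. - g x)"
      using conc unfolding concave_on_def by (rule convex_on_subset) auto
    then have "continuous_on {0<..<1} (\<lambda>x. - g x)" by (intro convex_on_continuous) auto
    then show ?thesis using continuous_on_minus by fastforce
  qed
  then have cont: "isCont g t" if "u < t" "t < v" for t
    using that uv by (simp add: continuous_on_eq_continuous_at)
  have anti: "s t' \<le> s t" if "u < t" "t \<le> t'" "t' < v" for t t'
    using that uv by (cases "t = t'") (auto intro: supergradient_antimono[OF sg sg])
  have right: "\<exists>t'>t. t' < v \<and> s t - e < s t'" if "u < t" "t < v" "0 < e" for t e
    by (rule supergradient_right_continuous[OF sg _ uv that(1,2) cont[OF that(1,2)] that(3)])
       (use uniq sg in blast)+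
  have left: "\<exists>t'<t. u < t' \<and> s t' < s t + e" if t: "u < t" "t < v" "0 < e" for t e
  proof -
    have c: "isCont (\<lambda>x. g (1 - x)) (1 - t)"
      using cont[OF t(1,2)] isCont_o2[where f = "\<lambda>x. 1 - x" and g = g and a = "1 - t"] by simp
    have "\<exists>t'>1 - t. t' < 1 - u \<and> - s (1 - (1 - t)) - e < - s (1 - t')"
    proof (rule supergradient_right_continuous[of "1 - v" "1 - u" "\<lambda>x. g (1 - x)" "\<lambda>x. - s (1 - x)", OF _ _ _ _ _ _ c t(3)])
      fix x s' assume x: "1 - v < x" "x < 1 - u"
      show "supergradient (\<lambda>x. g (1 - x)) x (- s (1 - x))" unfolding supergradient_reflect using sg[of "1 - x"] x by simp
      assume "supergradient (\<lambda>x. g (1 - x)) x s'"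
      then have "supergradient g (1 - x) (- s')" unfolding supergradient_reflect .
      then show "s' = - s (1 - x)" using uniq[of "1 - x" "- s'" "s (1 - x)"] sg[of "1 - x"] x by simp
    qed (use t uv in auto)
    then obtain t' where "1 - t < t'" "t' < 1 - u" "s (1 - t') < s t + e" by auto
    then show ?thesis by (intro exI[of _ "1 - t'"]) auto
  qed
  have scont: "isCont s t" if t: "u < t" "t < v" for t
    unfolding continuous_at_eps_delta
  proof (intro allI impI)
    fix e :: real assume e: "0 < e"
    obtain a where a: "a < t" "u < a" "s a < s t + e" using left[OF t e] by blast
    obtain b where b: "t < b" "b < v" "s t - e < s b" using right[OF t e] by blast
    show "\<exists>d>0. \<forall>x'. dist x' t < d \<longrightarrow> dist (s x') (s t) < e"
    proof (intro exI[of _ "min (t - a) (b - t)"] conjI allI impI)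
      fix x' assume "dist x' t < min (t - a) (b - t)"
      then have "a < x'" "x' < b" by (auto simp: dist_real_def)
      then have "s x' \<le> s a" "s b \<le> s x'" using a b anti by auto
      then show "dist (s x') (s t) < e" using a b by (auto simp: dist_real_def)
    qed (use a b in auto)
  qed
  have deriv: "(g has_vector_derivative s t) (at t)" if t: "u < t" "t < v" for t
  proof -
    have "(g has_derivative (\<lambda>h. h * s t)) (at t)"
      unfolding has_derivative_at_within
    proof
      show "((\<lambda>y. (g y - g t - (y - t) * s t) /\<^sub>R norm (y - t)) \<longlongrightarrow> 0) (at t)"
      proof (rule Lim_null_comparison)
        show "((\<lambda>y. \<bar>s y - s t\<bar>) \<longlongrightarrow> 0) (at t)"
          using scont[OF t] unfolding isCont_def by (intro tendsto_rabs_zero) (simp add: LIM_zero)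
        have "eventually (\<lambda>y. y \<in> {u<..<v}) (at t)" using t by (intro eventually_at_in_open') auto
        then show "eventually (\<lambda>y. norm ((g y - g t - (y - t) * s t) /\<^sub>R norm (y - t)) \<le> \<bar>s y - s t\<bar>) (at t)"
        proof eventually_elim
          case (elim y)
          have "g y \<le> g t + s t * (y - t)" "g t \<le> g y + s y * (t - y)"
            using sg[OF t] sg[of y] elim t uv unfolding supergradient_def by auto
          then have "g y - g t - (y - t) * s t \<le> 0" "(s y - s t) * (y - t) \<le> g y - g t - (y - t) * s t"
            by (simp_all add: algebra_simps)
          then have "\<bar>g y - g t - (y - t) * s t\<bar> \<le> \<bar>(s y - s t) * (y - t)\<bar>" by linarith
          then have "\<bar>g y - g t - (y - t) * s t\<bar> \<le> \<bar>s y - s t\<bar> * \<bar>y - t\<bar>" by (simp only: abs_mult)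
          then show ?case by (cases "y = t") (auto simp: divide_simps)
        qed
      qed
    qed (rule bounded_linear_mult_left)
    then show ?thesis by (simp add: has_vector_derivative_def)
  qed
  show ?thesis
    unfolding C1_differentiable_on_def
    using deriv scont by (intro exI[of _ s]) (auto intro: continuous_at_imp_continuous_on)
qed

text \<open>
  At a point of the envelope written as a convex combination of points on the graphs of the \<open>h i\<close>, a
  supporting line touches each of these graphs. It is determined by a contact point other than the given
  one, or by the derivative of \<open>h i\<close> if the contact is at the point itself.
\<close>

lemma envelope_C1:
  fixes g :: "real \<Rightarrow> real" and h :: "'i \<Rightarrow> real \<Rightarrow> real"
  assumes conc: "concave_on {0..1} g" and D: "finite D"
    and sub: "\<And>i. i \<in> D \<Longrightarrow> {\<alpha> i..\<beta> i} \<subseteq> {0..1}"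
    and le: "\<And>i t. i \<in> D \<Longrightarrow> t \<in> {\<alpha> i..\<beta> i} \<Longrightarrow> h i t \<le> g t"
    and dec: "\<And>t. t \<in> {0..1} \<Longrightarrow> \<exists>l x. (\<forall>i\<in>D. 0 \<le> l i \<and> x i \<in> {\<alpha> i..\<beta> i}) \<and> sum l D = 1 \<and>
        t = (\<Sum>i\<in>D. l i * x i) \<and> g t \<le> (\<Sum>i\<in>D. l i * h i (x i))"
    and minorant: "\<And>i t. i \<in> D \<Longrightarrow> \<alpha> i < t \<Longrightarrow> t < \<beta> i \<Longrightarrow> \<exists>e e'. e 0 = h i t \<and>
        (e has_real_derivative e') (at 0) \<and> (\<forall>\<^sub>F \<tau> in at 0. e \<tau> \<le> h i (t + \<tau>))"
    and uv: "0 \<le> u" "v \<le> 1" and avoid: "{u<..<v} \<inter> (\<alpha> ` D \<union> \<beta> ` D) = {}"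
  shows "g C1_differentiable_on {u<..<v}"
proof (rule concave_C1_of_unique_supergradient[OF conc uv])
  fix t s s' assume t: "u < t" "t < v" and s: "supergradient g t s" "supergradient g t s'"
  have t01: "t \<in> {0..1}" using t uv by auto
  obtain l x where lx: "\<And>i. i \<in> D \<Longrightarrow> 0 \<le> l i" "\<And>i. i \<in> D \<Longrightarrow> x i \<in> {\<alpha> i..\<beta> i}" "sum l D = 1"
      "t = (\<Sum>i\<in>D. l i * x i)" "g t \<le> (\<Sum>i\<in>D. l i * h i (x i))"
    using dec[OF t01] by blast
  obtain i where i: "i \<in> D" "l i > 0"
  proof (rule ccontr)
    assume "\<not> thesis"
    then have "l i = 0" if "i \<in> D" for i using that lx(1)[OF that] \<open>\<And>i. \<lbrakk>i \<in> D; 0 < l i\<rbrakk> \<Longrightarrow> thesis\<close> by force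
    then show False using lx(3) by simp
  qed
  have x01: "x j \<in> {0..1}" if "j \<in> D" for j using sub[OF that] lx(2)[OF that] by blast
  \<comment> \<open>A supporting line lies above every \<open>h j\<close>, while \<open>g t\<close>
    is at most the weighted sum of the \<open>h j (x j)\<close>. So the line meets the graph
    wherever the weight is positive.\<close>
  have contact: "h i (x i) = g t + s * (x i - t)" if s: "supergradient g t s" for s
  proof -
    have below: "0 \<le> l j * (g t + s * (x j - t) - h j (x j))" if j: "j \<in> D" for j
    proof (rule mult_nonneg_nonneg[OF lx(1)[OF j]])
      have "g (x j) \<le> g t + s * (x j - t)" using s x01[OF j] unfolding supergradient_def by blast
      then show "0 \<le> g t + s * (x j - t) - h j (x j)" using le[OF j lx(2)[OF j]] by simp
    qed
    have "(\<Sum>j\<in>D. l j * (g t + s * (x j - t) - h j (x j))) =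
        g t * sum l D + s * ((\<Sum>j\<in>D. l j * x j) - t * sum l D) - (\<Sum>j\<in>D. l j * h j (x j))"
      by (simp add: algebra_simps sum.distrib sum_subtractf sum_distrib_left sum_distrib_right)
    also have "\<dots> \<le> 0" using lx(3,4,5) by simp
    finally have "(\<Sum>j\<in>D. l j * (g t + s * (x j - t) - h j (x j))) = 0" using sum_nonneg[of D] below by (meson order_antisym)
    then have "l i * (g t + s * (x i - t) - h i (x i)) = 0"
      using sum_nonneg_eq_0_iff[OF D, of "\<lambda>j. l j * (g t + s * (x j - t) - h j (x j))"] below i by blast
    then show ?thesis using i by simp
  qed
  show "s = s'"
  proof (cases "x i = t")
    case False
    then show ?thesis using contact[OF s(1)] contact[OF s(2)] by simp
  next
    case True
    have "t \<noteq> \<alpha> i" "t \<noteq> \<beta> i" using avoid t i by auto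
    then have ti: "\<alpha> i < t" "t < \<beta> i" using lx(2)[OF i(1)] True by auto
    obtain e e' where e: "e 0 = h i t" "(e has_real_derivative e') (at 0)" "\<forall>\<^sub>F \<tau> in at 0. e \<tau> \<le> h i (t + \<tau>)"
      using minorant[OF i(1) ti] by blast
    \<comment> \<open>Near the contact point the minorant stays below the supporting line, so their
      difference has a local maximum at 0.\<close>
    have "e' = s" if s: "supergradient g t s" for s
    proof -
      have "\<forall>\<^sub>F \<tau> in at 0. \<tau> \<in> {\<alpha> i - t<..<\<beta> i - t}" using ti by (intro eventually_at_in_open') auto
      with e(3) have "\<forall>\<^sub>F \<tau> in at 0. e \<tau> - s * \<tau> \<le> e 0 - s * 0"
      proof eventually_elim
        case (elim \<tau>)
        have "h i (t + \<tau>) \<le> g (t + \<tau>)" using le[OF i(1), of "t + \<tau>"] elim by auto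
        moreover have "g (t + \<tau>) \<le> g t + s * ((t + \<tau>) - t)"
          using s sub[OF i(1)] elim unfolding supergradient_def by (intro bspec[where x = "t + \<tau>"]) auto
        ultimately show ?case using elim(1) e(1) contact[OF s] True by simp
      qed
      then obtain d where d: "d > 0" "\<forall>\<tau>. \<bar>0 - \<tau>\<bar> < d \<longrightarrow> e \<tau> - s * \<tau> \<le> e 0 - s * 0"
        unfolding eventually_at by (metis dist_commute dist_real_def order_refl UNIV_I)
      have "((\<lambda>\<tau>. e \<tau> - s * \<tau>) has_real_derivative e' - s) (at 0)"
        using e(2) by (auto intro!: derivative_eq_intros)
      then have "e' - s = 0" using d by (rule DERIV_local_max)
      then show ?thesis by simp
    qed
    then show ?thesis using s by metis
  qed
qed

section \<open>The entropy on a face\<close>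

context ergodic_graph
begin

text \<open>The flows q + \<tau> \<eta> through the maximiser have their means on the line w +
  \<tau> v, and their entropy is an explicit differentiable function below the maximum. One such
  function touching at \<open>w\<close> fixes the slope of a supporting line there.\<close>

lemma max_entropy_minorant:
  fixes \<phi> :: "'e \<Rightarrow> 'w::euclidean_space"
  assumes w: "w \<in> rel_interior (mean \<phi> ` flows)" and v: "w + v \<in> affine hull (mean \<phi> ` flows)"
  shows "\<exists>e e'. e 0 = max_entropy \<phi> w \<and> (e has_real_derivative e') (at 0) \<and>
    (\<forall>\<^sub>F \<tau> in at 0. e \<tau> \<le> max_entropy \<phi> (w + \<tau> *\<^sub>R v))"
proof -
  have "w \<in> mean \<phi> ` flows" using w rel_interior_subset by blast
  then obtain q where q: "q \<in> flows" "mean \<phi> q = w" "flow_entropy q = max_entropy \<phi> w"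
    and max: "\<And>q'. q' \<in> flows \<Longrightarrow> mean \<phi> q' = w \<Longrightarrow> flow_entropy q' \<le> flow_entropy q"
    using max_entropy_attained by metis
  have q_pos: "q e > 0" if "e \<in> E" for e using maximal_flow_positive[OF w q(1,2) max that] .
  have out_pos: "outflow q (src e) > 0" if "e \<in> E" for e
    using le_outflow[of q e] that q_pos[OF that] flowsD(2)[OF q(1)] by force
  have "v \<in> (\<lambda>x. x - mean \<phi> q) ` (affine hull (mean \<phi> ` flows))"
    using v q(2) by (intro image_eqI[of _ _ "w + v"]) auto
  then obtain \<eta> where \<eta>: "\<eta> \<in> circulations" "sum \<eta> E = 0" "mean \<phi> \<eta> = v"
    using mean_deviations_span[OF q(1)] by metis
  define r where "r \<tau> = q + \<tau> *\<^sub>R \<eta>" for \<tau> :: real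
  have term_deriv: "\<exists>D. ((\<lambda>\<tau>. (a + \<tau> * b) * ln ((a + \<tau> * b) / (c + \<tau> * n))) has_real_derivative D) (at 0)"
    if "a > 0" "c > 0" for a b c n :: real
  proof
    show "((\<lambda>\<tau>. (a + \<tau> * b) * ln ((a + \<tau> * b) / (c + \<tau> * n))) has_real_derivative
        (b * ln (a / c) + a * ((b * c - a * n) / (c * c) / (a / c)))) (at 0)"
      using that by (auto intro!: derivative_eq_intros)
  qed
  have "\<exists>D. \<forall>e\<in>E. ((\<lambda>\<tau>. (q e + \<tau> * \<eta> e) * ln ((q e + \<tau> * \<eta> e) / (outflow q (src e) + \<tau> * outflow \<eta> (src e)))) has_real_derivative D e) (at 0)"
    by (intro bchoice ballI term_deriv q_pos out_pos)
  then obtain D where D: "\<And>e. e \<in> E \<Longrightarrow> ((\<lambda>\<tau>. (q e + \<tau> * \<eta> e) * ln ((q e + \<tau> * \<eta> e) / (outflow q (src e) + \<tau> * outflow \<eta> (src e)))) has_real_derivative D e) (at 0)"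
    by blast
  have "((\<lambda>\<tau>. flow_entropy (r \<tau>)) has_real_derivative - (\<Sum>e\<in>E. D e)) (at 0)"
    unfolding flow_entropy_def r_def outflow_linear plus_fun_apply scaleR_fun_apply real_scaleR_def
    by (intro DERIV_minus DERIV_sum D)
  moreover have "\<forall>\<^sub>F \<tau> in at 0. flow_entropy (r \<tau>) \<le> max_entropy \<phi> (w + \<tau> *\<^sub>R v)"
  proof -
    have "((\<lambda>\<tau>. q e + \<tau> * \<eta> e) \<longlongrightarrow> q e + 0 * \<eta> e) (at 0)" for e by (intro tendsto_intros)
    then have "((\<lambda>\<tau>. r \<tau> e) \<longlongrightarrow> q e) (at 0)" for e by (simp add: r_def)
    then have "\<forall>\<^sub>F \<tau> in at 0. \<forall>e\<in>E. r \<tau> e > 0"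
      using finite_E q_pos by (intro eventually_ball_finite ballI order_tendstoD(1)) auto
    then show ?thesis
    proof eventually_elim
      case (elim \<tau>)
      have "r \<tau> \<in> circulations"
        unfolding r_def using flowsD(1)[OF q(1)] \<eta>(1) subspace_circulations by (intro subspace_add subspace_scale)
      moreover have "r \<tau> e \<ge> 0" for e
        using elim flowsD(4)[OF q(1)] \<eta>(1) by (cases "e \<in> E") (auto simp: r_def circulations_def less_imp_le)
      moreover have "sum (r \<tau>) E = sum q E + \<tau> * sum \<eta> E"
        by (simp add: r_def sum.distrib sum_distrib_left)
      ultimately have "r \<tau> \<in> flows" using \<eta>(2) flowsD(3)[OF q(1)] by (simp add: flows_def)
      then show ?case using max_entropy_ge[of "r \<tau>" \<phi>] by (simp add: r_def q(2) \<eta>(3))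
    qed
  qed
  moreover have "flow_entropy (r 0) = max_entropy \<phi> w" by (simp add: r_def q(3))
  ultimately show ?thesis by (intro exI[of _ "\<lambda>\<tau>. flow_entropy (r \<tau>)"] exI[of _ "- sum D E"] conjI)
qed

end

lemma segment_point_in_segment:
  fixes p d :: "'w::real_vector"
  assumes "s \<le> r"
  shows "closed_segment (p + s *\<^sub>R d) (p + r *\<^sub>R d) = (\<lambda>t. p + t *\<^sub>R d) ` {s..r}"
proof -
  have "(1 - u) *\<^sub>R (p + s *\<^sub>R d) + u *\<^sub>R (p + r *\<^sub>R d) = p + ((1 - u) * s + u * r) *\<^sub>R d" for u
    by (simp add: algebra_simps)
  then have "closed_segment (p + s *\<^sub>R d) (p + r *\<^sub>R d) = (\<lambda>t. p + t *\<^sub>R d) ` (\<lambda>u. (1 - u) * s + u * r) ` {0..1}"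
    by (simp add: closed_segment_image_interval image_image)
  also have "(\<lambda>u. (1 - u) * s + u * r) ` {0..1} = closed_segment s r"
    by (simp add: closed_segment_image_interval)
  finally show ?thesis using assms by (simp add: closed_segment_eq_real_ivl)
qed

lemma compact_convex_in_segment:
  fixes p d :: "'w::euclidean_space"
  assumes S: "compact S" "convex S" "S \<noteq> {}" "S \<subseteq> (\<lambda>t. p + t *\<^sub>R d) ` {0..1}"
  obtains \<alpha> \<beta> where "\<alpha> \<le> \<beta>" "{\<alpha>..\<beta>} \<subseteq> {0..1}" "S = (\<lambda>t. p + t *\<^sub>R d) ` {\<alpha>..\<beta>}"
proof -
  have "S \<subseteq> closed_segment p (p + d)" using S(4) segment_point_in_segment[of 0 1 p d] by simp
  then have "collinear S" using collinear_closed_segment collinear_subset by blast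
  then obtain a b where ab: "S = closed_segment a b" using compact_convex_collinear_segment[OF S(3,1,2)] by metis
  then have "a \<in> S" "b \<in> S" by auto
  then obtain s r where sr: "a = p + s *\<^sub>R d" "b = p + r *\<^sub>R d" "s \<in> {0..1}" "r \<in> {0..1}" using S(4) by blast
  have "S = (\<lambda>t. p + t *\<^sub>R d) ` {min s r..max s r}"
    using segment_point_in_segment[of s r p d] segment_point_in_segment[of r s p d] sr(1,2) ab closed_segment_commute[of a b]
    by (cases "s \<le> r") (auto simp: min_def max_def)
  then show ?thesis using that[of "min s r" "max s r"] sr(3,4) by auto
qed

context finite_graph
begin

text \<open>Minimality is Jensen's inequality: decomposing an optimal flow exhibits \<open>w\<close>
  as a convex combination of points at which the component entropies add up to at least
  \<open>H w\<close>, and a concave majorant dominates this sum.\<close>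

theorem face_concave_envelope:
  fixes \<phi> :: "'e \<Rightarrow> 'w::euclidean_space"
  assumes le: "\<And>q. q \<in> flows \<Longrightarrow> a \<bullet> mean \<phi> q \<le> b"
    and H: "\<And>w. w \<in> mean \<phi> ` flows \<Longrightarrow> H w = max_entropy \<phi> w"
    and F: "F = {w \<in> mean \<phi> ` flows. a \<bullet> w = b}"
  shows "\<exists>(t::nat) Fs hs. (\<forall>i<t. polytope (Fs i) \<and> Fs i \<subseteq> F \<and> concave_on (Fs i) (hs i) \<and>
            rel_real_analytic_on (rel_interior (Fs i)) (hs i)) \<and> concave_envelope {..<t} Fs hs F H"
proof -
  show ?thesis
  proof (rule face_decomposition[of a \<phi> b], rule le, assumption)
    fix \<D>
    assume \<D>: "finite \<D>" "\<And>D. D \<in> \<D> \<Longrightarrow> \<exists>r. ergodic_graph D src tgt r"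
      "\<And>D. D \<in> \<D> \<Longrightarrow> finite_graph.mean D \<phi> ` finite_graph.flows D src tgt \<subseteq> {w \<in> mean \<phi> ` flows. a \<bullet> w = b}"
      and hle: "\<And>D w. D \<in> \<D> \<Longrightarrow> w \<in> finite_graph.mean D \<phi> ` finite_graph.flows D src tgt \<Longrightarrow>
          finite_graph.max_entropy D src tgt \<phi> w \<le> max_entropy \<phi> w"
      and dec: "\<And>w. w \<in> mean \<phi> ` flows \<Longrightarrow> a \<bullet> w = b \<Longrightarrow>
          \<exists>l x. (\<forall>D\<in>\<D>. 0 \<le> l D \<and> x D \<in> finite_graph.mean D \<phi> ` finite_graph.flows D src tgt) \<and> sum l \<D> = 1 \<and>
            w = (\<Sum>D\<in>\<D>. l D *\<^sub>R x D) \<and>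
            max_entropy \<phi> w \<le> (\<Sum>D\<in>\<D>. l D * finite_graph.max_entropy D src tgt \<phi> (x D))"
    obtain f where f: "bij_betw f {..<card \<D>} \<D>"
      using ex_bij_betw_nat_finite[OF \<D>(1)] by (auto simp: atLeast0LessThan)
    define S where "S D = finite_graph.mean D \<phi> ` finite_graph.flows D src tgt" for D
    define h where "h D = finite_graph.max_entropy D src tgt \<phi>" for D
    have SF: "S D \<subseteq> F" if "D \<in> \<D>" for D using \<D>(3)[OF that] by (simp add: S_def F)
    have comp: "polytope (S D)" "concave_on (S D) (h D)" "rel_real_analytic_on (rel_interior (S D)) (h D)" if D: "D \<in> \<D>" for D
    proof -
      obtain r where "ergodic_graph D src tgt r" using \<D>(2)[OF D] by blast
      then interpret D: ergodic_graph D src tgt r .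
      show "polytope (S D)" unfolding S_def by (rule D.polytope_mean_flows)
      show "concave_on (S D) (h D)" unfolding S_def h_def by (rule D.concave_on_max_entropy)
      show "rel_real_analytic_on (rel_interior (S D)) (h D)" unfolding S_def h_def by (rule D.max_entropy_analytic)
    qed
    have convF: "convex F"
    proof -
      have "F = mean \<phi> ` flows \<inter> {w. a \<bullet> w = b}" by (auto simp: F)
      then show ?thesis by (simp only:) (intro convex_Int convex_mean_flows convex_hyperplane)
    qed
    have FR: "F \<subseteq> mean \<phi> ` flows" by (auto simp: F)
    have "concave_on F (max_entropy \<phi>)"
      using concave_on_max_entropy[of \<phi>] FR convF unfolding concave_on_def by (rule convex_on_subset)
    moreover have FH: "H w = max_entropy \<phi> w" if "w \<in> F" for w using H FR that by blast
    ultimately have concH: "concave_on F H"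
      using convF unfolding concave_on_iff by (metis FH convexD)
    have Un: "(\<Union>i<card \<D>. S (f i)) = (\<Union>D\<in>\<D>. S D)"
      using arg_cong[OF bij_betw_imp_surj_on[OF f], of "\<lambda>A. \<Union> (S ` A)"] by (simp add: image_image)
    have hull: "F = convex hull (\<Union>D\<in>\<D>. S D)"
    proof
      show "F \<subseteq> convex hull (\<Union>D\<in>\<D>. S D)"
      proof
        fix w assume "w \<in> F"
        then obtain l x where lx: "\<forall>D\<in>\<D>. 0 \<le> l D \<and> x D \<in> S D" "sum l \<D> = 1" "w = (\<Sum>D\<in>\<D>. l D *\<^sub>R x D)"
          using dec[of w] unfolding F S_def by blast
        show "w \<in> convex hull (\<Union>D\<in>\<D>. S D)"
          unfolding lx(3) using lx(1,2) \<D>(1) by (intro convex_sum convex_convex_hull) (auto intro: hull_inc)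
      qed
      show "convex hull (\<Union>D\<in>\<D>. S D) \<subseteq> F" using SF convF by (intro hull_minimal) auto
    qed
    have "concave_envelope {..<card \<D>} (\<lambda>i. S (f i)) (\<lambda>i. h (f i)) F H"
      unfolding concave_envelope_def Un
    proof (intro conjI ballI allI impI)
      show "F = convex hull (\<Union>D\<in>\<D>. S D)" by (rule hull)
      show "concave_on F H" by (rule concH)
    next
      fix i x assume "i \<in> {..<card \<D>}" and x: "x \<in> S (f i)"
      then have fi: "f i \<in> \<D>" using bij_betwE[OF f] by blast
      have "x \<in> F" using x SF[OF fi] by blast
      then show "h (f i) x \<le> H x" using hle[OF fi x[unfolded S_def]] FH by (simp add: h_def)
    next
      fix g w assume g: "concave_on F g \<and> (\<forall>i\<in>{..<card \<D>}. \<forall>x\<in>S (f i). h (f i) x \<le> g x)" and w: "w \<in> F"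
      have hg: "h D x \<le> g x" if "D \<in> \<D>" "x \<in> S D" for D x
      proof -
        have "D \<in> f ` {..<card \<D>}" using that(1) by (simp only: bij_betw_imp_surj_on[OF f])
        then show ?thesis using g that(2) by blast
      qed
      obtain l x where lx: "\<forall>D\<in>\<D>. 0 \<le> l D \<and> x D \<in> S D" "sum l \<D> = 1" "w = (\<Sum>D\<in>\<D>. l D *\<^sub>R x D)"
          "max_entropy \<phi> w \<le> (\<Sum>D\<in>\<D>. l D * h D (x D))"
        using dec[of w] w unfolding F S_def h_def by blast
      have "\<D> \<noteq> {}" using lx(2) by auto
      have "H w \<le> (\<Sum>D\<in>\<D>. l D * h D (x D))" using lx(4) FH[OF w] by simp
      also have "\<dots> \<le> (\<Sum>D\<in>\<D>. l D * g (x D))" using lx(1) hg by (intro sum_mono mult_left_mono) auto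
      also have "\<dots> \<le> g w"
      proof -
        have "convex_on F (\<lambda>x. - g x)" using g by (simp add: concave_on_def)
        then have "- g (\<Sum>D\<in>\<D>. l D *\<^sub>R x D) \<le> (\<Sum>D\<in>\<D>. l D * - g (x D))"
          by (intro convex_on_sum \<D>(1) \<open>\<D> \<noteq> {}\<close>) (use lx(1,2) SF in blast)+
        then show ?thesis by (simp add: lx(3) sum_negf)
      qed
      finally show "H w \<le> g w" .
    qed
    then show ?thesis
      using comp SF bij_betwE[OF f]
      by (intro exI[of _ "card \<D>"] exI[of _ "\<lambda>i. S (f i)"] exI[of _ "\<lambda>i. h (f i)"]) auto
  qed
qed

theorem face_entropy_C1:
  fixes \<phi> :: "'e \<Rightarrow> 'w::euclidean_space"
  assumes le: "\<And>q. q \<in> flows \<Longrightarrow> a \<bullet> mean \<phi> q \<le> b"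
    and seg: "{w \<in> mean \<phi> ` flows. a \<bullet> w = b} = closed_segment p q" and pq: "p \<noteq> q"
  obtains B where "finite B" "\<And>u v. 0 \<le> u \<Longrightarrow> v \<le> 1 \<Longrightarrow> {u<..<v} \<inter> B = {} \<Longrightarrow>
      (\<lambda>t. max_entropy \<phi> (p + t *\<^sub>R (q - p))) C1_differentiable_on {u<..<v}"
proof -
  show ?thesis
  proof (rule face_decomposition[of a \<phi> b], rule le, assumption)
    fix \<D>
    assume \<D>: "finite \<D>" "\<And>D. D \<in> \<D> \<Longrightarrow> \<exists>r. ergodic_graph D src tgt r"
      "\<And>D. D \<in> \<D> \<Longrightarrow> finite_graph.mean D \<phi> ` finite_graph.flows D src tgt \<subseteq> {w \<in> mean \<phi> ` flows. a \<bullet> w = b}"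
      and hle: "\<And>D w. D \<in> \<D> \<Longrightarrow> w \<in> finite_graph.mean D \<phi> ` finite_graph.flows D src tgt \<Longrightarrow>
          finite_graph.max_entropy D src tgt \<phi> w \<le> max_entropy \<phi> w"
      and dec: "\<And>w. w \<in> mean \<phi> ` flows \<Longrightarrow> a \<bullet> w = b \<Longrightarrow>
          \<exists>l x. (\<forall>D\<in>\<D>. 0 \<le> l D \<and> x D \<in> finite_graph.mean D \<phi> ` finite_graph.flows D src tgt) \<and> sum l \<D> = 1 \<and>
            w = (\<Sum>D\<in>\<D>. l D *\<^sub>R x D) \<and>
            max_entropy \<phi> w \<le> (\<Sum>D\<in>\<D>. l D * finite_graph.max_entropy D src tgt \<phi> (x D))"
    define d where "d = q - p"
    define P where "P t = p + t *\<^sub>R d" for t :: real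
    have d: "d \<noteq> 0" using pq by (simp add: d_def)
    define S where "S D = finite_graph.mean D \<phi> ` finite_graph.flows D src tgt" for D
    define h where "h D = finite_graph.max_entropy D src tgt \<phi>" for D
    have P01: "P ` {0..1} = {w \<in> mean \<phi> ` flows. a \<bullet> w = b}"
      unfolding seg P_def using segment_point_in_segment[of 0 1 p d] by (simp add: d_def)
    have "\<exists>\<alpha> \<beta>. \<alpha> \<le> \<beta> \<and> {\<alpha>..\<beta>} \<subseteq> {0..1} \<and> S D = P ` {\<alpha>..\<beta>}" if D: "D \<in> \<D>" for D
    proof -
      obtain r where "ergodic_graph D src tgt r" using \<D>(2)[OF D] by blast
      then interpret D: ergodic_graph D src tgt r .
      have "S D \<noteq> {}" using D.q0 by (auto simp: S_def)
      moreover have "compact (S D)" unfolding S_def by (intro polytope_imp_compact D.polytope_mean_flows)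
      moreover have "convex (S D)" unfolding S_def by (rule D.convex_mean_flows)
      moreover have "S D \<subseteq> P ` {0..1}" unfolding P01 S_def by (rule \<D>(3)[OF D])
      ultimately show ?thesis unfolding P_def using compact_convex_in_segment[of "S D" p d] by metis
    qed
    then obtain \<alpha> \<beta> where \<alpha>\<beta>: "\<And>D. D \<in> \<D> \<Longrightarrow> \<alpha> D \<le> \<beta> D" "\<And>D. D \<in> \<D> \<Longrightarrow> {\<alpha> D..\<beta> D} \<subseteq> {0..1}"
        "\<And>D. D \<in> \<D> \<Longrightarrow> S D = P ` {\<alpha> D..\<beta> D}" by metis
    define g where "g t = max_entropy \<phi> (P t)" for t
    have PR: "P t \<in> mean \<phi> ` flows" "a \<bullet> P t = b" if "t \<in> {0..1}" for t using that P01 by blast+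
    have conc: "concave_on {0..1} g"
      unfolding concave_on_iff g_def
    proof (intro conjI ballI allI impI)
      fix x y u v :: real assume "x \<in> {0..1}" "y \<in> {0..1}" and uv: "0 \<le> u" "0 \<le> v" "u + v = 1"
      then have "u * max_entropy \<phi> (P x) + v * max_entropy \<phi> (P y) \<le> max_entropy \<phi> (u *\<^sub>R P x + v *\<^sub>R P y)"
        using concave_on_max_entropy[of \<phi>] PR(1) unfolding concave_on_iff by blast
      moreover have "u *\<^sub>R P x + v *\<^sub>R P y = (u + v) *\<^sub>R p + (u * x + v * y) *\<^sub>R d" by (simp add: P_def algebra_simps)
      ultimately show "u * max_entropy \<phi> (P x) + v * max_entropy \<phi> (P y) \<le> max_entropy \<phi> (P (u *\<^sub>R x + v *\<^sub>R y))"
        by (simp add: uv(3) P_def)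
    qed simp
    show ?thesis
    proof (rule that[of "\<alpha> ` \<D> \<union> \<beta> ` \<D>"])
      show "finite (\<alpha> ` \<D> \<union> \<beta> ` \<D>)" using \<D>(1) by simp
      fix u v :: real assume uv: "0 \<le> u" "v \<le> 1" "{u<..<v} \<inter> (\<alpha> ` \<D> \<union> \<beta> ` \<D>) = {}"
      have "g C1_differentiable_on {u<..<v}"
      proof (rule envelope_C1[where h = "\<lambda>D t. h D (P t)", OF conc \<D>(1) \<alpha>\<beta>(2) _ _ _ uv])
        fix D t assume D: "D \<in> \<D>" and t: "t \<in> {\<alpha> D..\<beta> D}"
        then have "P t \<in> S D" using \<alpha>\<beta>(3)[OF D] by blast
        then show "h D (P t) \<le> g t" unfolding h_def g_def S_def by (rule hle[OF D])
      next
        fix t :: real assume t: "t \<in> {0..1}"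
        obtain l x where lx: "\<forall>D\<in>\<D>. 0 \<le> l D \<and> x D \<in> S D" "sum l \<D> = 1" "P t = (\<Sum>D\<in>\<D>. l D *\<^sub>R x D)"
            "g t \<le> (\<Sum>D\<in>\<D>. l D * h D (x D))"
          using dec[OF PR[OF t]] unfolding S_def h_def g_def by blast
        have "\<forall>D\<in>\<D>. \<exists>s. s \<in> {\<alpha> D..\<beta> D} \<and> x D = P s" using lx(1) \<alpha>\<beta>(3) by blast
        then obtain s where s: "\<And>D. D \<in> \<D> \<Longrightarrow> s D \<in> {\<alpha> D..\<beta> D}" "\<And>D. D \<in> \<D> \<Longrightarrow> x D = P (s D)" by metis
        have "P t = (\<Sum>D\<in>\<D>. l D *\<^sub>R P (s D))" unfolding lx(3) by (intro sum.cong) (auto simp: s(2))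
        also have "\<dots> = sum l \<D> *\<^sub>R p + (\<Sum>D\<in>\<D>. l D * s D) *\<^sub>R d"
          by (simp add: P_def scaleR_add_right sum.distrib scaleR_sum_left)
        finally have "t = (\<Sum>D\<in>\<D>. l D * s D)" using d by (simp add: P_def lx(2))
        then show "\<exists>l x. (\<forall>D\<in>\<D>. 0 \<le> l D \<and> x D \<in> {\<alpha> D..\<beta> D}) \<and> sum l \<D> = 1 \<and>
            t = (\<Sum>D\<in>\<D>. l D * x D) \<and> g t \<le> (\<Sum>D\<in>\<D>. l D * h D (P (x D)))"
          using lx s by (intro exI[of _ l] exI[of _ s]) auto
      next
        fix D t assume D: "D \<in> \<D>" and t: "\<alpha> D < t" "t < \<beta> D"
        obtain r where "ergodic_graph D src tgt r" using \<D>(2)[OF D] by blast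
        then interpret D: ergodic_graph D src tgt r .
        have S: "S D = closed_segment (P (\<alpha> D)) (P (\<beta> D))"
          unfolding \<alpha>\<beta>(3)[OF D] using segment_point_in_segment[OF \<alpha>\<beta>(1)[OF D], of p d] by (simp add: P_def)
        have comb: "P s = (1 - c) *\<^sub>R P (\<alpha> D) + c *\<^sub>R P (\<beta> D)" if "c = (s - \<alpha> D) / (\<beta> D - \<alpha> D)" for s c
        proof -
          have "(1 - c) *\<^sub>R P (\<alpha> D) + c *\<^sub>R P (\<beta> D) = p + (\<alpha> D + c * (\<beta> D - \<alpha> D)) *\<^sub>R d"
            by (simp add: P_def algebra_simps)
          then show ?thesis using that t by (simp add: P_def)
        qed
        have "P (\<alpha> D) \<noteq> P (\<beta> D)" using t d by (simp add: P_def)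
        then have "P t \<in> open_segment (P (\<alpha> D)) (P (\<beta> D))"
          unfolding in_segment using t by (intro conjI exI[of _ "(t - \<alpha> D) / (\<beta> D - \<alpha> D)"] comb refl) (auto simp: field_simps)
        then have ri: "P t \<in> rel_interior (D.mean \<phi> ` D.flows)"
          unfolding S[unfolded S_def] rel_interior_closed_segment using \<open>P (\<alpha> D) \<noteq> P (\<beta> D)\<close> by simp
        \<comment> \<open>The parameter of the point \<open>P (t + 1)\<close> on the line through
          the ends; it lies in the affine hull, so the direction \<open>d\<close> is tangent
          there.\<close>
        define c where "c = (t + 1 - \<alpha> D) / (\<beta> D - \<alpha> D)"
        have "P (\<alpha> D) \<in> affine hull (S D)" "P (\<beta> D) \<in> affine hull (S D)" by (simp_all add: S hull_inc)
        then have "(1 - c) *\<^sub>R P (\<alpha> D) + c *\<^sub>R P (\<beta> D) \<in> affine hull (S D)"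
          by (intro mem_affine affine_affine_hull) auto
        then have "P (t + 1) \<in> affine hull (S D)" using comb[OF c_def] by simp
        then have aff: "P t + d \<in> affine hull (D.mean \<phi> ` D.flows)" by (simp add: P_def S_def algebra_simps)
        show "\<exists>e e'. e 0 = h D (P t) \<and> (e has_real_derivative e') (at 0) \<and> (\<forall>\<^sub>F \<tau> in at 0. e \<tau> \<le> h D (P (t + \<tau>)))"
          using D.max_entropy_minorant[OF ri aff] by (simp add: h_def P_def algebra_simps)
      qed
      then show "(\<lambda>t. max_entropy \<phi> (p + t *\<^sub>R (q - p))) C1_differentiable_on {u<..<v}"
        by (simp add: g_def[abs_def] P_def d_def)
    qed
  qed
qed

end

section \<open>Traversing the boundary of a polygon\<close>

text \<open>The set may lie on either side of its supporting hyperplane; changing the sign of the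
  normal fixes the side.\<close>

lemma is_face_cases:
  assumes "is_face K F"
  obtains a b where "a \<noteq> 0" "F = K \<inter> {x. a \<bullet> x = b}" "\<And>x. x \<in> K \<Longrightarrow> a \<bullet> x \<le> b"
proof -
  obtain a b where a: "a \<noteq> 0" "F = K \<inter> {x. a \<bullet> x = b}" "\<not> (K \<inter> {x. a \<bullet> x < b} \<noteq> {} \<and> K \<inter> {x. a \<bullet> x > b} \<noteq> {})"
    using assms unfolding is_face_def supporting_hyperplane_def by blast
  show ?thesis
  proof (cases "K \<inter> {x. a \<bullet> x > b} = {}")
    case True
    then have "a \<bullet> x \<le> b" if "x \<in> K" for x using that not_less by blast
    then show ?thesis using that a by blast
  next
    case False
    then have "K \<inter> {x. a \<bullet> x < b} = {}" using a(3) by blast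
    then have "- a \<bullet> x \<le> - b" if "x \<in> K" for x using that not_less by fastforce
    moreover have "F = K \<inter> {x. - a \<bullet> x = - b}" using a(2) by simp
    ultimately show ?thesis using that[of "- a" "- b"] a(1) by simp
  qed
qed

lemma is_faceI:
  assumes "a \<noteq> 0" "\<And>x. x \<in> K \<Longrightarrow> a \<bullet> x \<le> b" "z \<in> K" "a \<bullet> z = b"
  shows "is_face K (K \<inter> {x. a \<bullet> x = b})"
proof -
  have "setdist {x. a \<bullet> x = b} K = 0" using assms(3,4) by (intro setdist_eq_0I[of z]) auto
  moreover have "K \<inter> {x. a \<bullet> x > b} = {}" using assms(2) by (auto simp: not_less[symmetric])
  ultimately show ?thesis
    unfolding is_face_def supporting_hyperplane_def using assms(1)
    by (intro exI[of _ "{x. a \<bullet> x = b}"] conjI exI[of _ a] exI[of _ b]) simp_all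
qed

lemma is_face_subset_frontier:
  fixes K :: "'v::euclidean_space set"
  assumes "closed K" "is_face K F"
  shows "F \<subseteq> frontier K"
proof
  fix x assume x: "x \<in> F"
  obtain a b where a: "a \<noteq> 0" "F = K \<inter> {x. a \<bullet> x = b}" "\<And>x. x \<in> K \<Longrightarrow> a \<bullet> x \<le> b" using is_face_cases[OF assms(2)] by blast
  have "x \<notin> interior K"
  proof
    assume "x \<in> interior K"
    then have "x \<in> interior {x. a \<bullet> x \<le> b}" using interior_mono[of K "{x. a \<bullet> x \<le> b}"] a(3) by blast
    then show False using x a(1,2) by (simp add: interior_halfspace_le)
  qed
  then show "x \<in> frontier K" using x a(2) assms(1) by (simp add: frontier_def)
qed

lemma frontier_point_in_face:
  fixes K :: "'v::euclidean_space set"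
  assumes K: "closed K" "convex K" and z: "z \<in> frontier K"
  obtains F where "is_face K F" "z \<in> F"
proof -
  have zK: "z \<in> K" "z \<notin> interior K" using z K(1) by (auto simp: frontier_def)
  have "\<exists>a b. a \<noteq> 0 \<and> (\<forall>x\<in>K. a \<bullet> x \<le> b) \<and> a \<bullet> z = b"
  \<comment> \<open>A convex set with empty interior lies in a hyperplane, which supports it at
    every point; otherwise \<open>z\<close> is a relative boundary point.\<close>
  proof (cases "interior K = {}")
    case True
    obtain a b where "a \<noteq> 0" "K \<subseteq> {x. a \<bullet> x = b}" using empty_interior_subset_hyperplane[OF K(2) True] by blast
    then show ?thesis using zK by (intro exI[of _ a] exI[of _ b]) auto
  next
    case False
    then have "z \<notin> rel_interior K" using zK(2) rel_interior_nonempty_interior by blast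
    then obtain a where "a \<noteq> 0" "\<And>y. y \<in> K \<Longrightarrow> a \<bullet> z \<le> a \<bullet> y"
      using supporting_hyperplane_rel_boundary[OF K(2) zK(1)] by metis
    then show ?thesis by (intro exI[of _ "- a"] exI[of _ "- a \<bullet> z"]) auto
  qed
  then obtain a b where "a \<noteq> 0" "\<And>x. x \<in> K \<Longrightarrow> a \<bullet> x \<le> b" "a \<bullet> z = b" by blast
  then show ?thesis using that[OF is_faceI[of a K b z]] zK(1) by blast
qed

lemma planar_face_segment:
  fixes K :: "'v::euclidean_space set"
  assumes dim: "DIM('v) = 2" and K: "compact K" "convex K" and F: "is_face K F" "F \<noteq> {}"
  obtains p q where "F = closed_segment p q"
proof -
  obtain a b where a: "a \<noteq> 0" "F = K \<inter> {x. a \<bullet> x = b}" using is_face_cases[OF F(1)] by blast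
  have "aff_dim F \<le> aff_dim {x. a \<bullet> x = b}" unfolding a(2) by (intro aff_dim_subset) auto
  also have "\<dots> = 1" using aff_dim_hyperplane[OF a(1)] dim by simp
  finally have "collinear F" by (simp add: collinear_aff_dim)
  moreover have "compact F" unfolding a(2) by (intro compact_Int_closed K closed_hyperplane)
  moreover have "convex F" unfolding a(2) by (intro convex_Int K convex_hyperplane)
  ultimately show ?thesis using compact_convex_collinear_segment F(2) that by metis
qed

lemma C1_affine_reparam:
  fixes G :: "real \<Rightarrow> real"
  assumes G: "G C1_differentiable_on {u<..<v}" and uv: "u \<le> v"
  shows "(\<lambda>s. G (u + s * (v - u))) C1_differentiable_on {0<..<1}"
    "(\<lambda>s. G (v + s * (u - v))) C1_differentiable_on {0<..<1}"
proof -
  have "(G \<circ> (\<lambda>s. c + s * m)) C1_differentiable_on {0<..<1}" if "m \<noteq> 0" "(\<lambda>s. c + s * m) ` {0<..<1} \<subseteq> {u<..<v}" for c m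
  proof (rule C1_differentiable_compose)
    show "(\<lambda>s. c + s * m) C1_differentiable_on {0<..<1}" by simp
    show "G C1_differentiable_on (\<lambda>s. c + s * m) ` {0<..<1}" by (rule C1_differentiable_on_subset[OF G that(2)])
    fix x
    have "(\<lambda>s. c + s * m) -` {x} \<subseteq> {(x - c) / m}" using that(1) by (auto simp: field_simps)
    then show "finite ({0<..<1} \<inter> (\<lambda>s. c + s * m) -` {x})" by (meson finite.simps finite_Int finite_subset)
  qed
  note comp = this
  have "(\<lambda>s. G (u + s * (v - u))) C1_differentiable_on {0<..<1} \<and> (\<lambda>s. G (v + s * (u - v))) C1_differentiable_on {0<..<1}"
  proof (cases "u = v")
    case False
    then have lt: "u < v" using uv by simp
    have "(\<lambda>s. u + s * (v - u)) ` {0<..<1} \<subseteq> {u<..<v}"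
    proof safe
      fix s :: real assume "s \<in> {0<..<1}"
      then have "0 < s * (v - u)" "s * (v - u) < 1 * (v - u)" using lt by (auto intro: mult_strict_right_mono)
      then show "u + s * (v - u) \<in> {u<..<v}" by simp
    qed
    moreover have "(\<lambda>s. v + s * (u - v)) ` {0<..<1} \<subseteq> {u<..<v}"
    proof safe
      fix s :: real assume "s \<in> {0<..<1}"
      then have "0 < s * (v - u)" "s * (v - u) < 1 * (v - u)" using lt by (auto intro: mult_strict_right_mono)
      then show "v + s * (u - v) \<in> {u<..<v}" by (simp add: algebra_simps)
    qed
    ultimately show ?thesis using comp[of "v - u" u] comp[of "u - v" v] False by (simp add: o_def)
  qed simp
  then show "(\<lambda>s. G (u + s * (v - u))) C1_differentiable_on {0<..<1}"
    "(\<lambda>s. G (v + s * (u - v))) C1_differentiable_on {0<..<1}" by auto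
qed

section \<open>Closed walks along finitely many segments\<close>

context
  fixes K :: "'v::euclidean_space set" and h :: "'v \<Rightarrow> real"
begin

text \<open>Differentiability is required in both directions to make the relation symmetric: the
  closed polygon may run back along a segment.\<close>

definition good_segment :: "'v \<Rightarrow> 'v \<Rightarrow> bool" where
  "good_segment x y \<longleftrightarrow> (\<exists>F. is_face K F \<and> closed_segment x y \<subseteq> F) \<and>
     (\<lambda>t. h ((1 - t) *\<^sub>R x + t *\<^sub>R y)) C1_differentiable_on {0<..<1} \<and>
     (\<lambda>t. h ((1 - t) *\<^sub>R y + t *\<^sub>R x)) C1_differentiable_on {0<..<1}"

lemma good_segment_sym: "good_segment x y \<Longrightarrow> good_segment y x"
  by (auto simp: good_segment_def closed_segment_commute)

lemma good_segment_reparam: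
  assumes F: "is_face K F" "closed_segment (p + u *\<^sub>R d) (p + v *\<^sub>R d) \<subseteq> F"
    and C1: "(\<lambda>t. h (p + t *\<^sub>R d)) C1_differentiable_on {u<..<v}" and uv: "u \<le> v"
  shows "good_segment (p + u *\<^sub>R d) (p + v *\<^sub>R d)"
proof -
  have "(1 - t) *\<^sub>R (p + u *\<^sub>R d) + t *\<^sub>R (p + v *\<^sub>R d) = p + (u + t * (v - u)) *\<^sub>R d"
    "(1 - t) *\<^sub>R (p + v *\<^sub>R d) + t *\<^sub>R (p + u *\<^sub>R d) = p + (v + t * (u - v)) *\<^sub>R d" for t
    by (simp_all add: algebra_simps)
  then show ?thesis
    unfolding good_segment_def using F C1_affine_reparam[OF C1 uv] by auto
qed

lemma good_subsegment:
  assumes "good_segment x y" "z \<in> closed_segment x y"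
  shows "good_segment x z"
proof -
  obtain F where F: "is_face K F" "closed_segment x y \<subseteq> F"
    and C1: "(\<lambda>t. h ((1 - t) *\<^sub>R x + t *\<^sub>R y)) C1_differentiable_on {0<..<1}"
    using assms(1) by (auto simp: good_segment_def)
  obtain s where s: "0 \<le> s" "s \<le> 1" "z = (1 - s) *\<^sub>R x + s *\<^sub>R y" using assms(2) by (auto simp: in_segment)
  have line: "(1 - t) *\<^sub>R x + t *\<^sub>R y = x + t *\<^sub>R (y - x)" for t by (simp add: algebra_simps)
  have "(\<lambda>t. h (x + t *\<^sub>R (y - x))) C1_differentiable_on {0<..<s}"
    using s(2) by (intro C1_differentiable_on_subset[OF C1[unfolded line]]) auto
  moreover have "closed_segment x z \<subseteq> F"
    using F(2) assms(2) by (meson ends_in_segment(1) order_trans subset_closed_segment)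
  ultimately show ?thesis
    using good_segment_reparam[OF F(1), of x 0 "y - x" s] s by (simp add: line)
qed

end

context
  fixes K :: "'v::euclidean_space set" and h :: "'v \<Rightarrow> real"
begin

abbreviation good_steps :: "('v \<times> 'v) set" where
  "good_steps \<equiv> {(x, y). good_segment K h x y}"

text \<open>The set \<open>S\<close> need only be contained in the union of the segments walked, so
  that detours do no harm.\<close>

definition covers :: "'v \<Rightarrow> 'v set \<Rightarrow> 'v \<Rightarrow> bool" where
  "covers x S y \<longleftrightarrow> (\<exists>(l::nat) a. a 0 = x \<and> a l = y \<and> (\<forall>i<l. good_segment K h (a i) (a (Suc i))) \<and>
     S \<subseteq> (\<Union>i<l. closed_segment (a i) (a (Suc i))))"

lemma covers_refl: "covers x {} x"
  unfolding covers_def by (intro exI[of _ 0] exI[of _ "\<lambda>_. x"]) auto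

lemma covers_step:
  assumes "covers x S y" "good_segment K h y z"
  shows "covers x (S \<union> closed_segment y z) z"
proof -
  obtain l a where a: "a 0 = x" "a l = y" "\<forall>i<l. good_segment K h (a i) (a (Suc i))"
      "S \<subseteq> (\<Union>i<l. closed_segment (a i) (a (Suc i)))"
    using assms(1) by (auto simp: covers_def)
  define a' where "a' = a(Suc l := z)"
  have eq: "closed_segment (a' i) (a' (Suc i)) = (if i < l then closed_segment (a i) (a (Suc i)) else closed_segment y z)"
    if "i < Suc l" for i using that a(2) by (auto simp: a'_def less_Suc_eq)
  have "(\<Union>i<Suc l. closed_segment (a' i) (a' (Suc i))) = (\<Union>i<l. closed_segment (a i) (a (Suc i))) \<union> closed_segment y z"
    unfolding lessThan_Suc using eq by auto
  moreover have "good_segment K h (a' i) (a' (Suc i))" if "i < Suc l" for i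
    using that a(2,3) assms(2) by (auto simp: a'_def less_Suc_eq)
  ultimately show ?thesis
    unfolding covers_def using a(1,4) by (intro exI[of _ "Suc l"] exI[of _ a']) (auto simp: a'_def)
qed

lemma covers_walk:
  assumes "(y, z) \<in> good_steps\<^sup>*" "covers x S y"
  shows "covers x S z"
  using assms
proof (induction rule: rtrancl_induct)
  case (step y' z')
  then have "covers x (S \<union> closed_segment y' z') z'" by (auto intro: covers_step)
  then show ?case unfolding covers_def by blast
qed

text \<open>Excursions from \<open>x\<close>: to the start of a segment, along it, and back to
  \<open>x\<close>, which is possible by symmetry of good steps.\<close>

lemma covers_all:
  assumes "finite \<S>" "\<And>y z. (y, z) \<in> \<S> \<Longrightarrow> good_segment K h y z \<and> (x, y) \<in> good_steps\<^sup>*"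
  shows "covers x (\<Union>(y, z)\<in>\<S>. closed_segment y z) x"
  using assms
proof (induction \<S> rule: finite_induct)
  case empty
  show ?case using covers_refl by simp
next
  case (insert e \<S>)
  obtain y z where e: "e = (y, z)" by (cases e)
  have g: "good_segment K h y z" "(x, y) \<in> good_steps\<^sup>*" using insert.prems[of y z] e by auto
  have "sym good_steps" by (auto simp: sym_def intro: good_segment_sym)
  moreover have "(x, z) \<in> good_steps\<^sup>*" by (rule rtrancl_into_rtrancl[OF g(2)]) (use g(1) in simp)
  ultimately have zx: "(z, x) \<in> good_steps\<^sup>*" by (meson sym_rtrancl symD)
  have "covers x (\<Union>(y, z)\<in>\<S>. closed_segment y z) x" by (rule insert.IH) (rule insert.prems, simp)
  from covers_step[OF covers_walk[OF g(2) this] g(1)]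
  have "covers x ((\<Union>(y, z)\<in>\<S>. closed_segment y z) \<union> closed_segment y z) x" by (rule covers_walk[OF zx])
  then show ?case by (simp add: e Un_commute)
qed

text \<open>
  A connected union of finitely many good segments can be walked through: since pieces of good segments
  are good, the points that can be reached from a given one form a union of some of the segments, and so do
  the other points.
\<close>

lemma closed_walk_exists:
  assumes S: "finite \<S>" "\<And>y z. (y, z) \<in> \<S> \<Longrightarrow> good_segment K h y z"
    and conn: "connected (\<Union>(y, z)\<in>\<S>. closed_segment y z)" and x: "x \<in> (\<Union>(y, z)\<in>\<S>. closed_segment y z)"
  shows "covers x (\<Union>(y, z)\<in>\<S>. closed_segment y z) x"
proof (rule covers_all[OF S(1)])
  fix y0 z0 assume e0: "(y0, z0) \<in> \<S>"
  define U where "U = (\<Union>(y, z)\<in>{(y, z) \<in> \<S>. (x, y) \<in> good_steps\<^sup>*}. closed_segment y z)"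
  define V where "V = (\<Union>(y, z)\<in>{(y, z) \<in> \<S>. (x, y) \<notin> good_steps\<^sup>*}. closed_segment y z)"
  have UV: "U \<union> V = (\<Union>(y, z)\<in>\<S>. closed_segment y z)" unfolding U_def V_def by blast
  have reachU: "(x, w) \<in> good_steps\<^sup>*" if w: "w \<in> U" for w
  proof -
    obtain y z where yz: "(y, z) \<in> \<S>" "(x, y) \<in> good_steps\<^sup>*" "w \<in> closed_segment y z"
      using w unfolding U_def by blast
    then have "good_segment K h y w" using good_subsegment[OF S(2)] by blast
    then show ?thesis using yz(2) by (simp add: rtrancl.rtrancl_into_rtrancl)
  qed
  have reach: "(x, y) \<in> good_steps\<^sup>*" if "(x, w) \<in> good_steps\<^sup>*" "(y, z) \<in> \<S>" "w \<in> closed_segment y z" for w y z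
  proof -
    have "good_segment K h w y" using good_subsegment[OF S(2)[OF that(2)] that(3)] by (rule good_segment_sym)
    then show ?thesis using that(1) by (simp add: rtrancl.rtrancl_into_rtrancl)
  qed
  have "U \<inter> V = {}"
  proof (rule ccontr)
    assume "U \<inter> V \<noteq> {}"
    then obtain w where w: "w \<in> U" "w \<in> V" by blast
    obtain y z where "(y, z) \<in> \<S>" "(x, y) \<notin> good_steps\<^sup>*" "w \<in> closed_segment y z" using w(2) unfolding V_def by blast
    then show False using reach[OF reachU[OF w(1)]] by blast
  qed
  moreover have "closed U" "closed V"
    unfolding U_def V_def using S(1) by (auto intro!: closed_UN elim: finite_subset[rotated] simp: split_beta)
  moreover have "x \<in> U"
  proof -
    obtain y z where "(y, z) \<in> \<S>" "x \<in> closed_segment y z" using x by blast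
    then show ?thesis using reach[of x y z] by (auto simp: U_def)
  qed
  ultimately have "V = {}" using conn unfolding UV[symmetric] connected_closed by blast
  then have "(x, y0) \<in> good_steps\<^sup>*" using e0 by (auto simp: V_def)
  then show "good_segment K h y0 z0 \<and> (x, y0) \<in> good_steps\<^sup>*" using S(2)[OF e0] by blast
qed

lemma segment_good_cover:
  assumes F: "is_face K F" "F = closed_segment p q" and B: "finite B"
    and C1: "\<And>u v. 0 \<le> u \<Longrightarrow> v \<le> 1 \<Longrightarrow> {u<..<v} \<inter> B = {} \<Longrightarrow>
      (\<lambda>t. h (p + t *\<^sub>R (q - p))) C1_differentiable_on {u<..<v}"
  shows "\<exists>\<S>. finite \<S> \<and> (\<forall>(y, z)\<in>\<S>. good_segment K h y z) \<and> F = (\<Union>(y, z)\<in>\<S>. closed_segment y z)"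
proof -
  define B' where "B' = B \<inter> {0..1} \<union> {0, 1}"
  define P where "P t = p + t *\<^sub>R (q - p)" for t
  have B': "finite B'" "0 \<in> B'" "1 \<in> B'" "B' \<subseteq> {0..1}" using B by (auto simp: B'_def)
  define J where "J = {(u, v) \<in> B' \<times> B'. u \<le> v \<and> {u<..<v} \<inter> B' = {}}"
  have J: "finite J" unfolding J_def by (rule finite_subset[OF _ finite_cartesian_product[OF B'(1) B'(1)]]) auto
  have FP: "F = P ` {0..1}" unfolding F(2) P_def using segment_point_in_segment[of 0 1 p "q - p"] by simp
  have seg: "closed_segment (P u) (P v) = P ` {u..v}" if "u \<le> v" for u v
    unfolding P_def by (rule segment_point_in_segment[OF that])
  have good: "good_segment K h (P u) (P v)" if uv: "(u, v) \<in> J" for u v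
  proof -
    have uv': "0 \<le> u" "v \<le> 1" "u \<le> v" "{u<..<v} \<inter> B' = {}" using uv B'(4) by (auto simp: J_def)
    then have "{u<..<v} \<inter> B = {}" by (auto simp: B'_def)
    moreover have "closed_segment (P u) (P v) \<subseteq> F" unfolding seg[OF uv'(3)] FP using uv' by (intro image_mono) auto
    ultimately show ?thesis unfolding P_def using uv' F(1) by (intro good_segment_reparam C1)
  qed
  have cover: "\<exists>(u, v)\<in>J. t \<in> {u..v}" if t: "t \<in> {0..1}" for t
  proof -
    define u where "u = Max {b \<in> B'. b \<le> t}"
    define v where "v = Min {b \<in> B'. t \<le> b}"
    have fin: "finite {b \<in> B'. b \<le> t}" "finite {b \<in> B'. t \<le> b}" using B'(1) by auto
    have ne: "{b \<in> B'. b \<le> t} \<noteq> {}" "{b \<in> B'. t \<le> b} \<noteq> {}" using B'(2,3) t by auto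
    have "u \<in> {b \<in> B'. b \<le> t}" "v \<in> {b \<in> B'. t \<le> b}" unfolding u_def v_def using fin ne by (intro Max_in Min_in; simp)+
    moreover have "b \<le> u \<or> v \<le> b" if "b \<in> B'" for b
      unfolding u_def v_def using fin that by (cases "b \<le> t") auto
    ultimately have "(u, v) \<in> J" "t \<in> {u..v}" unfolding J_def by force+
    then show ?thesis by blast
  qed
  have "F = (\<Union>(y, z)\<in>(\<lambda>(u, v). (P u, P v)) ` J. closed_segment y z)"
  proof
    show "F \<subseteq> (\<Union>(y, z)\<in>(\<lambda>(u, v). (P u, P v)) ` J. closed_segment y z)"
    proof
      fix w assume "w \<in> F"
      then obtain t where t: "t \<in> {0..1}" "w = P t" unfolding FP by blast
      obtain u v where uv: "(u, v) \<in> J" "t \<in> {u..v}" using cover[OF t(1)] by blast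
      then have "w \<in> closed_segment (P u) (P v)" using seg[of u v] t(2) by auto
      then show "w \<in> (\<Union>(y, z)\<in>(\<lambda>(u, v). (P u, P v)) ` J. closed_segment y z)" using uv(1) by force
    qed
    show "(\<Union>(y, z)\<in>(\<lambda>(u, v). (P u, P v)) ` J. closed_segment y z) \<subseteq> F"
    proof safe
      fix w u v assume uv: "(u, v) \<in> J" and w: "w \<in> closed_segment (P u) (P v)"
      have "u \<le> v" "0 \<le> u" "v \<le> 1" using uv B'(4) by (auto simp: J_def)
      then show "w \<in> F" using w seg[of u v] FP by auto
    qed
  qed
  then show ?thesis using J good by (intro exI[of _ "(\<lambda>(u, v). (P u, P v)) ` J"]) auto
qed

theorem planar_piecewise_C1:
  assumes dim: "DIM('v) = 2" and K: "polytope K" "K \<noteq> {}"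
    and C1: "\<And>F p q. is_face K F \<Longrightarrow> F = closed_segment p q \<Longrightarrow> p \<noteq> q \<Longrightarrow>
      \<exists>B. finite B \<and> (\<forall>u v. 0 \<le> u \<longrightarrow> v \<le> 1 \<longrightarrow> {u<..<v} \<inter> B = {} \<longrightarrow>
        (\<lambda>t. h (p + t *\<^sub>R (q - p))) C1_differentiable_on {u<..<v})"
  shows "piecewise_C1_on_frontier K h"
proof -
  have cK: "compact K" "convex K" "closed K" "bounded K"
    using K(1) by (auto intro: polytope_imp_compact polytope_imp_convex polytope_imp_closed polytope_imp_bounded)
  let ?\<F> = "{F. is_face K F}"
  have "?\<F> \<subseteq> {F. F face_of K}"
  proof safe
    fix F assume "is_face K F"
    then obtain a b where "F = K \<inter> {x. a \<bullet> x = b}" "\<And>x. x \<in> K \<Longrightarrow> a \<bullet> x \<le> b" using is_face_cases by blast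
    then show "F face_of K" using face_of_Int_supporting_hyperplane_le[OF cK(2)] by blast
  qed
  then have fin: "finite ?\<F>" using finite_polytope_faces[OF K(1)] finite_subset by blast
  have frontier: "frontier K = \<Union> ?\<F>"
    using is_face_subset_frontier[OF cK(3)] frontier_point_in_face[OF cK(3,2)] by blast
  have "\<exists>\<S>. finite \<S> \<and> (\<forall>(y, z)\<in>\<S>. good_segment K h y z) \<and> F = (\<Union>(y, z)\<in>\<S>. closed_segment y z)" if F: "is_face K F" for F
  proof (cases "F = {}")
    case True
    then show ?thesis by (intro exI[of _ "{}"]) simp
  next
    case False
    then obtain p q where pq: "F = closed_segment p q" using planar_face_segment[OF dim cK(1,2) F] by blast
    have "\<exists>B. finite B \<and> (\<forall>u v. 0 \<le> u \<longrightarrow> v \<le> 1 \<longrightarrow> {u<..<v} \<inter> B = {} \<longrightarrow>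
        (\<lambda>t. h (p + t *\<^sub>R (q - p))) C1_differentiable_on {u<..<v})"
    proof (cases "p = q")
      case True
      then show ?thesis by (intro exI[of _ "{}"]) simp
    qed (rule C1[OF F pq])
    then obtain B where B: "finite B" "\<And>u v. 0 \<le> u \<Longrightarrow> v \<le> 1 \<Longrightarrow> {u<..<v} \<inter> B = {} \<Longrightarrow>
        (\<lambda>t. h (p + t *\<^sub>R (q - p))) C1_differentiable_on {u<..<v}" by blast
    show ?thesis by (rule segment_good_cover[OF F pq B(1)]) (rule B(2))
  qed
  then obtain \<T> where \<T>: "\<And>F. is_face K F \<Longrightarrow> finite (\<T> F)" "\<And>F y z. is_face K F \<Longrightarrow> (y, z) \<in> \<T> F \<Longrightarrow> good_segment K h y z"
      "\<And>F. is_face K F \<Longrightarrow> F = (\<Union>(y, z)\<in>\<T> F. closed_segment y z)"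
    by (metis (no_types, lifting) case_prodD)
  define \<S> where "\<S> = \<Union> (\<T> ` ?\<F>)"
  have S: "finite \<S>" "\<And>y z. (y, z) \<in> \<S> \<Longrightarrow> good_segment K h y z"
    using fin \<T>(1,2) by (auto simp: \<S>_def)
  have fS: "frontier K = (\<Union>(y, z)\<in>\<S>. closed_segment y z)"
  proof -
    have "(\<Union>(y, z)\<in>\<S>. closed_segment y z) = (\<Union>F\<in>?\<F>. \<Union>(y, z)\<in>\<T> F. closed_segment y z)" by (simp add: \<S>_def)
    also have "\<dots> = (\<Union>F\<in>?\<F>. F)" by (intro SUP_cong refl) (simp add: \<T>(3)[symmetric])
    finally show ?thesis by (simp add: frontier)
  qed
  \<comment> \<open>A set without interior is its own frontier. Otherwise the complement of a
    bounded convex set in dimension two is connected, and with it the frontier.\<close>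
  have conn: "connected (frontier K)"
  proof (cases "interior K = {}")
    case True
    then show ?thesis using cK convex_connected by (simp add: frontier_def)
  next
    case False
    show ?thesis
      using cK dim by (intro connected_frontier_simple connected_complement_bounded_convex convex_connected) auto
  qed
  have "frontier K \<noteq> {}" using K(2) cK(4) frontier_eq_empty[of K] not_bounded_UNIV by auto
  then obtain x where x: "x \<in> frontier K" by blast
  have "covers x (frontier K) x"
    using closed_walk_exists[OF S] conn x unfolding fS by blast
  then obtain l a where a: "a 0 = x" "a l = x" "\<forall>i<l. good_segment K h (a i) (a (Suc i))"
      "frontier K \<subseteq> (\<Union>i<l. closed_segment (a i) (a (Suc i)))"
    by (auto simp: covers_def)
  have "a i \<in> frontier K" if "i \<le> l" for i
  proof (cases "i = l")
    case False
    then have "good_segment K h (a i) (a (Suc i))" using a(3) that by simp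
    then obtain F where "is_face K F" "closed_segment (a i) (a (Suc i)) \<subseteq> F" by (auto simp: good_segment_def)
    then show ?thesis using frontier by auto
  qed (use a x in simp)
  then show ?thesis
    unfolding piecewise_C1_on_frontier_def using a
    by (intro exI[of _ l] exI[of _ a]) (auto simp: good_segment_def)
qed

end

section \<open>Faces of the rotation set\<close>

text \<open>Irreducibility gives every symbol a successor, the first step of a path back to the
  symbol; iterating a choice of successors yields a point.\<close>

lemma sft_nonempty:
  assumes "transitive_sft d A"
  shows "sft d A \<noteq> {}"
proof -
  have zo: "d \<ge> 1" "\<And>i j. i < d \<Longrightarrow> j < d \<Longrightarrow> A i j \<in> {0, 1}"
    and irr: "\<And>i j. i < d \<Longrightarrow> j < d \<Longrightarrow> \<exists>n\<ge>1. matrix_power d A n i j > 0"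
    using assms by (auto simp: transitive_sft_def zero_one_matrix_def irreducible_matrix_def)
  have first: "n \<ge> 1 \<Longrightarrow> i < d \<Longrightarrow> j < d \<Longrightarrow> matrix_power d A n i j > 0 \<Longrightarrow> \<exists>k<d. A i k > 0" for n i j
  proof (induction n arbitrary: j)
    case (Suc n)
    have "(\<Sum>k<d. matrix_power d A n i k * A k j) \<noteq> 0"
      using Suc.prems(4) by (metis matrix_power.simps(2) less_irrefl)
    then obtain k where "k \<in> {..<d}" "matrix_power d A n i k * A k j \<noteq> 0" by (rule sum.not_neutral_contains_not_neutral)
    then have k: "k < d" "matrix_power d A n i k > 0" "A k j > 0" by simp_all
    then show ?case using Suc by (cases "n = 0") (auto split: if_splits)
  qed simp
  have "\<exists>k. i < d \<longrightarrow> k < d \<and> A i k = 1" for i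
  proof (cases "i < d")
    case True
    then obtain n where "n \<ge> 1" "matrix_power d A n i i > 0" using irr by blast
    then obtain k where "k < d" "A i k > 0" using first True by blast
    then show ?thesis using zo(2)[OF True, of k] by auto
  qed simp
  then obtain s where s: "\<And>i. i < d \<Longrightarrow> s i < d \<and> A i (s i) = 1" by metis
  define x where "x n = (s ^^ n) 0" for n
  have "x n < d" for n by (induction n) (use zo(1) s in \<open>auto simp: x_def\<close>)
  then have "x \<in> sft d A" using s by (simp add: sft_def) (simp add: x_def)
  then show ?thesis by blast
qed

lemma C1_differentiable_on_cong_open:
  assumes "f C1_differentiable_on S" "open S" "\<And>x. x \<in> S \<Longrightarrow> f x = g x"
  shows "g C1_differentiable_on S"
proof -
  obtain D where D: "\<And>x. x \<in> S \<Longrightarrow> (f has_vector_derivative D x) (at x)" "continuous_on S D"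
    using assms(1) by (auto simp: C1_differentiable_on_def)
  have "(g has_vector_derivative D x) (at x)" if "x \<in> S" for x
    by (rule has_vector_derivative_transform_within_open[OF D(1)[OF that] assms(2) that assms(3)])
  then show ?thesis unfolding C1_differentiable_on_def using D(2) by blast
qed

context shift_space
begin

text \<open>By the pigeonhole principle an orbit returns to a vertex. The edges passed in between,
  counted with multiplicity and normalised, form a flow.\<close>

lemma flows_nonempty:
  assumes "X \<noteq> {}"
  shows "flows \<noteq> {}"
proof -
  obtain x where x: "x \<in> X" using assms by blast
  define v where "v n = word N ((left_shift ^^ n) x)" for n
  define e where "e n = word (Suc N) ((left_shift ^^ n) x)" for n
  have e: "e n \<in> edges" "butlast (e n) = v n" "tl (e n) = v (Suc n)" for n
    using imageI[OF shift_funpow[OF x], of "word (Suc N)" n] word_left_shift[where n = N and x = "(left_shift ^^ n) x"]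
    by (simp_all add: e_def v_def edges_def del: upt_Suc add: butlast_word)
  have "range v \<subseteq> butlast ` edges" using e(1,2) by (metis image_subsetI rev_image_eqI)
  then have "finite (range v)" using finite_edges finite_subset by blast
  then have "\<not> inj v" using finite_imageD infinite_UNIV_nat by blast
  then obtain m n where mn: "m < n" "v m = v n" by (metis injI linorder_neqE_nat)
  define c where "c = 1 / real (n - m)"
  have c: "c > 0" using mn by (simp add: c_def)
  define q where "q y = c * (\<Sum>i\<in>{m..<n}. if e i = y then 1 else 0)" for y
  have q_sum: "(\<Sum>y | y \<in> edges \<and> P y. q y) = c * (\<Sum>i\<in>{m..<n}. if P (e i) then 1 else 0)" for P
  proof -
    have "(\<Sum>y | y \<in> edges \<and> P y. q y) = c * (\<Sum>i\<in>{m..<n}. \<Sum>y | y \<in> edges \<and> P y. if e i = y then 1 else 0)"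
      unfolding q_def sum_distrib_left[symmetric] by (subst sum.swap) simp
    also have "(\<Sum>i\<in>{m..<n}. \<Sum>y | y \<in> edges \<and> P y. if e i = y then 1 else (0::real)) = (\<Sum>i\<in>{m..<n}. if P (e i) then 1 else 0)"
      using finite_edges e(1) by (intro sum.cong refl) (simp add: sum.delta)
    finally show ?thesis .
  qed
  have "outflow q y = inflow q y" for y
  proof -
    have "(\<Sum>i\<in>{m..<n}. (if v (Suc i) = y then 1 else 0) - (if v i = y then 1 else (0::real))) = 0"
      using mn by (subst sum_Suc_diff') auto
    then show ?thesis by (simp add: outflow_def inflow_def q_sum e sum_subtractf)
  qed
  moreover have "sum q edges = 1" using q_sum[of "\<lambda>_. True"] mn by (simp add: c_def)
  moreover have "q y = 0" if "y \<notin> edges" for y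
  proof -
    have "(\<Sum>i\<in>{m..<n}. if e i = y then 1 else (0::real)) = 0" using that e(1) by (intro sum.neutral) auto
    then show ?thesis by (simp add: q_def)
  qed
  moreover have "q y \<ge> 0" for y using c by (simp add: q_def sum_nonneg)
  ultimately have "q \<in> flows" by (auto simp: flows_def circulations_def)
  then show ?thesis by blast
qed

context
  fixes \<Phi> :: "(nat \<Rightarrow> nat) \<Rightarrow> real ^ 'm" and \<phi> :: "nat list \<Rightarrow> real ^ 'm"
  assumes \<Phi>: "\<And>x. x \<in> X \<Longrightarrow> \<Phi> x = \<phi> (word (Suc N) x)"
begin

lemma localized_entropy_face_envelope:
  assumes "is_face (rotation_set X \<Phi>) F"
  shows "\<exists>(t::nat) Fs hs. (\<forall>i<t. polytope (Fs i) \<and> Fs i \<subseteq> F \<and> concave_on (Fs i) (hs i) \<and>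
            rel_real_analytic_on (rel_interior (Fs i)) (hs i)) \<and>
          concave_envelope {..<t} Fs hs F (localized_entropy X \<Phi>)"
proof -
  have R: "rotation_set X \<Phi> = mean \<phi> ` flows" by (rule rotation_set_eq_mean_flows) (rule \<Phi>)
  obtain a b where ab: "F = mean \<phi> ` flows \<inter> {x. a \<bullet> x = b}" "\<And>x. x \<in> mean \<phi> ` flows \<Longrightarrow> a \<bullet> x \<le> b"
    using is_face_cases[OF assms] unfolding R by metis
  show ?thesis
  proof (rule face_concave_envelope)
    show "a \<bullet> mean \<phi> q \<le> b" if "q \<in> flows" for q using ab(2) that by blast
    show "localized_entropy X \<Phi> w = max_entropy \<phi> w" if "w \<in> mean \<phi> ` flows" for w
      by (rule localized_entropy_eq_max_entropy[where \<Phi> = \<Phi> and \<phi> = \<phi>, OF \<Phi> that])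
    show "F = {w \<in> mean \<phi> ` flows. a \<bullet> w = b}" using ab(1) by blast
  qed
qed

lemma localized_entropy_piecewise_C1:
  assumes "CARD('m) = 2" "X \<noteq> {}"
  shows "piecewise_C1_on_frontier (rotation_set X \<Phi>) (localized_entropy X \<Phi>)"
proof -
  have R: "rotation_set X \<Phi> = mean \<phi> ` flows" by (rule rotation_set_eq_mean_flows) (rule \<Phi>)
  show ?thesis
    unfolding R
  proof (rule planar_piecewise_C1)
    show "DIM(real ^ 'm) = 2" using assms(1) by simp
    show "polytope (mean \<phi> ` flows)" by (rule polytope_mean_flows)
    show "mean \<phi> ` flows \<noteq> {}" using flows_nonempty[OF assms(2)] by simp
    fix F p q assume F: "is_face (mean \<phi> ` flows) F" "F = closed_segment p q" "p \<noteq> q"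
    obtain a b where ab: "F = mean \<phi> ` flows \<inter> {x. a \<bullet> x = b}" "\<And>x. x \<in> mean \<phi> ` flows \<Longrightarrow> a \<bullet> x \<le> b"
      using is_face_cases[OF F(1)] by metis
    have seg: "{w \<in> mean \<phi> ` flows. a \<bullet> w = b} = closed_segment p q" using ab(1) F(2) by blast
    obtain B where B: "finite B" "\<And>u v. 0 \<le> u \<Longrightarrow> v \<le> 1 \<Longrightarrow> {u<..<v} \<inter> B = {} \<Longrightarrow>
        (\<lambda>t. max_entropy \<phi> (p + t *\<^sub>R (q - p))) C1_differentiable_on {u<..<v}"
      using face_entropy_C1[OF _ seg F(3)] ab(2) by blast
    have "(\<lambda>t. localized_entropy X \<Phi> (p + t *\<^sub>R (q - p))) C1_differentiable_on {u<..<v}"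
      if uv: "0 \<le> u" "v \<le> 1" "{u<..<v} \<inter> B = {}" for u v
    proof (rule C1_differentiable_on_cong_open[OF B(2)[OF uv]])
      fix t assume t: "t \<in> {u<..<v}"
      have "(1 - t) *\<^sub>R p + t *\<^sub>R q \<in> closed_segment p q"
        unfolding in_segment using t uv by (intro exI[of _ t]) auto
      then have "p + t *\<^sub>R (q - p) \<in> mean \<phi> ` flows" using seg by (auto simp: algebra_simps)
      then show "max_entropy \<phi> (p + t *\<^sub>R (q - p)) = localized_entropy X \<Phi> (p + t *\<^sub>R (q - p))"
        using localized_entropy_eq_max_entropy[where \<Phi> = \<Phi> and \<phi> = \<phi>] \<Phi> by metis
    qed simp
    then show "\<exists>B. finite B \<and> (\<forall>u v. 0 \<le> u \<longrightarrow> v \<le> 1 \<longrightarrow> {u<..<v} \<inter> B = {} \<longrightarrow>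
        (\<lambda>t. localized_entropy X \<Phi> (p + t *\<^sub>R (q - p))) C1_differentiable_on {u<..<v})"
      using B(1) by blast
  qed
qed

end

end

section \<open>A non-analytic example\<close>

text \<open>With a single basis vector the multi-indices are natural numbers, and the sum is an
  ordinary power series, differentiable at its centre.\<close>

lemma one_dimensional_analytic_differentiable:
  assumes r: "r > 0" and sum: "\<And>u. (\<forall>x\<in>{b}. \<bar>u x\<bar> < r) \<Longrightarrow>
      ((\<lambda>\<alpha>. c \<alpha> * (\<Prod>x\<in>{b}. u x ^ \<alpha> x)) has_sum f (p + (\<Sum>x\<in>{b}. u x *\<^sub>R x))) ({b} \<rightarrow>\<^sub>E (UNIV :: nat set))"
  shows "\<exists>D. ((\<lambda>t. f (p + t *\<^sub>R b)) has_real_derivative D) (at 0)"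
proof -
  define k where "k n = restrict (\<lambda>_. n) {b}" for n :: nat
  have k: "bij_betw k UNIV ({b} \<rightarrow>\<^sub>E UNIV)"
  proof (rule bij_betw_byWitness[of _ "\<lambda>\<alpha>. \<alpha> b"])
    show "\<forall>\<alpha>\<in>{b} \<rightarrow>\<^sub>E UNIV. k (\<alpha> b) = \<alpha>"
      by (auto simp: k_def fun_eq_iff PiE_iff extensional_def)
    have "k n \<in> {b} \<rightarrow>\<^sub>E UNIV" for n unfolding k_def by (subst restrict_PiE_iff) simp
    then show "k ` UNIV \<subseteq> {b} \<rightarrow>\<^sub>E UNIV" by blast
  qed (auto simp: k_def)
  have sums: "(\<lambda>n. c (k n) * t ^ n) sums f (p + t *\<^sub>R b)" if "\<bar>t\<bar> < r" for t
  proof -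
    have "((\<lambda>\<alpha>. c \<alpha> * t ^ \<alpha> b) has_sum f (p + t *\<^sub>R b)) ({b} \<rightarrow>\<^sub>E UNIV)" using sum[of "\<lambda>_. t"] that by simp
    then have "((\<lambda>n. c (k n) * t ^ (k n b)) has_sum f (p + t *\<^sub>R b)) UNIV"
      using has_sum_reindex_bij_betw[OF k, of "\<lambda>\<alpha>. c \<alpha> * t ^ \<alpha> b"] by simp
    then show ?thesis by (intro has_sum_imp_sums) (simp add: k_def)
  qed
  have "((\<lambda>t. \<Sum>n. c (k n) * t ^ n) has_real_derivative (\<Sum>n. diffs (\<lambda>n. c (k n)) n * 0 ^ n)) (at 0)"
    using sums[of "r / 2"] r by (intro termdiffs_strong[of _ "r / 2"]) (auto intro: sums_summable)
  then have "((\<lambda>t. f (p + t *\<^sub>R b)) has_real_derivative (\<Sum>n. diffs (\<lambda>n. c (k n)) n * 0 ^ n)) (at 0)"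
  proof (rule has_field_derivative_transform_within_open)
    show "open {-r<..<r}" "0 \<in> {-r<..<r}" using r by auto
    show "(\<Sum>n. c (k n) * t ^ n) = f (p + t *\<^sub>R b)" if "t \<in> {-r<..<r}" for t
      using sums[of t] that by (intro sums_unique[symmetric]) auto
  qed
  then show ?thesis by blast
qed

text \<open>The one-sided derivatives are \<open>- C\<close> and \<open>C\<close>.\<close>

lemma abs_not_differentiable:
  fixes C :: real
  assumes "C \<noteq> 0" and ev: "\<forall>\<^sub>F t in at 0. g t = A - C * \<bar>t\<bar>" and g0: "g 0 = A"
  shows "\<not> (g has_real_derivative D) (at 0)"
proof
  assume "(g has_real_derivative D) (at 0)"
  then have lim: "((\<lambda>t. (g t - g 0) / t) \<longlongrightarrow> D) (at 0)" by (simp add: has_field_derivative_iff)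
  then have lims: "((\<lambda>t. (g t - g 0) / t) \<longlongrightarrow> D) (at_right 0)" "((\<lambda>t. (g t - g 0) / t) \<longlongrightarrow> D) (at_left 0)"
    by (simp_all add: filterlim_at_split)
  have evs: "\<forall>\<^sub>F t in at_right 0. g t = A - C * \<bar>t\<bar>" "\<forall>\<^sub>F t in at_left 0. g t = A - C * \<bar>t\<bar>"
    using ev by (simp_all add: eventually_at_split)
  have "\<forall>\<^sub>F t in at_right 0. (g t - g 0) / t = - C"
    using evs(1) eventually_at_right_less[of "0::real"] by eventually_elim (simp add: g0)
  then have "D = - C" by (intro tendsto_unique[OF trivial_limit_at_right_real lims(1)] tendsto_eventually)
  moreover have "\<forall>\<^sub>F t in at_left (0::real). t < 0" by (rule eventually_at_leftI[of "-1"]) auto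
  with evs(2) have "\<forall>\<^sub>F t in at_left 0. (g t - g 0) / t = C"
    by eventually_elim (simp add: g0)
  then have "D = C" by (intro tendsto_unique[OF trivial_limit_at_left_real lims(2)] tendsto_eventually)
  ultimately show False using assms(1) by simp
qed

text \<open>
  The full shift on the blocks \<open>{0}\<close>, \<open>{1, 2}\<close>, \<open>{3}\<close>: the first component of \<open>block_map\<close> is the number of
  the block of the first symbol, the second one counts the changes of the block. On the face where no
  block change occurs, the entropy is \<open>ln 2\<close> times the maximal frequency of the middle block.
\<close>

definition block :: "nat \<Rightarrow> real" where
  "block i = (if i = 0 then 0 else if i = 3 then 2 else 1)"

definition block_map :: "nat list \<Rightarrow> real ^ 2" where
  "block_map e = vector [block (e ! 0), if block (e ! 0) = block (e ! 1) then 0 else 1]"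

definition block_shift :: "(nat \<Rightarrow> nat) set" where
  "block_shift = sft 4 (\<lambda>_ _. 1)"

interpretation block_shift: shift_space block_shift 4 "Suc 0"
  unfolding block_shift_def by (rule sft_shift_space) simp

lemma block_shift_edges: "block_shift.edges = (\<lambda>(a, b). [a, b]) ` ({..<4} \<times> {..<4})"
proof
  show "block_shift.edges \<subseteq> (\<lambda>(a, b). [a, b]) ` ({..<4} \<times> {..<4})"
    unfolding block_shift.edges_def
  proof safe
    fix x assume "x \<in> block_shift"
    then have "x 0 < 4" "x 1 < 4" by (auto simp: block_shift_def sft_def)
    then show "word (Suc (Suc 0)) x \<in> (\<lambda>(a, b). [a, b]) ` ({..<4} \<times> {..<4})"
      by (intro image_eqI[of _ _ "(x 0, x 1)"]) auto
  qed
  show "(\<lambda>(a, b). [a, b]) ` ({..<4} \<times> {..<4}) \<subseteq> block_shift.edges"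
  proof safe
    fix a b :: nat assume "a < 4" "b < 4"
    then have "(\<lambda>n. if n = 0 then a else b) \<in> block_shift" by (simp add: block_shift_def sft_def)
    then show "[a, b] \<in> block_shift.edges" unfolding block_shift.edges_def by (rule image_eqI[rotated]) simp
  qed
qed

lemma sum_lessThan_4: "sum f {..<4 :: nat} = f 0 + f 1 + f 2 + f 3" for f :: "nat \<Rightarrow> 'x::comm_monoid_add"
proof -
  have "{..<4 :: nat} = {0, 1, 2, 3}" by auto
  then show ?thesis by (simp add: add.assoc)
qed

lemma sum_block_edges:
  "sum f block_shift.edges = (\<Sum>a<4. \<Sum>b<4. f [a, b])" for f :: "nat list \<Rightarrow> 'x::comm_monoid_add"
proof -
  have "inj_on (\<lambda>(a, b). [a, b]) ({..<4 :: nat} \<times> {..<4 :: nat})" by (auto simp: inj_on_def)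
  then have "sum f block_shift.edges = (\<Sum>(a, b)\<in>{..<4} \<times> {..<4}. f [a, b])"
    unfolding block_shift_edges by (simp only: sum.reindex o_def case_prod_beta')
  then show ?thesis by (simp only: sum.cartesian_product)
qed

lemma block_outflow: "block_shift.outflow q v = (\<Sum>a<4. \<Sum>b<4. if v = [a] then q [a, b] else 0)"
  and block_inflow: "block_shift.inflow q v = (\<Sum>a<4. \<Sum>b<4. if v = [b] then q [a, b] else 0)"
proof -
  have "block_shift.outflow q v = (\<Sum>e\<in>block_shift.edges. if butlast e = v then q e else 0)"
    unfolding block_shift.outflow_def using block_shift.finite_edges by (simp add: sum.inter_filter)
  then show "block_shift.outflow q v = (\<Sum>a<4. \<Sum>b<4. if v = [a] then q [a, b] else 0)" by (simp add: sum_block_edges eq_commute[of _ v])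
  have "block_shift.inflow q v = (\<Sum>e\<in>block_shift.edges. if tl e = v then q e else 0)"
    unfolding block_shift.inflow_def using block_shift.finite_edges by (simp add: sum.inter_filter)
  then show "block_shift.inflow q v = (\<Sum>a<4. \<Sum>b<4. if v = [b] then q [a, b] else 0)" by (simp add: sum_block_edges eq_commute[of _ v])
qed

lemma block_mean:
  "block_shift.mean block_map q $ 1 = (\<Sum>a<4. \<Sum>b<4. q [a, b] * block a)"
  "block_shift.mean block_map q $ 2 = (\<Sum>a<4. \<Sum>b<4. if block a = block b then 0 else q [a, b])"
proof -
  have mean: "block_shift.mean block_map q $ i = (\<Sum>a<4. \<Sum>b<4. q [a, b] * block_map [a, b] $ i)" for i
    by (simp add: block_shift.mean_def sum_component sum_block_edges)
  show "block_shift.mean block_map q $ 1 = (\<Sum>a<4. \<Sum>b<4. q [a, b] * block a)"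
    unfolding mean by (intro sum.cong refl) (simp add: block_map_def)
  show "block_shift.mean block_map q $ 2 = (\<Sum>a<4. \<Sum>b<4. if block a = block b then 0 else q [a, b])"
    unfolding mean by (intro sum.cong refl) (simp add: block_map_def)
qed

lemma block_face_flow:
  assumes q: "q \<in> block_shift.flows" and 0: "block_shift.mean block_map q $ 2 = 0"
  defines "s \<equiv> block_shift.mean block_map q $ 1"
  shows "block_shift.flow_entropy q \<le> ln 2 * min s (2 - s)" "0 \<le> s" "s \<le> 2"
proof -
  have nn: "q e \<ge> 0" for e by (rule block_shift.flowsD(2)[OF q])
  have "(\<Sum>a<4. \<Sum>b<4. if block a = block b then 0 else q [a, b]) = 0" using 0 block_mean by simp
  then have z: "q [a, b] = 0" if "a < 4" "b < 4" "block a \<noteq> block b" for a b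
    using that nn by (subst (asm) sum_nonneg_eq_0_iff) (auto simp: sum_nonneg sum_nonneg_eq_0_iff split: if_splits)
  have zs: "q [0, 1] = 0" "q [0, 2] = 0" "q [0, 3] = 0" "q [1, 0] = 0" "q [2, 0] = 0" "q [3, 0] = 0"
    "q [1, 3] = 0" "q [2, 3] = 0" "q [3, 1] = 0" "q [3, 2] = 0"
    by (auto intro!: z simp: block_def)
  define m where "m = q [1, 1] + q [1, 2] + q [2, 1] + q [2, 2]"
  have total: "q [0, 0] + m + q [3, 3] = 1"
    using block_shift.flowsD(3)[OF q] zs by (simp add: sum_block_edges sum_lessThan_4 m_def)
  have s: "s = m + 2 * q [3, 3]"
    unfolding s_def block_mean using zs by (simp add: sum_lessThan_4 m_def block_def)
  have "m \<ge> 0" using nn by (simp add: m_def)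
  then show "0 \<le> s" "s \<le> 2" using s total nn[of "[0, 0]"] nn[of "[3, 3]"] by linarith+
  \<comment> \<open>Transition probabilities of maximal entropy inside each block: forced in the two
    end blocks and 1/2 in the middle one.\<close>
  define p where "p e = (if e = [0, 0] \<or> e = [3, 3] then 1 else if e \<in> {[1, 1], [1, 2], [2, 1], [2, 2]} then 1 / 2 else (0 :: real))" for e :: "nat list"
  have "block_shift.flow_entropy q \<le> - (\<Sum>e\<in>block_shift.edges. q e * ln (p e))"
  proof (rule block_shift.flow_entropy_gibbs)
    fix e assume "e \<in> block_shift.edges" "q e > 0"
    then obtain a b where ab: "a < 4" "b < 4" "e = [a, b]" by (auto simp: block_shift_edges)
    have "a = 0 \<or> a = 1 \<or> a = 2 \<or> a = 3" "b = 0 \<or> b = 1 \<or> b = 2 \<or> b = 3" using ab by auto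
    then show "p e > 0" using \<open>q e > 0\<close> zs ab(3) by (elim disjE) (simp_all add: p_def)
  next
    fix v :: "nat list"
    show "block_shift.outflow p v \<le> 1"
    proof (cases "v \<in> {[0], [1], [2], [3]}")
      case True
      then show ?thesis by (elim insertE emptyE) (simp_all add: block_outflow sum_lessThan_4 p_def)
    next
      case False
      then show ?thesis by (simp add: block_outflow sum_lessThan_4)
    qed
  qed (simp_all add: nn p_def)
  also have "\<dots> = ln 2 * m"
    using zs by (simp add: sum_block_edges sum_lessThan_4 p_def m_def ln_div algebra_simps)
  \<comment> \<open>Since \<open>s = m + 2 * q [3, 3]\<close> and
    \<open>2 - s = m + 2 * q [0, 0]\<close>, the minimum is \<open>m\<close> plus twice the smaller
    end mass.\<close>
  also have "\<dots> \<le> ln 2 * min s (2 - s)"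
    using s total nn[of "[0, 0]"] nn[of "[3, 3]"] by (intro mult_left_mono) auto
  finally show "block_shift.flow_entropy q \<le> ln 2 * min s (2 - s)" .
qed

lemma block_face_flow_exists:
  assumes s: "0 \<le> s" "s \<le> 2"
  obtains q where "q \<in> block_shift.flows" "block_shift.mean block_map q = vector [s, 0]"
    "block_shift.flow_entropy q = ln 2 * min s (2 - s)"
proof -
  \<comment> \<open>Equality requires one end block to be without mass: {0} for s \<ge> 1 and {3}
    for s \<le> 1. The middle mass is spread evenly over the four edges of the middle block.\<close>
  define l where "l = min s (2 - s)"
  define l0 where "l0 = max 0 (1 - s)"
  define l2 where "l2 = max 0 (s - 1)"
  have l: "l \<ge> 0" "l0 \<ge> 0" "l2 \<ge> 0" "l0 + l + l2 = 1" "l + 2 * l2 = s" using s by (cases "s \<le> 1"; simp add: l_def l0_def l2_def)+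
  define q where "q e = (if e = [0, 0] then l0 else if e = [3, 3] then l2
      else if e \<in> {[1, 1], [1, 2], [2, 1], [2, 2]} then l / 4 else (0 :: real))" for e :: "nat list"
  have out: "block_shift.outflow q [0] = l0" "block_shift.outflow q [Suc 0] = l / 2" "block_shift.outflow q [2] = l / 2"
    "block_shift.outflow q [3] = l2"
    by (simp_all add: block_outflow sum_lessThan_4 q_def)
  have "block_shift.inflow q v = block_shift.outflow q v" for v
    by (cases "v \<in> {[0], [1], [2], [3]}"; (elim insertE emptyE)?) (simp_all add: block_outflow block_inflow sum_lessThan_4 q_def)
  moreover have "q e = 0" if "e \<notin> block_shift.edges" for e
    using that by (auto simp: q_def block_shift_edges)
  moreover have "sum q block_shift.edges = 1" using l(4) by (simp add: sum_block_edges sum_lessThan_4 q_def)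
  ultimately have "q \<in> block_shift.flows"
    using l by (simp add: block_shift.flows_def block_shift.circulations_def) (simp add: q_def)
  moreover have "block_shift.mean block_map q = vector [s, 0]"
    unfolding vec_eq_iff forall_2 block_mean using l(5) by (simp add: sum_lessThan_4 q_def block_def)
  moreover have "block_shift.flow_entropy q = ln 2 * l"
  proof -
    have "ln 4 = 2 * ln (2 :: real)" using ln_mult[of "2 :: real" 2] by simp
    then show ?thesis
      unfolding block_shift.flow_entropy_def sum_block_edges sum_lessThan_4 using l(1)
      by (cases "l = 0") (simp_all add: out q_def ln_div)
  qed
  ultimately show ?thesis using that unfolding l_def by blast
qed

abbreviation block_potential :: "(nat \<Rightarrow> nat) \<Rightarrow> real ^ 2" where
  "block_potential \<equiv> \<lambda>x. block_map (word (Suc (Suc 0)) x)"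

lemma block_rotation_set: "rotation_set block_shift block_potential = block_shift.mean block_map ` block_shift.flows"
  by (rule block_shift.rotation_set_eq_mean_flows) (rule refl)

lemma block_localized_entropy:
  assumes s: "0 \<le> s" "s \<le> 2"
  shows "localized_entropy block_shift block_potential (vector [s, 0]) = ln 2 * min s (2 - s)"
proof -
  obtain q where q: "q \<in> block_shift.flows" "block_shift.mean block_map q = vector [s, 0]"
      "block_shift.flow_entropy q = ln 2 * min s (2 - s)" using block_face_flow_exists[OF s] by metis
  then have mem: "vector [s, 0] \<in> block_shift.mean block_map ` block_shift.flows" by (metis image_eqI)
  obtain q' where q': "q' \<in> block_shift.flows" "block_shift.mean block_map q' = vector [s, 0]"
      "block_shift.flow_entropy q' = block_shift.max_entropy block_map (vector [s, 0])"
    using block_shift.max_entropy_attained[OF mem] by metis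
  have "block_shift.flow_entropy q' \<le> ln 2 * min s (2 - s)"
    using block_face_flow(1)[OF q'(1)] by (simp add: q'(2))
  moreover have "ln 2 * min s (2 - s) \<le> block_shift.max_entropy block_map (vector [s, 0])"
    using block_shift.max_entropy_ge[OF q(1), of block_map] q(2,3) by simp
  moreover have "localized_entropy block_shift block_potential (vector [s, 0]) = block_shift.max_entropy block_map (vector [s, 0])"
    by (rule block_shift.localized_entropy_eq_max_entropy[OF refl mem])
  ultimately show ?thesis using q'(3) by simp
qed

lemma block_face:
  "rotation_set block_shift block_potential \<inter> {w. w $ 2 = 0} = closed_segment (vector [0, 0]) (vector [2, 0])"
proof
  show "rotation_set block_shift block_potential \<inter> {w. w $ 2 = 0} \<subseteq> closed_segment (vector [0, 0]) (vector [2, 0])"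
  proof
    fix w assume "w \<in> rotation_set block_shift block_potential \<inter> {w. w $ 2 = 0}"
    then obtain q where q: "q \<in> block_shift.flows" "w = block_shift.mean block_map q" "w $ 2 = 0"
      unfolding block_rotation_set by blast
    then have "0 \<le> w $ 1" "w $ 1 \<le> 2" using block_face_flow(2,3)[OF q(1)] by simp_all
    then show "w \<in> closed_segment (vector [0, 0]) (vector [2, 0])"
      unfolding in_segment using q(3) by (intro exI[of _ "w $ 1 / 2"]) (auto simp: vec_eq_iff forall_2)
  qed
  show "closed_segment (vector [0, 0]) (vector [2, 0]) \<subseteq> rotation_set block_shift block_potential \<inter> {w. w $ 2 = 0}"
  proof
    fix w :: "real ^ 2" assume "w \<in> closed_segment (vector [0, 0]) (vector [2, 0])"
    then obtain u where u: "0 \<le> u" "u \<le> 1" "w = (1 - u) *\<^sub>R vector [0, 0] + u *\<^sub>R vector [2, 0]"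
      by (auto simp: in_segment)
    have w: "w = vector [2 * u, 0]" by (simp add: u(3) vec_eq_iff forall_2)
    obtain q where "q \<in> block_shift.flows" "block_shift.mean block_map q = vector [2 * u, 0]"
      using block_face_flow_exists[of "2 * u"] u by (metis mult.commute mult_le_cancel_left1 mult_nonneg_nonneg zero_le_numeral mult_left_le mult_left_mono mult.right_neutral)
    then show "w \<in> rotation_set block_shift block_potential \<inter> {w. w $ 2 = 0}"
      unfolding block_rotation_set w by (auto intro: rev_image_eqI)
  qed
qed

text \<open>The contradiction arises at the kink \<open>s = 1\<close>. The direction space of the
  face is one-dimensional, so any basis that analyticity provides there is a single nonzero multiple
  of the first unit vector, and the entropy would be differentiable along it.\<close>

lemma block_entropy_not_analytic:
  "\<not> rel_real_analytic_on (rel_interior (closed_segment (vector [0, 0]) (vector [2, 0])))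
     (localized_entropy block_shift block_potential)"
proof
  let ?p = "vector [0, 0] :: real ^ 2" and ?q = "vector [2, 0] :: real ^ 2" and ?c = "vector [1, 0] :: real ^ 2"
  let ?H = "localized_entropy block_shift block_potential" and ?e = "axis 1 1 :: real ^ 2"
  define S where "S = rel_interior (closed_segment ?p ?q)"
  assume an: "rel_real_analytic_on (rel_interior (closed_segment ?p ?q)) ?H"
  have ne: "?p \<noteq> ?q" by (simp add: vec_eq_iff forall_2)
  have S: "S = open_segment ?p ?q" using ne by (simp add: S_def rel_interior_closed_segment)
  have c: "?c \<in> S" "vector [3 / 2, 0] \<in> S"
    unfolding S in_segment using ne
    by (intro conjI exI[of _ "1/2"], auto simp: vec_eq_iff forall_2) (intro conjI exI[of _ "3/4"], auto simp: vec_eq_iff forall_2)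
  from bspec[OF an[folded S_def, unfolded rel_real_analytic_on_def] c(1)]
  obtain B cf r where B: "independent B" "span B = (\<lambda>x. x - ?c) ` (affine hull S)" "r > 0"
    and sum: "\<And>u. (\<forall>b\<in>B. \<bar>u b\<bar> < r) \<Longrightarrow>
      ((\<lambda>\<alpha>. cf \<alpha> * (\<Prod>b\<in>B. u b ^ \<alpha> b)) has_sum ?H (?c + (\<Sum>b\<in>B. u b *\<^sub>R b))) (B \<rightarrow>\<^sub>E (UNIV :: nat set))"
    by blast
  have "affine {w :: real ^ 2. w $ 2 = 0}" by (auto simp: affine_def)
  moreover have "S \<subseteq> {w. w $ 2 = 0}" unfolding S by (auto simp: in_segment)
  ultimately have "affine hull S \<subseteq> {w. w $ 2 = 0}" by (rule hull_minimal[rotated])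
  then have "span B \<subseteq> {w. w $ 2 = 0}" unfolding B(2) by auto
  then have B2: "b = b $ 1 *\<^sub>R ?e" if "b \<in> B" for b
    using span_base[OF that] by (auto simp: vec_eq_iff forall_2 axis_def)
  then have "B \<subseteq> span {?e}" by (metis span_base span_scale singletonI subsetI)
  then have "finite B \<and> card B \<le> card {?e}" using B(1) by (intro independent_span_bound) auto
  moreover have "B \<noteq> {}"
  proof
    assume "B = {}"
    moreover have "vector [3 / 2, 0] - ?c \<in> span B" unfolding B(2) using c(2) by (intro imageI hull_inc)
    ultimately show False by (simp add: vec_eq_iff forall_2)
  qed
  ultimately have "card B = 1" by (simp add: card_gt_0_iff le_antisym Suc_leI)
  then obtain b where b: "B = {b}" by (rule card_1_singletonE)
  define \<beta> where "\<beta> = b $ 1"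
  have beta: "b = \<beta> *\<^sub>R ?e" using B2 b unfolding \<beta>_def by simp
  have "b \<noteq> 0" using B(1) b dependent_zero by blast
  then have \<beta>0: "\<beta> \<noteq> 0" using beta by auto
  have cb: "?c + t *\<^sub>R b = vector [1 + t * \<beta>, 0]" for t
    by (simp add: beta vec_eq_iff forall_2 axis_def)
  obtain D where "((\<lambda>t. ?H (?c + t *\<^sub>R b)) has_real_derivative D) (at 0)"
    using one_dimensional_analytic_differentiable[OF B(3) sum[unfolded b]] by blast
  moreover have "\<forall>\<^sub>F t in at 0. ?H (?c + t *\<^sub>R b) = ln 2 - (ln 2 * \<bar>\<beta>\<bar>) * \<bar>t\<bar>"
  proof -
    have "\<forall>\<^sub>F t in at 0. t \<in> {- (1 / \<bar>\<beta>\<bar>)<..<1 / \<bar>\<beta>\<bar>}" using \<beta>0 by (intro eventually_at_in_open') auto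
    then show ?thesis
    proof eventually_elim
      case (elim t)
      then have "\<bar>t\<bar> < 1 / \<bar>\<beta>\<bar>" by (simp add: abs_less_iff)
      then have "\<bar>t\<bar> * \<bar>\<beta>\<bar> < 1" using \<beta>0 by (simp add: pos_less_divide_eq)
      then have "\<bar>t * \<beta>\<bar> < 1" by (simp add: abs_mult)
      then have "?H (?c + t *\<^sub>R b) = ln 2 * min (1 + t * \<beta>) (2 - (1 + t * \<beta>))"
        unfolding cb by (intro block_localized_entropy) auto
      also have "min (1 + t * \<beta>) (2 - (1 + t * \<beta>)) = 1 - \<bar>t * \<beta>\<bar>" by (auto simp: min_def abs_if)
      finally show ?case by (simp add: abs_mult algebra_simps)
    qed
  qed
  moreover have "?H (?c + 0 *\<^sub>R b) = ln 2" unfolding cb using block_localized_entropy[of 1] by simp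
  ultimately show False using abs_not_differentiable[of "ln 2 * \<bar>\<beta>\<bar>" "\<lambda>t. ?H (?c + t *\<^sub>R b)" "ln 2" D] \<beta>0 by simp
qed

text \<open>The second component of a mean is the mass of the block changes, hence nonnegative, and
  the face is where it attains its minimum 0.\<close>

lemma block_face_is_face:
  "is_face (rotation_set block_shift block_potential) (closed_segment (vector [0, 0]) (vector [2, 0]))"
proof -
  let ?R = "rotation_set block_shift block_potential" and ?a = "- axis 2 1 :: real ^ 2"
  have a: "?a \<bullet> w = - w $ 2" for w by (simp add: inner_axis')
  have "?a \<bullet> w \<le> 0" if w: "w \<in> ?R" for w
  proof -
    obtain q where q: "q \<in> block_shift.flows" "w = block_shift.mean block_map q"
      using w unfolding block_rotation_set by blast
    have "w $ 2 \<ge> 0"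
      unfolding q(2) block_mean using block_shift.flowsD(2)[OF q(1)] by (intro sum_nonneg) auto
    then show ?thesis by (simp only: a)
  qed
  moreover have "vector [0, 0] \<in> ?R" using block_face by auto
  ultimately have "is_face ?R (?R \<inter> {w. ?a \<bullet> w = 0})"
    by (intro is_faceI[of _ _ _ "vector [0, 0]"]) (simp_all add: a axis_eq_0_iff del: inner_minus_left)
  then show ?thesis using block_face by (simp only: a neg_equal_0_iff_equal)
qed

theorem nonanalytic_face_exists:
  "\<exists>(d::nat) A (\<Phi> :: (nat \<Rightarrow> nat) \<Rightarrow> real ^ 2) F.
     transitive_sft d A \<and> locally_constant_on (sft d A) \<Phi> \<and>
     is_face (rotation_set (sft d A) \<Phi>) F \<and> \<not> is_singleton F \<and>
     \<not> rel_real_analytic_on (rel_interior F) (localized_entropy (sft d A) \<Phi>)"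
proof -
  let ?F = "closed_segment (vector [0, 0]) (vector [2, 0]) :: (real ^ 2) set"
  have "matrix_power 4 (\<lambda>_ _. 1) 1 i j > 0" if "i < 4" for i j :: nat using that by (auto simp: sum.delta)
  then have "transitive_sft 4 (\<lambda>_ _. 1)"
    by (auto simp: transitive_sft_def zero_one_matrix_def irreducible_matrix_def intro!: exI[of _ 1])
  moreover have "locally_constant_on block_shift block_potential"
    unfolding locally_constant_on_def by (intro exI[of _ 2]) (auto simp: block_map_def)
  moreover have "\<not> is_singleton ?F"
  proof
    assume "is_singleton ?F"
    then obtain z where "?F = {z}" by (auto simp: is_singleton_def)
    then have "vector [0, 0] = z" "vector [2, 0] = z" using ends_in_segment[of "vector [0, 0] :: real ^ 2" "vector [2, 0]"] by blast+
    then have "(vector [0, 0] :: real ^ 2) $ 1 = (vector [2, 0] :: real ^ 2) $ 1" by simp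
    then show False by simp
  qed
  ultimately show ?thesis
    using block_face_is_face block_entropy_not_analytic unfolding block_shift_def by blast
qed

theorem theoremB:
  fixes d :: nat and A :: "nat \<Rightarrow> nat \<Rightarrow> nat" and \<Phi> :: "(nat \<Rightarrow> nat) \<Rightarrow> real ^ 'm"
  assumes "transitive_sft d A" and "locally_constant_on (sft d A) \<Phi>"
  shows "(\<forall>F. is_face (rotation_set (sft d A) \<Phi>) F \<and> \<not> is_singleton F \<longrightarrow>
            (\<exists>(t::nat) Fs hs.
               (\<forall>i<t. polytope (Fs i) \<and> Fs i \<subseteq> F \<and> concave_on (Fs i) (hs i) \<and>
                       rel_real_analytic_on (rel_interior (Fs i)) (hs i)) \<and>
               concave_envelope {..<t} Fs hs F (localized_entropy (sft d A) \<Phi>)))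
       \<and> (\<exists>(d'::nat) (A' :: nat \<Rightarrow> nat \<Rightarrow> nat) (\<Phi>' :: (nat \<Rightarrow> nat) \<Rightarrow> real ^ 2) F'.
            transitive_sft d' A' \<and> locally_constant_on (sft d' A') \<Phi>' \<and>
            is_face (rotation_set (sft d' A') \<Phi>') F' \<and> \<not> is_singleton F' \<and>
            \<not> rel_real_analytic_on (rel_interior F') (localized_entropy (sft d' A') \<Phi>'))
       \<and> (CARD('m) = 2 \<longrightarrow>
            piecewise_C1_on_frontier (rotation_set (sft d A) \<Phi>) (localized_entropy (sft d A) \<Phi>))"
proof -
  obtain N \<phi> where X: "shift_space (sft d A) d N" and \<phi>: "\<And>x. x \<in> sft d A \<Longrightarrow> \<Phi> x = \<phi> (word (Suc N) x)"
    using sft_coding[OF assms(2)] by blast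
  interpret shift_space "sft d A" d N by (rule X)
  have "\<exists>(t::nat) Fs hs. (\<forall>i<t. polytope (Fs i) \<and> Fs i \<subseteq> F \<and> concave_on (Fs i) (hs i) \<and>
            rel_real_analytic_on (rel_interior (Fs i)) (hs i)) \<and>
          concave_envelope {..<t} Fs hs F (localized_entropy (sft d A) \<Phi>)"
    if "is_face (rotation_set (sft d A) \<Phi>) F" for F
    using localized_entropy_face_envelope[of \<Phi> \<phi> F] \<phi> that by blast
  moreover have "piecewise_C1_on_frontier (rotation_set (sft d A) \<Phi>) (localized_entropy (sft d A) \<Phi>)"
    if "CARD('m) = 2"
    using localized_entropy_piecewise_C1[of \<Phi> \<phi>] \<phi> that sft_nonempty[OF assms(1)] by blast
  ultimately show ?thesis using nonanalytic_face_exists by blast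
qed

end
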